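(* Let $N=2$, $\Omega\subset\mathbb{R}^2$ a bounded domain, $F,Q$ as in the context, and $E(u)=\frac12\int_\Omega F^2(\nabla u)\,dx-\lambda\int_\Omega e^u\,dx$ on $W_0^{1,2}(\Omega)$. There exists a constant $\lambda_0>0$ such that for $0<\lambda<\lambda_0$ the problem $-Qu=\lambda e^u$ in $\Omega$, $u=0$ on $\partial\Omega$ admits a solution corresponding to a critical point of $E$ with critical value $$c=\inf_{\phi\in\mathfrak C}\max_{t\in[0,1]}E(\phi(t)),$$ where $\mathfrak C=\{\phi\in C([0,1],W_0^{1,2}(\Omega)):\ \phi(0)=0,\ \phi(1)=w_0\}$ for some $w_0\in W_0^{1,2}(\Omega)$ with $E(w_0)\le E(0)$. Moreover $c>E(0)=-\lambda|\Omega|$.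
   Context: Standing assumptions on $F$: $F:\mathbb{R}^N\to[0,\infty)$ is convex, $F\in C^2(\mathbb{R}^N\setminus\{0\})$, $F(t\xi)=|t|F(\xi)$, $F(\xi)>0$ for $\xi\neq0$; $a|\xi|\le F(\xi)\le b|\xi|$ for constants $0<a\le b$; and $\mu^2|V|^2\le\sum_{i,j}F_{\xi_i\xi_j}(\xi)V_iV_j\le\Lambda|V|^2$ for all unit $\xi$ and all $V\perp\xi$. $Qu:=\sum_i\partial_{x_i}(F(\nabla u)F_{\xi_i}(\nabla u))$; a solution is $u\in W_0^{1,2}(\Omega)$ with $\int_\Omega F(\nabla u)F_\xi(\nabla u)\cdot\nabla\phi=\lambda\int_\Omega e^u\phi$ for all $\phi\in C_c^\infty(\Omega)$. *)

theory Defs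
  imports "HOL-Analysis.Analysis"
begin

type_synonym R2 = "real^2"

definition pd :: "2 \<Rightarrow> (R2 \<Rightarrow> real) \<Rightarrow> R2 \<Rightarrow> real" where
  "pd i f x = (SOME d. ((\<lambda>t. f (x + t *\<^sub>R axis i 1)) has_real_derivative d) (at 0))"

fun iter_pd :: "2 list \<Rightarrow> (R2 \<Rightarrow> real) \<Rightarrow> R2 \<Rightarrow> real" where
  "iter_pd [] f = f"
| "iter_pd (i # is) f = pd i (iter_pd is f)"

definition smooth :: "(R2 \<Rightarrow> real) \<Rightarrow> bool" where
  "smooth f \<longleftrightarrow> (\<forall>is. continuous_on UNIV (iter_pd is f) \<and>
      (\<forall>i x. (\<lambda>t. iter_pd is f (x + t *\<^sub>R axis i 1)) differentiable (at 0)))"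

definition classical_grad :: "(R2 \<Rightarrow> real) \<Rightarrow> R2 \<Rightarrow> R2" where
  "classical_grad f x = (\<chi> i. pd i f x)"

definition test_fn :: "R2 set \<Rightarrow> (R2 \<Rightarrow> real) \<Rightarrow> bool" where
  "test_fn \<Omega> \<phi> \<longleftrightarrow> smooth \<phi> \<and> compact (closure {x. \<phi> x \<noteq> 0}) \<and> closure {x. \<phi> x \<noteq> 0} \<subseteq> \<Omega>"

definition weak_grad :: "R2 set \<Rightarrow> (R2 \<Rightarrow> real) \<Rightarrow> (R2 \<Rightarrow> R2) \<Rightarrow> bool" where
  "weak_grad \<Omega> u g \<longleftrightarrow>
     set_borel_measurable lebesgue \<Omega> u \<and> set_borel_measurable lebesgue \<Omega> g \<and>
     (\<forall>K. compact K \<and> K \<subseteq> \<Omega> \<longrightarrow> set_integrable lebesgue K u \<and> set_integrable lebesgue K g) \<and>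
     (\<forall>\<phi> i. test_fn \<Omega> \<phi> \<longrightarrow>
        (LINT x:\<Omega>|lebesgue. u x * pd i \<phi> x) = - (LINT x:\<Omega>|lebesgue. g x $ i * \<phi> x))"

definition wgrad :: "R2 set \<Rightarrow> (R2 \<Rightarrow> real) \<Rightarrow> R2 \<Rightarrow> R2" where
  "wgrad \<Omega> u = (SOME g. weak_grad \<Omega> u g)"

definition wdist :: "R2 set \<Rightarrow> (R2 \<Rightarrow> real) \<Rightarrow> (R2 \<Rightarrow> real) \<Rightarrow> real" where
  "wdist \<Omega> u v = sqrt (LINT x:\<Omega>|lebesgue. (u x - v x)\<^sup>2 + (norm (wgrad \<Omega> u x - wgrad \<Omega> v x))\<^sup>2)"

definition W0 :: "R2 set \<Rightarrow> (R2 \<Rightarrow> real) set" where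
  "W0 \<Omega> = {u. (\<forall>x. x \<notin> \<Omega> \<longrightarrow> u x = 0) \<and> u \<in> borel_measurable lebesgue \<and>
      set_integrable lebesgue \<Omega> (\<lambda>x. (u x)\<^sup>2) \<and>
      (\<exists>g. weak_grad \<Omega> u g \<and> set_integrable lebesgue \<Omega> (\<lambda>x. (norm (g x))\<^sup>2)) \<and>
      (\<exists>\<phi>. (\<forall>n. test_fn \<Omega> (\<phi> n)) \<and> (\<lambda>n. wdist \<Omega> (\<phi> n) u) \<longlonglongrightarrow> 0)}"

definition W0_path :: "R2 set \<Rightarrow> (real \<Rightarrow> R2 \<Rightarrow> real) \<Rightarrow> bool" where
  "W0_path \<Omega> \<gamma> \<longleftrightarrow> (\<forall>t\<in>{0..1}. \<gamma> t \<in> W0 \<Omega>) \<and>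
     (\<forall>t\<in>{0..1}. \<forall>e>0. \<exists>d>0. \<forall>s\<in>{0..1}. \<bar>s - t\<bar> < d \<longrightarrow> wdist \<Omega> (\<gamma> s) (\<gamma> t) < e)"

definition Fgrad :: "(R2 \<Rightarrow> real) \<Rightarrow> R2 \<Rightarrow> R2" where
  "Fgrad F \<xi> = (SOME v. (F has_derivative (\<lambda>h. v \<bullet> h)) (at \<xi>))"

definition FHess :: "(R2 \<Rightarrow> real) \<Rightarrow> R2 \<Rightarrow> real^2^2" where
  "FHess F \<xi> = (SOME H. (Fgrad F has_derivative (\<lambda>h. H *v h)) (at \<xi>))"

definition standing_F :: "(R2 \<Rightarrow> real) \<Rightarrow> real \<Rightarrow> real \<Rightarrow> real \<Rightarrow> real \<Rightarrow> bool" where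
  "standing_F F a b \<mu> \<Lambda> \<longleftrightarrow>
     convex_on UNIV F \<and> (\<forall>\<xi>. F \<xi> \<ge> 0) \<and>
     (\<forall>\<xi>. \<xi> \<noteq> 0 \<longrightarrow> (F has_derivative (\<lambda>h. Fgrad F \<xi> \<bullet> h)) (at \<xi>)) \<and>
     (\<forall>\<xi>. \<xi> \<noteq> 0 \<longrightarrow> (Fgrad F has_derivative (\<lambda>h. FHess F \<xi> *v h)) (at \<xi>)) \<and>
     continuous_on (UNIV - {0}) (FHess F) \<and>
     (\<forall>t \<xi>. F (t *\<^sub>R \<xi>) = \<bar>t\<bar> * F \<xi>) \<and>
     (\<forall>\<xi>. \<xi> \<noteq> 0 \<longrightarrow> F \<xi> > 0) \<and>
     0 < a \<and> a \<le> b \<and> (\<forall>\<xi>. a * norm \<xi> \<le> F \<xi> \<and> F \<xi> \<le> b * norm \<xi>) \<and>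
     0 < \<mu> \<and>
     (\<forall>\<xi> V. norm \<xi> = 1 \<and> V \<bullet> \<xi> = 0 \<longrightarrow>
        \<mu>\<^sup>2 * (norm V)\<^sup>2 \<le> V \<bullet> (FHess F \<xi> *v V) \<and> V \<bullet> (FHess F \<xi> *v V) \<le> \<Lambda> * (norm V)\<^sup>2)"

definition energy :: "(R2 \<Rightarrow> real) \<Rightarrow> R2 set \<Rightarrow> real \<Rightarrow> (R2 \<Rightarrow> real) \<Rightarrow> real" where
  "energy F \<Omega> lam u = 1/2 * (LINT x:\<Omega>|lebesgue. (F (wgrad \<Omega> u x))\<^sup>2) - lam * (LINT x:\<Omega>|lebesgue. exp (u x))"

definition weak_solution :: "(R2 \<Rightarrow> real) \<Rightarrow> R2 set \<Rightarrow> real \<Rightarrow> (R2 \<Rightarrow> real) \<Rightarrow> bool" where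
  "weak_solution F \<Omega> lam u \<longleftrightarrow> u \<in> W0 \<Omega> \<and>
     (\<forall>\<phi>. test_fn \<Omega> \<phi> \<longrightarrow>
        (LINT x:\<Omega>|lebesgue. F (wgrad \<Omega> u x) * (Fgrad F (wgrad \<Omega> u x) \<bullet> classical_grad \<phi> x))
        = lam * (LINT x:\<Omega>|lebesgue. exp (u x) * \<phi> x))"

definition critical_point :: "(R2 \<Rightarrow> real) \<Rightarrow> R2 set \<Rightarrow> real \<Rightarrow> (R2 \<Rightarrow> real) \<Rightarrow> bool" where
  "critical_point F \<Omega> lam u \<longleftrightarrow> u \<in> W0 \<Omega> \<and>
     (\<forall>v\<in>W0 \<Omega>. ((\<lambda>t. energy F \<Omega> lam (\<lambda>x. u x + t * v x)) has_real_derivative 0) (at 0))"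

definition minimax :: "(R2 \<Rightarrow> real) \<Rightarrow> R2 set \<Rightarrow> real \<Rightarrow> (R2 \<Rightarrow> real) \<Rightarrow> real" where
  "minimax F \<Omega> lam w0 = Inf {(SUP t\<in>{0..1}. energy F \<Omega> lam (\<gamma> t)) | \<gamma>.
      W0_path \<Omega> \<gamma> \<and> \<gamma> 0 = (\<lambda>x. 0) \<and> \<gamma> 1 = w0}"

end

theory Submission
  imports Defs "HOL-Complex_Analysis.Great_Picard"
begin

text \<open>Along a ray \<open>t u\<close> the second derivative of the energy is the constant \<open>\<integral> F(\<nabla>u)\<^sup>2\<close> minus
  \<open>\<lambda> \<integral> u\<^sup>2 exp (t u)\<close>. It is concave in \<open>t\<close> and, for small \<open>\<lambda>\<close>, positive at 0; hence the energy
  along a ray is first convex, then concave, and has at most one peak. The set of these peaks separates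
  0 from every point lying behind the peak of its ray, so an admissible path has to cross it, and the minimax value
  is the infimum of the energy over the set of peaks. That infimum is attained: an exponential integrability estimate of
  Trudinger type comes from \<open>\<integral> w\<^sup>2 \<le> \<integral> \<bar>\<partial>\<^sub>1 w\<bar> \<integral> \<bar>\<partial>\<^sub>2 w\<bar>\<close> applied to slices of \<open>u\<close> between consecutive
  integer levels, and comparing two almost minimal elements with their midpoint upgrades \<open>L\<^sup>2\<close> convergence
  of a minimizing sequence to convergence of gradients, by strict convexity of \<open>F\<^sup>2\<close>. A minimizer is a
  critical point, since otherwise the ray through it could be bent so as to avoid the set of peaks.\<close>

section \<open>Square-integrable functions\<close>

text \<open>The zero function is not a critical point: the derivative there is -\<lambda> times the
  integral of the direction. A ray may start upwards or downwards, and a stationary point on it need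
  not be its peak; this is why the separating set is defined by global maximality along the ray and
  not by a vanishing derivative. Along a nontrivial ray with u \<le> 0 the energy is unbounded, so
  such rays carry no peak, and the estimates have to keep track of the positive part of u. The
  midpoint of two peaks need not be a peak, so it is first moved along its own ray to one; the
  comparison survives because t u and t v have at most the energy of the peaks u and v. The weak
  gradient is a choice among functions equal almost everywhere. The variational part is therefore
  carried out over an abstract triple of measure, function space and gradient map, the last being
  linear almost everywhere. The exponential estimate is used on gradient balls, where any finite
  constant will do; the double exponential that the level decomposition produces is good
  enough.\<close>

definition sq_int :: "'a measure \<Rightarrow> ('a \<Rightarrow> 'b::euclidean_space) \<Rightarrow> bool" where
  "sq_int M f \<longleftrightarrow> f \<in> borel_measurable M \<and> integrable M (\<lambda>x. (norm (f x))\<^sup>2)"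

definition nsq :: "'a measure \<Rightarrow> ('a \<Rightarrow> 'b::euclidean_space) \<Rightarrow> real" where
  "nsq M f = (\<integral>x. (norm (f x))\<^sup>2 \<partial>M)"

lemma nsq_nonneg [simp]: "0 \<le> nsq M f"
  unfolding nsq_def by (rule integral_nonneg_AE) simp

lemma sq_int_meas: "sq_int M f \<Longrightarrow> f \<in> borel_measurable M"
  by (simp add: sq_int_def)

lemma sq_int_integrable: "sq_int M f \<Longrightarrow> integrable M (\<lambda>x. (norm (f x))\<^sup>2)"
  by (simp add: sq_int_def)

lemma norm_add_sq_le: "(norm (x + y))\<^sup>2 \<le> 2 * (norm x)\<^sup>2 + 2 * (norm (y::'b::real_normed_vector))\<^sup>2"
proof -
  have "(norm (x + y))\<^sup>2 \<le> (norm x + norm y)\<^sup>2"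
    by (intro power_mono norm_triangle_ineq) simp
  also have "\<dots> \<le> 2 * (norm x)\<^sup>2 + 2 * (norm y)\<^sup>2"
    using sum_squares_bound[of "norm x" "norm y"] by (simp add: power2_sum)
  finally show ?thesis .
qed

lemma sq_int_scaleR:
  assumes "sq_int M f" shows "sq_int M (\<lambda>x. c *\<^sub>R f x)"
  using assms unfolding sq_int_def by (auto simp: power_mult_distrib)

lemma nsq_scaleR: "nsq M (\<lambda>x. c *\<^sub>R f x) = c\<^sup>2 * nsq M f"
  unfolding nsq_def by (simp add: power_mult_distrib)

lemma sq_int_add:
  assumes "sq_int M f" "sq_int M g" shows "sq_int M (\<lambda>x. f x + g x)"
proof -
  have [measurable]: "f \<in> borel_measurable M" "g \<in> borel_measurable M"
    using assms by (auto simp: sq_int_def)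
  have "integrable M (\<lambda>x. (norm (f x + g x))\<^sup>2)"
  proof (rule Bochner_Integration.integrable_bound)
    show "integrable M (\<lambda>x. 2 * (norm (f x))\<^sup>2 + 2 * (norm (g x))\<^sup>2)"
      using assms by (auto simp: sq_int_def)
  qed (auto intro!: AE_I2 norm_add_sq_le)
  then show ?thesis by (simp add: sq_int_def)
qed

lemma sq_int_lin:
  assumes "sq_int M f" "sq_int M g" shows "sq_int M (\<lambda>x. s *\<^sub>R f x + t *\<^sub>R g x)"
  by (intro sq_int_add sq_int_scaleR assms)

lemma sq_int_diff:
  assumes "sq_int M f" "sq_int M g" shows "sq_int M (\<lambda>x. f x - g x)"
  using sq_int_lin[OF assms, of 1 "-1"] by simp

lemma nsq_cong_AE:
  assumes "AE x in M. f x = g x" "f \<in> borel_measurable M" "g \<in> borel_measurable M"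
  shows "nsq M f = nsq M g"
  unfolding nsq_def by (rule integral_cong_AE) (use assms in auto)

lemma nsq_le_add:
  assumes "sq_int M f" "sq_int M g"
  shows "nsq M (\<lambda>x. f x + g x) \<le> 2 * nsq M f + 2 * nsq M g"
proof -
  have "nsq M (\<lambda>x. f x + g x) \<le> (\<integral>x. 2 * (norm (f x))\<^sup>2 + 2 * (norm (g x))\<^sup>2 \<partial>M)"
    unfolding nsq_def using assms sq_int_add[OF assms]
    by (intro integral_mono) (auto simp: sq_int_def norm_add_sq_le)
  also have "\<dots> = 2 * nsq M f + 2 * nsq M g"
    unfolding nsq_def using assms by (subst Bochner_Integration.integral_add) (auto simp: sq_int_def)
  finally show ?thesis .
qed

lemma nsq_minus: "nsq M (\<lambda>x. f x - g x) = nsq M (\<lambda>x. g x - f x)"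
  unfolding nsq_def by (simp add: norm_minus_commute)

lemma sq_int_mult_integrable:
  assumes "sq_int M f" "sq_int M g"
  shows "integrable M (\<lambda>x. norm (f x) * norm (g x))"
proof -
  have [measurable]: "f \<in> borel_measurable M" "g \<in> borel_measurable M"
    using assms by (auto simp: sq_int_def)
  show ?thesis
  proof (rule Bochner_Integration.integrable_bound)
    show "integrable M (\<lambda>x. (norm (f x))\<^sup>2 + (norm (g x))\<^sup>2)"
      using assms by (auto simp: sq_int_def)
    have "norm (f x) * norm (g x) \<le> (norm (f x))\<^sup>2 + (norm (g x))\<^sup>2" for x
      using sum_squares_bound[of "norm (f x)" "norm (g x)"]
        mult_nonneg_nonneg[OF norm_ge_zero norm_ge_zero, of "f x" "g x"] by linarith
    then show "AE x in M. norm (norm (f x) * norm (g x)) \<le> norm ((norm (f x))\<^sup>2 + (norm (g x))\<^sup>2)"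
      by simp
  qed simp
qed

text \<open>Transferred from the inequality for nonnegative integrals; stated with norms so that
  scalar functions, gradients and constant weights are covered alike.\<close>

lemma Cauchy_Schwarz_integral:
  assumes "sq_int M f" "sq_int M g"
  shows "(\<integral>x. norm (f x) * norm (g x) \<partial>M) \<le> sqrt (nsq M f) * sqrt (nsq M g)"
proof -
  have [measurable]: "f \<in> borel_measurable M" "g \<in> borel_measurable M"
    using assms by (auto simp: sq_int_def)
  let ?I = "\<integral>x. norm (f x) * norm (g x) \<partial>M"
  have I: "?I \<ge> 0" by (rule integral_nonneg_AE) simp
  have 1: "(\<integral>\<^sup>+x. ennreal (norm (f x)) * ennreal (norm (g x)) \<partial>M) = ennreal ?I"
    using sq_int_mult_integrable[OF assms]
    by (subst nn_integral_eq_integral[symmetric]) (auto simp: ennreal_mult)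
  have 2: "(\<integral>\<^sup>+x. ennreal (norm (f x)) ^ 2 \<partial>M) = ennreal (nsq M f)"
    "(\<integral>\<^sup>+x. ennreal (norm (g x)) ^ 2 \<partial>M) = ennreal (nsq M g)"
    unfolding nsq_def using assms
    by (auto simp: sq_int_def ennreal_power nn_integral_eq_integral)
  have "(ennreal ?I)\<^sup>2 \<le> ennreal (nsq M f) * ennreal (nsq M g)"
    using Cauchy_Schwarz_nn_integral[of "\<lambda>x. ennreal (norm (f x))" M "\<lambda>x. ennreal (norm (g x))"]
    unfolding 1 2 by simp
  then have "ennreal (?I\<^sup>2) \<le> ennreal (nsq M f * nsq M g)"
    using I by (simp add: ennreal_power ennreal_mult)
  then have "?I\<^sup>2 \<le> nsq M f * nsq M g"
    by (simp add: ennreal_le_iff)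
  then have "?I \<le> sqrt (nsq M f * nsq M g)"
    by (rule real_le_rsqrt)
  then show ?thesis by (simp add: real_sqrt_mult)
qed

lemma sqrt_nsq_triangle:
  assumes "sq_int M f" "sq_int M g"
  shows "sqrt (nsq M (\<lambda>x. f x + g x)) \<le> sqrt (nsq M f) + sqrt (nsq M g)"
proof (rule real_le_lsqrt)
  have "nsq M (\<lambda>x. f x + g x) \<le> (\<integral>x. (norm (f x))\<^sup>2 + 2 * (norm (f x) * norm (g x)) + (norm (g x))\<^sup>2 \<partial>M)"
    unfolding nsq_def using assms sq_int_add[OF assms] sq_int_mult_integrable[OF assms]
  proof (intro integral_mono)
    fix x
    have "(norm (f x + g x))\<^sup>2 \<le> (norm (f x) + norm (g x))\<^sup>2"
      by (intro power_mono norm_triangle_ineq) simp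
    then show "(norm (f x + g x))\<^sup>2 \<le> (norm (f x))\<^sup>2 + 2 * (norm (f x) * norm (g x)) + (norm (g x))\<^sup>2"
      by (simp add: power2_sum)
  qed (auto simp: sq_int_def)
  also have "\<dots> = nsq M f + 2 * (\<integral>x. norm (f x) * norm (g x) \<partial>M) + nsq M g"
    unfolding nsq_def using assms sq_int_mult_integrable[OF assms] by (simp add: sq_int_def)
  also have "\<dots> \<le> nsq M f + 2 * (sqrt (nsq M f) * sqrt (nsq M g)) + nsq M g"
    using Cauchy_Schwarz_integral[OF assms] by simp
  also have "\<dots> = (sqrt (nsq M f) + sqrt (nsq M g))\<^sup>2"
    by (simp add: power2_sum)
  finally show "nsq M (\<lambda>x. f x + g x) \<le> (sqrt (nsq M f) + sqrt (nsq M g))\<^sup>2" .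
qed simp

text \<open>The reverse triangle inequality holds for the square roots; squaring the limit returns
  to the norm without a root.\<close>

lemma nsq_tendsto:
  assumes "\<And>n. sq_int M (f n)" "sq_int M g" "(\<lambda>n. nsq M (\<lambda>x. f n x - g x)) \<longlonglongrightarrow> 0"
  shows "(\<lambda>n. nsq M (f n)) \<longlonglongrightarrow> nsq M g"
proof -
  have d: "sq_int M (\<lambda>x. f n x - g x)" for n by (intro sq_int_diff assms)
  have a: "\<bar>sqrt (nsq M (f n)) - sqrt (nsq M g)\<bar> \<le> sqrt (nsq M (\<lambda>x. f n x - g x))" for n
  proof -
    have "sqrt (nsq M (f n)) \<le> sqrt (nsq M (\<lambda>x. f n x - g x)) + sqrt (nsq M g)"
      using sqrt_nsq_triangle[OF d assms(2), of n] by simp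
    moreover have "sqrt (nsq M g) \<le> sqrt (nsq M (\<lambda>x. f n x - g x)) + sqrt (nsq M (f n))"
      using sqrt_nsq_triangle[OF sq_int_diff[OF assms(2) assms(1)] assms(1), of n n]
      by (simp add: nsq_minus[of M "f n"])
    ultimately show ?thesis by simp
  qed
  have "(\<lambda>n. sqrt (nsq M (f n)) - sqrt (nsq M g)) \<longlonglongrightarrow> 0"
  proof (rule Lim_null_comparison)
    show "\<forall>\<^sub>F n in sequentially. norm (sqrt (nsq M (f n)) - sqrt (nsq M g)) \<le> sqrt (nsq M (\<lambda>x. f n x - g x))"
      using a by simp
    show "(\<lambda>n. sqrt (nsq M (\<lambda>x. f n x - g x))) \<longlonglongrightarrow> 0"
      using tendsto_real_sqrt[OF assms(3)] by simp
  qed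
  then have "(\<lambda>n. sqrt (nsq M (f n))) \<longlonglongrightarrow> sqrt (nsq M g)"
    by (simp add: LIM_zero_iff)
  from tendsto_power[OF this, of 2] show ?thesis by simp
qed

section \<open>Almost everywhere limits and completeness\<close>

lemma nsq_AE_subseq:
  assumes "\<And>n. sq_int M (f n)" "(\<lambda>n. nsq M (f n)) \<longlonglongrightarrow> 0"
  shows "\<exists>r::nat\<Rightarrow>nat. strict_mono r \<and> (AE x in M. (\<lambda>n. f (r n) x) \<longlonglongrightarrow> 0)"
proof -
  have "\<exists>r::nat\<Rightarrow>nat. strict_mono r \<and> (AE x in M. (\<lambda>n. (norm (f (r n) x))\<^sup>2) \<longlonglongrightarrow> 0)"
    using assms by (intro tendsto_L1_AE_subseq) (auto simp: sq_int_def nsq_def)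
  then obtain r :: "nat \<Rightarrow> nat" where r: "strict_mono r" "AE x in M. (\<lambda>n. (norm (f (r n) x))\<^sup>2) \<longlonglongrightarrow> 0"
    by blast
  have "AE x in M. (\<lambda>n. f (r n) x) \<longlonglongrightarrow> 0"
    using r(2)
  proof eventually_elim
    case (elim x)
    have "(\<lambda>n. sqrt ((norm (f (r n) x))\<^sup>2)) \<longlonglongrightarrow> 0"
      using tendsto_real_sqrt[OF elim] by simp
    then show ?case by (simp add: tendsto_norm_zero_iff)
  qed
  with r(1) show ?thesis by blast
qed

text \<open>Fatou's lemma. Asking for the bound only from N on allows an application to Cauchy
  sequences, where it holds on tails.\<close>

lemma nsq_le_of_AE_lim:
  fixes f :: "nat \<Rightarrow> 'a \<Rightarrow> 'b::euclidean_space"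
  assumes "\<And>n. sq_int M (f n)" "g \<in> borel_measurable M" "AE x in M. (\<lambda>n. f n x) \<longlonglongrightarrow> g x"
    and b: "\<And>n. n \<ge> N \<Longrightarrow> nsq M (f n) \<le> B"
  shows "sq_int M g" "nsq M g \<le> B"
proof -
  have B: "B \<ge> 0" using b[of N] nsq_nonneg[of M "f N"] by linarith
  have m[measurable]: "f n \<in> borel_measurable M" for n using assms(1) by (simp add: sq_int_def)
  note [measurable] = assms(2)
  have eq: "(\<integral>\<^sup>+x. ennreal ((norm (f n x))\<^sup>2) \<partial>M) = ennreal (nsq M (f n))" for n
    unfolding nsq_def using assms(1) by (auto simp: sq_int_def nn_integral_eq_integral)
  have "(\<integral>\<^sup>+x. ennreal ((norm (g x))\<^sup>2) \<partial>M) \<le> (\<integral>\<^sup>+x. liminf (\<lambda>n. ennreal ((norm (f n x))\<^sup>2)) \<partial>M)"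
  proof (rule nn_integral_mono_AE)
    show "AE x in M. ennreal ((norm (g x))\<^sup>2) \<le> liminf (\<lambda>n. ennreal ((norm (f n x))\<^sup>2))"
      using assms(3)
    proof eventually_elim
      case (elim x)
      have "(\<lambda>n. ennreal ((norm (f n x))\<^sup>2)) \<longlonglongrightarrow> ennreal ((norm (g x))\<^sup>2)"
        by (intro tendsto_ennrealI tendsto_intros elim)
      then have "liminf (\<lambda>n. ennreal ((norm (f n x))\<^sup>2)) = ennreal ((norm (g x))\<^sup>2)"
        by (rule lim_imp_Liminf[rotated]) simp
      then show ?case by simp
    qed
  qed
  also have "\<dots> \<le> liminf (\<lambda>n. (\<integral>\<^sup>+x. ennreal ((norm (f n x))\<^sup>2) \<partial>M))"
    by (rule nn_integral_liminf) simp
  also have "\<dots> \<le> ennreal B"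
  proof (rule Liminf_le)
    show "\<forall>\<^sub>F n in sequentially. (\<integral>\<^sup>+x. ennreal ((norm (f n x))\<^sup>2) \<partial>M) \<le> ennreal B"
      using b by (auto simp: eq eventually_sequentially ennreal_leI intro!: exI[of _ N])
  qed simp
  finally have *: "(\<integral>\<^sup>+x. ennreal ((norm (g x))\<^sup>2) \<partial>M) \<le> ennreal B" .
  then have "(\<integral>\<^sup>+x. ennreal ((norm (g x))\<^sup>2) \<partial>M) < \<infinity>"
    by (simp add: le_less_trans)
  then show g: "sq_int M g"
    unfolding sq_int_def integrable_iff_bounded by simp
  then show "nsq M g \<le> B"
    using * B unfolding nsq_def sq_int_def by (simp add: nn_integral_eq_integral ennreal_le_iff)
qed

text \<open>Riesz-Fischer: a subsequence with geometrically small increments converges almost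
  everywhere, and Fatou's lemma turns its limit into the limit in norm.\<close>

lemma sq_int_complete:
  fixes f :: "nat \<Rightarrow> 'a \<Rightarrow> 'b::euclidean_space"
  assumes f: "\<And>n. sq_int M (f n)"
    and C: "\<And>e. e > 0 \<Longrightarrow> \<exists>N. \<forall>m\<ge>N. \<forall>n\<ge>N. nsq M (\<lambda>x. f m x - f n x) < e"
  shows "\<exists>g. sq_int M g \<and> (\<lambda>n. nsq M (\<lambda>x. f n x - g x)) \<longlonglongrightarrow> 0"
proof -
  have [measurable]: "f n \<in> borel_measurable M" for n using f by (simp add: sq_int_def)
  have d: "sq_int M (\<lambda>x. f m x - f n x)" for m n by (intro sq_int_diff f)
  have "\<exists>N. \<forall>k. (\<forall>m\<ge>N k. \<forall>n\<ge>N k. nsq M (\<lambda>x. f m x - f n x) < (1/4)^k) \<and> N k \<le> N (Suc k)"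
  proof -
    have "\<exists>N0. \<forall>k. \<forall>m\<ge>N0 k. \<forall>n\<ge>N0 k. nsq M (\<lambda>x. f m x - f n x) < (1/4)^k"
      by (rule choice) (auto intro!: C)
    then obtain N0 where N0: "\<And>k m n. m \<ge> N0 k \<Longrightarrow> n \<ge> N0 k \<Longrightarrow> nsq M (\<lambda>x. f m x - f n x) < (1/4)^k"
      by blast
    \<comment> \<open>The maximum over all earlier indices makes the sequence nondecreasing and
      keeps the bounds.\<close>
    show ?thesis
    proof (intro exI[of _ "\<lambda>k. Max (N0 ` {..k})"] allI conjI impI)
      fix k m n assume "Max (N0 ` {..k}) \<le> m" "Max (N0 ` {..k}) \<le> n"
      then show "nsq M (\<lambda>x. f m x - f n x) < (1/4)^k" by (intro N0) auto
    next
      fix k show "Max (N0 ` {..k}) \<le> Max (N0 ` {..Suc k})"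
        by (intro Max_mono) auto
    qed
  qed
  then obtain N where N: "\<And>k m n. m \<ge> N k \<Longrightarrow> n \<ge> N k \<Longrightarrow> nsq M (\<lambda>x. f m x - f n x) < (1/4)^k"
    and Nmono: "\<And>k. N k \<le> N (Suc k)" by blast
  define d' where "d' k x = f (N (Suc k)) x - f (N k) x" for k x
  have d'_sq: "sq_int M (d' k)" for k unfolding d'_def[abs_def] by (rule d)
  have d'_b: "nsq M (d' k) < (1/4)^k" for k
    unfolding d'_def[abs_def] by (rule N) (use Nmono in auto)
  have [measurable]: "d' k \<in> borel_measurable M" for k using d'_sq by (simp add: sq_int_def)
  \<comment> \<open>The squared norms are below (1/4)^k, so the weight 2^k leaves a summable series;
    its finiteness at x forces \<open>norm (d' k x)\<close> to decay geometrically.\<close>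
  have "(\<integral>\<^sup>+x. (\<Sum>k. ennreal (2^k * (norm (d' k x))\<^sup>2)) \<partial>M) = (\<Sum>k. (\<integral>\<^sup>+x. ennreal (2^k * (norm (d' k x))\<^sup>2) \<partial>M))"
    by (rule nn_integral_suminf) simp
  also have "\<dots> = (\<Sum>k. ennreal (2^k * nsq M (d' k)))"
    unfolding nsq_def using d'_sq by (simp add: nn_integral_eq_integral sq_int_def)
  also have "\<dots> \<le> (\<Sum>k. ennreal ((1/2)^k))"
  proof (rule suminf_le)
    fix k
    have "2^k * nsq M (d' k) \<le> 2^k * (1/4)^k"
      using d'_b[of k] by (intro mult_left_mono) auto
    also have "\<dots> = (1/2::real)^k" by (simp flip: power_mult_distrib)
    finally show "ennreal (2^k * nsq M (d' k)) \<le> ennreal ((1/2)^k)" by (rule ennreal_leI)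
  qed auto
  also have "\<dots> < \<infinity>"
    by (subst suminf_ennreal2) (auto simp: summable_geometric)
  finally have fin: "AE x in M. (\<Sum>k. ennreal (2^k * (norm (d' k x))\<^sup>2)) \<noteq> \<infinity>"
    by (intro nn_integral_PInf_AE) auto
  have conv: "AE x in M. convergent (\<lambda>k. f (N k) x)"
    using fin
  proof eventually_elim
    case (elim x)
    define S where "S = (\<Sum>k. ennreal (2^k * (norm (d' k x))\<^sup>2))"
    obtain s where s: "S = ennreal s" "s \<ge> 0"
      using elim unfolding S_def[symmetric] by (cases S) auto
    have le: "2^k * (norm (d' k x))\<^sup>2 \<le> s" for k
    proof -
      have "ennreal (2^k * (norm (d' k x))\<^sup>2) \<le> S"
        unfolding S_def
        by (rule sum_le_suminf[of _ "{k}", OF summableI, simplified])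
      then show ?thesis using s by (simp add: ennreal_le_iff)
    qed
    have le2: "norm (d' k x) \<le> sqrt s * (sqrt (1/2))^k" for k
    proof -
      have "(norm (d' k x))\<^sup>2 \<le> s * (1/2)^k"
        using le[of k] by (simp add: power_divide field_simps)
      then have "norm (d' k x) \<le> sqrt (s * (1/2)^k)" by (rule real_le_rsqrt)
      then show ?thesis by (simp add: real_sqrt_mult real_sqrt_power)
    qed
    have "summable (\<lambda>k. d' k x)"
    proof (rule summable_comparison_test)
      show "\<exists>N. \<forall>n\<ge>N. norm (d' n x) \<le> sqrt s * (sqrt (1/2))^n" using le2 by blast
      show "summable (\<lambda>n. sqrt s * sqrt (1/2) ^ n)"
        by (intro summable_mult summable_geometric) (simp add: real_sqrt_lt_1_iff)
    qed
    then have "convergent (\<lambda>n. \<Sum>k<n. d' k x)" by (simp add: summable_iff_convergent)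
    moreover have "(\<Sum>k<n. d' k x) = f (N n) x - f (N 0) x" for n
      unfolding d'_def by (rule sum_lessThan_telescope)
    ultimately have "convergent (\<lambda>n. (f (N n) x - f (N 0) x) + f (N 0) x)"
      by (intro convergent_add) (auto simp: convergent_const)
    then show ?case by simp
  qed
  define g where "g x = lim (\<lambda>k. f (N k) x)" for x
  have gm[measurable]: "g \<in> borel_measurable M"
    unfolding g_def[abs_def] by (rule borel_measurable_lim_metric) simp
  have lim: "AE x in M. (\<lambda>k. f (N k) x) \<longlonglongrightarrow> g x"
    using conv by eventually_elim (simp add: g_def convergent_LIMSEQ_iff)
  \<comment> \<open>Fatou's lemma in the second index turns the Cauchy bound into a bound for the
    distance to the limit.\<close>
  have key: "sq_int M (\<lambda>x. f n x - g x) \<and> nsq M (\<lambda>x. f n x - g x) \<le> (1/4)^k" if n: "n \<ge> N k" for n k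
  proof -
    have AE: "AE x in M. (\<lambda>j. f n x - f (N j) x) \<longlonglongrightarrow> f n x - g x"
      using lim by eventually_elim (intro tendsto_intros)
    have Nj: "N j \<ge> N k" if "j \<ge> k" for j using that Nmono lift_Suc_mono_le by blast
    have b: "nsq M (\<lambda>x. f n x - f (N j) x) \<le> (1/4)^k" if "j \<ge> k" for j
      using N[of k n "N j"] n Nj[OF that] by auto
    show ?thesis using nsq_le_of_AE_lim[OF d _ AE b] by simp
  qed
  have sg: "sq_int M g"
    using sq_int_diff[OF f[of "N 0"] conjunct1[OF key[of 0 "N 0"]]] by simp
  have "(\<lambda>n. nsq M (\<lambda>x. f n x - g x)) \<longlonglongrightarrow> 0"
  proof (rule LIMSEQ_I)
    fix e :: real assume "e > 0"
    then obtain k where k: "(1/4::real)^k < e"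
      using real_arch_pow_inv[of e "1/4"] by auto
    have "norm (nsq M (\<lambda>x. f n x - g x) - 0) < e" if "n \<ge> N k" for n
      using conjunct2[OF key[OF that]] k by simp
    then show "\<exists>no. \<forall>n\<ge>no. norm (nsq M (\<lambda>x. f n x - g x) - 0) < e" by blast
  qed
  with sg show ?thesis by blast
qed

section \<open>Continuously differentiable functions with compact support in the plane\<close>

text \<open>Identifies the plane with a product of two lines, so that Tonelli and Fubini apply to
  \<open>real^2\<close>.\<close>

definition pt :: "real \<Rightarrow> real \<Rightarrow> R2" where "pt x y = (\<chi> i. if i = 1 then x else y)"

lemma pt_nth [simp]: "pt x y $ 1 = x" "pt x y $ 2 = y" by (auto simp: pt_def)

lemma pt_eta [simp]: "pt (z $ 1) (z $ 2) = z" by (simp add: vec_eq_iff forall_2)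

lemma pt_axis: "pt x y + t *\<^sub>R axis 1 1 = pt (x + t) y" "pt x y + t *\<^sub>R axis 2 1 = pt x (y + t)"
  by (auto simp: vec_eq_iff forall_2 axis_def)

lemma continuous_pt: "continuous_on UNIV (\<lambda>p. pt (fst p) (snd p))"
  unfolding pt_def
proof (intro continuous_on_vec_lambda)
  fix i :: 2
  show "continuous_on UNIV (\<lambda>p :: real \<times> real. if i = 1 then fst p else snd p)"
    by (cases "i = 1") (simp_all add: continuous_on_fst continuous_on_snd continuous_on_id)
qed

lemma continuous_on_pt: "continuous_on S f \<Longrightarrow> continuous_on S g \<Longrightarrow> continuous_on S (\<lambda>x. pt (f x) (g x))"
  using continuous_on_compose2[OF continuous_pt continuous_on_Pair, of S f g] by simp

lemma measurable_pt [measurable]: "(\<lambda>p. pt (fst p) (snd p)) \<in> borel \<rightarrow>\<^sub>M borel"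
  by (rule borel_measurable_continuous_onI[OF continuous_pt])

lemma prod_Basis_R2: "(\<Prod>b\<in>(Basis :: R2 set). f b) = f (axis 1 1) * (f (axis 2 1) :: real)"
proof -
  have B: "(Basis :: R2 set) = {axis 1 1, axis 2 1}" by (auto simp: Basis_vec_def UNIV_2)
  have ne: "(axis 1 1 :: R2) \<noteq> axis 2 1" by (simp add: axis_eq_axis)
  show ?thesis unfolding B using ne by simp
qed

text \<open>Both measures give a box the product of its side lengths, and these values determine
  Lebesgue measure.\<close>

lemma lborel_R2: "(lborel :: R2 measure) = distr (lborel \<Otimes>\<^sub>M lborel) borel (\<lambda>p. pt (fst p) (snd p))"
proof (rule lborel_eqI)
  fix l u :: R2 assume le: "\<And>b. b \<in> Basis \<Longrightarrow> l \<bullet> b \<le> u \<bullet> b"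
  have le': "l $ i \<le> u $ i" for i using le[of "axis i 1"] by (simp add: inner_axis axis_in_Basis_iff)
  have eq: "(\<lambda>p. pt (fst p) (snd p)) -` box l u = {l$1<..<u$1} \<times> {l$2<..<u$2}"
    by (auto simp: mem_box_cart forall_2)
  have "emeasure (distr (lborel \<Otimes>\<^sub>M lborel) borel (\<lambda>p. pt (fst p) (snd p))) (box l u) =
     emeasure (lborel \<Otimes>\<^sub>M lborel) ({l$1<..<u$1} \<times> {l$2<..<u$2})"
    by (subst emeasure_distr) (simp_all add: eq lborel_prod)
  also have "\<dots> = emeasure lborel {l$1<..<u$1} * emeasure lborel {l$2<..<u$2}"
    by (rule lborel.emeasure_pair_measure_Times) auto
  also have "\<dots> = ennreal ((u$1 - l$1) * (u$2 - l$2))"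
    using le'[of 1] le'[of 2] by (simp add: ennreal_mult)
  also have "(u$1 - l$1) * (u$2 - l$2) = (\<Prod>b\<in>Basis. (u - l) \<bullet> b)"
    by (subst prod_Basis_R2) (simp add: inner_axis)
  finally show "emeasure (distr (lborel \<Otimes>\<^sub>M lborel) borel (\<lambda>p. pt (fst p) (snd p))) (box l u) = ennreal (\<Prod>b\<in>Basis. (u - l) \<bullet> b)" .
qed simp

lemma nn_integral_R2:
  assumes [measurable]: "f \<in> borel_measurable borel"
  shows "(\<integral>\<^sup>+z. f z \<partial>lborel) = (\<integral>\<^sup>+x. \<integral>\<^sup>+y. f (pt x y) \<partial>lborel \<partial>lborel)"
    and "(\<integral>\<^sup>+z. f z \<partial>lborel) = (\<integral>\<^sup>+y. \<integral>\<^sup>+x. f (pt x y) \<partial>lborel \<partial>lborel)"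
proof -
  have m: "(\<lambda>p. f (pt (fst p) (snd p))) \<in> borel_measurable (lborel \<Otimes>\<^sub>M lborel)"
    unfolding lborel_prod by measurable
  have 0: "(\<integral>\<^sup>+z. f z \<partial>lborel) = (\<integral>\<^sup>+p. f (pt (fst p) (snd p)) \<partial>(lborel \<Otimes>\<^sub>M lborel))"
    by (subst lborel_R2, subst nn_integral_distr) (auto simp: lborel_prod)
  show "(\<integral>\<^sup>+z. f z \<partial>lborel) = (\<integral>\<^sup>+x. \<integral>\<^sup>+y. f (pt x y) \<partial>lborel \<partial>lborel)"
    unfolding 0 using lborel.nn_integral_fst[OF m] by simp
  show "(\<integral>\<^sup>+z. f z \<partial>lborel) = (\<integral>\<^sup>+y. \<integral>\<^sup>+x. f (pt x y) \<partial>lborel \<partial>lborel)"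
    unfolding 0 using lborel_pair.nn_integral_snd[OF m] by simp
qed

text \<open>The inequality includes the sides of the square, so the function is zero on them as
  well; this removes the boundary terms on every coordinate line.\<close>

definition bsupp :: "real \<Rightarrow> (R2 \<Rightarrow> real) \<Rightarrow> bool" where
  "bsupp R w \<longleftrightarrow> continuous_on UNIV w \<and> (\<forall>z. R \<le> \<bar>z $ 1\<bar> \<or> R \<le> \<bar>z $ 2\<bar> \<longrightarrow> w z = 0)"

lemma bsupp_cont: "bsupp R w \<Longrightarrow> continuous_on S w"
  unfolding bsupp_def using continuous_on_subset by blast

lemma bsupp_meas: "bsupp R w \<Longrightarrow> w \<in> borel_measurable borel"
  by (rule borel_measurable_continuous_onI) (simp add: bsupp_def)

lemma bsupp_zero: "bsupp R w \<Longrightarrow> R \<le> \<bar>x\<bar> \<or> R \<le> \<bar>y\<bar> \<Longrightarrow> w (pt x y) = 0"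
  unfolding bsupp_def by (metis pt_nth)

lemma bsupp_map: "bsupp R w \<Longrightarrow> continuous_on UNIV f \<Longrightarrow> f 0 = 0 \<Longrightarrow> bsupp R (\<lambda>z. f (w z))"
  unfolding bsupp_def using continuous_on_compose2[of UNIV f UNIV w] by auto

lemma bsupp_mult: "bsupp R w \<Longrightarrow> continuous_on UNIV v \<Longrightarrow> bsupp R (\<lambda>z. v z * w z)"
  unfolding bsupp_def by (auto intro: continuous_intros)

definition sqbox :: "real \<Rightarrow> R2 set" where "sqbox R = cbox (pt (-R) (-R)) (pt R R)"

lemma mem_sqbox: "z \<in> sqbox R \<longleftrightarrow> \<bar>z $ 1\<bar> \<le> R \<and> \<bar>z $ 2\<bar> \<le> R"
  unfolding sqbox_def by (auto simp: mem_box_cart forall_2)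

lemma bsupp_integrable: assumes "bsupp R w" shows "integrable lborel w"
proof -
  have "integrable lborel (\<lambda>z. indicator (sqbox R) z *\<^sub>R w z)"
    unfolding sqbox_def by (intro borel_integrable_compact compact_cbox bsupp_cont[OF assms])
  moreover have "(\<lambda>z. indicator (sqbox R) z *\<^sub>R w z) = w"
  proof
    fix z
    show "indicator (sqbox R) z *\<^sub>R w z = w z"
    proof (cases "z \<in> sqbox R")
      case False
      then have "R \<le> \<bar>z $ 1\<bar> \<or> R \<le> \<bar>z $ 2\<bar>" by (auto simp: mem_sqbox)
      then have "w z = 0" using assms unfolding bsupp_def by blast
      then show ?thesis by simp
    qed simp
  qed
  ultimately show ?thesis by simp
qed

lemma bsupp_sq_int: assumes "bsupp R w" shows "sq_int lborel w"
proof -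
  have "bsupp R (\<lambda>z. (norm (w z))\<^sup>2)" by (rule bsupp_map[OF assms]) (auto intro!: continuous_intros)
  then show ?thesis using bsupp_integrable bsupp_meas[OF assms] by (auto simp: sq_int_def)
qed

text \<open>The partial derivatives are carried as explicit functions, so that products and
  compositions come with formulas and not with chosen values of \<open>pd\<close>.\<close>

definition C1c :: "real \<Rightarrow> (R2 \<Rightarrow> real) \<Rightarrow> (R2 \<Rightarrow> real) \<Rightarrow> (R2 \<Rightarrow> real) \<Rightarrow> bool" where
  "C1c R w w1 w2 \<longleftrightarrow> bsupp R w \<and> bsupp R w1 \<and> bsupp R w2 \<and>
     (\<forall>z. ((\<lambda>t. w (z + t *\<^sub>R axis 1 1)) has_real_derivative w1 z) (at 0)) \<and>
     (\<forall>z. ((\<lambda>t. w (z + t *\<^sub>R axis 2 1)) has_real_derivative w2 z) (at 0))"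

lemma C1c_slice1:
  assumes "C1c R w w1 w2" shows "((\<lambda>s. w (pt s y)) has_real_derivative w1 (pt s y)) (at s)"
proof -
  have "((\<lambda>t. w (pt (s + t) y)) has_real_derivative w1 (pt s y)) (at 0)"
    using assms unfolding C1c_def pt_axis(1)[symmetric] by blast
  then show ?thesis using DERIV_shift[of "\<lambda>s. w (pt s y)" "w1 (pt s y)" 0 s] by (simp add: add.commute)
qed

lemma C1c_slice2:
  assumes "C1c R w w1 w2" shows "((\<lambda>s. w (pt x s)) has_real_derivative w2 (pt x s)) (at s)"
proof -
  have "((\<lambda>t. w (pt x (s + t))) has_real_derivative w2 (pt x s)) (at 0)"
    using assms unfolding C1c_def pt_axis(2)[symmetric] by blast
  then show ?thesis using DERIV_shift[of "\<lambda>s. w (pt x s)" "w2 (pt x s)" 0 s] by (simp add: add.commute)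
qed

lemma abs_le_nn_integral_deriv:
  fixes f f' :: "real \<Rightarrow> real"
  assumes der: "\<And>s. (f has_real_derivative f' s) (at s)" and cont: "continuous_on UNIV f'"
    and z: "\<And>s. R \<le> \<bar>s\<bar> \<Longrightarrow> f s = 0"
  shows "ennreal \<bar>f x\<bar> \<le> (\<integral>\<^sup>+s. ennreal \<bar>f' s\<bar> \<partial>lborel)"
proof -
  \<comment> \<open>A point to the left of both x and the support; the absolute value covers a
    negative R, for which f vanishes everywhere.\<close>
  define c where "c = min x (- \<bar>R\<bar>)"
  have c: "c \<le> x" "f c = 0" by (auto simp: c_def intro!: z)
  have h: "has_bochner_integral lborel (\<lambda>s. f' s * indicator {c..x} s) (f x - f c)"
    using cont by (intro has_bochner_integral_FTC_Icc_real c der) (simp add: continuous_on_eq_continuous_at)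
  have "ennreal (norm (\<integral>s. f' s * indicator {c..x} s \<partial>lborel)) \<le> (\<integral>\<^sup>+s. ennreal (norm (f' s * indicator {c..x} s)) \<partial>lborel)"
    using h by (intro integral_norm_bound_ennreal) (auto simp: has_bochner_integral_iff)
  also have "\<dots> \<le> (\<integral>\<^sup>+s. ennreal \<bar>f' s\<bar> \<partial>lborel)"
    by (intro nn_integral_mono ennreal_leI) (auto simp: indicator_def)
  finally show ?thesis using h c by (simp add: has_bochner_integral_iff)
qed

text \<open>The Gagliardo-Nirenberg argument: integration along horizontal lines bounds |w(x,y)| by
  a function of y alone, along vertical lines by a function of x alone, and the integral of the
  product of these bounds splits.\<close>

lemma planar_product_inequality:
  assumes w: "C1c R w w1 w2"
  shows "nsq lborel w \<le> (\<integral>z. \<bar>w1 z\<bar> \<partial>lborel) * (\<integral>z. \<bar>w2 z\<bar> \<partial>lborel)"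
proof -
  have bs: "bsupp R w" "bsupp R w1" "bsupp R w2" using w by (auto simp: C1c_def)
  note [measurable] = bsupp_meas[OF bs(1)] bsupp_meas[OF bs(2)] bsupp_meas[OF bs(3)]
  have [measurable]: "(\<lambda>p. pt (fst p) (snd p)) \<in> borel_measurable (lborel \<Otimes>\<^sub>M lborel)"
    unfolding lborel_prod by measurable
  have [measurable]: "(\<lambda>p. pt (snd p) (fst p)) \<in> borel_measurable (lborel \<Otimes>\<^sub>M lborel)"
    unfolding lborel_prod measurable_lborel2
    by (rule borel_measurable_continuous_onI) (intro continuous_on_pt continuous_intros)
  define p where "p y = (\<integral>\<^sup>+s. ennreal \<bar>w1 (pt s y)\<bar> \<partial>lborel)" for y
  define q where "q x = (\<integral>\<^sup>+s. ennreal \<bar>w2 (pt x s)\<bar> \<partial>lborel)" for x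
  have m1: "(\<lambda>z. ennreal \<bar>w1 (pt (snd z) (fst z))\<bar>) \<in> borel_measurable (lborel \<Otimes>\<^sub>M lborel)" by measurable
  have m2: "(\<lambda>z. ennreal \<bar>w2 (pt (fst z) (snd z))\<bar>) \<in> borel_measurable (lborel \<Otimes>\<^sub>M lborel)" by measurable
  have pm[measurable]: "p \<in> borel_measurable lborel"
    unfolding p_def[abs_def] using lborel.borel_measurable_nn_integral_fst[OF m1] by simp
  have qm[measurable]: "q \<in> borel_measurable lborel"
    unfolding q_def[abs_def] using lborel.borel_measurable_nn_integral_fst[OF m2] by simp
  have b: "ennreal ((norm (w (pt x y)))\<^sup>2) \<le> q x * p y" for x y
  proof -
    have 1: "ennreal \<bar>w (pt x y)\<bar> \<le> p y" unfolding p_def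
    proof (rule abs_le_nn_integral_deriv[OF C1c_slice1[OF w]])
      show "continuous_on UNIV (\<lambda>s. w1 (pt s y))"
        by (rule continuous_on_compose2[OF bsupp_cont[OF bs(2), of UNIV]]) (intro continuous_on_pt continuous_intros, simp)
    qed (use bsupp_zero[OF bs(1)] in blast)
    have 2: "ennreal \<bar>w (pt x y)\<bar> \<le> q x" unfolding q_def
    proof (rule abs_le_nn_integral_deriv[OF C1c_slice2[OF w]])
      show "continuous_on UNIV (\<lambda>s. w2 (pt x s))"
        by (rule continuous_on_compose2[OF bsupp_cont[OF bs(3), of UNIV]]) (intro continuous_on_pt continuous_intros, simp)
    qed (use bsupp_zero[OF bs(1)] in blast)
    have "ennreal ((norm (w (pt x y)))\<^sup>2) = ennreal \<bar>w (pt x y)\<bar> * ennreal \<bar>w (pt x y)\<bar>"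
      by (simp add: power2_eq_square flip: ennreal_mult)
    also have "\<dots> \<le> q x * p y" by (intro mult_mono 1 2) auto
    finally show ?thesis .
  qed
  have "ennreal (nsq lborel w) = (\<integral>\<^sup>+z. ennreal ((norm (w z))\<^sup>2) \<partial>lborel)"
    unfolding nsq_def using bsupp_sq_int[OF bs(1)] by (simp add: nn_integral_eq_integral sq_int_def)
  also have "\<dots> = (\<integral>\<^sup>+x. \<integral>\<^sup>+y. ennreal ((norm (w (pt x y)))\<^sup>2) \<partial>lborel \<partial>lborel)"
    by (rule nn_integral_R2(1)) measurable
  also have "\<dots> \<le> (\<integral>\<^sup>+x. \<integral>\<^sup>+y. q x * p y \<partial>lborel \<partial>lborel)" by (intro nn_integral_mono b)
  also have "\<dots> = (\<integral>\<^sup>+x. q x * (\<integral>\<^sup>+y. p y \<partial>lborel) \<partial>lborel)" by (simp add: nn_integral_cmult)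
  also have "\<dots> = (\<integral>\<^sup>+x. q x \<partial>lborel) * (\<integral>\<^sup>+y. p y \<partial>lborel)" by (simp add: nn_integral_multc)
  also have "(\<integral>\<^sup>+x. q x \<partial>lborel) = (\<integral>\<^sup>+z. ennreal \<bar>w2 z\<bar> \<partial>lborel)"
    unfolding q_def by (rule nn_integral_R2(1)[symmetric]) measurable
  also have "(\<integral>\<^sup>+y. p y \<partial>lborel) = (\<integral>\<^sup>+z. ennreal \<bar>w1 z\<bar> \<partial>lborel)"
    unfolding p_def by (rule nn_integral_R2(2)[symmetric]) measurable
  also have "(\<integral>\<^sup>+z. ennreal \<bar>w1 z\<bar> \<partial>lborel) = ennreal (\<integral>z. \<bar>w1 z\<bar> \<partial>lborel)"
    using bsupp_integrable[OF bs(2)] by (intro nn_integral_eq_integral) auto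
  also have "(\<integral>\<^sup>+z. ennreal \<bar>w2 z\<bar> \<partial>lborel) = ennreal (\<integral>z. \<bar>w2 z\<bar> \<partial>lborel)"
    using bsupp_integrable[OF bs(3)] by (intro nn_integral_eq_integral) auto
  finally have "ennreal (nsq lborel w) \<le> ennreal ((\<integral>z. \<bar>w1 z\<bar> \<partial>lborel) * (\<integral>z. \<bar>w2 z\<bar> \<partial>lborel))"
    by (simp add: ennreal_mult mult.commute integral_nonneg_AE)
  then show ?thesis by (subst (asm) ennreal_le_iff) (auto simp: integral_nonneg_AE)
qed

text \<open>The weight \<open>k\<close> is meant to equal one where the derivatives of
  \<open>w\<close> live. Its norm then enters as a factor, which makes the inequality a recursion
  when \<open>k\<close> is the step at the level below.\<close>

lemma planar_weighted_inequality:
  assumes w: "C1c R w w1 w2" and k: "sq_int lborel k" and g: "sq_int lborel g"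
    and b: "\<And>z. \<bar>w1 z\<bar> \<le> norm (k z) * norm (g z)" "\<And>z. \<bar>w2 z\<bar> \<le> norm (k z) * norm (g z)"
  shows "nsq lborel w \<le> nsq lborel k * nsq lborel g"
proof -
  have bs: "bsupp R w1" "bsupp R w2" using w by (auto simp: C1c_def)
  define q where "q = sqrt (nsq lborel k) * sqrt (nsq lborel g)"
  have "(\<integral>z. \<bar>w1 z\<bar> \<partial>lborel) \<le> (\<integral>z. norm (k z) * norm (g z) \<partial>lborel)"
    by (intro integral_mono integrable_abs bsupp_integrable[OF bs(1)] sq_int_mult_integrable k g b)
  also have "\<dots> \<le> q" unfolding q_def by (rule Cauchy_Schwarz_integral[OF k g])
  finally have 1: "(\<integral>z. \<bar>w1 z\<bar> \<partial>lborel) \<le> q" .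
  have "(\<integral>z. \<bar>w2 z\<bar> \<partial>lborel) \<le> (\<integral>z. norm (k z) * norm (g z) \<partial>lborel)"
    by (intro integral_mono integrable_abs bsupp_integrable[OF bs(2)] sq_int_mult_integrable k g b)
  also have "\<dots> \<le> q" unfolding q_def by (rule Cauchy_Schwarz_integral[OF k g])
  finally have 2: "(\<integral>z. \<bar>w2 z\<bar> \<partial>lborel) \<le> q" .
  have "nsq lborel w \<le> (\<integral>z. \<bar>w1 z\<bar> \<partial>lborel) * (\<integral>z. \<bar>w2 z\<bar> \<partial>lborel)" by (rule planar_product_inequality[OF w])
  also have "\<dots> \<le> q * q" using 1 2 by (intro mult_mono) (auto simp: integral_nonneg_AE q_def)
  also have "\<dots> = nsq lborel k * nsq lborel g" by (simp add: q_def algebra_simps)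
  finally show ?thesis .
qed

section \<open>An exponential integrability estimate\<close>

lemma max_zero_sq_deriv: "((\<lambda>z::real. (max 0 z)\<^sup>2) has_real_derivative 2 * max 0 z) (at z)"
proof -
  consider "z > 0" | "z < 0" | "z = 0" by linarith
  then show ?thesis
  proof cases
    case 1
    show ?thesis
      by (rule has_field_derivative_transform_within_open[of "\<lambda>z. z\<^sup>2" _ _ "{0<..}"])
        (use 1 in \<open>auto intro!: derivative_eq_intros\<close>)
  next
    case 2
    show ?thesis
      by (rule has_field_derivative_transform_within_open[of "\<lambda>z. 0" _ _ "{..<0}"])
        (use 2 in auto)
  next
    case 3
    have "((\<lambda>h. (max 0 h)\<^sup>2 / h) \<longlongrightarrow> 0) (at (0::real))"
    proof (rule Lim_null_comparison)
      show "\<forall>\<^sub>F h in at 0. norm ((max 0 h)\<^sup>2 / h) \<le> \<bar>h\<bar>"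
        by (auto simp: max_def power2_eq_square intro!: always_eventually)
      show "((\<lambda>h::real. \<bar>h\<bar>) \<longlongrightarrow> 0) (at 0)" by (auto intro!: tendsto_eq_intros)
    qed
    then show ?thesis using 3 by (simp add: DERIV_def)
  qed
qed

text \<open>A continuously differentiable transition from 0 to 1 across [0,1]: the derivative is the
  tent on [0,1] with peak 2 at 1/2, built from truncated linear functions.\<close>

definition step_fn :: "real \<Rightarrow> real" where
  "step_fn z = 2 * (max 0 z)\<^sup>2 - 4 * (max 0 (z - 1/2))\<^sup>2 + 2 * (max 0 (z - 1))\<^sup>2"
definition step_fn' :: "real \<Rightarrow> real" where
  "step_fn' z = 4 * max 0 z - 8 * max 0 (z - 1/2) + 4 * max 0 (z - 1)"

lemma step_fn_deriv: "(step_fn has_real_derivative step_fn' z) (at z)"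
proof -
  have s: "((\<lambda>z. (max 0 (z - c))\<^sup>2) has_real_derivative 2 * max 0 (z - c)) (at z)" for c :: real
    using DERIV_shift[of "\<lambda>z. (max 0 z)\<^sup>2" "2 * max 0 (z - c)" z "- c"] max_zero_sq_deriv[of "z - c"] by simp
  show ?thesis unfolding step_fn_def[abs_def] step_fn'_def
    using DERIV_add[OF DERIV_diff[OF DERIV_cmult[OF s[of 0], of 2] DERIV_cmult[OF s[of "1/2"], of 4]] DERIV_cmult[OF s[of 1], of 2]]
    by simp
qed

lemma step_fn_low: "z \<le> 0 \<Longrightarrow> step_fn z = 0" and step_fn'_low: "z \<le> 0 \<Longrightarrow> step_fn' z = 0"
  by (auto simp: step_fn_def step_fn'_def max_def)

lemma step_fn_high: "1 \<le> z \<Longrightarrow> step_fn z = 1" and step_fn'_high: "1 \<le> z \<Longrightarrow> step_fn' z = 0"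
  by (auto simp: step_fn_def step_fn'_def max_def power2_eq_square algebra_simps)

lemma step_fn'_bounds: "0 \<le> step_fn' z" "step_fn' z \<le> 2"
  by (auto simp: step_fn'_def max_def)

lemma step_fn_mono: "x \<le> y \<Longrightarrow> step_fn x \<le> step_fn y"
  by (rule DERIV_nonneg_imp_nondecreasing[of x y step_fn]) (use step_fn_deriv step_fn'_bounds in blast)+

lemma step_fn_bounds: "0 \<le> step_fn z" "step_fn z \<le> 1"
  using step_fn_mono[of "min 0 z" z] step_fn_mono[of z "max 1 z"] step_fn_low[of "min 0 z"] step_fn_high[of "max 1 z"] by auto

lemma step_fn_cont: "continuous_on UNIV step_fn" and step_fn'_cont: "continuous_on UNIV step_fn'"
  unfolding step_fn_def[abs_def] step_fn'_def[abs_def] by (intro continuous_intros)+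

text \<open>The assumption j \<ge> 0 makes the composition vanish wherever \<open>u\<close> does, so
  the support does not grow.\<close>

lemma C1c_step:
  assumes u: "C1c R u u1 u2" and j: "j \<ge> 0"
  shows "C1c R (\<lambda>z. step_fn (u z - j)) (\<lambda>z. step_fn' (u z - j) * u1 z) (\<lambda>z. step_fn' (u z - j) * u2 z)"
proof -
  have bs: "bsupp R u" "bsupp R u1" "bsupp R u2" using u by (auto simp: C1c_def)
  have c1: "continuous_on UNIV (\<lambda>x. step_fn (x - j))" 
    by (rule continuous_on_compose2[OF step_fn_cont]) (auto intro!: continuous_intros)
  have c2: "continuous_on UNIV (\<lambda>z. step_fn' (u z - j))"
    by (rule continuous_on_compose2[OF step_fn'_cont]) (auto intro!: continuous_intros bsupp_cont[OF bs(1)])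
  have d: "((\<lambda>t. step_fn (u (z + t *\<^sub>R e) - j)) has_real_derivative step_fn' (u z - j) * v) (at 0)"
    if "((\<lambda>t. u (z + t *\<^sub>R e)) has_real_derivative v) (at 0)" for z e v
  proof -
    have "((\<lambda>t. u (z + t *\<^sub>R e) - j) has_real_derivative v) (at 0)" using that by (auto intro!: derivative_eq_intros)
    from DERIV_chain2[OF step_fn_deriv this] show ?thesis by simp
  qed
  show ?thesis unfolding C1c_def
    using u bsupp_map[OF bs(1) c1] step_fn_low[of "-j"] j bsupp_mult[OF bs(2) c2] bsupp_mult[OF bs(3) c2] d
    unfolding C1c_def by auto
qed

lemma emeasure_sqbox:
  assumes "R \<ge> 0" shows "emeasure lborel (sqbox R) = ennreal (4 * R\<^sup>2)"
proof -
  have "emeasure lborel (sqbox R) = ennreal (\<Prod>b\<in>Basis. (pt R R - pt (-R) (-R)) \<bullet> b)"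
    unfolding sqbox_def by (rule emeasure_lborel_cbox)
      (use assms in \<open>auto simp: Basis_vec_def inner_axis pt_def\<close>)
  then show ?thesis by (subst (asm) prod_Basis_R2) (simp add: inner_axis power2_eq_square)
qed

lemma nsq_indicator_box_le:
  assumes "R \<ge> 0" "bsupp R w" "\<And>z. \<bar>w z\<bar> \<le> 1" shows "nsq lborel w \<le> 4 * R\<^sup>2"
proof -
  have ms: "emeasure lborel (sqbox R) = ennreal (4 * R\<^sup>2)"
    by (rule emeasure_sqbox[OF assms(1)])
  have int: "integrable lborel (indicat_real (sqbox R))"
    using ms by (intro integrable_real_indicator) (auto simp: sqbox_def)
  have "nsq lborel w \<le> (\<integral>z. indicat_real (sqbox R) z \<partial>lborel)"
    unfolding nsq_def
  proof (intro integral_mono int sq_int_integrable bsupp_sq_int[OF assms(2)])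
    fix z
    show "(norm (w z))\<^sup>2 \<le> indicat_real (sqbox R) z"
    proof (cases "z \<in> sqbox R")
      case True then show ?thesis using assms(3)[of z] by (simp add: abs_square_le_1)
    next
      case False
      then have "R \<le> \<bar>z $ 1\<bar> \<or> R \<le> \<bar>z $ 2\<bar>" by (auto simp: mem_sqbox)
      then have "w z = 0" using assms(2) unfolding bsupp_def by blast
      then show ?thesis by simp
    qed
  qed
  also have "\<dots> = 4 * R\<^sup>2" using ms by (simp add: measure_def sqbox_def)
  finally show ?thesis .
qed

text \<open>Each level set of height one costs a factor \<open>d j\<close>, the energy spent there; since the
  energies add up, \<open>x \<le> exp (K x) / K\<close> turns the product into an arbitrarily fast geometric decay.\<close>

lemma level_decay:
  assumes R: "R \<ge> 0" and u: "C1c R u u1 u2" and K: "K > 0"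
  shows "nsq lborel (\<lambda>z. step_fn (u z - real n)) \<le>
     4 * R\<^sup>2 * (1 / K) ^ n * exp (K * (4 * (nsq lborel u1 + nsq lborel u2)))"
proof -
  have bs: "bsupp R u" "bsupp R u1" "bsupp R u2" using u by (auto simp: C1c_def)
  define g where "g z = sqrt ((u1 z)\<^sup>2 + (u2 z)\<^sup>2)" for z
  have gb: "bsupp R g"
    using bs(2,3) unfolding g_def[abs_def] bsupp_def by (auto intro!: continuous_intros)
  have g2: "(norm (g z))\<^sup>2 = (norm (u1 z))\<^sup>2 + (norm (u2 z))\<^sup>2" for z by (simp add: g_def)
  have gD: "nsq lborel g = nsq lborel u1 + nsq lborel u2"
    unfolding nsq_def g2 using sq_int_integrable[OF bsupp_sq_int[OF bs(2)]] sq_int_integrable[OF bsupp_sq_int[OF bs(3)]] by simp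
  have gu: "\<bar>u1 z\<bar> \<le> norm (g z)" "\<bar>u2 z\<bar> \<le> norm (g z)" for z
    unfolding g_def by (auto intro: real_le_rsqrt)
  define q where "q j = nsq lborel (\<lambda>z. step_fn (u z - real j))" for j
  define f where "f j z = step_fn' (u z - real j) * g z" for j z
  define d where "d j = nsq lborel (f j)" for j
  have c2: "continuous_on UNIV (\<lambda>z. step_fn' (u z - j))" for j
    by (rule continuous_on_compose2[OF step_fn'_cont]) (auto intro!: continuous_intros bsupp_cont[OF bs(1)])
  have fb: "bsupp R (f j)" for j unfolding f_def[abs_def] by (rule bsupp_mult[OF gb c2])
  have sb: "bsupp R (\<lambda>z. step_fn (u z - real j))" for j using C1c_step[OF u, of "real j"] by (simp add: C1c_def)
  have step: "q (Suc j) \<le> q j * d (Suc j)" for j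
    unfolding q_def d_def
  proof (rule planar_weighted_inequality[OF C1c_step[OF u]])
    show "sq_int lborel (\<lambda>z. step_fn (u z - real j))" by (rule bsupp_sq_int[OF sb])
    show "sq_int lborel (f (Suc j))" by (rule bsupp_sq_int[OF fb])
    \<comment> \<open>Where the slope at level j+1 is nonzero, u exceeds j+1, so the step at level j
      equals one there and can be inserted as a weight for free.\<close>
    have *: "\<bar>step_fn' (u z - real (Suc j)) * v\<bar> \<le> norm (step_fn (u z - real j)) * norm (f (Suc j) z)" if "\<bar>v\<bar> \<le> norm (g z)" for z v
    proof (cases "u z - real (Suc j) \<le> 0")
      case True then show ?thesis by (simp add: step_fn'_low)
    next
      case False
      then have "step_fn (u z - real j) = 1" by (intro step_fn_high) simp
      then show ?thesis using that by (simp add: f_def abs_mult mult_left_mono)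
    qed
    show "\<bar>step_fn' (u z - real (Suc j)) * u1 z\<bar> \<le> norm (step_fn (u z - real j)) * norm (f (Suc j) z)" for z by (rule *[OF gu(1)])
    show "\<bar>step_fn' (u z - real (Suc j)) * u2 z\<bar> \<le> norm (step_fn (u z - real j)) * norm (f (Suc j) z)" for z by (rule *[OF gu(2)])
  qed simp
  have ind: "q n \<le> q 0 * (1 / K) ^ n * exp (K * (\<Sum>j=1..n. d j))" for n
  proof (induction n)
    case (Suc n)
    have "d (Suc n) \<le> (1 / K) * exp (K * d (Suc n))"
    proof -
      have "K * d (Suc n) \<le> exp (K * d (Suc n))" using exp_ge_add_one_self[of "K * d (Suc n)"] by linarith
      then show ?thesis using K by (simp add: field_simps)
    qed
    then have "q (Suc n) \<le> q n * ((1 / K) * exp (K * d (Suc n)))"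
      by (intro order_trans[OF step[of n]] mult_left_mono) (simp_all add: q_def)
    also have "\<dots> \<le> (q 0 * (1 / K) ^ n * exp (K * (\<Sum>j=1..n. d j))) * ((1 / K) * exp (K * d (Suc n)))"
      using K by (intro mult_right_mono Suc.IH) auto
    also have "\<dots> = q 0 * (1 / K) ^ Suc n * exp (K * (\<Sum>j=1..Suc n. d j))"
      by (simp add: exp_add distrib_left)
    finally show ?case .
  qed simp
  have "(\<Sum>j=1..n. d j) \<le> 4 * nsq lborel g"
  proof -
    have "(\<Sum>j=1..n. d j) = (\<integral>z. (\<Sum>j=1..n. (norm (f j z))\<^sup>2) \<partial>lborel)"
      unfolding d_def nsq_def by (rule Bochner_Integration.integral_sum[symmetric]) (rule sq_int_integrable[OF bsupp_sq_int[OF fb]])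
    also have "\<dots> \<le> (\<integral>z. 4 * (norm (g z))\<^sup>2 \<partial>lborel)"
    proof (intro integral_mono Bochner_Integration.integrable_sum sq_int_integrable[OF bsupp_sq_int[OF fb]] integrable_mult_right sq_int_integrable[OF bsupp_sq_int[OF gb]])
      fix z
      \<comment> \<open>Only the slice with index the integer part of u z can be active at z; a
        negative integer part is sent by \<open>nat\<close> to 0, outside the range of summation.
        The factor 4 is the square of the largest slope.\<close>
      define k where "k = nat \<lfloor>u z\<rfloor>"
      have zero: "(norm (f j z))\<^sup>2 = 0" if "j \<noteq> k" "1 \<le> j" for j
      proof (cases "0 < u z - real j \<and> u z - real j < 1")
        case True
        then have "\<lfloor>u z\<rfloor> = int j" by (intro floor_unique) auto
        then have "k = j" by (simp add: k_def)
        then show ?thesis using that by simp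
      next
        case False
        then show ?thesis using step_fn'_low[of "u z - real j"] step_fn'_high[of "u z - real j"] by (auto simp: f_def not_less)
      qed
      have b4: "(norm (f j z))\<^sup>2 \<le> 4 * (norm (g z))\<^sup>2" for j
      proof -
        have "norm (f j z) \<le> 2 * norm (g z)" unfolding f_def norm_mult
          using step_fn'_bounds[of "u z - real j"] by (intro mult_right_mono) auto
        then have "(norm (f j z))\<^sup>2 \<le> (2 * norm (g z))\<^sup>2" by (intro power_mono) auto
        then show ?thesis by (simp add: power_mult_distrib)
      qed
      have "(\<Sum>j=1..n. (norm (f j z))\<^sup>2) = (\<Sum>j\<in>{1..n} \<inter> {k}. (norm (f j z))\<^sup>2)"
        by (rule sum.mono_neutral_right) (use zero in auto)
      also have "\<dots> \<le> 4 * (norm (g z))\<^sup>2" using b4[of k] by (cases "k \<in> {1..n}") auto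
      finally show "(\<Sum>j=1..n. (norm (f j z))\<^sup>2) \<le> 4 * (norm (g z))\<^sup>2" .
    qed
    also have "\<dots> = 4 * nsq lborel g" by (simp add: nsq_def)
    finally show ?thesis .
  qed
  then have e: "exp (K * (\<Sum>j=1..n. d j)) \<le> exp (K * (4 * nsq lborel g))" using K by simp
  have q0: "q 0 \<le> 4 * R\<^sup>2" unfolding q_def using step_fn_bounds by (intro nsq_indicator_box_le R sb) auto
  have "q n \<le> q 0 * (1 / K) ^ n * exp (K * (\<Sum>j=1..n. d j))" by (rule ind)
  also have "\<dots> \<le> 4 * R\<^sup>2 * (1 / K) ^ n * exp (K * (4 * nsq lborel g))"
    using q0 e K by (intro mult_mono) (auto simp: q_def)
  finally show ?thesis unfolding q_def gD .
qed

text \<open>On the square, exp (p u) is at most exp (2 p) times one plus the sum of exp (p j) times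
  the squared step at level j, and the decay of the levels can be made faster than exp (p j) grows.
  The sum is finite because u is bounded, but the resulting bound is independent of its
  length.\<close>

lemma exp_integral_bound:
  assumes R: "R \<ge> 0" and u: "C1c R u u1 u2" and p: "p \<ge> 0" and B: "nsq lborel u1 + nsq lborel u2 \<le> B"
  shows "(\<integral>\<^sup>+z\<in>sqbox R. ennreal (exp (p * u z)) \<partial>lborel) \<le>
    ennreal (exp (2 * p) * (4 * R\<^sup>2) * (1 + 2 * exp (8 * exp p * B)))"
proof -
  have bs: "bsupp R u" using u by (auto simp: C1c_def)
  note [measurable] = bsupp_meas[OF bs]
  have "bounded (u ` sqbox R)"
    unfolding sqbox_def by (intro compact_imp_bounded compact_continuous_image bsupp_cont[OF bs] compact_cbox)
  then obtain b where b: "\<And>z. z \<in> sqbox R \<Longrightarrow> \<bar>u z\<bar> \<le> b" by (auto simp: bounded_iff)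
  obtain n :: nat where n: "b < real n" using reals_Archimedean2 by blast
  \<comment> \<open>Twice exp p, so that exp (p j) times the decay (1/K)^j is (1/2)^j.\<close>
  define K where "K = 2 * exp p"
  have K: "K > 0" by (simp add: K_def)
  define S where "S z = (\<Sum>j<n. exp (p * real j) * (step_fn (u z - real j))\<^sup>2)" for z
  have pt_le: "exp (p * u z) \<le> exp (2 * p) * (1 + S z)" if z: "z \<in> sqbox R" for z
  proof -
    have S0: "S z \<ge> 0" unfolding S_def by (intro sum_nonneg) auto
    show ?thesis
    proof (cases "u z < 1")
      case True
      have "p * u z \<le> 2 * p" using mult_left_mono[of "u z" 2 p] True p by (simp add: mult.commute)
      then have "exp (p * u z) \<le> exp (2 * p)" by simp
      also have "\<dots> \<le> exp (2 * p) * (1 + S z)" using S0 by simp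
      finally show ?thesis .
    next
      case False
      \<comment> \<open>One below the integer part, so that u z - j \<ge> 1 and the step is already
        equal to 1; since u z < j + 2, the price is exp (2 p).\<close>
      define j where "j = nat \<lfloor>u z\<rfloor> - 1"
      have f: "real (nat \<lfloor>u z\<rfloor>) \<le> u z" "u z < real (nat \<lfloor>u z\<rfloor>) + 1" "nat \<lfloor>u z\<rfloor> \<ge> 1"
        using False by linarith+
      have "real j = real (nat \<lfloor>u z\<rfloor>) - 1" using f(3) unfolding j_def by (subst of_nat_diff) simp_all
      then have j: "real j \<le> u z - 1" "u z < real j + 2" using f(1,2) by linarith+
      have "real j < real n" using j(1) b[OF z] n by linarith
      then have jn: "j \<in> {..<n}" by simp
      have "exp (p * real j) = exp (p * real j) * (step_fn (u z - real j))\<^sup>2" using j(1) by (simp add: step_fn_high)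
      also have "\<dots> \<le> S z" unfolding S_def by (rule member_le_sum[OF jn]) auto
      finally have "exp (2 * p) * exp (p * real j) \<le> exp (2 * p) * (1 + S z)" by simp
      moreover have "exp (p * u z) \<le> exp (2 * p) * exp (p * real j)"
      proof -
        have "p * u z \<le> p * (real j + 2)" using j(2) p by (intro mult_left_mono) auto
        then show ?thesis by (simp add: exp_add[symmetric] algebra_simps)
      qed
      ultimately show ?thesis by linarith
    qed
  qed
  have sb: "bsupp R (\<lambda>z. step_fn (u z - real j))" for j using C1c_step[OF u, of "real j"] by (simp add: C1c_def)
  have ib: "integrable lborel (indicat_real (sqbox R))"
    by (intro integrable_real_indicator) (auto simp: sqbox_def emeasure_lborel_cbox_eq)
  have mb: "(\<integral>z. indicat_real (sqbox R) z \<partial>lborel) = 4 * R\<^sup>2"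
    using emeasure_sqbox[of R] R by (simp add: measure_def sqbox_def)
  have intS: "integrable lborel (\<lambda>z. exp (p * real j) * (norm (step_fn (u z - real j)))\<^sup>2)" for j
    by (intro integrable_mult_right sq_int_integrable bsupp_sq_int[OF sb])
  have intH: "integrable lborel (\<lambda>z. exp (2 * p) * (indicat_real (sqbox R) z + (\<Sum>j<n. exp (p * real j) * (norm (step_fn (u z - real j)))\<^sup>2)))"
    by (intro integrable_mult_right Bochner_Integration.integrable_add Bochner_Integration.integrable_sum intS ib)
  have "(\<integral>\<^sup>+z\<in>sqbox R. ennreal (exp (p * u z)) \<partial>lborel) \<le>
    (\<integral>\<^sup>+z. ennreal (exp (2 * p) * (indicat_real (sqbox R) z + (\<Sum>j<n. exp (p * real j) * (norm (step_fn (u z - real j)))\<^sup>2))) \<partial>lborel)"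
  proof (intro nn_integral_mono)
    fix z
    show "ennreal (exp (p * u z)) * indicator (sqbox R) z \<le>
      ennreal (exp (2 * p) * (indicat_real (sqbox R) z + (\<Sum>j<n. exp (p * real j) * (norm (step_fn (u z - real j)))\<^sup>2)))"
      using pt_le[of z] by (auto simp: indicator_def S_def intro!: ennreal_leI)
  qed
  also have "\<dots> = ennreal (\<integral>z. exp (2 * p) * (indicat_real (sqbox R) z + (\<Sum>j<n. exp (p * real j) * (norm (step_fn (u z - real j)))\<^sup>2)) \<partial>lborel)"
    by (intro nn_integral_eq_integral intH AE_I2) (auto intro!: mult_nonneg_nonneg add_nonneg_nonneg sum_nonneg)
  also have "(\<integral>z. exp (2 * p) * (indicat_real (sqbox R) z + (\<Sum>j<n. exp (p * real j) * (norm (step_fn (u z - real j)))\<^sup>2)) \<partial>lborel) =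
    exp (2 * p) * (4 * R\<^sup>2 + (\<Sum>j<n. exp (p * real j) * nsq lborel (\<lambda>z. step_fn (u z - real j))))"
  proof -
    have "(\<integral>z. (\<Sum>j<n. exp (p * real j) * (norm (step_fn (u z - real j)))\<^sup>2) \<partial>lborel) =
      (\<Sum>j<n. exp (p * real j) * nsq lborel (\<lambda>z. step_fn (u z - real j)))"
      unfolding nsq_def by (subst Bochner_Integration.integral_sum[OF intS]) simp
    then show ?thesis
      using Bochner_Integration.integral_add[OF ib Bochner_Integration.integrable_sum[of "{..<n}", OF intS]] mb by simp
  qed
  also have "\<dots> \<le> exp (2 * p) * (4 * R\<^sup>2 + (\<Sum>j<n. 4 * R\<^sup>2 * exp (8 * exp p * B) * (1/2)^j))"
  proof (intro mult_left_mono add_left_mono sum_mono)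
    fix j assume "j \<in> {..<n}"
    have e: "exp (p * real j) = exp p ^ j" by (simp add: exp_of_nat_mult[symmetric] mult.commute)
    have "exp (p * real j) * nsq lborel (\<lambda>z. step_fn (u z - real j)) \<le>
      exp (p * real j) * (4 * R\<^sup>2 * (1 / K) ^ j * exp (K * (4 * (nsq lborel u1 + nsq lborel u2))))"
      by (intro mult_left_mono level_decay[OF R u K]) simp
    also have "\<dots> \<le> exp (p * real j) * (4 * R\<^sup>2 * (1 / K) ^ j * exp (K * (4 * B)))"
      using B K by (intro mult_left_mono) auto
    also have "\<dots> = 4 * R\<^sup>2 * exp (8 * exp p * B) * (exp p / K) ^ j"
      unfolding e by (simp add: K_def power_divide power_mult_distrib mult_ac)
    also have "exp p / K = 1/2" by (simp add: K_def)
    finally show "exp (p * real j) * nsq lborel (\<lambda>z. step_fn (u z - real j)) \<le> 4 * R\<^sup>2 * exp (8 * exp p * B) * (1/2)^j" .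
  qed simp
  also have "\<dots> \<le> exp (2 * p) * (4 * R\<^sup>2) * (1 + 2 * exp (8 * exp p * B))"
  proof -
    have "(\<Sum>j<n. (1/2::real)^j) \<le> 2" by (simp add: sum_gp_strict)
    then have "(\<Sum>j<n. 4 * R\<^sup>2 * exp (8 * exp p * B) * (1/2)^j) \<le> 4 * R\<^sup>2 * exp (8 * exp p * B) * 2"
      unfolding sum_distrib_left[symmetric] by (intro mult_left_mono) auto
    then have "exp (2 * p) * (4 * R\<^sup>2 + (\<Sum>j<n. 4 * R\<^sup>2 * exp (8 * exp p * B) * (1/2)^j)) \<le>
       exp (2 * p) * (4 * R\<^sup>2 + 4 * R\<^sup>2 * exp (8 * exp p * B) * 2)" by (intro mult_left_mono add_left_mono) auto
    then show ?thesis by (simp add: algebra_simps)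
  qed
  finally show ?thesis by (simp add: ennreal_leI)
qed

section \<open>A compactness estimate\<close>

lemma integral_quadratic:
  fixes f :: "real \<Rightarrow> real"
  assumes ab: "a \<le> b" and f: "continuous_on {a..b} f"
  shows "integral {a..b} (\<lambda>x. A * (f x)\<^sup>2 + B * f x + C) =
    A * integral {a..b} (\<lambda>x. (f x)\<^sup>2) + B * integral {a..b} f + C * (b - a)"
proof (rule integral_unique)
  have i: "(f has_integral integral {a..b} f) {a..b}" "((\<lambda>x. (f x)\<^sup>2) has_integral integral {a..b} (\<lambda>x. (f x)\<^sup>2)) {a..b}"
    by (intro integrable_integral integrable_continuous_real continuous_intros f)+
  have c: "((\<lambda>x. C) has_integral C * (b - a)) {a..b}"
    using has_integral_const_real[of C a b] ab by (simp add: mult.commute)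
  show "((\<lambda>x. A * (f x)\<^sup>2 + B * f x + C) has_integral
      A * integral {a..b} (\<lambda>x. (f x)\<^sup>2) + B * integral {a..b} f + C * (b - a)) {a..b}"
    by (intro has_integral_add has_integral_mult_right i c)
qed

text \<open>The integral of the square of f minus its mean is nonnegative.\<close>

lemma integral_square_le:
  fixes f :: "real \<Rightarrow> real"
  assumes ab: "a \<le> b" and f: "continuous_on {a..b} f"
  shows "(integral {a..b} f)\<^sup>2 \<le> (b - a) * integral {a..b} (\<lambda>x. (f x)\<^sup>2)"
proof (cases "a = b")
  case False
  define L where "L = b - a"
  have L: "L > 0" using False ab by (simp add: L_def)
  define c where "c = integral {a..b} f / L"
  have "0 \<le> integral {a..b} (\<lambda>x. (f x - c)\<^sup>2)"
    by (rule integral_nonneg) (auto intro!: integrable_continuous_real continuous_intros f)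
  also have "integral {a..b} (\<lambda>x. (f x - c)\<^sup>2) = integral {a..b} (\<lambda>x. 1 * (f x)\<^sup>2 + (- 2 * c) * f x + c\<^sup>2)"
    by (simp add: power2_diff algebra_simps)
  also have "\<dots> = 1 * integral {a..b} (\<lambda>x. (f x)\<^sup>2) + (- 2 * c) * integral {a..b} f + c\<^sup>2 * L"
    unfolding L_def by (rule integral_quadratic[OF ab f])
  also have "\<dots> = integral {a..b} (\<lambda>x. (f x)\<^sup>2) - (integral {a..b} f)\<^sup>2 / L"
    using L by (simp add: c_def power2_eq_square field_simps)
  finally show ?thesis using L by (simp add: L_def field_simps)
qed simp

text \<open>The fundamental theorem of calculus and Cauchy-Schwarz on the interval between the two
  points.\<close>

lemma oscillation_square_le:
  fixes f f' :: "real \<Rightarrow> real"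
  assumes der: "\<And>s. (f has_real_derivative f' s) (at s)" and cont: "continuous_on UNIV f'"
    and x: "x \<in> {a..b}" and y: "y \<in> {a..b}"
  shows "(f x - f y)\<^sup>2 \<le> (b - a) * integral {a..b} (\<lambda>s. (f' s)\<^sup>2)"
proof -
  have *: "(f x - f y)\<^sup>2 \<le> (b - a) * integral {a..b} (\<lambda>s. (f' s)\<^sup>2)" if yx: "y \<le> x" "x \<in> {a..b}" "y \<in> {a..b}" for x y
  proof -
    have c: "continuous_on S f'" for S using cont continuous_on_subset by blast
    have "(f' has_integral (f x - f y)) {y..x}"
      using der yx(1) by (intro fundamental_theorem_of_calculus)
        (auto simp: has_real_derivative_iff_has_vector_derivative[symmetric] intro: has_field_derivative_at_within)
    then have "f x - f y = integral {y..x} f'" by (simp add: integral_unique)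
    then have "(f x - f y)\<^sup>2 \<le> (x - y) * integral {y..x} (\<lambda>s. (f' s)\<^sup>2)"
      using integral_square_le[OF yx(1) c] by simp
    also have "\<dots> \<le> (b - a) * integral {a..b} (\<lambda>s. (f' s)\<^sup>2)"
    proof (intro mult_mono integral_subset_le)
      show "(\<lambda>s. (f' s)\<^sup>2) integrable_on {y..x}" "(\<lambda>s. (f' s)\<^sup>2) integrable_on {a..b}"
        by (intro integrable_continuous_real continuous_intros c)+
      show "0 \<le> integral {y..x} (\<lambda>s. (f' s)\<^sup>2)"
        by (rule integral_nonneg) (auto intro!: integrable_continuous_real continuous_intros c)
    qed (use yx in auto)
    finally show ?thesis .
  qed
  show ?thesis
  proof (cases "y \<le> x")
    case True then show ?thesis using *[of y x] x y by simp
  next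
    case False
    then have "(f y - f x)\<^sup>2 \<le> (b - a) * integral {a..b} (\<lambda>s. (f' s)\<^sup>2)" using *[of x y] x y by simp
    then show ?thesis by (simp add: power2_commute)
  qed
qed

text \<open>Integrating the bound for (f x - f y)^2 over both variables produces the variance of f,
  without looking for a point where f attains its mean.\<close>

lemma poincare_interval:
  fixes f f' :: "real \<Rightarrow> real"
  assumes ab: "a < b" and der: "\<And>s. (f has_real_derivative f' s) (at s)" and cont: "continuous_on UNIV f'"
  shows "integral {a..b} (\<lambda>x. (f x)\<^sup>2) \<le> (integral {a..b} f)\<^sup>2 / (b - a) + (b - a)\<^sup>2 * integral {a..b} (\<lambda>s. (f' s)\<^sup>2)"
proof -
  define L where "L = b - a"
  have L: "L > 0" using ab by (simp add: L_def)
  define S where "S = L * integral {a..b} (\<lambda>s. (f' s)\<^sup>2)"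
  have fc: "continuous_on T f" for T using der by (meson DERIV_isCont continuous_at_imp_continuous_on)
  define p q where "p = integral {a..b} f" and "q = integral {a..b} (\<lambda>x. (f x)\<^sup>2)"
  have 1: "q - (2 * f y) * p + (f y)\<^sup>2 * L \<le> S * L" if y: "y \<in> {a..b}" for y
  proof -
    have "integral {a..b} (\<lambda>x. (f x - f y)\<^sup>2) \<le> integral {a..b} (\<lambda>x. S)"
      unfolding S_def L_def
      by (intro integral_le oscillation_square_le der cont y) (auto intro!: integrable_continuous_real continuous_intros fc)
    also have "integral {a..b} (\<lambda>x. (f x - f y)\<^sup>2) = integral {a..b} (\<lambda>x. 1 * (f x)\<^sup>2 + (- 2 * f y) * f x + (f y)\<^sup>2)"
      by (simp add: power2_diff algebra_simps)
    also have "\<dots> = 1 * q + (- 2 * f y) * p + (f y)\<^sup>2 * L"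
      unfolding p_def q_def L_def by (rule integral_quadratic[OF less_imp_le[OF ab] fc])
    also have "integral {a..b} (\<lambda>x. S) = S * L" using ab by (simp add: L_def)
    finally show ?thesis by simp
  qed
  have "integral {a..b} (\<lambda>y. L * (f y)\<^sup>2 + (- 2 * p) * f y + q) \<le> integral {a..b} (\<lambda>y. S * L)"
    by (rule integral_le) (use 1 in \<open>auto intro!: integrable_continuous_real continuous_intros fc simp: algebra_simps\<close>)
  also have "integral {a..b} (\<lambda>y. L * (f y)\<^sup>2 + (- 2 * p) * f y + q) = L * q + (- 2 * p) * p + q * L"
    using integral_quadratic[OF less_imp_le[OF ab] fc] unfolding p_def q_def L_def .
  also have "integral {a..b} (\<lambda>y. S * L) = S * L * L" using ab by (simp add: L_def)
  \<comment> \<open>The double integration gives 2 (L q - p^2) \<le> S L^2; the factor 1/2 in front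
    of S is given away below.\<close>
  finally have "2 * (L * q) \<le> 2 * p\<^sup>2 + S * L * L" by (simp add: power2_eq_square algebra_simps)
  moreover have "S \<ge> 0" unfolding S_def using L
    by (intro mult_nonneg_nonneg integral_nonneg) (auto intro!: integrable_continuous_real continuous_intros continuous_on_subset[OF cont])
  then have "0 \<le> S * L * L" using L by simp
  ultimately have "L * q \<le> p\<^sup>2 + S * L * L" by linarith
  then have "q \<le> p\<^sup>2 / L + L * S" using L by (simp add: field_simps)
  then show ?thesis by (simp add: p_def q_def L_def S_def power2_eq_square mult.assoc)
qed

section \<open>Averages over square grids and the compactness criterion\<close>

definition grid_pt :: "real \<Rightarrow> nat \<Rightarrow> nat \<Rightarrow> real" where "grid_pt R m i = - R + real i * (2 * R / real m)"

lemma grid_pt_Suc: "grid_pt R m (Suc i) - grid_pt R m i = 2 * R / real m" by (simp add: grid_pt_def distrib_right add_divide_distrib)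

lemma grid_pt_less: "R > 0 \<Longrightarrow> m > 0 \<Longrightarrow> grid_pt R m i < grid_pt R m (Suc i)"
  using grid_pt_Suc[of R m i] by (smt (verit) divide_pos_pos of_nat_0_less_iff)

lemma grid_pt_ends: "grid_pt R m 0 = - R" "m > 0 \<Longrightarrow> grid_pt R m m = R" by (auto simp: grid_pt_def)

lemma integral_grid_pt:
  fixes f :: "real \<Rightarrow> real"
  assumes R: "R > 0" and m: "m > 0" and f: "continuous_on UNIV f"
  shows "integral {-R..R} f = (\<Sum>i<m. integral {grid_pt R m i..grid_pt R m (Suc i)} f)"
proof -
  have "integral {-R..grid_pt R m k} f = (\<Sum>i<k. integral {grid_pt R m i..grid_pt R m (Suc i)} f) \<and> - R \<le> grid_pt R m k" for k
  proof (induction k)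
    case (Suc k)
    have "integral {-R..grid_pt R m k} f + integral {grid_pt R m k..grid_pt R m (Suc k)} f = integral {-R..grid_pt R m (Suc k)} f"
      using Suc grid_pt_less[OF R m, of k] continuous_on_subset[OF f]
      by (intro Henstock_Kurzweil_Integration.integral_combine integrable_continuous_real) auto
    then show ?case using Suc grid_pt_less[OF R m, of k] by simp
  qed (simp add: grid_pt_ends)
  from this[of m] show ?thesis using grid_pt_ends(2)[OF m] by simp
qed

lemma poincare_grid:
  fixes f f' :: "real \<Rightarrow> real"
  assumes R: "R > 0" and m: "m > 0" and der: "\<And>s. (f has_real_derivative f' s) (at s)" and cont: "continuous_on UNIV f'"
  defines "h \<equiv> 2 * R / real m"
  shows "integral {-R..R} (\<lambda>x. (f x)\<^sup>2) \<le> (\<Sum>i<m. (integral {grid_pt R m i..grid_pt R m (Suc i)} f)\<^sup>2) / h + h\<^sup>2 * integral {-R..R} (\<lambda>s. (f' s)\<^sup>2)"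
proof -
  have fc: "continuous_on UNIV f" using der by (meson DERIV_isCont continuous_at_imp_continuous_on)
  have "integral {-R..R} (\<lambda>x. (f x)\<^sup>2) = (\<Sum>i<m. integral {grid_pt R m i..grid_pt R m (Suc i)} (\<lambda>x. (f x)\<^sup>2))"
    by (intro integral_grid_pt R m continuous_intros fc)
  also have "\<dots> \<le> (\<Sum>i<m. (integral {grid_pt R m i..grid_pt R m (Suc i)} f)\<^sup>2 / h + h\<^sup>2 * integral {grid_pt R m i..grid_pt R m (Suc i)} (\<lambda>s. (f' s)\<^sup>2))"
    using poincare_interval[OF grid_pt_less[OF R m] der cont] unfolding grid_pt_Suc h_def by (intro sum_mono) simp
  also have "\<dots> = (\<Sum>i<m. (integral {grid_pt R m i..grid_pt R m (Suc i)} f)\<^sup>2) / h + h\<^sup>2 * (\<Sum>i<m. integral {grid_pt R m i..grid_pt R m (Suc i)} (\<lambda>s. (f' s)\<^sup>2))"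
    by (simp add: sum.distrib sum_divide_distrib sum_distrib_left)
  also have "(\<Sum>i<m. integral {grid_pt R m i..grid_pt R m (Suc i)} (\<lambda>s. (f' s)\<^sup>2)) = integral {-R..R} (\<lambda>s. (f' s)\<^sup>2)"
    by (intro integral_grid_pt[symmetric] R m continuous_intros cont)
  finally show ?thesis .
qed

lemma bsupp_slice_cont:
  fixes w :: "R2 \<Rightarrow> real"
  assumes "continuous_on UNIV w"
  shows "continuous_on S (\<lambda>s. w (pt s y))" "continuous_on S (\<lambda>s. w (pt x s))"
    "continuous_on T (\<lambda>p. w (pt (fst p) (snd p)))" "continuous_on T (\<lambda>p. w (pt (snd p) (fst p)))"
  by (rule continuous_on_compose2[OF assms]; (intro continuous_on_pt continuous_intros)?; simp)+

lemma slice_integral_cont: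
  fixes w :: "R2 \<Rightarrow> real"
  assumes "continuous_on UNIV w"
  shows "continuous_on U (\<lambda>y. integral {c..d} (\<lambda>s. w (pt s y)))" "continuous_on U (\<lambda>x. integral {c..d} (\<lambda>s. w (pt x s)))"
proof -
  show "continuous_on U (\<lambda>y. integral {c..d} (\<lambda>s. w (pt s y)))"
    using integral_continuous_on_param[of U c d "\<lambda>y s. w (pt s y)"] bsupp_slice_cont(4)[OF assms]
    by (simp add: case_prod_beta)
  show "continuous_on U (\<lambda>x. integral {c..d} (\<lambda>s. w (pt x s)))"
    using integral_continuous_on_param[of U c d "\<lambda>y s. w (pt y s)"] bsupp_slice_cont(3)[OF assms]
    by (simp add: case_prod_beta)
qed

text \<open>Connects the Bochner integral, in which the norms are defined, with the gauge integral,
  in which Leibniz's rule and the fundamental theorem are applied.\<close>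

lemma lborel_integral_eq_interval:
  fixes f :: "real \<Rightarrow> real"
  assumes "continuous_on UNIV f" "\<And>s. R \<le> \<bar>s\<bar> \<Longrightarrow> f s = 0"
  shows "integrable lborel f" "(\<integral>s. f s \<partial>lborel) = integral {-R..R} f"
proof -
  have "integrable lborel (\<lambda>s. indicator {-R..R} s *\<^sub>R f s)"
    by (intro borel_integrable_compact compact_Icc continuous_on_subset[OF assms(1)]) simp
  moreover have "(\<lambda>s. indicator {-R..R} s *\<^sub>R f s) = f" using assms(2) by (force simp: indicator_def fun_eq_iff)
  ultimately show i: "integrable lborel f" by simp
  have "(f has_integral (\<integral>s. f s \<partial>lborel)) UNIV" by (rule has_integral_integral_lborel[OF i])
  moreover have "(f has_integral (integral {-R..R} f)) UNIV"
    by (rule has_integral_on_superset[OF integrable_integral]) (auto intro!: integrable_continuous_real continuous_on_subset[OF assms(1)] assms(2))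
  ultimately show "(\<integral>s. f s \<partial>lborel) = integral {-R..R} f" by (rule has_integral_unique)
qed

lemma bsupp_iterated:
  assumes w: "bsupp R w"
  shows "(\<integral>z. w z \<partial>lborel) = integral {-R..R} (\<lambda>y. integral {-R..R} (\<lambda>x. w (pt x y)))"
    and "(\<integral>z. w z \<partial>lborel) = integral {-R..R} (\<lambda>x. integral {-R..R} (\<lambda>y. w (pt x y)))"
proof -
  have c: "continuous_on UNIV w" using w by (simp add: bsupp_def)
  note [measurable] = bsupp_meas[OF w]
  have 0: "(\<integral>z. w z \<partial>lborel) = (\<integral>p. w (pt (fst p) (snd p)) \<partial>(lborel \<Otimes>\<^sub>M lborel))"
    by (subst lborel_R2, subst integral_distr) (auto simp: lborel_prod)
  have "integrable (distr (lborel \<Otimes>\<^sub>M lborel) borel (\<lambda>p. pt (fst p) (snd p))) w"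
    using bsupp_integrable[OF w] unfolding lborel_R2[symmetric] .
  then have i: "integrable (lborel \<Otimes>\<^sub>M lborel) (\<lambda>p. w (pt (fst p) (snd p)))"
    by (subst (asm) integrable_distr_eq) (auto simp: lborel_prod)
  then have i': "integrable (lborel \<Otimes>\<^sub>M lborel) (\<lambda>(x, y). w (pt x y))" by (simp add: case_prod_beta')
  have "(\<integral>p. w (pt (fst p) (snd p)) \<partial>(lborel \<Otimes>\<^sub>M lborel)) = (\<integral>y. \<integral>x. w (pt x y) \<partial>lborel \<partial>lborel)"
    using lborel_pair.integral_snd[OF i'] by (simp add: case_prod_beta')
  also have "\<dots> = (\<integral>y. integral {-R..R} (\<lambda>x. w (pt x y)) \<partial>lborel)"
    by (intro Bochner_Integration.integral_cong refl lborel_integral_eq_interval bsupp_slice_cont[OF c] bsupp_zero[OF w]) auto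
  also have "\<dots> = integral {-R..R} (\<lambda>y. integral {-R..R} (\<lambda>x. w (pt x y)))"
    by (rule lborel_integral_eq_interval[OF slice_integral_cont(1)[OF c]]) (simp add: bsupp_zero[OF w])
  finally show "(\<integral>z. w z \<partial>lborel) = integral {-R..R} (\<lambda>y. integral {-R..R} (\<lambda>x. w (pt x y)))" unfolding 0 .
  have "(\<integral>p. w (pt (fst p) (snd p)) \<partial>(lborel \<Otimes>\<^sub>M lborel)) = (\<integral>x. \<integral>y. w (pt x y) \<partial>lborel \<partial>lborel)"
    using lborel_pair.integral_fst[OF i'] by (simp add: case_prod_beta')
  also have "\<dots> = (\<integral>x. integral {-R..R} (\<lambda>y. w (pt x y)) \<partial>lborel)"
    by (intro Bochner_Integration.integral_cong refl lborel_integral_eq_interval bsupp_slice_cont[OF c] bsupp_zero[OF w]) auto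
  also have "\<dots> = integral {-R..R} (\<lambda>x. integral {-R..R} (\<lambda>y. w (pt x y)))"
    by (rule lborel_integral_eq_interval[OF slice_integral_cont(2)[OF c]]) (simp add: bsupp_zero[OF w])
  finally show "(\<integral>z. w z \<partial>lborel) = integral {-R..R} (\<lambda>x. integral {-R..R} (\<lambda>y. w (pt x y)))" unfolding 0 .
qed

text \<open>For a product of two functions this is integration by parts without boundary
  terms.\<close>

lemma C1c_integral_deriv_zero:
  assumes w: "C1c R w w1 w2" and R: "R > 0"
  shows "(\<integral>z. w1 z \<partial>lborel) = 0" "(\<integral>z. w2 z \<partial>lborel) = 0"
proof -
  have bs: "bsupp R w" "bsupp R w1" "bsupp R w2" using w by (auto simp: C1c_def)
  have "integral {-R..R} (\<lambda>x. w1 (pt x y)) = w (pt R y) - w (pt (-R) y)" for y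
    using C1c_slice1[OF w] R by (intro integral_unique fundamental_theorem_of_calculus)
        (auto simp: has_real_derivative_iff_has_vector_derivative[symmetric] intro: has_field_derivative_at_within)
  then show "(\<integral>z. w1 z \<partial>lborel) = 0" unfolding bsupp_iterated(1)[OF bs(2)] using bsupp_zero[OF bs(1)] R by simp
  have "integral {-R..R} (\<lambda>y. w2 (pt x y)) = w (pt x R) - w (pt x (-R))" for x
    using C1c_slice2[OF w] R by (intro integral_unique fundamental_theorem_of_calculus)
        (auto simp: has_real_derivative_iff_has_vector_derivative[symmetric] intro: has_field_derivative_at_within)
  then show "(\<integral>z. w2 z \<partial>lborel) = 0" unfolding bsupp_iterated(2)[OF bs(3)] using bsupp_zero[OF bs(1)] R by simp
qed

text \<open>Not divided by the area of the cell: the sum of the squares of these numbers over h^2 is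
  the squared norm of the piecewise constant average.\<close>

definition cell :: "real \<Rightarrow> nat \<Rightarrow> nat \<Rightarrow> nat \<Rightarrow> (R2 \<Rightarrow> real) \<Rightarrow> real" where
  "cell R m i j w = integral {grid_pt R m j..grid_pt R m (Suc j)} (\<lambda>y. integral {grid_pt R m i..grid_pt R m (Suc i)} (\<lambda>x. w (pt x y)))"

text \<open>The one-dimensional inequality is used twice: in x on every horizontal line, then in y
  on the strip integrals \<open>g i\<close>. By Leibniz's rule these have the strip integrals of w2
  as derivatives.\<close>

lemma cell_estimate:
  assumes R: "R > 0" and m: "m > 0" and w: "C1c R w w1 w2"
  defines "h \<equiv> 2 * R / real m"
  shows "nsq lborel w \<le> (\<Sum>i<m. \<Sum>j<m. (cell R m i j w)\<^sup>2) / h\<^sup>2 + h\<^sup>2 * (nsq lborel w1 + nsq lborel w2)"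
proof -
  have bs: "bsupp R w" "bsupp R w1" "bsupp R w2" using w by (auto simp: C1c_def)
  have c: "continuous_on UNIV w" "continuous_on UNIV w1" "continuous_on UNIV w2" using bs by (auto simp: bsupp_def)
  have csq: "continuous_on UNIV (\<lambda>z. (w z)\<^sup>2)" "continuous_on UNIV (\<lambda>z. (w1 z)\<^sup>2)" "continuous_on UNIV (\<lambda>z. (w2 z)\<^sup>2)"
    by (intro continuous_intros c)+
  have h: "h > 0" using R m by (simp add: h_def)
  have sq: "nsq lborel v = integral {-R..R} (\<lambda>y. integral {-R..R} (\<lambda>x. (v (pt x y))\<^sup>2))" if "bsupp R v" for v
  proof -
    have "bsupp R (\<lambda>z. (v z)\<^sup>2)" by (rule bsupp_map[OF that]) (auto intro!: continuous_intros)
    then show ?thesis unfolding nsq_def by (simp add: bsupp_iterated(1))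
  qed
  define g where "g i y = integral {grid_pt R m i..grid_pt R m (Suc i)} (\<lambda>x. w (pt x y))" for i y
  define g' where "g' i y = integral {grid_pt R m i..grid_pt R m (Suc i)} (\<lambda>x. w2 (pt x y))" for i y
  have gc: "continuous_on U (g i)" for i U unfolding g_def[abs_def] by (rule slice_integral_cont[OF c(1)])
  have g'c: "continuous_on U (g' i)" for i U unfolding g'_def[abs_def] by (rule slice_integral_cont[OF c(3)])
  have gd: "(g i has_real_derivative g' i y) (at y)" for i y
  proof -
    have "((\<lambda>y. integral (cbox (grid_pt R m i) (grid_pt R m (Suc i))) (\<lambda>x. w (pt x y))) has_real_derivative
      integral (cbox (grid_pt R m i) (grid_pt R m (Suc i))) (\<lambda>x. w2 (pt x y))) (at y within UNIV)"
    proof (rule leibniz_rule_field_derivative)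
      show "((\<lambda>y. w (pt t y)) has_real_derivative w2 (pt t x)) (at x within UNIV)" for t x
        using C1c_slice2[OF w] by simp
      show "(\<lambda>t. w (pt t x)) integrable_on cbox (grid_pt R m i) (grid_pt R m (Suc i))" for x
        by (intro integrable_continuous bsupp_slice_cont[OF c(1)])
      show "continuous_on (UNIV \<times> cbox (grid_pt R m i) (grid_pt R m (Suc i))) (\<lambda>(x, t). w2 (pt t x))"
        using bsupp_slice_cont(4)[OF c(3)] by (simp add: case_prod_beta)
    qed auto
    then show ?thesis by (simp add: g_def[abs_def] g'_def)
  qed
  have step1: "integral {-R..R} (\<lambda>x. (w (pt x y))\<^sup>2) \<le> (\<Sum>i<m. (g i y)\<^sup>2) / h + h\<^sup>2 * integral {-R..R} (\<lambda>x. (w1 (pt x y))\<^sup>2)" for y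
    unfolding g_def h_def
    by (rule poincare_grid[OF R m C1c_slice1[OF w]]) (rule bsupp_slice_cont[OF c(2)])
  have step2: "integral {-R..R} (\<lambda>y. (g i y)\<^sup>2) \<le> (\<Sum>j<m. (cell R m i j w)\<^sup>2) / h + h\<^sup>2 * integral {-R..R} (\<lambda>y. (g' i y)\<^sup>2)" for i
    using poincare_grid[OF R m gd g'c] unfolding cell_def g_def h_def .
  \<comment> \<open>Cauchy-Schwarz across a strip of width h gives back the factor h that is lost in
    the division by h.\<close>
  have step3: "(\<Sum>i<m. (g' i y)\<^sup>2) \<le> h * integral {-R..R} (\<lambda>x. (w2 (pt x y))\<^sup>2)" for y
  proof -
    have "(\<Sum>i<m. (g' i y)\<^sup>2) \<le> (\<Sum>i<m. h * integral {grid_pt R m i..grid_pt R m (Suc i)} (\<lambda>x. (w2 (pt x y))\<^sup>2))"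
    proof (rule sum_mono)
      fix i
      show "(g' i y)\<^sup>2 \<le> h * integral {grid_pt R m i..grid_pt R m (Suc i)} (\<lambda>x. (w2 (pt x y))\<^sup>2)"
        using integral_square_le[OF less_imp_le[OF grid_pt_less[OF R m, of i]] bsupp_slice_cont(1)[OF c(3), of _ y]]
        unfolding g'_def grid_pt_Suc h_def .
    qed
    also have "\<dots> = h * (\<Sum>i<m. integral {grid_pt R m i..grid_pt R m (Suc i)} (\<lambda>x. (w2 (pt x y))\<^sup>2))" by (simp add: sum_distrib_left)
    also have "(\<Sum>i<m. integral {grid_pt R m i..grid_pt R m (Suc i)} (\<lambda>x. (w2 (pt x y))\<^sup>2)) = integral {-R..R} (\<lambda>x. (w2 (pt x y))\<^sup>2)"
      by (intro integral_grid_pt[symmetric] R m bsupp_slice_cont(1)[OF csq(3)])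
    finally show ?thesis .
  qed
  have ic: "f integrable_on {-R..R}" if "continuous_on UNIV f" for f :: "real \<Rightarrow> real"
    using that by (intro integrable_continuous_real continuous_on_subset[OF that]) auto
  define C where "C = (\<Sum>i<m. \<Sum>j<m. (cell R m i j w)\<^sup>2)"
  have A: "(\<Sum>i<m. integral {-R..R} (\<lambda>y. (g i y)\<^sup>2)) \<le> C / h + h\<^sup>2 * (h * nsq lborel w2)"
  proof -
    have "(\<Sum>i<m. integral {-R..R} (\<lambda>y. (g i y)\<^sup>2)) \<le> (\<Sum>i<m. (\<Sum>j<m. (cell R m i j w)\<^sup>2) / h + h\<^sup>2 * integral {-R..R} (\<lambda>y. (g' i y)\<^sup>2))"
      by (intro sum_mono step2)
    also have "\<dots> = C / h + h\<^sup>2 * (\<Sum>i<m. integral {-R..R} (\<lambda>y. (g' i y)\<^sup>2))"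
      by (simp add: C_def sum.distrib sum_divide_distrib sum_distrib_left)
    also have "(\<Sum>i<m. integral {-R..R} (\<lambda>y. (g' i y)\<^sup>2)) = integral {-R..R} (\<lambda>y. \<Sum>i<m. (g' i y)\<^sup>2)"
      by (rule integral_sum[symmetric]) (auto intro!: ic continuous_intros g'c)
    also have "\<dots> \<le> integral {-R..R} (\<lambda>y. h * integral {-R..R} (\<lambda>x. (w2 (pt x y))\<^sup>2))"
      by (intro integral_le step3 ic continuous_intros g'c slice_integral_cont(1)[OF csq(3)])
    also have "\<dots> = h * nsq lborel w2" by (simp add: sq[OF bs(3)])
    finally show ?thesis by (simp add: add_left_mono mult_left_mono)
  qed
  have "nsq lborel w = integral {-R..R} (\<lambda>y. integral {-R..R} (\<lambda>x. (w (pt x y))\<^sup>2))" by (rule sq[OF bs(1)])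
  also have "\<dots> \<le> integral {-R..R} (\<lambda>y. (\<Sum>i<m. (g i y)\<^sup>2) / h + h\<^sup>2 * integral {-R..R} (\<lambda>x. (w1 (pt x y))\<^sup>2))"
    using h by (intro integral_le step1 ic continuous_intros gc slice_integral_cont(1)[OF csq(2)] slice_integral_cont(1)[OF csq(1)]) auto
  also have "\<dots> = integral {-R..R} (\<lambda>y. (\<Sum>i<m. (g i y)\<^sup>2) / h) + integral {-R..R} (\<lambda>y. h\<^sup>2 * integral {-R..R} (\<lambda>x. (w1 (pt x y))\<^sup>2))"
    using h by (intro Henstock_Kurzweil_Integration.integral_add ic continuous_intros gc slice_integral_cont(1)[OF csq(2)]) auto
  also have "integral {-R..R} (\<lambda>y. (\<Sum>i<m. (g i y)\<^sup>2) / h) = (\<Sum>i<m. integral {-R..R} (\<lambda>y. (g i y)\<^sup>2)) / h"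
    by (subst integral_sum[symmetric]) (auto intro!: ic continuous_intros gc)
  also have "integral {-R..R} (\<lambda>y. h\<^sup>2 * integral {-R..R} (\<lambda>x. (w1 (pt x y))\<^sup>2)) = h\<^sup>2 * nsq lborel w1"
    by (simp add: sq[OF bs(2)])
  also have "(\<Sum>i<m. integral {-R..R} (\<lambda>y. (g i y)\<^sup>2)) / h \<le> (C / h + h\<^sup>2 * (h * nsq lborel w2)) / h"
    using A h by (intro divide_right_mono) auto
  also have "(C / h + h\<^sup>2 * (h * nsq lborel w2)) / h = C / h\<^sup>2 + h\<^sup>2 * nsq lborel w2"
    using h by (simp add: field_simps power2_eq_square)
  finally show ?thesis by (simp add: C_def algebra_simps)
qed

lemma C1c_lin:
  assumes u: "C1c R u u1 u2" and v: "C1c R v v1 v2"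
  shows "C1c R (\<lambda>z. s * u z + t * v z) (\<lambda>z. s * u1 z + t * v1 z) (\<lambda>z. s * u2 z + t * v2 z)"
proof -
  have d: "((\<lambda>r. s * u (z + r *\<^sub>R e) + t * v (z + r *\<^sub>R e)) has_real_derivative s * a + t * b) (at 0)"
    if "((\<lambda>r. u (z + r *\<^sub>R e)) has_real_derivative a) (at 0)" "((\<lambda>r. v (z + r *\<^sub>R e)) has_real_derivative b) (at 0)" for z e a b
    by (rule DERIV_add[OF DERIV_cmult[OF that(1)] DERIV_cmult[OF that(2)]])
  show ?thesis using u v d unfolding C1c_def bsupp_def by (auto intro!: continuous_intros)
qed

lemma C1c_diff:
  assumes u: "C1c R u u1 u2" and v: "C1c R v v1 v2"
  shows "C1c R (\<lambda>z. u z - v z) (\<lambda>z. u1 z - v1 z) (\<lambda>z. u2 z - v2 z)"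
  using C1c_lin[OF u v, of 1 "-1"] by simp

text \<open>The weight is the indicator of the square, whose squared norm is the area
  \<open>4 * R\<^sup>2\<close>.\<close>

lemma C1c_poincare:
  assumes u: "C1c R u u1 u2" and R: "R \<ge> 0"
  shows "nsq lborel u \<le> 4 * R\<^sup>2 * (nsq lborel u1 + nsq lborel u2)"
proof -
  have bs: "bsupp R u" "bsupp R u1" "bsupp R u2" using u by (auto simp: C1c_def)
  define g where "g z = sqrt ((u1 z)\<^sup>2 + (u2 z)\<^sup>2)" for z
  have gb: "bsupp R g"
    using bs(2,3) unfolding g_def[abs_def] bsupp_def by (auto intro!: continuous_intros)
  have g2: "(norm (g z))\<^sup>2 = (norm (u1 z))\<^sup>2 + (norm (u2 z))\<^sup>2" for z by (simp add: g_def)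
  have gD: "nsq lborel g = nsq lborel u1 + nsq lborel u2"
    unfolding nsq_def g2 using sq_int_integrable[OF bsupp_sq_int[OF bs(2)]] sq_int_integrable[OF bsupp_sq_int[OF bs(3)]] by simp
  have gu: "\<bar>u1 z\<bar> \<le> norm (g z)" "\<bar>u2 z\<bar> \<le> norm (g z)" for z
    unfolding g_def by (auto intro: real_le_rsqrt)
  have ms: "emeasure lborel (sqbox R) = ennreal (4 * R\<^sup>2)"
    using R by (intro emeasure_sqbox) auto
  have sb: "sqbox R \<in> sets borel" by (simp add: sqbox_def)
  have i: "integrable lborel (indicat_real (sqbox R))"
    using ms sb by (intro integrable_real_indicator) auto
  have sq: "(norm (indicat_real (sqbox R) z))\<^sup>2 = indicat_real (sqbox R) z" for z by (simp add: indicator_def)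
  have ks: "sq_int lborel (indicat_real (sqbox R))" unfolding sq_int_def sq using i sb by simp
  have kn: "nsq lborel (indicat_real (sqbox R)) = 4 * R\<^sup>2"
    unfolding nsq_def sq using ms sb by (simp add: measure_def)
  have b: "\<bar>v z\<bar> \<le> norm (indicat_real (sqbox R) z) * norm (g z)" if "bsupp R v" "\<And>z. \<bar>v z\<bar> \<le> norm (g z)" for v z
  proof (cases "z \<in> sqbox R")
    case False
    then have "R \<le> \<bar>z $ 1\<bar> \<or> R \<le> \<bar>z $ 2\<bar>" by (auto simp: mem_sqbox)
    then have "v z = 0" using that(1) unfolding bsupp_def by blast
    then show ?thesis by simp
  qed (use that(2)[of z] in simp)
  show ?thesis
    using planar_weighted_inequality[OF u ks bsupp_sq_int[OF gb] b[OF bs(2) gu(1)] b[OF bs(3) gu(2)]]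
    unfolding kn gD .
qed

lemma grid_pt_range: "R > 0 \<Longrightarrow> m > 0 \<Longrightarrow> i < m \<Longrightarrow> {grid_pt R m i..grid_pt R m (Suc i)} \<subseteq> {-R..R}"
proof
  fix x assume R: "R > 0" and m: "m > 0" and i: "i < m" and x: "x \<in> {grid_pt R m i..grid_pt R m (Suc i)}"
  have "grid_pt R m i \<ge> - R" using R by (simp add: grid_pt_def)
  moreover have "grid_pt R m (Suc i) \<le> R"
  proof -
    have "real (Suc i) * (2 * R / real m) \<le> real m * (2 * R / real m)" using R i by (intro mult_right_mono) auto
    then show ?thesis using m by (simp add: grid_pt_def)
  qed
  ultimately show "x \<in> {-R..R}" using x by auto
qed

text \<open>A bound for the extraction of convergent subsequences, so the crude |w| \<le> 1 + w^2 is
  sharp enough: it bounds a cell integral by the area of the square plus the squared norm.\<close>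

lemma cell_bound:
  assumes R: "R > 0" and m: "m > 0" and ij: "i < m" "j < m" and w: "bsupp R w"
  shows "\<bar>cell R m i j w\<bar> \<le> 4 * R\<^sup>2 + nsq lborel w"
proof -
  have c: "continuous_on UNIV w" using w by (simp add: bsupp_def)
  have csq: "continuous_on UNIV (\<lambda>z. 1 + (w z)\<^sup>2)" by (intro continuous_intros c)
  have le: "\<bar>w z\<bar> \<le> 1 + (w z)\<^sup>2" for z
    using zero_le_power2[of "\<bar>w z\<bar> - 1"] by (simp add: power2_eq_square algebra_simps)
  note I = grid_pt_range[OF R m ij(1)] and J = grid_pt_range[OF R m ij(2)]
  have ic: "f integrable_on {p..q}" if "continuous_on UNIV f" for f :: "real \<Rightarrow> real" and p q
    using that by (intro integrable_continuous_real continuous_on_subset[OF that]) auto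
  define g where "g y = integral {-R..R} (\<lambda>x. 1 + (w (pt x y))\<^sup>2)" for y
  have gc: "continuous_on UNIV g" unfolding g_def[abs_def] by (rule slice_integral_cont(1)[OF csq])
  have sc: "continuous_on UNIV (\<lambda>x. 1 + (w (pt x y))\<^sup>2)" for y by (rule bsupp_slice_cont(1)[OF csq])
  have wc: "continuous_on UNIV (\<lambda>x. w (pt x y))" for y by (rule bsupp_slice_cont(1)[OF c])
  have inner: "\<bar>integral {grid_pt R m i..grid_pt R m (Suc i)} (\<lambda>x. w (pt x y))\<bar> \<le> g y" for y
  proof -
    have "\<bar>integral {grid_pt R m i..grid_pt R m (Suc i)} (\<lambda>x. w (pt x y))\<bar> \<le> integral {grid_pt R m i..grid_pt R m (Suc i)} (\<lambda>x. 1 + (w (pt x y))\<^sup>2)"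
      using Henstock_Kurzweil_Integration.integral_norm_bound_integral[OF ic[OF wc[of y]] ic[OF sc[of y]], of "grid_pt R m i" "grid_pt R m (Suc i)"] le by simp
    also have "\<dots> \<le> g y" unfolding g_def
      by (rule integral_subset_le[OF I ic[OF sc] ic[OF sc]]) simp
    finally show ?thesis .
  qed
  have "\<bar>cell R m i j w\<bar> \<le> integral {grid_pt R m j..grid_pt R m (Suc j)} g"
    unfolding cell_def
    using Henstock_Kurzweil_Integration.integral_norm_bound_integral[OF ic[OF slice_integral_cont(1)[OF c]] ic[OF gc], of "grid_pt R m j" "grid_pt R m (Suc j)"] inner by simp
  also have "\<dots> \<le> integral {-R..R} g"
    by (rule integral_subset_le[OF J ic[OF gc] ic[OF gc]]) (use inner abs_ge_zero order_trans in blast)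
  also have "\<dots> = integral {-R..R} (\<lambda>y. 2 * R + integral {-R..R} (\<lambda>x. (w (pt x y))\<^sup>2))"
  proof -
    have c2: "continuous_on UNIV (\<lambda>x. (w (pt x y))\<^sup>2)" for y by (intro continuous_intros wc)
    have "g y = 2 * R + integral {-R..R} (\<lambda>x. (w (pt x y))\<^sup>2)" for y
      unfolding g_def using Henstock_Kurzweil_Integration.integral_add[OF ic[OF continuous_on_const] ic[OF c2]] R by simp
    then have "g = (\<lambda>y. 2 * R + integral {-R..R} (\<lambda>x. (w (pt x y))\<^sup>2))" by (rule ext)
    then show ?thesis by simp
  qed
  also have "\<dots> = 4 * R\<^sup>2 + nsq lborel w"
  proof -
    have c2: "continuous_on UNIV (\<lambda>z. (w z)\<^sup>2)" by (intro continuous_intros c)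
    have "bsupp R (\<lambda>z. (w z)\<^sup>2)" by (rule bsupp_map[OF w]) (auto intro!: continuous_intros)
    then have "nsq lborel w = integral {-R..R} (\<lambda>y. integral {-R..R} (\<lambda>x. (w (pt x y))\<^sup>2))"
      unfolding nsq_def by (simp add: bsupp_iterated(1))
    then show ?thesis
      using Henstock_Kurzweil_Integration.integral_add[OF ic[OF continuous_on_const] ic[OF slice_integral_cont(1)[OF c2]], of "-R" R "2 * R" "-R" R] R
      by (simp add: power2_eq_square)
  qed
  finally show ?thesis .
qed

lemma cell_diff:
  assumes "continuous_on UNIV u" "continuous_on UNIV v"
  shows "cell R m i j (\<lambda>z. u z - v z) = cell R m i j u - cell R m i j v"
proof -
  have ic: "f integrable_on {p..q}" if "continuous_on UNIV f" for f :: "real \<Rightarrow> real" and p q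
    using that by (intro integrable_continuous_real continuous_on_subset[OF that]) auto
  have 1: "integral {p..q} (\<lambda>x. u (pt x y) - v (pt x y)) = integral {p..q} (\<lambda>x. u (pt x y)) - integral {p..q} (\<lambda>x. v (pt x y))" for p q y
    by (rule Henstock_Kurzweil_Integration.integral_diff[OF ic[OF bsupp_slice_cont(1)[OF assms(1)]] ic[OF bsupp_slice_cont(1)[OF assms(2)]]])
  show ?thesis unfolding cell_def 1
    by (rule Henstock_Kurzweil_Integration.integral_diff[OF ic[OF slice_integral_cont(1)[OF assms(1)]] ic[OF slice_integral_cont(1)[OF assms(2)]]])
qed

text \<open>All grids together have countably many cells, so a diagonal subsequence makes every cell
  integral converge. On a fine enough grid the cell integrals control the norm up to a small
  multiple of the gradient bound.\<close>

lemma C1c_rellich: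
  assumes R: "R > 0" and w: "\<And>n. C1c R (w n) (w1 n) (w2 n)" and B: "\<And>n. nsq lborel (w1 n) + nsq lborel (w2 n) \<le> B"
  shows "\<exists>k::nat \<Rightarrow> nat. strict_mono k \<and> (\<forall>e>0. \<exists>N. \<forall>m\<ge>N. \<forall>n\<ge>N. nsq lborel (\<lambda>z. w (k m) z - w (k n) z) < e)"
proof -
  have bs: "bsupp R (w n)" "bsupp R (w1 n)" "bsupp R (w2 n)" for n using w[of n] by (auto simp: C1c_def)
  have wc: "continuous_on UNIV (w n)" for n using bs(1)[of n] by (simp add: bsupp_def)
  have B0: "B \<ge> 0" using B[of 0] nsq_nonneg[of lborel "w1 0"] nsq_nonneg[of lborel "w2 0"] by linarith
  define S where "S = {(m, i, j). 0 < m \<and> i < m \<and> j < (m::nat)}"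
  define f where "f n = (\<lambda>(m, i, j). cell R m i j (w n))" for n
  have bd: "norm (f n s) \<le> 4 * R\<^sup>2 + 4 * R\<^sup>2 * B" if "s \<in> S" for n s
  proof -
    obtain m i j where s: "s = (m, i, j)" by (cases s)
    then have "0 < m" "i < m" "j < m" using that by (auto simp: S_def)
    then have "norm (f n s) \<le> 4 * R\<^sup>2 + nsq lborel (w n)" using cell_bound[OF R _ _ _ bs(1)] by (simp add: f_def s)
    also have "nsq lborel (w n) \<le> 4 * R\<^sup>2 * (nsq lborel (w1 n) + nsq lborel (w2 n))"
      using R by (intro C1c_poincare[OF w]) simp
    also have "\<dots> \<le> 4 * R\<^sup>2 * B" by (intro mult_left_mono B) simp
    finally show ?thesis by simp
  qed
  obtain k :: "nat \<Rightarrow> nat" where k: "strict_mono k" "\<And>s. s \<in> S \<Longrightarrow> \<exists>l. (\<lambda>n. f (k n) s) \<longlonglongrightarrow> l"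
  proof (rule function_convergent_subsequence[of S f "4 * R\<^sup>2 + 4 * R\<^sup>2 * B"])
    show "countable S" by simp
    show "norm (f n s) \<le> 4 * R\<^sup>2 + 4 * R\<^sup>2 * B" if "s \<in> S" for n s by (rule bd[OF that])
  qed blast
  have "\<exists>N. \<forall>p\<ge>N. \<forall>q\<ge>N. nsq lborel (\<lambda>z. w (k p) z - w (k q) z) < e" if e: "e > 0" for e
  proof -
    \<comment> \<open>The mesh is chosen so fine that the gradient term h^2 (4 B) is at most
      e/4.\<close>
    obtain m0 :: nat where m0: "real m0 > 16 * R\<^sup>2 * (4 * B + 1) / e" using reals_Archimedean2 by blast
    define m where "m = Suc m0"
    have m: "m > 0" "real m > 16 * R\<^sup>2 * (4 * B + 1) / e" "real m \<ge> 1" using m0 by (auto simp: m_def)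
    define h where "h = 2 * R / real m"
    have h: "h > 0" using R m by (simp add: h_def)
    have hB: "h\<^sup>2 * (4 * B) \<le> e / 4"
    proof -
      have "h\<^sup>2 * (4 * B) \<le> h\<^sup>2 * (4 * B + 1)" by (intro mult_left_mono) auto
      also have "h\<^sup>2 * (4 * B + 1) = 4 * R\<^sup>2 * (4 * B + 1) / (real m * real m)" by (simp add: h_def power2_eq_square)
      also have "\<dots> \<le> 4 * R\<^sup>2 * (4 * B + 1) / real m"
        using m(3) B0 by (intro divide_left_mono) (auto simp: mult_le_cancel_left1)
      also have "\<dots> \<le> e / 4" using m(2,3) e by (simp add: field_simps)
      finally show ?thesis .
    qed
    \<comment> \<open>With this tolerance the m^2 cells together contribute e/4 after the division
      by h^2.\<close>
    define \<eta> where "\<eta> = e * h\<^sup>2 / (4 * real m * real m)"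
    have \<eta>: "\<eta> > 0" using e h m by (simp add: \<eta>_def)
    have "\<forall>s\<in>{m} \<times> {..<m} \<times> {..<m}. \<exists>N. \<forall>p\<ge>N. \<forall>q\<ge>N. (f (k p) s - f (k q) s)\<^sup>2 < \<eta>"
    proof
      fix s assume "s \<in> {m} \<times> {..<m} \<times> {..<m}"
      then have "s \<in> S" using m(1) by (auto simp: S_def)
      then have "Cauchy (\<lambda>n. f (k n) s)" using k(2) LIMSEQ_imp_Cauchy by blast
      then obtain N where N: "\<forall>p\<ge>N. \<forall>q\<ge>N. norm (f (k p) s - f (k q) s) < sqrt \<eta>"
        using \<eta> unfolding Cauchy_iff by (meson real_sqrt_gt_0_iff)
      have "(f (k p) s - f (k q) s)\<^sup>2 < \<eta>" if "p \<ge> N" "q \<ge> N" for p q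
      proof -
        have "\<bar>f (k p) s - f (k q) s\<bar> < sqrt \<eta>" using N that by simp
        then have "\<bar>f (k p) s - f (k q) s\<bar>\<^sup>2 < (sqrt \<eta>)\<^sup>2" by (intro power_strict_mono) auto
        then show ?thesis using \<eta> by simp
      qed
      then show "\<exists>N. \<forall>p\<ge>N. \<forall>q\<ge>N. (f (k p) s - f (k q) s)\<^sup>2 < \<eta>" by blast
    qed
    then obtain Nf where Nf: "\<forall>s\<in>{m} \<times> {..<m} \<times> {..<m}. \<forall>p\<ge>Nf s. \<forall>q\<ge>Nf s. (f (k p) s - f (k q) s)\<^sup>2 < \<eta>"
      by (metis (no_types, lifting))
    define N where "N = Max (Nf ` ({m} \<times> {..<m} \<times> {..<m}))"
    have "nsq lborel (\<lambda>z. w (k p) z - w (k q) z) < e" if pq: "p \<ge> N" "q \<ge> N" for p q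
    proof -
      have cl: "(cell R m i j (\<lambda>z. w (k p) z - w (k q) z))\<^sup>2 \<le> \<eta>" if ij: "i < m" "j < m" for i j
      proof -
        have mem: "(m, i, j) \<in> {m} \<times> {..<m} \<times> {..<m}" using ij by simp
        then have "Nf (m, i, j) \<le> N" unfolding N_def by (intro Max_ge) auto
        then have "(f (k p) (m, i, j) - f (k q) (m, i, j))\<^sup>2 < \<eta>" using Nf mem pq by (meson order_trans)
        then show ?thesis unfolding cell_diff[OF wc wc] by (simp add: f_def)
      qed
      note dC = C1c_diff[OF w[of "k p"] w[of "k q"]]
      have "nsq lborel (\<lambda>z. w (k p) z - w (k q) z) \<le>
        (\<Sum>i<m. \<Sum>j<m. (cell R m i j (\<lambda>z. w (k p) z - w (k q) z))\<^sup>2) / h\<^sup>2 +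
        h\<^sup>2 * (nsq lborel (\<lambda>z. w1 (k p) z - w1 (k q) z) + nsq lborel (\<lambda>z. w2 (k p) z - w2 (k q) z))"
        unfolding h_def by (rule cell_estimate[OF R m(1) dC])
      also have "\<dots> \<le> (\<Sum>i<m. \<Sum>j<m. \<eta>) / h\<^sup>2 + h\<^sup>2 * (4 * B)"
      proof (intro add_mono divide_right_mono sum_mono mult_left_mono)
        have d: "nsq lborel (\<lambda>z. x z - y z) \<le> 2 * nsq lborel x + 2 * nsq lborel y" if "sq_int lborel x" "sq_int lborel y" for x y :: "R2 \<Rightarrow> real"
          using nsq_le_add[OF that(1) sq_int_scaleR[OF that(2), of "-1"]] nsq_scaleR[of lborel "-1" y] by simp
        show "nsq lborel (\<lambda>z. w1 (k p) z - w1 (k q) z) + nsq lborel (\<lambda>z. w2 (k p) z - w2 (k q) z) \<le> 4 * B"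
          using d[OF bsupp_sq_int[OF bs(2)[of "k p"]] bsupp_sq_int[OF bs(2)[of "k q"]]]
            d[OF bsupp_sq_int[OF bs(3)[of "k p"]] bsupp_sq_int[OF bs(3)[of "k q"]]] B[of "k p"] B[of "k q"] by linarith
      qed (use cl in auto)
      also have "(\<Sum>i<m. \<Sum>j<m. \<eta>) / h\<^sup>2 = e / 4" using h m by (simp add: \<eta>_def)
      also have "e / 4 + h\<^sup>2 * (4 * B) < e" using hB e by linarith
      finally show ?thesis .
    qed
    then show ?thesis by blast
  qed
  then show ?thesis using k(1) by blast
qed

section \<open>Smooth bump functions\<close>

text \<open>Existence of n continuous derivatives on the whole line; the derivative is quantified
  existentially so that closure under products and compositions is an induction on n.\<close>

fun Cn :: "nat \<Rightarrow> (real \<Rightarrow> real) \<Rightarrow> bool" where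
  "Cn 0 f \<longleftrightarrow> continuous_on UNIV f"
| "Cn (Suc n) f \<longleftrightarrow> (\<exists>f'. (\<forall>x. (f has_real_derivative f' x) (at x)) \<and> Cn n f')"

lemma Cn_SucD: "Cn (Suc n) f \<Longrightarrow> Cn n f"
proof (induction n arbitrary: f)
  case 0
  then obtain f' where "\<forall>x. (f has_real_derivative f' x) (at x)" by auto
  then show ?case using DERIV_isCont by (auto intro!: continuous_at_imp_continuous_on)
next
  case (Suc n)
  from Suc.prems obtain f' where "\<forall>x. (f has_real_derivative f' x) (at x)" "Cn (Suc n) f'" unfolding Cn.simps(2)[of "Suc n"] by blast
  then show ?case using Suc.IH[of f'] by auto
qed

lemma Cn_add: "Cn n f \<Longrightarrow> Cn n g \<Longrightarrow> Cn n (\<lambda>x. f x + g x)"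
proof (induction n arbitrary: f g)
  case (Suc n)
  then obtain f' g' where d: "\<forall>x. (f has_real_derivative f' x) (at x)" "Cn n f'" "\<forall>x. (g has_real_derivative g' x) (at x)" "Cn n g'" by auto
  then have "\<forall>x. ((\<lambda>x. f x + g x) has_real_derivative f' x + g' x) (at x)" by (auto intro!: derivative_eq_intros)
  then show ?case using Suc.IH[OF d(2,4)] unfolding Cn.simps by (intro exI[of _ "\<lambda>x. f' x + g' x"] conjI)
qed (auto intro: continuous_intros)

lemma Cn_mult: "Cn n f \<Longrightarrow> Cn n g \<Longrightarrow> Cn n (\<lambda>x. f x * g x)"
proof (induction n arbitrary: f g)
  case (Suc n)
  then obtain f' g' where d: "\<forall>x. (f has_real_derivative f' x) (at x)" "Cn n f'" "\<forall>x. (g has_real_derivative g' x) (at x)" "Cn n g'" by auto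
  then have 1: "\<forall>x. ((\<lambda>x. f x * g x) has_real_derivative f' x * g x + f x * g' x) (at x)"
    by (auto intro!: derivative_eq_intros)
  have "Cn n (\<lambda>x. f' x * g x + f x * g' x)"
    by (rule Cn_add[OF Suc.IH[OF d(2) Cn_SucD[OF Suc.prems(2)]] Suc.IH[OF Cn_SucD[OF Suc.prems(1)] d(4)]])
  then show ?case using 1 unfolding Cn.simps by (intro exI[of _ "\<lambda>x. f' x * g x + f x * g' x"] conjI)
qed (auto intro: continuous_intros)

lemma Cn_const: "Cn n (\<lambda>x. c)"
proof (induction n arbitrary: c)
  case (Suc n)
  have "\<forall>x. ((\<lambda>x. c) has_real_derivative 0) (at x)" by auto
  then show ?case using Suc[of 0] unfolding Cn.simps by (intro exI[of _ "\<lambda>x. 0"] conjI)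
qed simp

lemma Cn_exp: "Cn n f \<Longrightarrow> Cn n (\<lambda>x. exp (f x))"
proof (induction n arbitrary: f)
  case (Suc n)
  then obtain f' where d: "\<forall>x. (f has_real_derivative f' x) (at x)" "Cn n f'" by auto
  then have 1: "\<forall>x. ((\<lambda>x. exp (f x)) has_real_derivative exp (f x) * f' x) (at x)"
    by (auto intro!: derivative_eq_intros)
  have "Cn n (\<lambda>x. exp (f x) * f' x)" by (rule Cn_mult[OF Suc.IH[OF Cn_SucD[OF Suc.prems]] d(2)])
  then show ?case using 1 unfolding Cn.simps by (intro exI[of _ "\<lambda>x. exp (f x) * f' x"] conjI)
qed (auto intro: continuous_intros)

lemma Cn_affine: "Cn n f \<Longrightarrow> Cn n (\<lambda>x. f (c * x + d))"
proof (induction n arbitrary: f)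
  case 0 then show ?case by (auto intro!: continuous_intros continuous_on_compose2[of UNIV f])
next
  case (Suc n)
  then obtain f' where d: "\<forall>x. (f has_real_derivative f' x) (at x)" "Cn n f'" by auto
  have 1: "\<forall>x. ((\<lambda>x. f (c * x + d)) has_real_derivative f' (c * x + d) * c) (at x)"
  proof
    fix x
    have "((\<lambda>x. c * x + d) has_real_derivative c) (at x)" by (auto intro!: derivative_eq_intros)
    from DERIV_chain2[OF d(1)[rule_format] this] show "((\<lambda>x. f (c * x + d)) has_real_derivative f' (c * x + d) * c) (at x)" .
  qed
  have "Cn n (\<lambda>x. f' (c * x + d) * c)" by (rule Cn_mult[OF Suc.IH[OF d(2)] Cn_const])
  then show ?case using 1 unfolding Cn.simps by (intro exI[of _ "\<lambda>x. f' (c * x + d) * c"] conjI)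
qed

definition smooth1 :: "(real \<Rightarrow> real) \<Rightarrow> bool" where "smooth1 f \<longleftrightarrow> (\<forall>n. Cn n f)"

lemma smooth1_deriv:
  assumes "smooth1 f" shows "\<exists>f'. (\<forall>x. (f has_real_derivative f' x) (at x)) \<and> smooth1 f'"
proof -
  obtain f' where f': "\<forall>x. (f has_real_derivative f' x) (at x)"
    using assms unfolding smooth1_def by (metis Cn.simps(2))
  have "Cn n f'" for n
  proof -
    obtain g where g: "\<forall>x. (f has_real_derivative g x) (at x)" "Cn n g"
      using assms unfolding smooth1_def by (metis Cn.simps(2))
    have "g = f'" using f' g(1) DERIV_unique by blast
    then show ?thesis using g by simp
  qed
  then show ?thesis using f' by (auto simp: smooth1_def)
qed

lemma smooth1_cont: "smooth1 f \<Longrightarrow> continuous_on UNIV f" unfolding smooth1_def by (metis Cn.simps(1))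

text \<open>All derivatives of exp (-1/x) are polynomials in 1/x times the same exponential; with
  the polynomial as a parameter the family is closed under differentiation.\<close>

definition flat :: "real poly \<Rightarrow> real \<Rightarrow> real" where
  "flat p x = (if x \<le> 0 then 0 else poly p (1 / x) * exp (- (1 / x)))"

lemma poly_exp_lim: "((\<lambda>y. poly p y * exp (- y)) \<longlongrightarrow> (0::real)) at_top"
proof -
  have "((\<lambda>y. \<Sum>i\<le>degree p. coeff p i * (y ^ i / exp y)) \<longlongrightarrow> (\<Sum>i\<le>degree p. coeff p i * 0)) at_top"
    by (intro tendsto_sum tendsto_mult tendsto_const tendsto_power_div_exp_0)
  moreover have "(\<lambda>y. \<Sum>i\<le>degree p. coeff p i * (y ^ i / exp y)) = (\<lambda>y. poly p y * exp (- y))"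
    by (auto simp: poly_altdef exp_minus sum_distrib_right divide_inverse mult.assoc)
  ultimately show ?thesis by simp
qed

lemma flat_deriv: "(flat p has_real_derivative flat ([:0, 0, 1:] * (p - pderiv p)) x) (at x)"
proof -
  consider "x < 0" | "x = 0" | "x > 0" by linarith
  then show ?thesis
  proof cases
    case 1
    show ?thesis
      by (rule has_field_derivative_transform_within_open[of "\<lambda>_. 0" _ _ "{..<0}"]) (use 1 in \<open>auto simp: flat_def\<close>)
  next
    case 3
    show ?thesis
    proof (rule has_field_derivative_transform_within_open[of "\<lambda>x. poly p (1 / x) * exp (- (1 / x))" _ _ "{0<..}"])
      show "((\<lambda>x. poly p (1 / x) * exp (- (1 / x))) has_real_derivative flat ([:0, 0, 1:] * (p - pderiv p)) x) (at x)"
      proof -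
        have i: "((\<lambda>x::real. 1 / x) has_real_derivative - (1 / x\<^sup>2)) (at x)"
          using 3 by (auto intro!: derivative_eq_intros simp: power2_eq_square)
        have "((\<lambda>x. poly p (1 / x)) has_real_derivative poly (pderiv p) (1 / x) * - (1 / x\<^sup>2)) (at x)"
          by (rule DERIV_chain2[OF poly_DERIV i])
        moreover have "((\<lambda>x. exp (- (1 / x))) has_real_derivative exp (- (1 / x)) * (1 / x\<^sup>2)) (at x)"
          using DERIV_chain2[OF DERIV_exp DERIV_minus[OF i]] by simp
        ultimately have "((\<lambda>x. poly p (1 / x) * exp (- (1 / x))) has_real_derivative
          poly (pderiv p) (1 / x) * - (1 / x\<^sup>2) * exp (- (1 / x)) + exp (- (1 / x)) * (1 / x\<^sup>2) * poly p (1 / x)) (at x)"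
          by (rule DERIV_mult)
        then show ?thesis using 3 by (simp add: flat_def power2_eq_square algebra_simps)
      qed
    qed (use 3 in \<open>auto simp: flat_def\<close>)
  next
    case 2
    have "((\<lambda>h. (flat p (0 + h) - flat p 0) / h) \<longlongrightarrow> 0) (at 0)"
    proof (rule filterlim_split_at)
      show "((\<lambda>h. (flat p (0 + h) - flat p 0) / h) \<longlongrightarrow> 0) (at_left 0)"
        by (rule Lim_transform_eventually[OF tendsto_const[of 0]]) (auto simp: eventually_at_filter flat_def)
      \<comment> \<open>The difference quotient at 0 is again polynomial times exponential in 1/h,
        now with the polynomial y p(y).\<close>
      have "((\<lambda>h. poly ([:0, 1:] * p) (inverse h) * exp (- inverse h)) \<longlongrightarrow> 0) (at_right (0::real))"
        by (rule filterlim_compose[OF poly_exp_lim filterlim_inverse_at_top_right])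
      then show "((\<lambda>h. (flat p (0 + h) - flat p 0) / h) \<longlongrightarrow> 0) (at_right 0)"
        by (rule Lim_transform_eventually) (auto simp: eventually_at_filter flat_def divide_inverse)
    qed
    then show ?thesis unfolding DERIV_def using 2 by (simp add: flat_def)
  qed
qed

lemma smooth1_flat: "smooth1 (flat p)"
proof -
  have "Cn n (flat p)" for n p
  proof (induction n arbitrary: p)
    case 0
    show ?case using DERIV_isCont[OF flat_deriv] by (auto intro!: continuous_at_imp_continuous_on)
  next
    case (Suc n)
    then show ?case unfolding Cn.simps using flat_deriv[of p]
      by (intro exI[of _ "flat ([:0, 0, 1:] * (p - pderiv p))"]) blast
  qed
  then show ?thesis by (simp add: smooth1_def)
qed

text \<open>Supported in a fixed interval, positive inside for n > 0, and increasing with n to the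
  indicator of the open interval: one family serves as a nontrivial test function and as an
  approximation of box indicators.\<close>

definition bump :: "real \<Rightarrow> real \<Rightarrow> nat \<Rightarrow> real \<Rightarrow> real" where
  "bump c d n x = 1 - exp (- real n * (flat 1 (x - c) * flat 1 (d - x)))"

lemma smooth1_bump: "smooth1 (bump c d n)"
proof -
  have "Cn k (\<lambda>x. 1 + (-1) * exp ((- real n) * (flat 1 (1 * x + (- c)) * flat 1 ((-1) * x + d))))" for k
    using smooth1_flat[of 1] unfolding smooth1_def
    by (intro Cn_add Cn_mult Cn_const Cn_exp Cn_affine) auto
  moreover have "bump c d n = (\<lambda>x. 1 + (-1) * exp ((- real n) * (flat 1 (1 * x + (- c)) * flat 1 ((-1) * x + d))))"
    by (auto simp: bump_def)
  ultimately show ?thesis by (simp add: smooth1_def)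
qed

lemma flat_nonneg: "0 \<le> flat 1 x" by (simp add: flat_def)

lemma bump_bounds: "0 \<le> bump c d n x" "bump c d n x \<le> 1"
proof -
  have "0 \<le> real n * (flat 1 (x - c) * flat 1 (d - x))" by (intro mult_nonneg_nonneg flat_nonneg) simp
  then show "0 \<le> bump c d n x" "bump c d n x \<le> 1" by (auto simp: bump_def)
qed

lemma bump_outside: "x \<notin> {c<..<d} \<Longrightarrow> bump c d n x = 0"
  by (auto simp: bump_def flat_def)

lemma bump_pos: "c < x \<Longrightarrow> x < d \<Longrightarrow> n > 0 \<Longrightarrow> bump c d n x > 0"
  by (simp add: bump_def flat_def)

lemma bump_lim: assumes "x \<in> {c<..<d}" shows "(\<lambda>n. bump c d n x) \<longlonglongrightarrow> 1"
proof -
  define e where "e = flat 1 (x - c) * flat 1 (d - x)"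
  have e: "e > 0" using assms by (simp add: e_def flat_def)
  have "(\<lambda>n. exp (- e) ^ n) \<longlonglongrightarrow> 0" using e by (intro LIMSEQ_power_zero) simp
  moreover have "exp (- e) ^ n = exp (- real n * e)" for n
    by (simp add: exp_of_nat_mult[symmetric])
  ultimately have "(\<lambda>n. 1 - exp (- real n * e)) \<longlonglongrightarrow> 1 - 0" by (intro tendsto_diff tendsto_const) simp
  then show ?thesis by (simp add: bump_def e_def)
qed

section \<open>Test functions\<close>

text \<open>The choice in \<open>pd\<close> is pinned down by uniqueness of derivatives as soon as a
  derivative exists.\<close>

lemma pd_eqI: "((\<lambda>t. f (x + t *\<^sub>R axis i 1)) has_real_derivative d) (at 0) \<Longrightarrow> pd i f x = d"
  unfolding pd_def by (rule some_equality, assumption, rule DERIV_unique)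

lemma smooth_pd:
  assumes "smooth f" shows "((\<lambda>t. f (x + t *\<^sub>R axis i 1)) has_real_derivative pd i f x) (at 0)"
proof -
  have "(\<lambda>t. iter_pd [] f (x + t *\<^sub>R axis i 1)) differentiable (at 0)" using assms unfolding smooth_def by blast
  then obtain d where "((\<lambda>t. f (x + t *\<^sub>R axis i 1)) has_real_derivative d) (at 0)"
    by (auto simp: real_differentiable_def)
  then show ?thesis using pd_eqI by metis
qed

lemma smooth_cont: "smooth f \<Longrightarrow> continuous_on UNIV f" unfolding smooth_def by (metis iter_pd.simps(1))

lemma smooth_pd_cont: "smooth f \<Longrightarrow> continuous_on UNIV (pd i f)" unfolding smooth_def by (metis iter_pd.simps)

lemma iter_pd_lin:
  assumes f: "smooth f" and g: "smooth g"
  shows "iter_pd is (\<lambda>x. s * f x + t * g x) = (\<lambda>x. s * iter_pd is f x + t * iter_pd is g x)"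
proof (induction "is")
  case (Cons i "is")
  show ?case
  proof
    fix x
    have d: "((\<lambda>r. iter_pd is h (x + r *\<^sub>R axis i 1)) has_real_derivative pd i (iter_pd is h) x) (at 0)" if "smooth h" for h
    proof -
      have "(\<lambda>r. iter_pd is h (x + r *\<^sub>R axis i 1)) differentiable (at 0)" using that unfolding smooth_def by blast
      then obtain d where "((\<lambda>r. iter_pd is h (x + r *\<^sub>R axis i 1)) has_real_derivative d) (at 0)"
        by (auto simp: real_differentiable_def)
      then show ?thesis using pd_eqI[of "iter_pd is h"] by metis
    qed
    have "((\<lambda>r. s * iter_pd is f (x + r *\<^sub>R axis i 1) + t * iter_pd is g (x + r *\<^sub>R axis i 1)) has_real_derivative
      s * pd i (iter_pd is f) x + t * pd i (iter_pd is g) x) (at 0)"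
      by (intro DERIV_add DERIV_cmult d f g)
    then show "iter_pd (i # is) (\<lambda>x. s * f x + t * g x) x = s * iter_pd (i # is) f x + t * iter_pd (i # is) g x"
      unfolding iter_pd.simps Cons.IH by (intro pd_eqI[of "\<lambda>x. s * iter_pd is f x + t * iter_pd is g x"])
  qed
qed simp

lemma smooth_lin:
  assumes f: "smooth f" and g: "smooth g" shows "smooth (\<lambda>x. s * f x + t * g x)"
  unfolding smooth_def iter_pd_lin[OF f g]
proof (intro allI conjI)
  fix "is" and i :: 2 and x :: R2
  show "continuous_on UNIV (\<lambda>x. s * iter_pd is f x + t * iter_pd is g x)"
    using f g unfolding smooth_def by (intro continuous_intros) blast+
  show "(\<lambda>r. s * iter_pd is f (x + r *\<^sub>R axis i 1) + t * iter_pd is g (x + r *\<^sub>R axis i 1)) differentiable at 0"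
    using f g unfolding smooth_def by (intro differentiable_add differentiable_mult differentiable_const) blast+
qed

lemma pd_lin:
  assumes "smooth f" "smooth g" shows "pd i (\<lambda>x. s * f x + t * g x) x = s * pd i f x + t * pd i g x"
  by (rule pd_eqI[OF DERIV_add[OF DERIV_cmult[OF smooth_pd[OF assms(1)]] DERIV_cmult[OF smooth_pd[OF assms(2)]]]])

lemma test_fn_smooth: "test_fn \<Omega> \<phi> \<Longrightarrow> smooth \<phi>" by (simp add: test_fn_def)

lemma test_fn_lin:
  assumes f: "test_fn \<Omega> f" and g: "test_fn \<Omega> g" shows "test_fn \<Omega> (\<lambda>x. s * f x + t * g x)"
proof -
  have "{x. s * f x + t * g x \<noteq> 0} \<subseteq> {x. f x \<noteq> 0} \<union> {x. g x \<noteq> 0}" by auto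
  then have sub: "closure {x. s * f x + t * g x \<noteq> 0} \<subseteq> closure {x. f x \<noteq> 0} \<union> closure {x. g x \<noteq> 0}"
    unfolding closure_Un[symmetric] by (rule closure_mono)
  have "compact (closure {x. f x \<noteq> 0} \<union> closure {x. g x \<noteq> 0})"
    using f g by (auto simp: test_fn_def)
  then have "compact (closure {x. s * f x + t * g x \<noteq> 0})"
    using bounded_subset[OF compact_imp_bounded sub] by (simp add: compact_eq_bounded_closed)
  then show ?thesis using f g sub smooth_lin unfolding test_fn_def by blast
qed

lemma test_fn_zero_outside: "test_fn \<Omega> \<phi> \<Longrightarrow> x \<notin> \<Omega> \<Longrightarrow> \<phi> x = 0"
  unfolding test_fn_def using closure_subset[of "{x. \<phi> x \<noteq> 0}"] by blast

text \<open>The complement of the support is open and contains x, also when x is a boundary point of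
  the domain; near x the function is therefore zero on the coordinate line.\<close>

lemma test_fn_pd_outside:
  assumes "test_fn \<Omega> \<phi>" "x \<notin> \<Omega>" shows "pd i \<phi> x = 0"
proof (rule pd_eqI)
  let ?S = "- closure {x. \<phi> x \<noteq> 0}"
  have "continuous_on UNIV (\<lambda>t. x + t *\<^sub>R axis i (1::real))" by (intro continuous_intros)
  then have o: "open ((\<lambda>t. x + t *\<^sub>R axis i (1::real)) -` ?S)" by (intro open_vimage) auto
  have "x \<in> ?S" using assms unfolding test_fn_def by blast
  then have z: "0 \<in> (\<lambda>t. x + t *\<^sub>R axis i (1::real)) -` ?S" by simp
  show "((\<lambda>t. \<phi> (x + t *\<^sub>R axis i 1)) has_real_derivative 0) (at 0)"
  proof (rule has_field_derivative_transform_within_open[OF _ o z])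
    show "((\<lambda>t::real. 0::real) has_real_derivative 0) (at 0)" by simp
    fix t assume "t \<in> (\<lambda>t. x + t *\<^sub>R axis i (1::real)) -` ?S"
    then have "x + t *\<^sub>R axis i 1 \<notin> {x. \<phi> x \<noteq> 0}"
      using closure_subset[of "{x. \<phi> x \<noteq> 0}"] by (auto simp del: mem_Collect_eq)
    then show "0 = \<phi> (x + t *\<^sub>R axis i 1)" by simp
  qed
qed

lemma test_fn_C1c:
  assumes \<phi>: "test_fn \<Omega> \<phi>" and R: "\<And>z. z \<in> \<Omega> \<Longrightarrow> \<bar>z $ 1\<bar> < R \<and> \<bar>z $ 2\<bar> < R"
  shows "C1c R \<phi> (pd 1 \<phi>) (pd 2 \<phi>)"
proof -
  have out: "z \<notin> \<Omega>" if "R \<le> \<bar>z $ 1\<bar> \<or> R \<le> \<bar>z $ 2\<bar>" for z using R[of z] that by auto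
  show ?thesis unfolding C1c_def bsupp_def
    using smooth_pd[OF test_fn_smooth[OF \<phi>]] smooth_cont[OF test_fn_smooth[OF \<phi>]] smooth_pd_cont[OF test_fn_smooth[OF \<phi>]]
      test_fn_zero_outside[OF \<phi> out] test_fn_pd_outside[OF \<phi> out] by blast
qed

lemma C1c_mult:
  assumes u: "C1c R u u1 u2" and v: "C1c R v v1 v2"
  shows "C1c R (\<lambda>z. u z * v z) (\<lambda>z. u z * v1 z + u1 z * v z) (\<lambda>z. u z * v2 z + u2 z * v z)"
proof -
  have d: "((\<lambda>t. u (z + t *\<^sub>R e) * v (z + t *\<^sub>R e)) has_real_derivative u z * b + a * v z) (at 0)"
    if "((\<lambda>t. u (z + t *\<^sub>R e)) has_real_derivative a) (at 0)" "((\<lambda>t. v (z + t *\<^sub>R e)) has_real_derivative b) (at 0)" for z e a b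
    using DERIV_mult'[OF that] by simp
  show ?thesis using u v d unfolding C1c_def bsupp_def by (auto intro!: continuous_intros)
qed

text \<open>Products of a smooth function of the first and one of the second coordinate are closed
  under both partial derivatives, so every iterated partial is again of this form.\<close>

lemma smooth_product:
  assumes "smooth1 f" "smooth1 g" shows "smooth (\<lambda>x. f (x $ 1) * g (x $ 2))"
proof -
  have nth: "(x + t *\<^sub>R axis i 1) $ j = x $ j + t * (if i = j then 1 else 0)" for x :: R2 and t i j
    by (simp add: axis_def)
  have der: "\<exists>f' g'. smooth1 f' \<and> smooth1 g' \<and>
     (\<forall>x. ((\<lambda>t. f ((x + t *\<^sub>R axis i 1) $ 1) * g ((x + t *\<^sub>R axis i 1) $ 2)) has_real_derivative f' (x $ 1) * g' (x $ 2)) (at 0))"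
    if fg: "smooth1 f" "smooth1 g" for f g and i :: 2
  proof -
    obtain f' where f': "\<forall>x. (f has_real_derivative f' x) (at x)" "smooth1 f'" using smooth1_deriv[OF fg(1)] by blast
    obtain g' where g': "\<forall>x. (g has_real_derivative g' x) (at x)" "smooth1 g'" using smooth1_deriv[OF fg(2)] by blast
    have sh: "((\<lambda>t. k (c + t)) has_real_derivative k' c) (at 0)" if "\<forall>x. (k has_real_derivative k' x) (at x)" for k k' :: "real \<Rightarrow> real" and c
      using DERIV_shift[of k "k' c" 0 c] that by (simp add: add.commute)
    show ?thesis
    proof (cases "i = 1")
      case True
      have "((\<lambda>t. f (x $ 1 + t) * g (x $ 2)) has_real_derivative f' (x $ 1) * g (x $ 2)) (at 0)" for x :: R2
        by (intro DERIV_cmult_right sh f')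
      then show ?thesis using True f' fg unfolding nth by (intro exI[of _ f'] exI[of _ g]) auto
    next
      case False
      then have i: "i = 2" using exhaust_2 by blast
      have "((\<lambda>t. f (x $ 1) * g (x $ 2 + t)) has_real_derivative f (x $ 1) * g' (x $ 2)) (at 0)" for x :: R2
        by (intro DERIV_cmult sh g')
      then show ?thesis using i g' fg unfolding nth by (intro exI[of _ f] exI[of _ g']) auto
    qed
  qed
  have it: "\<exists>f' g'. smooth1 f' \<and> smooth1 g' \<and> iter_pd is (\<lambda>x. f (x $ 1) * g (x $ 2)) = (\<lambda>x. f' (x $ 1) * g' (x $ 2))" for "is"
  proof (induction "is")
    case Nil then show ?case using assms by auto
  next
    case (Cons i "is")
    then obtain f' g' where fg': "smooth1 f'" "smooth1 g'" "iter_pd is (\<lambda>x. f (x $ 1) * g (x $ 2)) = (\<lambda>x. f' (x $ 1) * g' (x $ 2))" by blast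
    obtain f'' g'' where fg'': "smooth1 f''" "smooth1 g''"
      "\<forall>x. ((\<lambda>t. f' ((x + t *\<^sub>R axis i 1) $ 1) * g' ((x + t *\<^sub>R axis i 1) $ 2)) has_real_derivative f'' (x $ 1) * g'' (x $ 2)) (at 0)"
      using der[OF fg'(1,2), of i] by blast
    have "pd i (\<lambda>x. f' (x $ 1) * g' (x $ 2)) x = f'' (x $ 1) * g'' (x $ 2)" for x
      by (rule pd_eqI) (use fg''(3) in blast)
    then show ?case using fg''(1,2) unfolding iter_pd.simps fg'(3) by blast
  qed
  show ?thesis unfolding smooth_def
  proof (intro allI conjI)
    fix "is" and i :: 2 and x :: R2
    obtain f' g' where fg': "smooth1 f'" "smooth1 g'" "iter_pd is (\<lambda>x. f (x $ 1) * g (x $ 2)) = (\<lambda>x. f' (x $ 1) * g' (x $ 2))" using it by blast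
    show "continuous_on UNIV (iter_pd is (\<lambda>x. f (x $ 1) * g (x $ 2)))" unfolding fg'(3)
      by (intro continuous_intros continuous_on_compose2[OF smooth1_cont[OF fg'(1)]] continuous_on_compose2[OF smooth1_cont[OF fg'(2)]]) auto
    show "(\<lambda>t. iter_pd is (\<lambda>x. f (x $ 1) * g (x $ 2)) (x + t *\<^sub>R axis i 1)) differentiable at 0"
    proof -
      obtain f'' g'' where "((\<lambda>t. f' ((x + t *\<^sub>R axis i 1) $ 1) * g' ((x + t *\<^sub>R axis i 1) $ 2)) has_real_derivative f'' (x $ 1) * g'' (x $ 2)) (at 0)"
        using der[OF fg'(1,2), of i] by blast
      then show ?thesis unfolding fg'(3) real_differentiable_def by blast
    qed
  qed
qed

lemma test_fn_bump:
  assumes "cbox l u \<subseteq> \<Omega>"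
  shows "test_fn \<Omega> (\<lambda>x. bump (l$1) (u$1) n (x$1) * bump (l$2) (u$2) n (x$2))"
proof -
  let ?f = "\<lambda>x::R2. bump (l$1) (u$1) n (x$1) * bump (l$2) (u$2) n (x$2)"
  have "{x. ?f x \<noteq> 0} \<subseteq> cbox l u"
  proof
    fix x assume "x \<in> {x. ?f x \<noteq> 0}"
    then have "bump (l$1) (u$1) n (x$1) \<noteq> 0" "bump (l$2) (u$2) n (x$2) \<noteq> 0" by auto
    then have "x$1 \<in> {l$1<..<u$1}" "x$2 \<in> {l$2<..<u$2}" using bump_outside by blast+
    then show "x \<in> cbox l u" by (auto simp: mem_box_cart forall_2)
  qed
  then have sub: "closure {x. ?f x \<noteq> 0} \<subseteq> cbox l u" by (meson closed_cbox closure_minimal)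
  then have "compact (closure {x. ?f x \<noteq> 0})" by (meson bounded_cbox bounded_subset closed_closure compact_eq_bounded_closed)
  then show ?thesis unfolding test_fn_def using sub assms smooth_product[OF smooth1_bump smooth1_bump] by blast
qed

section \<open>The fundamental lemma of the calculus of variations\<close>

text \<open>Boxes form an intersection-stable generator of the Borel sets, so the integral vanishes
  over every Borel set; the total integral settles the complements.\<close>

lemma AE_zero_if_zero_on_boxes:
  fixes f :: "'a::euclidean_space \<Rightarrow> real"
  assumes f: "integrable lborel f" and tot: "(\<integral>x. f x \<partial>lborel) = 0"
    and box: "\<And>l u. (\<integral>x. indicator (box l u) x * f x \<partial>lborel) = 0"
  shows "AE x in lborel. f x = 0"
proof (rule sigma_finite_measure.density_zero[OF sigma_finite_lborel f])
  fix A :: "'a set" assume "A \<in> sets lborel"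
  moreover have sl: "sets (lborel :: 'a measure) = sigma_sets UNIV (range (\<lambda>(a, b). box a b))"
    by (simp add: borel_eq_box)
  ultimately have A: "A \<in> sigma_sets UNIV (range (\<lambda>(a, b). box a b))" by simp
  have "Int_stable (range (\<lambda>(a, b). box a b :: 'a set))" by (auto simp: Int_stable_def box_Int_box)
  moreover have "range (\<lambda>(a, b). box a b :: 'a set) \<subseteq> Pow UNIV" by auto
  moreover note A
  ultimately show "(LINT x:A|lborel. f x) = 0"
  proof (induction rule: sigma_sets_induct_disjoint)
    case (basic A) then show ?case using box by (auto simp: set_lebesgue_integral_def)
  next
    case empty then show ?case by (simp add: set_lebesgue_integral_def)
  next
    case (compl A)
    then have [measurable]: "A \<in> sets lborel" unfolding sl by blast
    have i: "integrable lborel (\<lambda>x. indicator A x *\<^sub>R f x)"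
      by (rule integrable_mult_indicator[OF \<open>A \<in> sets lborel\<close> f])
    have "(LINT x:UNIV - A|lborel. f x) = (\<integral>x. f x - indicator A x *\<^sub>R f x \<partial>lborel)"
      unfolding set_lebesgue_integral_def by (intro Bochner_Integration.integral_cong) (auto simp: indicator_def)
    also have "\<dots> = 0" using compl tot f i by (simp add: set_lebesgue_integral_def)
    finally show ?case .
  next
    case (union B)
    then have Bs: "\<And>i. B i \<in> sets lborel" unfolding sl by blast
    have "(LINT x:(\<Union>i. B i)|lborel. f x) = (\<Sum>i. (LINT x:(B i)|lborel. f x))"
    proof (rule lebesgue_integral_countable_add)
      show "set_integrable lborel (\<Union>i. B i) f" unfolding set_integrable_def
        by (rule integrable_mult_indicator[OF sets.countable_UN f]) (use Bs in blast)
      show "B i \<in> sets lborel" for i by (rule Bs)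
    qed (use union in \<open>auto simp: disjoint_family_on_def\<close>)
    then show ?case using union by simp
  qed
qed

text \<open>Dominated convergence along bump functions gives vanishing integrals over boxes inside
  the domain, hence g = 0 almost everywhere on each closed box, and countably many closed boxes
  exhaust the domain.\<close>

lemma fundamental_lemma:
  fixes g :: "R2 \<Rightarrow> real"
  assumes op: "open \<Omega>" and loc: "\<And>K. compact K \<Longrightarrow> K \<subseteq> \<Omega> \<Longrightarrow> set_integrable lebesgue K g"
    and zero: "\<And>\<phi>. test_fn \<Omega> \<phi> \<Longrightarrow> (LINT x:\<Omega>|lebesgue. g x * \<phi> x) = 0"
  shows "AE x in lebesgue. x \<in> \<Omega> \<longrightarrow> g x = 0"
proof -
  have bl: "box l u \<in> sets lebesgue" for l u :: R2 by (rule sets_completionI_sets) simp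
  have bm: "indicat_real (box l u) \<in> borel_measurable lebesgue" for l u :: R2
    by (rule borel_measurable_indicator[OF bl])
  have bz: "(\<integral>x. indicator (box l u) x * g x \<partial>lebesgue) = 0" if sub: "cbox l u \<subseteq> \<Omega>" for l u
  proof -
    define \<phi> where "\<phi> n x = bump (l$1) (u$1) n (x$1) * bump (l$2) (u$2) n (x$2)" for n and x :: R2
    have t: "test_fn \<Omega> (\<phi> n)" for n unfolding \<phi>_def[abs_def] by (rule test_fn_bump[OF sub])
    have int: "integrable lebesgue (\<lambda>x. indicator (cbox l u) x *\<^sub>R g x)"
      using loc[OF compact_cbox sub] by (simp add: set_integrable_def)
    have out: "\<phi> n x = 0" if "x \<notin> box l u" for n x
    proof -
      have "x$1 \<notin> {l$1<..<u$1} \<or> x$2 \<notin> {l$2<..<u$2}" using that by (auto simp: mem_box_cart forall_2)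
      then show ?thesis using bump_outside by (auto simp: \<phi>_def)
    qed
    have eq: "indicator \<Omega> x *\<^sub>R (g x * \<phi> n x) = (indicator (cbox l u) x *\<^sub>R g x) * \<phi> n x" for n x
      using out[of x n] sub box_subset_cbox[of l u] by (cases "x \<in> box l u") (auto simp: indicator_def)
    have pm[measurable]: "\<phi> n \<in> borel_measurable lebesgue" for n
      by (rule measurable_completion) (use smooth_cont[OF test_fn_smooth[OF t]] in \<open>auto intro: borel_measurable_continuous_onI\<close>)
    have b01: "0 \<le> \<phi> n x" "\<phi> n x \<le> 1" for n x unfolding \<phi>_def using bump_bounds by (auto intro!: mult_nonneg_nonneg mult_le_one)
    have "(\<lambda>n. \<integral>x. (indicator (cbox l u) x *\<^sub>R g x) * \<phi> n x \<partial>lebesgue) \<longlonglongrightarrow> (\<integral>x. indicator (box l u) x * (indicator (cbox l u) x *\<^sub>R g x) \<partial>lebesgue)"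
    proof (rule integral_dominated_convergence[OF _ _ integrable_norm[OF int]])
      show "(\<lambda>x. indicator (box l u) x * (indicator (cbox l u) x *\<^sub>R g x)) \<in> borel_measurable lebesgue"
        by (intro borel_measurable_times bm borel_measurable_integrable[OF int])
      show "(\<lambda>x. (indicator (cbox l u) x *\<^sub>R g x) * \<phi> n x) \<in> borel_measurable lebesgue" for n
        by (intro borel_measurable_times pm borel_measurable_integrable[OF int])
      show "AE x in lebesgue. (\<lambda>n. (indicator (cbox l u) x *\<^sub>R g x) * \<phi> n x) \<longlonglongrightarrow> indicator (box l u) x * (indicator (cbox l u) x *\<^sub>R g x)"
      proof (rule AE_I2)
        fix x :: R2
        have "(\<lambda>n. \<phi> n x) \<longlonglongrightarrow> indicator (box l u) x"
        proof (cases "x \<in> box l u")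
          case True
          then have "x$1 \<in> {l$1<..<u$1}" "x$2 \<in> {l$2<..<u$2}" by (auto simp: mem_box_cart forall_2)
          then have "(\<lambda>n. \<phi> n x) \<longlonglongrightarrow> 1 * 1" unfolding \<phi>_def by (intro tendsto_mult bump_lim)
          then show ?thesis using True by simp
        next
          case False then show ?thesis using out by simp
        qed
        from tendsto_mult[OF tendsto_const[of "indicator (cbox l u) x *\<^sub>R g x"] this]
        show "(\<lambda>n. (indicator (cbox l u) x *\<^sub>R g x) * \<phi> n x) \<longlonglongrightarrow> indicator (box l u) x * (indicator (cbox l u) x *\<^sub>R g x)"
          by (simp add: mult.commute)
      qed
      show "AE x in lebesgue. norm ((indicator (cbox l u) x *\<^sub>R g x) * \<phi> n x) \<le> norm (indicator (cbox l u) x *\<^sub>R g x)" for n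
        using b01 by (auto simp: abs_mult intro!: mult_left_le)
    qed
    moreover have "(\<integral>x. (indicator (cbox l u) x *\<^sub>R g x) * \<phi> n x \<partial>lebesgue) = 0" for n
      using zero[OF t[of n]] unfolding set_lebesgue_integral_def eq .
    ultimately have "(\<integral>x. indicator (box l u) x * (indicator (cbox l u) x *\<^sub>R g x) \<partial>lebesgue) = 0"
      by (simp add: LIMSEQ_const_iff)
    moreover have "(\<lambda>x. indicator (box l u) x * (indicator (cbox l u) x *\<^sub>R g x)) = (\<lambda>x. indicator (box l u) x * g x)"
      using box_subset_cbox[of l u] by (auto simp: indicator_def fun_eq_iff)
    ultimately show ?thesis by (simp only:)
  qed
  have cb: "AE x in lebesgue. x \<in> cbox l u \<longrightarrow> g x = 0" if sub: "cbox l u \<subseteq> \<Omega>" for l u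
  proof -
    have int: "integrable lebesgue (\<lambda>x. indicator (cbox l u) x *\<^sub>R g x)"
      using loc[OF compact_cbox sub] by (simp add: set_integrable_def)
    have intb: "integrable lebesgue (\<lambda>x. indicator (box l u) x * g x)"
    proof -
      have "integrable lebesgue (\<lambda>x. indicator (box l u) x *\<^sub>R (indicator (cbox l u) x *\<^sub>R g x))"
        by (rule integrable_mult_indicator[OF bl int])
      moreover have "(\<lambda>x. indicator (box l u) x *\<^sub>R (indicator (cbox l u) x *\<^sub>R g x)) = (\<lambda>x. indicator (box l u) x * g x)"
        using box_subset_cbox[of l u] by (auto simp: indicator_def fun_eq_iff)
      ultimately show ?thesis by (simp only:)
    qed
    \<comment> \<open>The argument over Borel sets requires a Borel integrand, so g times the
      indicator is replaced by a Borel function equal to it almost everywhere.\<close>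
    obtain f where f: "f \<in> borel_measurable lborel" "AE x in lborel. indicator (box l u) x * g x = f x"
      using completion_ex_borel_measurable_real[OF borel_measurable_integrable[OF intb]] by blast
    have f': "f \<in> borel_measurable lebesgue" "AE x in lebesgue. indicator (box l u) x * g x = f x"
      by (rule measurable_completion[OF f(1)], rule AE_completion[OF f(2)])
    have "integrable lebesgue f" by (rule integrable_cong_AE_imp[OF intb f'(1,2)])
    then have fi: "integrable lborel f" using integrable_completion[OF f(1)] by simp
    have fz: "(\<integral>x. indicator (box l' u') x * f x \<partial>lborel) = 0" for l' u'
    proof -
      obtain l2 u2 where b2: "box l' u' \<inter> box l u = box l2 u2" using box_Int_box by blast
      have "(\<integral>x. indicator (box l' u') x * f x \<partial>lborel) = (\<integral>x. indicator (box l' u') x * f x \<partial>lebesgue)"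
        by (intro integral_completion[symmetric] borel_measurable_times f(1)) simp
      also have "\<dots> = (\<integral>x. indicator (box l' u') x * (indicator (box l u) x * g x) \<partial>lebesgue)"
      proof (rule integral_cong_AE)
        show "AE x in lebesgue. indicator (box l' u') x * f x = indicator (box l' u') x * (indicator (box l u) x * g x)"
          using f'(2) by eventually_elim simp
      qed (intro borel_measurable_times bm f'(1) borel_measurable_integrable[OF intb])+
      also have "\<dots> = (\<integral>x. indicator (box l2 u2) x * g x \<partial>lebesgue)"
        unfolding b2[symmetric] by (intro Bochner_Integration.integral_cong) (auto simp: indicator_def)
      also have "\<dots> = 0"
      \<comment> \<open>When the open box is empty, the closed box with the same corners may be
        degenerate and stick out of the domain; otherwise closures can be compared.\<close>
      proof (cases "box l2 u2 = {}")
        case False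
        have "box l2 u2 \<subseteq> box l u" using b2 by blast
        then have "closure (box l2 u2) \<subseteq> closure (box l u)" by (rule closure_mono)
        moreover have "box l u \<noteq> {}" using False \<open>box l2 u2 \<subseteq> box l u\<close> by blast
        ultimately have "cbox l2 u2 \<subseteq> cbox l u" using False by (simp add: closure_box)
        then show ?thesis using bz sub by blast
      qed simp
      finally show ?thesis .
    qed
    have tot: "(\<integral>x. f x \<partial>lborel) = 0"
    proof -
      have "(\<integral>x. f x \<partial>lborel) = (\<integral>x. f x \<partial>lebesgue)" by (rule integral_completion[OF f(1), symmetric])
      also have "\<dots> = (\<integral>x. indicator (box l u) x * g x \<partial>lebesgue)"
      proof (rule integral_cong_AE[OF f'(1) borel_measurable_integrable[OF intb]])
        show "AE x in lebesgue. f x = indicator (box l u) x * g x"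
          using f'(2) by eventually_elim simp
      qed
      also have "\<dots> = 0" by (rule bz[OF sub])
      finally show ?thesis .
    qed
    have "AE x in lborel. f x = 0" by (rule AE_zero_if_zero_on_boxes[OF fi tot fz])
    then have "AE x in lebesgue. f x = 0" by (rule AE_completion)
    then have 1: "AE x in lebesgue. indicator (box l u) x * g x = 0" using f'(2) by eventually_elim simp
    have "negligible (cbox l u - box l u)" by (rule negligible_frontier_interval)
    then have "AE x in lebesgue. x \<notin> cbox l u - box l u" unfolding negligible_iff_null_sets by (rule AE_not_in)
    with 1 show ?thesis by eventually_elim (auto simp: indicator_def split: if_splits)
  qed
  obtain \<D> where \<D>: "countable \<D>" "\<D> \<subseteq> Pow \<Omega>" "\<And>X. X \<in> \<D> \<Longrightarrow> \<exists>a b. X = cbox a b" "\<Union>\<D> = \<Omega>"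
    by (rule open_countable_Union_open_cbox[OF op]) blast
  have "AE x in lebesgue. \<forall>X\<in>\<D>. x \<in> X \<longrightarrow> g x = 0"
    unfolding AE_ball_countable[OF \<D>(1)]
  proof
    fix X assume X: "X \<in> \<D>"
    obtain l u where "X = cbox l u" using \<D>(3)[OF X] by blast
    then show "AE x in lebesgue. x \<in> X \<longrightarrow> g x = 0" using cb[of l u] X \<D>(2) by blast
  qed
  then show ?thesis by eventually_elim (use \<D>(4) in blast)
qed

section \<open>The space \<open>W\<^sub>0\<close>\<close>

lemma R2_norm_sq: "(norm (x::R2))\<^sup>2 = (x $ 1)\<^sup>2 + (x $ 2)\<^sup>2"
  unfolding power2_norm_eq_inner inner_vec_def by (simp add: sum_2 power2_eq_square)

lemma R2_meas:
  fixes g :: "'a \<Rightarrow> R2"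
  shows "g \<in> borel_measurable M \<longleftrightarrow> (\<lambda>x. g x $ 1) \<in> borel_measurable M \<and> (\<lambda>x. g x $ 2) \<in> borel_measurable M"
proof
  assume g: "g \<in> borel_measurable M"
  have "(\<lambda>x. g x $ i) \<in> borel_measurable M" for i
    by (rule measurable_compose[OF g borel_measurable_continuous_onI]) (intro continuous_intros)
  then show "(\<lambda>x. g x $ 1) \<in> borel_measurable M \<and> (\<lambda>x. g x $ 2) \<in> borel_measurable M" by blast
next
  assume g: "(\<lambda>x. g x $ 1) \<in> borel_measurable M \<and> (\<lambda>x. g x $ 2) \<in> borel_measurable M"
  then have "(\<lambda>x. pt (fst (g x $ 1, g x $ 2)) (snd (g x $ 1, g x $ 2))) \<in> borel_measurable M"
    by (intro measurable_compose[OF borel_measurable_Pair measurable_pt]) auto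
  then show "g \<in> borel_measurable M" by simp
qed

lemma comp_meas: "g \<in> borel_measurable M \<Longrightarrow> (\<lambda>x. g x $ i) \<in> borel_measurable M" for g :: "'a \<Rightarrow> R2"
  using R2_meas[of g M] exhaust_2[of i] by auto

lemma comp_sq_int:
  fixes g :: "'a \<Rightarrow> R2" assumes g: "sq_int M g" shows "sq_int M (\<lambda>x. g x $ i)"
proof -
  note m = comp_meas[OF sq_int_meas[OF g], of i]
  have "integrable M (\<lambda>x. (norm (g x $ i))\<^sup>2)"
  proof (rule Bochner_Integration.integrable_bound[OF sq_int_integrable[OF g]])
    show "AE x in M. norm ((norm (g x $ i))\<^sup>2) \<le> norm ((norm (g x))\<^sup>2)"
    proof (rule AE_I2)
      fix x
      have "(norm (g x $ i))\<^sup>2 \<le> (norm (g x))\<^sup>2" using component_le_norm_cart[of "g x" i] by (intro power_mono) auto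
      then show "norm ((norm (g x $ i))\<^sup>2) \<le> norm ((norm (g x))\<^sup>2)" by simp
    qed
  qed (use m in measurable)
  then show ?thesis using m by (simp add: sq_int_def)
qed

lemma comp_nsq_le:
  fixes g :: "'a \<Rightarrow> R2" assumes g: "sq_int M g" shows "nsq M (\<lambda>x. g x $ i) \<le> nsq M g"
  unfolding nsq_def
proof (intro integral_mono sq_int_integrable comp_sq_int g)
  fix x show "(norm (g x $ i))\<^sup>2 \<le> (norm (g x))\<^sup>2"
    using component_le_norm_cart[of "g x" i] by (intro power_mono) auto
qed

lemma sq_int_mult_real:
  fixes f g :: "'a \<Rightarrow> real" assumes "sq_int M f" "sq_int M g"
  shows "integrable M (\<lambda>x. f x * g x)" "\<bar>\<integral>x. f x * g x \<partial>M\<bar> \<le> sqrt (nsq M f) * sqrt (nsq M g)"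
proof -
  have [measurable]: "f \<in> borel_measurable M" "g \<in> borel_measurable M" using assms by (auto simp: sq_int_def)
  show i: "integrable M (\<lambda>x. f x * g x)"
    by (rule Bochner_Integration.integrable_bound[OF sq_int_mult_integrable[OF assms]]) (auto simp: abs_mult)
  have "\<bar>\<integral>x. f x * g x \<partial>M\<bar> \<le> (\<integral>x. norm (f x * g x) \<partial>M)" using integral_norm_bound[of M "\<lambda>x. f x * g x"] by simp
  also have "\<dots> = (\<integral>x. norm (f x) * norm (g x) \<partial>M)" by (simp add: abs_mult)
  also have "\<dots> \<le> sqrt (nsq M f) * sqrt (nsq M g)" by (rule Cauchy_Schwarz_integral[OF assms])
  finally show "\<bar>\<integral>x. f x * g x \<partial>M\<bar> \<le> sqrt (nsq M f) * sqrt (nsq M g)" .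
qed

lemma (in finite_measure) sq_int_imp_integrable:
  fixes f :: "'a \<Rightarrow> 'b::euclidean_space" assumes f: "sq_int M f" shows "integrable M f"
proof (rule Bochner_Integration.integrable_bound)
  show "integrable M (\<lambda>x. 1 + (norm (f x))\<^sup>2)" using sq_int_integrable[OF f] by simp
  have "norm (f x) \<le> 1 + (norm (f x))\<^sup>2" for x
  proof -
    have "2 * norm (f x) \<le> 1 + (norm (f x))\<^sup>2"
      using zero_le_power2[of "norm (f x) - 1"] by (simp add: power2_eq_square algebra_simps)
    then show ?thesis using norm_ge_zero[of "f x"] by linarith
  qed
  then show "AE x in M. norm (f x) \<le> norm (1 + (norm (f x))\<^sup>2)" by simp
qed (rule sq_int_meas[OF f])

lemma sq_int_cong_AE:
  assumes "sq_int M f" "g \<in> borel_measurable M" "AE x in M. f x = g x" shows "sq_int M g"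
proof -
  note [measurable] = assms(2) sq_int_meas[OF assms(1)]
  have "integrable M (\<lambda>x. (norm (g x))\<^sup>2)"
    by (rule integrable_cong_AE_imp[OF sq_int_integrable[OF assms(1)]]) (measurable, use assms(3) in auto)
  then show ?thesis using assms(2) by (simp add: sq_int_def)
qed

locale planar_domain =
  fixes \<Omega> :: "R2 set" and R :: real
  assumes op: "open \<Omega>" and ne: "\<Omega> \<noteq> {}" and R: "R > 0"
    and box: "\<And>z. z \<in> \<Omega> \<Longrightarrow> \<bar>z $ 1\<bar> < R \<and> \<bar>z $ 2\<bar> < R"
begin

text \<open>Set integrals over the domain become integrals over a single finite measure space, to
  which the abstract variational argument applies.\<close>

definition MO :: "R2 measure" where "MO = restrict_space lebesgue \<Omega>"

lemma Om_sets: "\<Omega> \<in> sets lebesgue" by (rule sets_completionI_sets) (use op in auto)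

lemma Om_sets': "\<Omega> \<inter> space lebesgue \<in> sets lebesgue" using Om_sets by simp

lemma Om_sub: "\<Omega> \<subseteq> sqbox R" using box by (auto simp: mem_sqbox less_imp_le)

lemma space_MO: "space MO = \<Omega>" by (simp add: MO_def)

lemma integral_MO:
  fixes f :: "R2 \<Rightarrow> 'b::{banach, second_countable_topology}"
  shows "(LINT x:\<Omega>|lebesgue. f x) = (\<integral>x. f x \<partial>MO)"
  unfolding MO_def set_lebesgue_integral_def by (rule integral_restrict_space[OF Om_sets', symmetric])

lemma integrable_MO:
  fixes f :: "R2 \<Rightarrow> 'b::{banach, second_countable_topology}"
  shows "set_integrable lebesgue \<Omega> f \<longleftrightarrow> integrable MO f"
  unfolding MO_def set_integrable_def by (rule integrable_restrict_space[OF Om_sets', symmetric])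

lemma meas_MO:
  fixes f :: "R2 \<Rightarrow> 'b::real_normed_vector"
  shows "set_borel_measurable lebesgue \<Omega> f \<longleftrightarrow> f \<in> borel_measurable MO"
  unfolding MO_def set_borel_measurable_def by (rule borel_measurable_restrict_space_iff[OF Om_sets', symmetric])

lemma emeasure_Om: "emeasure lebesgue \<Omega> < \<infinity>"
proof -
  have "emeasure lebesgue \<Omega> = emeasure lborel \<Omega>" using op by simp
  also have "\<dots> \<le> emeasure lborel (sqbox R)" using Om_sub by (intro emeasure_mono) (auto simp: sqbox_def)
  also have "\<dots> < \<infinity>" by (simp add: sqbox_def emeasure_lborel_cbox_eq)
  finally show ?thesis .
qed

lemma measure_MO: "measure MO (space MO) = measure lebesgue \<Omega>"
  using measure_restrict_space[OF Om_sets' subset_refl] unfolding space_MO unfolding MO_def .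

sublocale MOf: finite_measure MO
proof
  have "emeasure MO (space MO) = emeasure lebesgue \<Omega>"
    using emeasure_restrict_space[OF Om_sets' subset_refl] unfolding space_MO unfolding MO_def .
  then show "emeasure MO (space MO) \<noteq> \<infinity>" using emeasure_Om by simp
qed

text \<open>Carries the estimates on the whole plane over to Borel functions supported in the
  domain.\<close>

lemma supp_integral_MO:
  fixes f :: "R2 \<Rightarrow> real"
  assumes f: "f \<in> borel_measurable borel" and z: "\<And>x. x \<notin> \<Omega> \<Longrightarrow> f x = 0"
  shows "(\<integral>x. f x \<partial>MO) = (\<integral>x. f x \<partial>lborel)" "integrable MO f \<longleftrightarrow> integrable lborel f"
    "f \<in> borel_measurable MO"
proof -
  have f': "f \<in> borel_measurable lborel" using f by simp
  have eq: "(\<lambda>x. indicator \<Omega> x *\<^sub>R f x) = f" using z by (auto simp: indicator_def fun_eq_iff)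
  show "(\<integral>x. f x \<partial>MO) = (\<integral>x. f x \<partial>lborel)"
    unfolding MO_def integral_restrict_space[OF Om_sets'] eq by (rule integral_completion[OF f'])
  show "integrable MO f \<longleftrightarrow> integrable lborel f"
    unfolding MO_def integrable_restrict_space[OF Om_sets'] eq by (rule integrable_completion[OF f'])
  show "f \<in> borel_measurable MO"
    unfolding MO_def borel_measurable_restrict_space_iff[OF Om_sets'] eq by (rule measurable_completion[OF f'])
qed

lemma supp_nsq_MO:
  fixes f :: "R2 \<Rightarrow> real"
  assumes f: "f \<in> borel_measurable borel" and z: "\<And>x. x \<notin> \<Omega> \<Longrightarrow> f x = 0"
  shows "nsq MO f = nsq lborel f" "sq_int MO f \<longleftrightarrow> sq_int lborel f"
proof -
  have m: "(\<lambda>x. (norm (f x))\<^sup>2) \<in> borel_measurable borel" using f by measurable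
  note * = supp_integral_MO[OF m]
  show "nsq MO f = nsq lborel f" unfolding nsq_def using *(1) z by simp
  show "sq_int MO f \<longleftrightarrow> sq_int lborel f" unfolding sq_int_def using *(2) z supp_integral_MO(3)[OF f z] f by simp
qed

lemma tf_C1c: "test_fn \<Omega> \<phi> \<Longrightarrow> C1c R \<phi> (pd 1 \<phi>) (pd 2 \<phi>)"
  by (rule test_fn_C1c[OF _ box])

lemma tf_bs: assumes "test_fn \<Omega> \<phi>" shows "bsupp R \<phi>" "bsupp R (pd i \<phi>)"
  using tf_C1c[OF assms] exhaust_2[of i] by (auto simp: C1c_def)

lemma tf_sq:
  assumes \<phi>: "test_fn \<Omega> \<phi>"
  shows "sq_int MO \<phi>" "sq_int MO (pd i \<phi>)" "nsq MO \<phi> = nsq lborel \<phi>" "nsq MO (pd i \<phi>) = nsq lborel (pd i \<phi>)"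
proof -
  note a = supp_nsq_MO[OF bsupp_meas[OF tf_bs(1)[OF \<phi>]] test_fn_zero_outside[OF \<phi>]]
  note b = supp_nsq_MO[OF bsupp_meas[OF tf_bs(2)[OF \<phi>, of i]] test_fn_pd_outside[OF \<phi>]]
  show "sq_int MO \<phi>" "sq_int MO (pd i \<phi>)" "nsq MO \<phi> = nsq lborel \<phi>" "nsq MO (pd i \<phi>) = nsq lborel (pd i \<phi>)"
    using a b bsupp_sq_int[OF tf_bs(1)[OF \<phi>]] bsupp_sq_int[OF tf_bs(2)[OF \<phi>]] by auto
qed

lemma cg_nth [simp]: "classical_grad \<phi> x $ i = pd i \<phi> x" by (simp add: classical_grad_def)

lemma cg_sq:
  assumes \<phi>: "test_fn \<Omega> \<phi>"
  shows "sq_int MO (classical_grad \<phi>)" "nsq MO (classical_grad \<phi>) = nsq lborel (pd 1 \<phi>) + nsq lborel (pd 2 \<phi>)"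
proof -
  have n: "(norm (classical_grad \<phi> x))\<^sup>2 = (norm (pd 1 \<phi> x))\<^sup>2 + (norm (pd 2 \<phi> x))\<^sup>2" for x by (simp add: R2_norm_sq)
  have m: "classical_grad \<phi> \<in> borel_measurable MO"
    using sq_int_meas[OF tf_sq(2)[OF \<phi>]] unfolding R2_meas by simp
  show "sq_int MO (classical_grad \<phi>)" unfolding sq_int_def n
    using m sq_int_integrable[OF tf_sq(2)[OF \<phi>, of 1]] sq_int_integrable[OF tf_sq(2)[OF \<phi>, of 2]] by simp
  show "nsq MO (classical_grad \<phi>) = nsq lborel (pd 1 \<phi>) + nsq lborel (pd 2 \<phi>)"
    unfolding tf_sq(4)[OF \<phi>, symmetric] unfolding nsq_def n
    using sq_int_integrable[OF tf_sq(2)[OF \<phi>, of 1]] sq_int_integrable[OF tf_sq(2)[OF \<phi>, of 2]] by simp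
qed

text \<open>Local integrability is automatic: the domain has finite measure, so square-integrable
  functions are integrable.\<close>

lemma weak_gradI:
  assumes u: "sq_int MO u" and g: "sq_int MO g"
    and parts: "\<And>\<phi> i. test_fn \<Omega> \<phi> \<Longrightarrow> (\<integral>x. u x * pd i \<phi> x \<partial>MO) = - (\<integral>x. g x $ i * \<phi> x \<partial>MO)"
  shows "weak_grad \<Omega> u g"
  unfolding weak_grad_def integral_MO meas_MO
proof (intro conjI allI impI)
  have sub: "set_integrable lebesgue K f" if "compact K \<and> K \<subseteq> \<Omega>" "integrable MO f"
    for K and f :: "R2 \<Rightarrow> 'b::{banach, second_countable_topology}"
  proof -
    have "K \<in> sets lebesgue" by (rule sets_completionI_sets) (use that(1) in \<open>simp add: borel_compact\<close>)
    then show ?thesis using set_integrable_subset[of lebesgue \<Omega> f K] that integrable_MO by blast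
  qed
  show "set_integrable lebesgue K u" if "compact K \<and> K \<subseteq> \<Omega>" for K by (rule sub[OF that MOf.sq_int_imp_integrable[OF u]])
  show "set_integrable lebesgue K g" if "compact K \<and> K \<subseteq> \<Omega>" for K by (rule sub[OF that MOf.sq_int_imp_integrable[OF g]])
qed (use parts sq_int_meas[OF u] sq_int_meas[OF g] in auto)

lemma weak_gradD:
  assumes "weak_grad \<Omega> u g" "test_fn \<Omega> \<phi>"
  shows "(\<integral>x. u x * pd i \<phi> x \<partial>MO) = - (\<integral>x. g x $ i * \<phi> x \<partial>MO)"
  using assms unfolding weak_grad_def integral_MO by blast

lemma weak_grad_meas: "weak_grad \<Omega> u g \<Longrightarrow> g \<in> borel_measurable MO"
  unfolding weak_grad_def meas_MO by blast

text \<open>Integration by parts for the product of two test functions.\<close>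

lemma weak_grad_test:
  assumes \<phi>: "test_fn \<Omega> \<phi>" shows "weak_grad \<Omega> \<phi> (classical_grad \<phi>)"
proof (rule weak_gradI[OF tf_sq(1)[OF \<phi>] cg_sq(1)[OF \<phi>]])
  fix \<psi> i assume \<psi>: "test_fn \<Omega> \<psi>"
  note C = C1c_mult[OF tf_C1c[OF \<phi>] tf_C1c[OF \<psi>]]
  have zero: "(\<integral>x. \<phi> x * pd i \<psi> x + pd i \<phi> x * \<psi> x \<partial>lborel) = 0"
    using C1c_integral_deriv_zero[OF C R] exhaust_2[of i] by auto
  have m: "(\<lambda>x. \<phi> x * pd i \<psi> x + pd i \<phi> x * \<psi> x) \<in> borel_measurable borel"
    using bsupp_meas[OF tf_bs(1)[OF \<phi>]] bsupp_meas[OF tf_bs(1)[OF \<psi>]]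
      bsupp_meas[OF tf_bs(2)[OF \<phi>, of i]] bsupp_meas[OF tf_bs(2)[OF \<psi>, of i]] by measurable
  have "(\<integral>x. \<phi> x * pd i \<psi> x + pd i \<phi> x * \<psi> x \<partial>MO) = 0"
    unfolding zero[symmetric]
    by (rule supp_integral_MO(1)[OF m]) (simp add: test_fn_zero_outside[OF \<phi>] test_fn_zero_outside[OF \<psi>])
  then have "(\<integral>x. \<phi> x * pd i \<psi> x \<partial>MO) + (\<integral>x. pd i \<phi> x * \<psi> x \<partial>MO) = 0"
    using sq_int_mult_real(1)[OF tf_sq(1)[OF \<phi>] tf_sq(2)[OF \<psi>, of i]] sq_int_mult_real(1)[OF tf_sq(2)[OF \<phi>, of i] tf_sq(1)[OF \<psi>]] by simp
  then show "(\<integral>x. \<phi> x * pd i \<psi> x \<partial>MO) = - (\<integral>x. classical_grad \<phi> x $ i * \<psi> x \<partial>MO)" by simp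
qed

text \<open>Weak gradients are merely locally integrable by definition; a test function confines the
  product to a compact set and is bounded there.\<close>

lemma loc_int_mult:
  fixes g :: "R2 \<Rightarrow> real"
  assumes loc: "\<And>K. compact K \<Longrightarrow> K \<subseteq> \<Omega> \<Longrightarrow> set_integrable lebesgue K g" and \<phi>: "test_fn \<Omega> \<phi>"
  shows "integrable MO (\<lambda>x. g x * \<phi> x)"
proof -
  define K where "K = closure {x. \<phi> x \<noteq> 0}"
  have K: "compact K" "K \<subseteq> \<Omega>" using \<phi> by (auto simp: test_fn_def K_def)
  have out: "\<phi> x = 0" if "x \<notin> K" for x using that closure_subset[of "{x. \<phi> x \<noteq> 0}"] by (auto simp: K_def)
  have int: "integrable lebesgue (\<lambda>x. indicator K x *\<^sub>R g x)" using loc[OF K] by (simp add: set_integrable_def)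
  have "bounded (\<phi> ` K)"
    by (intro compact_imp_bounded compact_continuous_image K continuous_on_subset[OF smooth_cont[OF test_fn_smooth[OF \<phi>]]]) simp
  then obtain B where B: "\<And>x. x \<in> K \<Longrightarrow> \<bar>\<phi> x\<bar> \<le> B" by (auto simp: bounded_iff)
  have pm: "\<phi> \<in> borel_measurable lebesgue"
    by (rule measurable_completion) (use bsupp_meas[OF tf_bs(1)[OF \<phi>]] in simp)
  have "integrable lebesgue (\<lambda>x. (indicator K x *\<^sub>R g x) * \<phi> x)"
  proof (rule Bochner_Integration.integrable_bound[OF integrable_mult_left[OF integrable_norm[OF int], of B]])
    show "(\<lambda>x. (indicator K x *\<^sub>R g x) * \<phi> x) \<in> borel_measurable lebesgue"
      by (intro borel_measurable_times pm borel_measurable_integrable[OF int])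
    show "AE x in lebesgue. norm ((indicator K x *\<^sub>R g x) * \<phi> x) \<le> norm (norm (indicator K x *\<^sub>R g x) * B)"
    proof (rule AE_I2)
      fix x
      show "norm ((indicator K x *\<^sub>R g x) * \<phi> x) \<le> norm (norm (indicator K x *\<^sub>R g x) * B)"
      proof (cases "x \<in> K")
        case True
        then have "\<bar>\<phi> x\<bar> \<le> \<bar>B\<bar>" using B[of x] by linarith
        then show ?thesis using True by (simp add: abs_mult mult_left_mono)
      qed simp
    qed
  qed
  moreover have "(\<lambda>x. (indicator K x *\<^sub>R g x) * \<phi> x) = (\<lambda>x. indicator \<Omega> x *\<^sub>R (g x * \<phi> x))"
    using out K(2) by (fastforce simp: indicator_def fun_eq_iff)
  ultimately show ?thesis unfolding MO_def integrable_restrict_space[OF Om_sets'] by simp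
qed

text \<open>The fundamental lemma, applied to the components of the difference. It makes the
  arbitrary choice in \<open>wgrad\<close> harmless up to null sets.\<close>

lemma weak_grad_unique:
  assumes g: "weak_grad \<Omega> u g" and h: "weak_grad \<Omega> u h" shows "AE x in MO. g x = h x"
proof -
  have comp: "AE x in lebesgue. x \<in> \<Omega> \<longrightarrow> g x $ i - h x $ i = 0" for i
  proof (rule fundamental_lemma[OF op])
    have li: "set_integrable lebesgue K (\<lambda>x. f x $ i)" if "weak_grad \<Omega> u f" "compact K" "K \<subseteq> \<Omega>" for K f
    proof -
      have "set_integrable lebesgue K f" using that unfolding weak_grad_def by blast
      from integrable_bounded_linear[OF bounded_linear_vec_nth this[unfolded set_integrable_def], of i]
      show ?thesis by (simp add: set_integrable_def)
    qed
    show loc: "set_integrable lebesgue K (\<lambda>x. g x $ i - h x $ i)" if "compact K" "K \<subseteq> \<Omega>" for K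
      using set_integral_diff(1)[OF li[OF g that] li[OF h that]] .
    fix \<phi> assume \<phi>: "test_fn \<Omega> \<phi>"
    have ig: "integrable MO (\<lambda>x. g x $ i * \<phi> x)" by (rule loc_int_mult[OF li[OF g] \<phi>])
    have ih: "integrable MO (\<lambda>x. h x $ i * \<phi> x)" by (rule loc_int_mult[OF li[OF h] \<phi>])
    have "(\<integral>x. (g x $ i - h x $ i) * \<phi> x \<partial>MO) = (\<integral>x. g x $ i * \<phi> x \<partial>MO) - (\<integral>x. h x $ i * \<phi> x \<partial>MO)"
      using Bochner_Integration.integral_diff[OF ig ih] by (simp add: left_diff_distrib)
    also have "\<dots> = 0" using weak_gradD[OF g \<phi>, of i] weak_gradD[OF h \<phi>, of i] by simp
    finally show "(LINT x:\<Omega>|lebesgue. (g x $ i - h x $ i) * \<phi> x) = 0" unfolding integral_MO .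
  qed
  have "AE x in lebesgue. x \<in> \<Omega> \<longrightarrow> g x = h x"
    using comp[of 1] comp[of 2] by eventually_elim (auto simp: vec_eq_iff forall_2)
  then show ?thesis unfolding MO_def by (subst AE_restrict_space_iff[OF Om_sets'])
qed

lemma wgrad_weak: "weak_grad \<Omega> u g \<Longrightarrow> weak_grad \<Omega> u (wgrad \<Omega> u)"
  unfolding wgrad_def by (rule someI[of "weak_grad \<Omega> u"])

lemma wgrad_AE: "weak_grad \<Omega> u g \<Longrightarrow> AE x in MO. wgrad \<Omega> u x = g x"
  by (rule weak_grad_unique[OF wgrad_weak])

lemma wgrad_sq: assumes "weak_grad \<Omega> u g" "sq_int MO g" shows "sq_int MO (wgrad \<Omega> u)" "nsq MO (wgrad \<Omega> u) = nsq MO g"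
proof -
  note m = weak_grad_meas[OF wgrad_weak[OF assms(1)]] weak_grad_meas[OF assms(1)]
  have "AE x in MO. g x = wgrad \<Omega> u x" using wgrad_AE[OF assms(1)] by eventually_elim simp
  from sq_int_cong_AE[OF assms(2) m(1) this] show "sq_int MO (wgrad \<Omega> u)" .
  show "nsq MO (wgrad \<Omega> u) = nsq MO g" by (rule nsq_cong_AE[OF wgrad_AE[OF assms(1)] m])
qed

lemma wgrad_test:
  assumes \<phi>: "test_fn \<Omega> \<phi>"
  shows "sq_int MO (wgrad \<Omega> \<phi>)" "AE x in MO. wgrad \<Omega> \<phi> x = classical_grad \<phi> x"
    "nsq MO (wgrad \<Omega> \<phi>) = nsq lborel (pd 1 \<phi>) + nsq lborel (pd 2 \<phi>)"
  using wgrad_sq[OF weak_grad_test[OF \<phi>] cg_sq(1)[OF \<phi>]] wgrad_AE[OF weak_grad_test[OF \<phi>]] cg_sq(2)[OF \<phi>] by auto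

lemma wdist_eq:
  assumes "sq_int MO u" "sq_int MO v" "sq_int MO (wgrad \<Omega> u)" "sq_int MO (wgrad \<Omega> v)"
  shows "wdist \<Omega> u v = sqrt (nsq MO (\<lambda>x. u x - v x) + nsq MO (\<lambda>x. wgrad \<Omega> u x - wgrad \<Omega> v x))"
proof -
  have "(\<integral>x. (u x - v x)\<^sup>2 + (norm (wgrad \<Omega> u x - wgrad \<Omega> v x))\<^sup>2 \<partial>MO) =
    nsq MO (\<lambda>x. u x - v x) + nsq MO (\<lambda>x. wgrad \<Omega> u x - wgrad \<Omega> v x)"
    using sq_int_integrable[OF sq_int_diff[OF assms(1,2)]] sq_int_integrable[OF sq_int_diff[OF assms(3,4)]]
    unfolding nsq_def by simp
  then show ?thesis unfolding wdist_def integral_MO by simp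
qed

lemma W0_props:
  assumes "u \<in> W0 \<Omega>"
  shows "sq_int MO u" "sq_int MO (wgrad \<Omega> u)" "weak_grad \<Omega> u (wgrad \<Omega> u)"
    "\<And>x. x \<notin> \<Omega> \<Longrightarrow> u x = 0" "u \<in> borel_measurable lebesgue"
proof -
  obtain g where g: "weak_grad \<Omega> u g" "set_integrable lebesgue \<Omega> (\<lambda>x. (norm (g x))\<^sup>2)" using assms unfolding W0_def by blast
  have gs: "sq_int MO g" using g(2) weak_grad_meas[OF g(1)] by (simp add: sq_int_def integrable_MO)
  show "sq_int MO (wgrad \<Omega> u)" "weak_grad \<Omega> u (wgrad \<Omega> u)" by (rule wgrad_sq[OF g(1) gs], rule wgrad_weak[OF g(1)])
  show "sq_int MO u"
  proof -
    have "u \<in> borel_measurable MO" using g(1) unfolding weak_grad_def meas_MO by blast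
    moreover have "set_integrable lebesgue \<Omega> (\<lambda>x. (u x)\<^sup>2)" using assms unfolding W0_def by blast
    ultimately show ?thesis by (simp add: sq_int_def integrable_MO)
  qed
  show "\<And>x. x \<notin> \<Omega> \<Longrightarrow> u x = 0" "u \<in> borel_measurable lebesgue" using assms unfolding W0_def by blast+
qed

text \<open>The gradient is an argument, so that membership in \<open>W0\<close> can be verified
  with a computed weak gradient g in place of the chosen \<open>wgrad\<close>.\<close>

definition approx :: "(nat \<Rightarrow> R2 \<Rightarrow> real) \<Rightarrow> (R2 \<Rightarrow> real) \<Rightarrow> (R2 \<Rightarrow> R2) \<Rightarrow> bool" where
  "approx \<phi> u g \<longleftrightarrow> (\<forall>n. test_fn \<Omega> (\<phi> n)) \<and> (\<lambda>n. nsq MO (\<lambda>x. \<phi> n x - u x)) \<longlonglongrightarrow> 0 \<and>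
     (\<lambda>n. nsq MO (\<lambda>x. classical_grad (\<phi> n) x - g x)) \<longlonglongrightarrow> 0"

lemma nsq_wgrad_test_diff:
  assumes \<phi>: "test_fn \<Omega> \<phi>" and u: "weak_grad \<Omega> u g"
  shows "nsq MO (\<lambda>x. wgrad \<Omega> \<phi> x - wgrad \<Omega> u x) = nsq MO (\<lambda>x. classical_grad \<phi> x - g x)"
proof (rule nsq_cong_AE)
  show "AE x in MO. wgrad \<Omega> \<phi> x - wgrad \<Omega> u x = classical_grad \<phi> x - g x"
    using wgrad_test(2)[OF \<phi>] wgrad_AE[OF u] by eventually_elim simp
  show "(\<lambda>x. wgrad \<Omega> \<phi> x - wgrad \<Omega> u x) \<in> borel_measurable MO"
    by (intro borel_measurable_diff weak_grad_meas[OF wgrad_weak[OF u]] sq_int_meas[OF wgrad_test(1)[OF \<phi>]])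
  show "(\<lambda>x. classical_grad \<phi> x - g x) \<in> borel_measurable MO"
    by (intro borel_measurable_diff weak_grad_meas[OF u] sq_int_meas[OF cg_sq(1)[OF \<phi>]])
qed

lemma wdist_conv_iff:
  assumes \<phi>: "\<And>n. test_fn \<Omega> (\<phi> n)" and u: "sq_int MO u" "weak_grad \<Omega> u g" "sq_int MO g"
  shows "(\<lambda>n. wdist \<Omega> (\<phi> n) u) \<longlonglongrightarrow> 0 \<longleftrightarrow> approx \<phi> u g"
proof -
  have eq: "wdist \<Omega> (\<phi> n) u = sqrt (nsq MO (\<lambda>x. \<phi> n x - u x) + nsq MO (\<lambda>x. classical_grad (\<phi> n) x - g x))" for n
    unfolding wdist_eq[OF tf_sq(1)[OF \<phi>] u(1) wgrad_test(1)[OF \<phi>] wgrad_sq(1)[OF u(2,3)]] nsq_wgrad_test_diff[OF \<phi> u(2)] ..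
  show ?thesis
  proof
    assume "(\<lambda>n. wdist \<Omega> (\<phi> n) u) \<longlonglongrightarrow> 0"
    from tendsto_power[OF this, of 2]
    have s: "(\<lambda>n. nsq MO (\<lambda>x. \<phi> n x - u x) + nsq MO (\<lambda>x. classical_grad (\<phi> n) x - g x)) \<longlonglongrightarrow> 0" unfolding eq by simp
    have "(\<lambda>n. nsq MO (\<lambda>x. \<phi> n x - u x)) \<longlonglongrightarrow> 0"
      by (rule tendsto_sandwich[OF _ _ tendsto_const s]) auto
    moreover have "(\<lambda>n. nsq MO (\<lambda>x. classical_grad (\<phi> n) x - g x)) \<longlonglongrightarrow> 0"
      by (rule tendsto_sandwich[OF _ _ tendsto_const s]) auto
    ultimately show "approx \<phi> u g" using \<phi> by (simp add: approx_def)
  next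
    assume "approx \<phi> u g"
    then have "(\<lambda>n. nsq MO (\<lambda>x. \<phi> n x - u x) + nsq MO (\<lambda>x. classical_grad (\<phi> n) x - g x)) \<longlonglongrightarrow> 0 + 0"
      unfolding approx_def by (intro tendsto_add) auto
    from tendsto_real_sqrt[OF this] show "(\<lambda>n. wdist \<Omega> (\<phi> n) u) \<longlonglongrightarrow> 0" unfolding eq by simp
  qed
qed

lemma W0_approx: assumes "u \<in> W0 \<Omega>" shows "\<exists>\<phi>. approx \<phi> u (wgrad \<Omega> u)"
proof -
  obtain \<phi> where \<phi>: "\<forall>n. test_fn \<Omega> (\<phi> n)" "(\<lambda>n. wdist \<Omega> (\<phi> n) u) \<longlonglongrightarrow> 0" using assms unfolding W0_def by blast
  then show ?thesis using wdist_conv_iff[of \<phi> u "wgrad \<Omega> u"] W0_props(1-3)[OF assms] by blast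
qed

lemma W0_I:
  assumes "\<And>x. x \<notin> \<Omega> \<Longrightarrow> u x = 0" "u \<in> borel_measurable lebesgue" "sq_int MO u" "weak_grad \<Omega> u g" "sq_int MO g" "approx \<phi> u g"
  shows "u \<in> W0 \<Omega>"
proof -
  have t: "\<And>n. test_fn \<Omega> (\<phi> n)" using assms(6) by (simp add: approx_def)
  have "(\<lambda>n. wdist \<Omega> (\<phi> n) u) \<longlonglongrightarrow> 0" using wdist_conv_iff[of \<phi>, OF t assms(3,4,5)] assms(6) by blast
  moreover have "set_integrable lebesgue \<Omega> (\<lambda>x. (u x)\<^sup>2)" "set_integrable lebesgue \<Omega> (\<lambda>x. (norm (g x))\<^sup>2)"
    unfolding integrable_MO using sq_int_integrable[OF assms(3)] sq_int_integrable[OF assms(5)] by auto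
  ultimately show ?thesis unfolding W0_def using assms(1,2,4) t by blast
qed

lemma test_in_W0: assumes \<phi>: "test_fn \<Omega> \<phi>" shows "\<phi> \<in> W0 \<Omega>"
proof (rule W0_I[where \<phi> = "\<lambda>n. \<phi>", OF test_fn_zero_outside[OF \<phi>] _ tf_sq(1)[OF \<phi>] weak_grad_test[OF \<phi>] cg_sq(1)[OF \<phi>]])
  show "\<phi> \<in> borel_measurable lebesgue"
    by (rule measurable_completion) (use bsupp_meas[OF tf_bs(1)[OF \<phi>]] in simp)
  show "approx (\<lambda>n. \<phi>) \<phi> (classical_grad \<phi>)" using \<phi> by (simp add: approx_def nsq_def)
qed

end

section \<open>The Finsler norm\<close>

locale finsler =
  fixes F :: "R2 \<Rightarrow> real" and a b \<mu> \<Lambda> :: real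
  assumes standing: "standing_F F a b \<mu> \<Lambda>"
begin

lemma F_convex: "convex_on UNIV F" and F_nonneg: "F \<xi> \<ge> 0"
  and F_deriv: "\<xi> \<noteq> 0 \<Longrightarrow> (F has_derivative (\<lambda>h. Fgrad F \<xi> \<bullet> h)) (at \<xi>)"
  and F_hess: "\<xi> \<noteq> 0 \<Longrightarrow> (Fgrad F has_derivative (\<lambda>h. FHess F \<xi> *v h)) (at \<xi>)"
  and F_hom: "F (t *\<^sub>R \<xi>) = \<bar>t\<bar> * F \<xi>"
  and F_pos: "\<xi> \<noteq> 0 \<Longrightarrow> F \<xi> > 0"
  and a_pos: "0 < a" and a_le_b: "a \<le> b"
  and F_lower: "a * norm \<xi> \<le> F \<xi>" and F_upper: "F \<xi> \<le> b * norm \<xi>"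
  and mu_pos: "0 < \<mu>"
  and F_ellip: "norm \<xi> = 1 \<Longrightarrow> V \<bullet> \<xi> = 0 \<Longrightarrow> \<mu>\<^sup>2 * (norm V)\<^sup>2 \<le> V \<bullet> (FHess F \<xi> *v V)"
  using standing unfolding standing_F_def by blast+

lemma b_pos: "0 < b" using a_pos a_le_b by simp

lemma F_zero [simp]: "F 0 = 0" using F_hom[of 0 0] by simp

lemma F_triangle: "F (x + y) \<le> F x + F y"
proof -
  have "F ((1 - 1/2) *\<^sub>R (2 *\<^sub>R x) + (1/2) *\<^sub>R (2 *\<^sub>R y)) \<le> (1 - 1/2) * F (2 *\<^sub>R x) + (1/2) * F (2 *\<^sub>R y)"
    using F_convex by (intro convex_onD) auto
  then show ?thesis by (simp add: F_hom)
qed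

lemma F_lipschitz: "\<bar>F x - F y\<bar> \<le> b * norm (x - y)"
proof -
  have "F x \<le> F (x - y) + F y" using F_triangle[of "x - y" y] by simp
  moreover have "F y \<le> F (y - x) + F x" using F_triangle[of "y - x" x] by simp
  moreover have "F (x - y) \<le> b * norm (x - y)" "F (y - x) \<le> b * norm (x - y)"
    using F_upper[of "x - y"] F_upper[of "y - x"] by (auto simp: norm_minus_commute)
  ultimately show ?thesis by linarith
qed

lemma F_continuous: "continuous_on UNIV F"
proof (rule continuous_on_subset[OF lipschitz_on_continuous_on])
  show "b-lipschitz_on UNIV F"
    using F_lipschitz b_pos by (auto simp: lipschitz_on_def dist_norm)
qed simp

lemma F_sq_lipschitz: "\<bar>(F x)\<^sup>2 - (F y)\<^sup>2\<bar> \<le> b\<^sup>2 * (norm (x - y) * (norm x + norm y))"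
proof -
  have "\<bar>(F x)\<^sup>2 - (F y)\<^sup>2\<bar> = \<bar>F x - F y\<bar> * (F x + F y)"
    using F_nonneg[of x] F_nonneg[of y] by (simp add: power2_eq_square square_diff_square_factored abs_mult mult.commute)
  also have "\<dots> \<le> (b * norm (x - y)) * (b * norm x + b * norm y)"
    using F_lipschitz[of x y] F_upper[of x] F_upper[of y] F_nonneg[of x] F_nonneg[of y] b_pos
    by (intro mult_mono) auto
  finally show ?thesis by (simp add: power2_eq_square algebra_simps)
qed

lemma F_sq_upper: "(F x)\<^sup>2 \<le> b\<^sup>2 * (norm x)\<^sup>2"
  using power_mono[OF F_upper F_nonneg, of x 2] by (simp add: power_mult_distrib)

lemma F_sq_lower: "a\<^sup>2 * (norm x)\<^sup>2 \<le> (F x)\<^sup>2"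
  using power_mono[OF F_lower, of x 2] a_pos by (simp add: power_mult_distrib)

lemma F_line_deriv:
  assumes "p + s *\<^sub>R q \<noteq> 0"
  shows "((\<lambda>s. F (p + s *\<^sub>R q)) has_real_derivative Fgrad F (p + s *\<^sub>R q) \<bullet> q) (at s)"
proof -
  have "((\<lambda>s. p + s *\<^sub>R q) has_derivative (\<lambda>h. h *\<^sub>R q)) (at s)"
    by (auto intro!: derivative_eq_intros)
  from has_derivative_compose[OF this F_deriv[OF assms]]
  have "((\<lambda>s. F (p + s *\<^sub>R q)) has_derivative (\<lambda>h. h * (Fgrad F (p + s *\<^sub>R q) \<bullet> q))) (at s)"
    by simp
  then show ?thesis by (simp add: has_field_derivative_def mult_commute_abs)
qed

text \<open>F is Lipschitz with constant b; its derivative is tested in the direction of the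
  gradient itself.\<close>

lemma Fgrad_bound: assumes "\<xi> \<noteq> 0" shows "norm (Fgrad F \<xi>) \<le> b"
proof -
  define v where "v = Fgrad F \<xi>"
  have "((\<lambda>s. F (\<xi> + s *\<^sub>R v)) has_real_derivative v \<bullet> v) (at 0)"
    using F_line_deriv[of \<xi> 0 v] assms by (simp add: v_def)
  then have "((\<lambda>h. (F (\<xi> + h *\<^sub>R v) - F \<xi>) / h) \<longlongrightarrow> v \<bullet> v) (at 0)"
    by (simp add: DERIV_def)
  moreover have "\<forall>\<^sub>F h in at 0. (F (\<xi> + h *\<^sub>R v) - F \<xi>) / h \<le> b * norm v"
  proof (rule eventually_at_topological[THEN iffD2], intro exI[of _ UNIV] conjI ballI impI)
    fix h :: real assume "h \<noteq> 0"
    have "(F (\<xi> + h *\<^sub>R v) - F \<xi>) / h \<le> \<bar>F (\<xi> + h *\<^sub>R v) - F \<xi>\<bar> / \<bar>h\<bar>"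
      by (metis abs_divide abs_ge_self)
    also have "\<dots> \<le> (b * norm (h *\<^sub>R v)) / \<bar>h\<bar>"
      using F_lipschitz[of "\<xi> + h *\<^sub>R v" \<xi>] by (intro divide_right_mono) auto
    finally show "(F (\<xi> + h *\<^sub>R v) - F \<xi>) / h \<le> b * norm v" using \<open>h \<noteq> 0\<close> by simp
  qed auto
  ultimately have "v \<bullet> v \<le> b * norm v"
    by (intro tendsto_upperbound) auto
  then have "norm v * norm v \<le> b * norm v" by (simp add: power2_norm_eq_inner[symmetric] power2_eq_square)
  then show ?thesis using b_pos unfolding v_def by (metis mult_right_le_imp_le norm_ge_zero order_le_less)
qed

text \<open>The gradient of F^2/2, which is the flux of the equation. At the origin, where
  \<open>Fgrad\<close> is an arbitrary choice, the factor F 0 = 0 gives the correct value.\<close>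

definition P :: "R2 \<Rightarrow> R2" where "P \<xi> = F \<xi> *\<^sub>R Fgrad F \<xi>"

lemma P_zero [simp]: "P 0 = 0" by (simp add: P_def)

lemma P_bound: "norm (P \<xi>) \<le> b\<^sup>2 * norm \<xi>"
proof (cases "\<xi> = 0")
  case False
  have "norm (P \<xi>) = F \<xi> * norm (Fgrad F \<xi>)" using F_nonneg[of \<xi>] by (simp add: P_def)
  also have "\<dots> \<le> (b * norm \<xi>) * b"
    using Fgrad_bound[OF False] F_upper[of \<xi>] F_nonneg[of \<xi>] b_pos by (intro mult_mono) auto
  finally show ?thesis by (simp add: power2_eq_square mult_ac)
qed simp

text \<open>Away from the origin the gradient of F is differentiable, hence continuous; at the
  origin the linear bound on P suffices.\<close>

lemma P_continuous: "continuous_on UNIV P"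
proof -
  have "isCont P \<xi>" for \<xi>
  proof (cases "\<xi> = 0")
    case True
    have "(P \<longlongrightarrow> 0) (at 0)"
    proof (rule Lim_null_comparison)
      show "\<forall>\<^sub>F x in at 0. norm (P x) \<le> b\<^sup>2 * norm x" using P_bound by simp
      show "((\<lambda>x. b\<^sup>2 * norm x) \<longlongrightarrow> 0) (at 0)" by (auto intro!: tendsto_eq_intros)
    qed
    then show ?thesis using True by (simp add: isCont_def)
  next
    case False
    have "isCont (Fgrad F) \<xi>" using F_hess[OF False] has_derivative_continuous by blast
    moreover have "isCont F \<xi>" using F_continuous by (simp add: continuous_on_eq_continuous_at)
    ultimately show ?thesis unfolding P_def[abs_def] by (intro continuous_intros)
  qed
  then show ?thesis by (simp add: continuous_at_imp_continuous_on)
qed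

text \<open>F has a corner at the origin, but on a line that reaches the origin at parameter s the
  function F^2 is the parabola (s' - s)^2 F(q)^2, whose derivative at s is 0.\<close>

lemma half_F_sq_line_deriv:
  "((\<lambda>s. (F (p + s *\<^sub>R q))\<^sup>2 / 2) has_real_derivative P (p + s *\<^sub>R q) \<bullet> q) (at s)"
proof (cases "p + s *\<^sub>R q = 0")
  case False
  show ?thesis
    by (rule derivative_eq_intros F_line_deriv[OF False] refl | simp add: P_def)+
next
  case True
  then have p: "p = - (s *\<^sub>R q)" by (simp add: add_eq_0_iff)
  have "(\<lambda>s'. (F (p + s' *\<^sub>R q))\<^sup>2 / 2) = (\<lambda>s'. (s' - s)\<^sup>2 * (F q)\<^sup>2 / 2)"
  proof
    fix s'
    have "p + s' *\<^sub>R q = (s' - s) *\<^sub>R q" by (simp add: p algebra_simps)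
    then show "(F (p + s' *\<^sub>R q))\<^sup>2 / 2 = (s' - s)\<^sup>2 * (F q)\<^sup>2 / 2"
      by (simp add: F_hom power_mult_distrib)
  qed
  moreover have "((\<lambda>s'. (s' - s)\<^sup>2 * (F q)\<^sup>2 / 2) has_real_derivative 0) (at s)"
    by (auto intro!: derivative_eq_intros)
  ultimately show ?thesis by (simp add: True)
qed

lemma Fgrad_scale: assumes "\<xi> \<noteq> 0" "t > 0" shows "Fgrad F (t *\<^sub>R \<xi>) = Fgrad F \<xi>"
proof -
  have nz: "t *\<^sub>R \<xi> \<noteq> 0" using assms by simp
  have 1: "((\<lambda>x. F (t *\<^sub>R x)) has_derivative (\<lambda>h. Fgrad F (t *\<^sub>R \<xi>) \<bullet> (t *\<^sub>R h))) (at \<xi>)"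
    by (rule has_derivative_compose[where f="\<lambda>x. t *\<^sub>R x" and g=F, OF _ F_deriv[OF nz]])
      (auto intro!: derivative_eq_intros)
  have 2: "((\<lambda>x. F (t *\<^sub>R x)) has_derivative (\<lambda>h. t * (Fgrad F \<xi> \<bullet> h))) (at \<xi>)"
    unfolding F_hom using assms F_deriv[OF assms(1)] by (auto intro!: derivative_eq_intros)
  have "Fgrad F (t *\<^sub>R \<xi>) \<bullet> (t *\<^sub>R h) = t * (Fgrad F \<xi> \<bullet> h)" for h
    using has_derivative_unique[OF 1 2] by meson
  then have "Fgrad F (t *\<^sub>R \<xi>) \<bullet> h = Fgrad F \<xi> \<bullet> h" for h using assms by simp
  then show ?thesis by (metis vector_eq_ldot inner_commute)
qed

lemma Fgrad_euler: assumes "\<xi> \<noteq> 0" shows "\<xi> \<bullet> Fgrad F \<xi> = F \<xi>"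
proof -
  have "((\<lambda>s. F (\<xi> + s *\<^sub>R \<xi>)) has_real_derivative Fgrad F \<xi> \<bullet> \<xi>) (at 0)"
    using F_line_deriv[of \<xi> 0 \<xi>] assms by simp
  moreover have "((\<lambda>s. F (\<xi> + s *\<^sub>R \<xi>)) has_real_derivative F \<xi>) (at 0)"
  proof (rule has_field_derivative_transform_within_open)
    show "((\<lambda>s. (1 + s) * F \<xi>) has_real_derivative F \<xi>) (at 0)" by (auto intro!: derivative_eq_intros)
    show "open {-1::real<..}" by simp
    fix s :: real assume s: "s \<in> {-1<..}"
    have "\<xi> + s *\<^sub>R \<xi> = (1 + s) *\<^sub>R \<xi>" by (simp add: algebra_simps)
    then have "F (\<xi> + s *\<^sub>R \<xi>) = \<bar>1 + s\<bar> * F \<xi>" by (simp only: F_hom)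
    then show "(1 + s) * F \<xi> = F (\<xi> + s *\<^sub>R \<xi>)" using s by simp
  qed simp
  ultimately show ?thesis using DERIV_unique by (metis inner_commute)
qed

lemma FHess_line:
  assumes "z \<noteq> 0"
  shows "((\<lambda>s. Fgrad F (z + s *\<^sub>R h)) has_derivative (\<lambda>s. s *\<^sub>R (FHess F z *v h))) (at 0)"
proof -
  have 1: "((\<lambda>s. z + s *\<^sub>R h) has_derivative (\<lambda>s. s *\<^sub>R h)) (at 0)"
    by (auto intro!: derivative_eq_intros)
  have "(Fgrad F has_derivative (\<lambda>h. FHess F z *v h)) (at (z + 0 *\<^sub>R h))"
    using F_hess[OF assms] by simp
  from has_derivative_compose[OF 1 this] show ?thesis
    by (simp add: matrix_vector_mult_scaleR)
qed

lemma FHess_radial: assumes "z \<noteq> 0" shows "FHess F z *v z = 0"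
proof -
  have 1: "((\<lambda>s. Fgrad F (z + s *\<^sub>R z)) has_derivative (\<lambda>s. s *\<^sub>R (FHess F z *v z))) (at 0)"
    by (rule FHess_line[OF assms])
  have 2: "((\<lambda>s. Fgrad F (z + s *\<^sub>R z)) has_derivative (\<lambda>s. 0)) (at 0)"
  proof (rule has_derivative_transform_within_open)
    show "((\<lambda>s::real. Fgrad F z) has_derivative (\<lambda>s. 0)) (at 0)" by simp
    show "open {-1::real<..}" by simp
    fix s :: real assume s: "s \<in> {-1<..}"
    have "z + s *\<^sub>R z = (1 + s) *\<^sub>R z" by (simp add: algebra_simps)
    then show "Fgrad F z = Fgrad F (z + s *\<^sub>R z)" using Fgrad_scale[OF assms, of "1 + s"] s by simp
  qed simp
  have "1 *\<^sub>R (FHess F z *v z) = 0" using has_derivative_unique[OF 1 2] by meson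
  then show ?thesis by simp
qed

text \<open>Euler's relation is differentiated along h: the two terms containing the gradient
  cancel, and what remains is the row counterpart of \<open>FHess_radial\<close>.\<close>

lemma FHess_radial': assumes "z \<noteq> 0" shows "z \<bullet> (FHess F z *v h) = 0"
proof -
  have 1: "((\<lambda>s. z + s *\<^sub>R h) has_derivative (\<lambda>s. s *\<^sub>R h)) (at 0)"
    by (auto intro!: derivative_eq_intros)
  have D1: "((\<lambda>s. (z + s *\<^sub>R h) \<bullet> Fgrad F (z + s *\<^sub>R h)) has_derivative
      (\<lambda>s. (z + 0 *\<^sub>R h) \<bullet> (s *\<^sub>R (FHess F z *v h)) + (s *\<^sub>R h) \<bullet> Fgrad F (z + 0 *\<^sub>R h))) (at 0)"
    by (rule has_derivative_inner[OF 1 FHess_line[OF assms]])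
  have "((\<lambda>s. F (z + s *\<^sub>R h)) has_real_derivative Fgrad F z \<bullet> h) (at 0)"
    using F_line_deriv[of z 0 h] assms by simp
  then have D2: "((\<lambda>s. F (z + s *\<^sub>R h)) has_derivative (\<lambda>s. (Fgrad F z \<bullet> h) * s)) (at 0)"
    by (simp add: has_field_derivative_def)
  have "isCont (\<lambda>s. z + s *\<^sub>R h) 0" by (intro continuous_intros)
  then have "\<forall>\<^sub>F s in nhds 0. z + s *\<^sub>R h \<noteq> 0"
    using assms unfolding isCont_def eventually_nhds_conv_at
    by (auto dest: tendsto_imp_eventually_ne[of _ z _ 0])
  then obtain S where S: "open S" "0 \<in> S" "\<And>s. s \<in> S \<Longrightarrow> z + s *\<^sub>R h \<noteq> 0"
    unfolding eventually_nhds by blast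
  have D3: "((\<lambda>s. F (z + s *\<^sub>R h)) has_derivative
      (\<lambda>s. (z + 0 *\<^sub>R h) \<bullet> (s *\<^sub>R (FHess F z *v h)) + (s *\<^sub>R h) \<bullet> Fgrad F (z + 0 *\<^sub>R h))) (at 0)"
    by (rule has_derivative_transform_within_open[OF D1 S(1,2)]) (use S(3) Fgrad_euler in auto)
  have "(z + 0 *\<^sub>R h) \<bullet> (1 *\<^sub>R (FHess F z *v h)) + (1 *\<^sub>R h) \<bullet> Fgrad F (z + 0 *\<^sub>R h) = (Fgrad F z \<bullet> h) * 1"
    using has_derivative_unique[OF D3 D2] by meson
  then show ?thesis by (simp add: inner_commute)
qed

text \<open>Equal values at the ends and the centre make F constant on the segment, by convexity.
  The Hessian at z then degenerates along V, so ellipticity removes the part of V orthogonal to z,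
  and homogeneity removes the radial part.\<close>

lemma strict_convex_unit:
  assumes F1: "F (z - V) = F z" "F (z + V) = F z" and z: "norm z = 1"
  shows "V = 0"
proof -
  have z0: "z \<noteq> 0" using z by auto
  define A where "A = F z"
  have A: "A > 0" using F_pos[OF z0] by (simp add: A_def)
  have seg: "F (z + t *\<^sub>R V) \<le> A" if t: "\<bar>t\<bar> \<le> 1" for t
  proof -
    define s where "s = (1 + t) / 2"
    have s: "0 \<le> s" "s \<le> 1" using t by (auto simp: s_def)
    have "F ((1 - s) *\<^sub>R (z - V) + s *\<^sub>R (z + V)) \<le> (1 - s) * F (z - V) + s * F (z + V)"
      using F_convex s by (intro convex_onD) auto
    moreover have "(1 - s) *\<^sub>R (z - V) + s *\<^sub>R (z + V) = z + t *\<^sub>R V"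
    proof -
      have "(1 - s) *\<^sub>R (z - V) + s *\<^sub>R (z + V) = z + (2 * s - 1) *\<^sub>R V"
        by (simp add: vec_eq_iff algebra_simps)
      moreover have "2 * s - 1 = t" by (simp add: s_def field_simps)
      ultimately show ?thesis by simp
    qed
    ultimately show ?thesis using F1 by (simp add: A_def algebra_simps)
  qed
  have const: "F (z + t *\<^sub>R V) = A" if t: "\<bar>t\<bar> \<le> 1" for t
  proof -
    have "F ((1 - 1/2) *\<^sub>R (z + t *\<^sub>R V) + (1/2) *\<^sub>R (z + (-t) *\<^sub>R V)) \<le> (1 - 1/2) * F (z + t *\<^sub>R V) + (1/2) * F (z + (-t) *\<^sub>R V)"
      using F_convex by (intro convex_onD) auto
    moreover have "(1 - 1/2) *\<^sub>R (z + t *\<^sub>R V) + (1/2) *\<^sub>R (z + (-t) *\<^sub>R V) = z"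
      by (simp add: vec_eq_iff algebra_simps)
    ultimately have "A \<le> 1/2 * F (z + t *\<^sub>R V) + 1/2 * F (z + (-t) *\<^sub>R V)" by (simp add: A_def)
    with seg[of t] seg[of "-t"] t show ?thesis by simp
  qed
  have nz: "z + t *\<^sub>R V \<noteq> 0" if "\<bar>t\<bar> \<le> 1" for t using const[OF that] A by force
  have d0: "Fgrad F (z + t *\<^sub>R V) \<bullet> V = 0" if t: "t \<in> {-1<..<1}" for t
  proof -
    have "((\<lambda>s. F (z + s *\<^sub>R V)) has_real_derivative Fgrad F (z + t *\<^sub>R V) \<bullet> V) (at t)"
      using F_line_deriv nz t by auto
    moreover have "((\<lambda>s. F (z + s *\<^sub>R V)) has_real_derivative 0) (at t)"
      by (rule has_field_derivative_transform_within_open[of "\<lambda>_. A" _ _ "{-1<..<1}"]) (use t const in auto)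
    ultimately show ?thesis by (rule DERIV_unique)
  qed
  have D1: "((\<lambda>s. Fgrad F (z + s *\<^sub>R V) \<bullet> V) has_derivative (\<lambda>s. (s *\<^sub>R (FHess F z *v V)) \<bullet> V)) (at 0)"
    by (rule has_derivative_inner_left[OF FHess_line[OF z0]])
  have D2: "((\<lambda>s. Fgrad F (z + s *\<^sub>R V) \<bullet> V) has_derivative (\<lambda>s. 0)) (at 0)"
    by (rule has_derivative_transform_within_open[of "\<lambda>_. 0" _ _ _ "{-1<..<1}"]) (use d0 in auto)
  have "(1 *\<^sub>R (FHess F z *v V)) \<bullet> V = 0" using has_derivative_unique[OF D1 D2] by meson
  then have HV: "V \<bullet> (FHess F z *v V) = 0" by (simp add: inner_commute)
  \<comment> \<open>V is split into a radial part, on which the Hessian form vanishes in either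
    argument, and a tangential part, to which ellipticity applies.\<close>
  define \<alpha> where "\<alpha> = V \<bullet> z"
  define W where "W = V - \<alpha> *\<^sub>R z"
  have V: "V = \<alpha> *\<^sub>R z + W" by (simp add: W_def)
  have zz: "z \<bullet> z = 1" using z by (simp add: norm_eq_1)
  have Wz: "W \<bullet> z = 0" by (simp add: W_def \<alpha>_def inner_diff_left zz)
  have H: "FHess F z *v V = FHess F z *v W"
    unfolding V by (simp add: matrix_vector_right_distrib matrix_vector_mult_scaleR FHess_radial[OF z0])
  have "V \<bullet> (FHess F z *v V) = \<alpha> * (z \<bullet> (FHess F z *v W)) + W \<bullet> (FHess F z *v W)"
    unfolding H by (subst V) (simp add: inner_add_left)
  then have "W \<bullet> (FHess F z *v W) = 0"
    using HV FHess_radial'[OF z0] by simp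
  then have "\<mu>\<^sup>2 * (norm W)\<^sup>2 \<le> 0" using F_ellip[OF z Wz] by simp
  then have "\<mu>\<^sup>2 * (norm W)\<^sup>2 = 0" by (intro order_antisym) auto
  then have "W = 0" using mu_pos by simp
  then have V: "V = \<alpha> *\<^sub>R z" using V by simp
  have "z + V = (1 + \<alpha>) *\<^sub>R z" "z - V = (1 - \<alpha>) *\<^sub>R z" unfolding V by (auto simp: algebra_simps)
  then have "\<bar>1 + \<alpha>\<bar> * A = A" "\<bar>1 - \<alpha>\<bar> * A = A" using F1 F_hom unfolding A_def by metis+
  then have "\<bar>1 + \<alpha>\<bar> = 1" "\<bar>1 - \<alpha>\<bar> = 1" using A by auto
  then have "\<alpha> = 0" by linarith
  then show ?thesis using V by simp
qed

text \<open>The midpoint convexity defect of F^2; its integral is the drop of the quadratic part of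
  the energy at a midpoint.\<close>

definition Psi :: "R2 \<times> R2 \<Rightarrow> real" where
  "Psi = (\<lambda>(x, y). (F x)\<^sup>2 / 2 + (F y)\<^sup>2 / 2 - (F ((1/2) *\<^sub>R (x + y)))\<^sup>2)"

lemma F_midpoint: "F ((1/2) *\<^sub>R (x + y)) \<le> (F x + F y) / 2"
  using F_triangle[of x y] by (simp add: F_hom)

lemma Psi_nonneg: "0 \<le> Psi (x, y)"
proof -
  have "(F ((1/2) *\<^sub>R (x + y)))\<^sup>2 \<le> ((F x + F y) / 2)\<^sup>2"
    using F_midpoint F_nonneg by (intro power_mono) auto
  also have "\<dots> \<le> (F x)\<^sup>2 / 2 + (F y)\<^sup>2 / 2"
    using zero_le_power2[of "F x - F y"] by (simp add: power2_eq_square field_simps)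
  finally show ?thesis by (simp add: Psi_def)
qed

text \<open>A zero defect forces equality in the triangle inequality and between arithmetic and
  quadratic mean, so F has one value at x, y and the midpoint. Rescaling a nonzero midpoint to a
  unit vector leads to \<open>strict_convex_unit\<close>.\<close>

lemma Psi_eq_0: assumes "Psi (x, y) = 0" shows "x = y"
proof -
  define z where "z = (1/2) *\<^sub>R (x + y)"
  define V where "V = (1/2) *\<^sub>R (y - x)"
  have xy: "x = z - V" "y = z + V"
    unfolding z_def V_def by (auto simp: vec_eq_iff field_simps)
  have e: "(F z)\<^sup>2 = (F x)\<^sup>2 / 2 + (F y)\<^sup>2 / 2" using assms by (simp add: Psi_def z_def)
  have le: "(F z)\<^sup>2 \<le> ((F x + F y) / 2)\<^sup>2"
    unfolding z_def using F_midpoint F_nonneg by (intro power_mono) auto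
  have "(F x - F y)\<^sup>2 \<le> 0" using le unfolding e by (simp add: power2_eq_square field_simps)
  then have eq: "F x = F y" by simp
  then have "(F z)\<^sup>2 = (F x)\<^sup>2" using e by simp
  then have eqz: "F z = F x" using F_nonneg by (simp add: power2_eq_iff_nonneg)
  show ?thesis
  proof (cases "z = 0")
    case True
    then have "F x = 0" "F y = 0" using eq eqz by auto
    then have "x = 0" "y = 0" using F_pos by force+
    then show ?thesis by simp
  next
    case False
    define c where "c = inverse (norm z)"
    have c: "c > 0" using False by (simp add: c_def)
    have "c *\<^sub>R V = 0"
    proof (rule strict_convex_unit[of "c *\<^sub>R z"])
      show "norm (c *\<^sub>R z) = 1" using False by (simp add: c_def)
      show "F (c *\<^sub>R z - c *\<^sub>R V) = F (c *\<^sub>R z)"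
        using eqz xy(1) F_hom by (metis scaleR_diff_right)
      show "F (c *\<^sub>R z + c *\<^sub>R V) = F (c *\<^sub>R z)"
        using eqz eq xy(2) F_hom by (metis scaleR_add_right)
    qed
    then show ?thesis using c xy by simp
  qed
qed

lemma Psi_scale: "Psi (t *\<^sub>R x, t *\<^sub>R y) = t\<^sup>2 * Psi (x, y)"
proof -
  have "(1/2) *\<^sub>R (t *\<^sub>R x + t *\<^sub>R y) = t *\<^sub>R ((1/2) *\<^sub>R (x + y))"
    by (simp add: algebra_simps)
  then have "F ((1/2) *\<^sub>R (t *\<^sub>R x + t *\<^sub>R y)) = \<bar>t\<bar> * F ((1/2) *\<^sub>R (x + y))" by (simp only: F_hom)
  then show ?thesis unfolding Psi_def prod.case F_hom[of t]
    by (simp only: power_mult_distrib power2_abs) (simp add: field_simps)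
qed

lemma Psi_continuous: "continuous_on UNIV Psi"
proof -
  have F: "continuous_on UNIV (\<lambda>x. F (f x))" if "continuous_on UNIV f" for f :: "R2 \<times> R2 \<Rightarrow> R2"
    using continuous_on_compose2[OF F_continuous that] by simp
  show ?thesis unfolding Psi_def case_prod_beta by (intro continuous_intros F) auto
qed

text \<open>Both sides are homogeneous of degree 2, so the unit sphere of pairs decides. There the
  pairs with |x - y|^2 \<ge> \<epsilon> form a compact set without zeros of the defect, on which it
  is at least some k > 0.\<close>

lemma Psi_modulus:
  assumes "\<epsilon> > 0"
  shows "\<exists>\<kappa>\<ge>0. \<forall>x y. (norm (x - y))\<^sup>2 \<le> \<epsilon> * ((norm x)\<^sup>2 + (norm y)\<^sup>2) + \<kappa> * Psi (x, y)"
proof -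
  define S where "S = {p :: R2 \<times> R2. norm p = 1 \<and> \<epsilon> \<le> (norm (fst p - snd p))\<^sup>2}"
  have "compact S"
  proof -
    have "closed {p :: R2 \<times> R2. \<epsilon> \<le> (norm (fst p - snd p))\<^sup>2}"
      by (intro closed_Collect_le continuous_intros)
    then have "compact (sphere 0 1 \<inter> {p :: R2 \<times> R2. \<epsilon> \<le> (norm (fst p - snd p))\<^sup>2})"
      by (intro compact_Int_closed) auto
    moreover have "S = sphere 0 1 \<inter> {p :: R2 \<times> R2. \<epsilon> \<le> (norm (fst p - snd p))\<^sup>2}"
      by (auto simp: S_def)
    ultimately show ?thesis by simp
  qed
  have "\<exists>k>0. \<forall>p\<in>S. k \<le> Psi p"
  proof (cases "S = {}")
    case False
    from continuous_attains_inf[OF \<open>compact S\<close> False continuous_on_subset[OF Psi_continuous subset_UNIV]]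
    obtain p where p: "p \<in> S" "\<forall>q\<in>S. Psi p \<le> Psi q" by blast
    obtain x y where xy: "p = (x, y)" by (cases p)
    have "x \<noteq> y" using p(1) assms unfolding S_def xy by auto
    then have "Psi p > 0" using Psi_eq_0[of x y] Psi_nonneg[of x y] unfolding xy by force
    then show ?thesis using p(2) by blast
  qed (auto intro: exI[of _ 1])
  then obtain k where k: "k > 0" "\<And>p. p \<in> S \<Longrightarrow> k \<le> Psi p" by blast
  \<comment> \<open>Outside the trivial case k r^2 \<le> Psi, while |x - y|^2 \<le> 2 r^2 always;
    hence the constant 2/k.\<close>
  have "(norm (x - y))\<^sup>2 \<le> \<epsilon> * ((norm x)\<^sup>2 + (norm y)\<^sup>2) + (2 / k) * Psi (x, y)" for x y
  proof -
    define r where "r = norm (x, y)"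
    have r2: "r\<^sup>2 = (norm x)\<^sup>2 + (norm y)\<^sup>2" by (simp add: r_def norm_Pair)
    show ?thesis
    proof (cases "(norm (x - y))\<^sup>2 \<le> \<epsilon> * r\<^sup>2")
      case True
      then show ?thesis using Psi_nonneg[of x y] k by (simp add: r2 add_increasing2)
    next
      case False
      then have "r \<noteq> 0" using r2 assms by auto
      then have r: "r > 0" by (simp add: r_def)
      have d: "inverse r *\<^sub>R x - inverse r *\<^sub>R y = inverse r *\<^sub>R (x - y)" by (simp add: algebra_simps)
      have "(inverse r *\<^sub>R x, inverse r *\<^sub>R y) \<in> S"
      proof -
        have "norm (inverse r *\<^sub>R (x, y)) = 1" using r unfolding norm_scaleR r_def[symmetric] by simp
        moreover have "\<epsilon> \<le> (norm (inverse r *\<^sub>R (x - y)))\<^sup>2"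
          unfolding norm_scaleR power_mult_distrib using False r
          by (simp add: power_inverse divide_inverse[symmetric] field_simps)
        ultimately show ?thesis by (simp add: S_def d)
      qed
      from k(2)[OF this] have "k \<le> (inverse r)\<^sup>2 * Psi (x, y)" unfolding Psi_scale .
      then have "k * r\<^sup>2 \<le> Psi (x, y)" using r by (simp add: power_inverse field_simps)
      moreover have "(norm (x - y))\<^sup>2 \<le> 2 * r\<^sup>2"
      proof -
        have "(norm (x - y))\<^sup>2 \<le> (norm x + norm y)\<^sup>2"
          by (intro power_mono norm_triangle_ineq4) simp
        then show ?thesis using sum_squares_bound[of "norm x" "norm y"] by (simp add: r2 power2_sum)
      qed
      ultimately have "k * (norm (x - y))\<^sup>2 \<le> 2 * Psi (x, y)"
        using mult_left_mono[of "(norm (x - y))\<^sup>2" "2 * r\<^sup>2" k] k(1) by linarith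
      then have "(norm (x - y))\<^sup>2 \<le> (2 / k) * Psi (x, y)" using k(1)
        by (simp add: field_simps)
      moreover have "0 \<le> \<epsilon> * ((norm x)\<^sup>2 + (norm y)\<^sup>2)" using assms by simp
      ultimately show ?thesis by linarith
    qed
  qed
  then show ?thesis using k(1) by (intro exI[of _ "2 / k"]) auto
qed

end

section \<open>Shape of functions on a ray and differentiation under the integral\<close>

lemma convex_concave_shape:
  fixes h h' h'' :: "real \<Rightarrow> real"
  assumes d1: "\<And>t. (h has_real_derivative h' t) (at t)"
    and d2: "\<And>t. (h' has_real_derivative h'' t) (at t)"
    and conc: "\<And>\<theta> t. 0 \<le> \<theta> \<Longrightarrow> \<theta> \<le> 1 \<Longrightarrow> 0 \<le> t \<Longrightarrow> (1 - \<theta>) * h'' 0 + \<theta> * h'' t \<le> h'' (\<theta> * t)"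
    and pos: "h'' 0 > 0"
    and s: "0 < s1" "s1 < s2" "s2 < s3" and v: "h 0 < h s1" "h s2 \<le> h s1"
  shows "h s3 < h s2"
proof (rule ccontr)
  assume "\<not> h s3 < h s2"
  then have v3: "h s2 \<le> h s3" by simp
  obtain p where p: "0 < p" "p < s1" "h s1 - h 0 = (s1 - 0) * h' p"
    using MVT2[OF s(1) d1] by blast
  obtain q where q: "s1 < q" "q < s2" "h s2 - h s1 = (s2 - s1) * h' q"
    using MVT2[OF s(2) d1] by blast
  obtain r where r: "s2 < r" "r < s3" "h s3 - h s2 = (s3 - s2) * h' r"
    using MVT2[OF s(3) d1] by blast
  \<comment> \<open>If h failed to drop on the third interval, the three mean slopes would be
    positive, nonpositive and nonnegative, so h'' would be negative at some p' and nonnegative at a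
    later r'.\<close>
  have hp: "h' p > 0" using p s v by (smt (verit) zero_less_mult_pos)
  have hq: "h' q \<le> 0" using q s v by (smt (verit) mult_pos_pos)
  have hr: "h' r \<ge> 0" using r s v3 by (smt (verit) mult_pos_neg)
  have pq: "p < q" "q < r" using p q r by auto
  obtain p' where p': "p < p'" "p' < q" "h' q - h' p = (q - p) * h'' p'"
    using MVT2[OF pq(1) d2] by blast
  obtain r' where r': "q < r'" "r' < r" "h' r - h' q = (r - q) * h'' r'"
    using MVT2[OF pq(2) d2] by blast
  have hp': "h'' p' < 0" using p' hp hq by (smt (verit) mult_nonneg_nonneg)
  have hr': "h'' r' \<ge> 0" using r' hq hr pq by (smt (verit) mult_pos_neg)
  \<comment> \<open>p' lies between 0 and r'; since h'' is positive at 0 and nonnegative at r',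
    concavity seen from the origin makes it positive at p'.\<close>
  define \<theta> where "\<theta> = p' / r'"
  have \<theta>: "0 \<le> \<theta>" "\<theta> < 1" "\<theta> * r' = p'" using p p' r' by (auto simp: \<theta>_def)
  have "(1 - \<theta>) * h'' 0 + \<theta> * h'' r' \<le> h'' p'"
    using conc[of \<theta> r'] \<theta> p p' r' by auto
  moreover have "(1 - \<theta>) * h'' 0 > 0" "\<theta> * h'' r' \<ge> 0" using \<theta> pos hr' by auto
  ultimately show False using hp' by linarith
qed

text \<open>By the mean value theorem the difference quotients are bounded by the dominating
  function, so dominated convergence applies along every sequence tending to 0.\<close>

lemma DERIV_integral_dominated:
  fixes f f' :: "real \<Rightarrow> 'a \<Rightarrow> real"
  assumes d: "d > 0"
    and der: "\<And>t x. \<bar>t - t0\<bar> < d \<Longrightarrow> ((\<lambda>t. f t x) has_real_derivative f' t x) (at t)"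
    and int: "\<And>t. \<bar>t - t0\<bar> < d \<Longrightarrow> integrable M (f t)"
    and m: "f' t0 \<in> borel_measurable M" and w: "integrable M w"
    and b: "\<And>t x. \<bar>t - t0\<bar> < d \<Longrightarrow> \<bar>f' t x\<bar> \<le> w x"
  shows "((\<lambda>t. \<integral>x. f t x \<partial>M) has_real_derivative (\<integral>x. f' t0 x \<partial>M)) (at t0)"
  unfolding DERIV_def tendsto_at_iff_sequentially
proof (intro allI impI)
  fix X :: "nat \<Rightarrow> real" assume X: "\<forall>i. X i \<in> UNIV - {0}" "X \<longlonglongrightarrow> 0"
  obtain N where N: "\<And>n. n \<ge> N \<Longrightarrow> \<bar>X n\<bar> < d"
    using LIMSEQ_D[OF X(2) d] by auto
  \<comment> \<open>The domination holds within distance d, so the finitely many larger terms are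
    shifted away.\<close>
  define Y where "Y n = X (n + N)" for n
  have Y: "Y n \<noteq> 0" "\<bar>Y n\<bar> < d" for n using X(1) N by (auto simp: Y_def)
  have Yl: "Y \<longlonglongrightarrow> 0" unfolding Y_def[abs_def] using X(2) by (rule LIMSEQ_ignore_initial_segment)
  have int0: "integrable M (f t0)" using int[of t0] d by simp
  have intY: "integrable M (f (t0 + Y n))" for n using int[of "t0 + Y n"] Y by simp
  have "(\<lambda>n. \<integral>x. (f (t0 + Y n) x - f t0 x) / Y n \<partial>M) \<longlonglongrightarrow> (\<integral>x. f' t0 x \<partial>M)"
  proof (rule integral_dominated_convergence[OF m _ w])
    show "(\<lambda>x. (f (t0 + Y n) x - f t0 x) / Y n) \<in> borel_measurable M" for n
      using intY int0 by measurable
    show "AE x in M. (\<lambda>n. (f (t0 + Y n) x - f t0 x) / Y n) \<longlonglongrightarrow> f' t0 x"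
    proof (rule AE_I2)
      fix x
      have "((\<lambda>h. (f (t0 + h) x - f t0 x) / h) \<longlongrightarrow> f' t0 x) (at 0)"
        using der[of t0 x] d by (simp add: DERIV_def)
      then show "(\<lambda>n. (f (t0 + Y n) x - f t0 x) / Y n) \<longlonglongrightarrow> f' t0 x"
        using Y Yl unfolding tendsto_at_iff_sequentially by (auto simp: o_def)
    qed
    show "AE x in M. norm ((f (t0 + Y n) x - f t0 x) / Y n) \<le> w x" for n
    proof (rule AE_I2)
      fix x
      have w0: "\<exists>z. \<bar>z - t0\<bar> < d \<and> f (t0 + Y n) x - f t0 x = Y n * f' z x"
      proof (cases "Y n > 0")
        case True
        then have "t0 < t0 + Y n" by simp
        from MVT2[OF this, of "\<lambda>t. f t x" "\<lambda>t. f' t x"] der Y[of n]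
        obtain z where "t0 < z" "z < t0 + Y n" "f (t0 + Y n) x - f t0 x = (t0 + Y n - t0) * f' z x"
          by force
        then show ?thesis using Y[of n] by (intro exI[of _ z]) auto
      next
        case False
        then have "t0 + Y n < t0" using Y[of n] by simp
        from MVT2[OF this, of "\<lambda>t. f t x" "\<lambda>t. f' t x"] der Y[of n]
        obtain z where "t0 + Y n < z" "z < t0" "f t0 x - f (t0 + Y n) x = (t0 - (t0 + Y n)) * f' z x"
          by force
        then show ?thesis using Y[of n] by (intro exI[of _ z]) (auto simp: algebra_simps)
      qed
      then show "norm ((f (t0 + Y n) x - f t0 x) / Y n) \<le> w x"
        using Y[of n] b by (auto simp: abs_mult)
    qed
  qed
  moreover have "(\<integral>x. (f (t0 + Y n) x - f t0 x) / Y n \<partial>M) = ((\<integral>x. f (t0 + Y n) x \<partial>M) - (\<integral>x. f t0 x \<partial>M)) / Y n" for n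
    using Bochner_Integration.integral_diff[OF intY int0] by simp
  ultimately have "(\<lambda>n. ((\<integral>x. f (t0 + X (n + N)) x \<partial>M) - (\<integral>x. f t0 x \<partial>M)) / X (n + N)) \<longlonglongrightarrow> (\<integral>x. f' t0 x \<partial>M)"
    by (simp only: Y_def)
  then have "(\<lambda>n. ((\<integral>x. f (t0 + X n) x \<partial>M) - (\<integral>x. f t0 x \<partial>M)) / X n) \<longlonglongrightarrow> (\<integral>x. f' t0 x \<partial>M)"
    by (rule LIMSEQ_offset)
  then show "((\<lambda>h. ((\<integral>x. f (t0 + h) x \<partial>M) - (\<integral>x. f t0 x \<partial>M)) / h) \<circ> X) \<longlonglongrightarrow> (\<integral>x. f' t0 x \<partial>M)"
    by (simp add: o_def)
qed

lemma abs_le_exp_abs: "\<bar>x::real\<bar> \<le> exp \<bar>x\<bar>"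
  using exp_ge_add_one_self[of "\<bar>x\<bar>"] by linarith

lemma exp_ge_power: "0 \<le> (x::real) \<Longrightarrow> x ^ n / fact n \<le> exp x"
proof -
  assume x: "0 \<le> x"
  have "(\<Sum>k\<in>{n}. x ^ k /\<^sub>R fact k) \<le> (\<Sum>k. x ^ k /\<^sub>R fact k)"
    using x by (intro sum_le_suminf summable_exp_generic) (auto simp: scaleR_conv_of_real)
  then show ?thesis by (simp add: exp_def divide_inverse mult.commute)
qed

text \<open>The tangent inequality for exp, used at both points.\<close>

lemma exp_diff_le: "\<bar>exp (x::real) - exp y\<bar> \<le> \<bar>x - y\<bar> * (exp x + exp y)"
proof -
  have *: "exp x - exp y \<le> (x - y) * exp x" for x y :: real
  proof -
    have "exp x * (1 + (y - x)) \<le> exp x * exp (y - x)"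
      by (intro mult_left_mono exp_ge_add_one_self) auto
    then show ?thesis by (simp add: exp_diff algebra_simps)
  qed
  have abs: "(x - y) * exp x \<le> \<bar>x - y\<bar> * (exp x + exp y)" for x y :: real
    by (intro mult_mono) auto
  have "exp x - exp y \<le> \<bar>x - y\<bar> * (exp x + exp y)"
    using *[of x y] abs[of x y] by linarith
  moreover have "exp y - exp x \<le> \<bar>x - y\<bar> * (exp x + exp y)"
    using *[of y x] abs[of y x] by (simp add: abs_minus_commute add.commute)
  ultimately show ?thesis by linarith
qed

section \<open>The variational argument\<close>

lemma abs_integral_le:
  fixes f g :: "'a \<Rightarrow> real"
  assumes "integrable M f" "integrable M g" "\<And>x. \<bar>f x\<bar> \<le> g x"
  shows "\<bar>\<integral>x. f x \<partial>M\<bar> \<le> (\<integral>x. g x \<partial>M)"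
proof -
  have "\<bar>\<integral>x. f x \<partial>M\<bar> \<le> (\<integral>x. \<bar>f x\<bar> \<partial>M)" using integral_norm_bound[of M f] by simp
  also have "\<dots> \<le> (\<integral>x. g x \<partial>M)" using assms by (intro integral_mono) auto
  finally show ?thesis .
qed

text \<open>The variational part sees the function space through these properties alone. Linearity
  of \<open>G\<close> holds almost everywhere because the weak gradient is a choice;
  \<open>trudinger\<close> is uniform on gradient balls and allows exponents p of both signs, hence
  controls exp of the absolute value; \<open>nontrivial\<close> provides a direction in which the
  exponential term eventually wins.\<close>

locale sobolev_model = finite_measure M for M :: "'a measure" +
  fixes W :: "('a \<Rightarrow> real) set" and G :: "('a \<Rightarrow> real) \<Rightarrow> 'a \<Rightarrow> R2"
  assumes W_sq: "u \<in> W \<Longrightarrow> sq_int M u" and G_sq: "u \<in> W \<Longrightarrow> sq_int M (G u)"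
    and W_lin: "u \<in> W \<Longrightarrow> v \<in> W \<Longrightarrow> (\<lambda>x. s * u x + t * v x) \<in> W"
    and G_lin: "u \<in> W \<Longrightarrow> v \<in> W \<Longrightarrow> AE x in M. G (\<lambda>x. s * u x + t * v x) x = s *\<^sub>R G u x + t *\<^sub>R G v x"
    and W_complete: "(\<And>n. U n \<in> W) \<Longrightarrow>
      (\<And>e. e > 0 \<Longrightarrow> \<exists>N. \<forall>m\<ge>N. \<forall>n\<ge>N. nsq M (\<lambda>x. U m x - U n x) < e \<and> nsq M (\<lambda>x. G (U m) x - G (U n) x) < e) \<Longrightarrow>
      \<exists>u\<in>W. (\<lambda>n. nsq M (\<lambda>x. U n x - u x)) \<longlonglongrightarrow> 0 \<and> (\<lambda>n. nsq M (\<lambda>x. G (U n) x - G u x)) \<longlonglongrightarrow> 0"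
    and poincare: "\<exists>C>0. \<forall>u\<in>W. nsq M u \<le> C * nsq M (G u)"
    and trudinger: "\<exists>C. \<forall>u\<in>W. nsq M (G u) \<le> B \<longrightarrow>
      integrable M (\<lambda>x. exp (p * u x)) \<and> (\<integral>x. exp (p * u x) \<partial>M) \<le> C"
    and rellich: "(\<And>n. U n \<in> W) \<Longrightarrow> (\<And>n. nsq M (G (U n)) \<le> B) \<Longrightarrow>
      \<exists>r::nat \<Rightarrow> nat. strict_mono r \<and> (\<forall>e>0. \<exists>N. \<forall>m\<ge>N. \<forall>n\<ge>N. nsq M (\<lambda>x. U (r m) x - U (r n) x) < e)"
    and nontrivial: "\<exists>u\<in>W. \<not> (AE x in M. u x \<le> 0)"
begin

definition D :: "('a \<Rightarrow> real) \<Rightarrow> real" where "D u = nsq M (G u)"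

definition W_conv :: "(nat \<Rightarrow> 'a \<Rightarrow> real) \<Rightarrow> ('a \<Rightarrow> real) \<Rightarrow> bool" where
  "W_conv U u \<longleftrightarrow> (\<lambda>n. nsq M (\<lambda>x. U n x - u x)) \<longlonglongrightarrow> 0 \<and> (\<lambda>n. nsq M (\<lambda>x. G (U n) x - G u x)) \<longlonglongrightarrow> 0"

text \<open>Continuity by sequences, the form in which the convergence of the energy is
  available.\<close>

definition is_path :: "(real \<Rightarrow> 'a \<Rightarrow> real) \<Rightarrow> bool" where
  "is_path \<gamma> \<longleftrightarrow> (\<forall>t\<in>{0..1}. \<gamma> t \<in> W) \<and>
     (\<forall>t\<in>{0..1}. \<forall>X. (\<forall>n. X n \<in> {0..1}) \<longrightarrow> X \<longlonglongrightarrow> t \<longrightarrow> W_conv (\<lambda>n. \<gamma> (X n)) (\<gamma> t))"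

lemma D_nonneg [simp]: "0 \<le> D u" by (simp add: D_def)

lemma W_meas: "u \<in> W \<Longrightarrow> u \<in> borel_measurable M" using W_sq by (simp add: sq_int_def)
lemma G_meas: "u \<in> W \<Longrightarrow> G u \<in> borel_measurable M" using G_sq by (simp add: sq_int_def)

lemma W_scale: "u \<in> W \<Longrightarrow> (\<lambda>x. t * u x) \<in> W"
  using W_lin[of u u t 0] by simp

lemma W_zero: "(\<lambda>x. 0) \<in> W"
proof -
  obtain u where "u \<in> W" using nontrivial by blast
  from W_scale[OF this, of 0] show ?thesis by simp
qed

lemma G_scale: "u \<in> W \<Longrightarrow> AE x in M. G (\<lambda>x. t * u x) x = t *\<^sub>R G u x"
  using G_lin[of u u t 0] by simp

lemma nsq_G_lin:
  assumes "u \<in> W" "v \<in> W"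
  shows "nsq M (G (\<lambda>x. s * u x + t * v x)) = nsq M (\<lambda>x. s *\<^sub>R G u x + t *\<^sub>R G v x)"
proof (rule nsq_cong_AE[OF G_lin[OF assms] G_meas[OF W_lin[OF assms]]])
  note [measurable] = G_meas[OF assms(1)] G_meas[OF assms(2)]
  show "(\<lambda>x. s *\<^sub>R G u x + t *\<^sub>R G v x) \<in> borel_measurable M" by measurable
qed

lemma D_scale: "u \<in> W \<Longrightarrow> D (\<lambda>x. t * u x) = t\<^sup>2 * D u"
  using nsq_G_lin[of u u t 0] by (simp add: D_def nsq_scaleR)

lemma exp_int: "u \<in> W \<Longrightarrow> integrable M (\<lambda>x. exp (p * u x))"
  using trudinger[of "nsq M (G u)" p] by force

lemma exp_abs_int:
  assumes "u \<in> W" shows "integrable M (\<lambda>x. exp (c * \<bar>u x\<bar>))"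
proof (rule Bochner_Integration.integrable_bound)
  note [measurable] = W_meas[OF assms]
  show "integrable M (\<lambda>x. exp (c * u x) + exp ((-c) * u x))"
    by (intro Bochner_Integration.integrable_add exp_int assms)
  show "AE x in M. norm (exp (c * \<bar>u x\<bar>)) \<le> norm (exp (c * u x) + exp ((-c) * u x))"
  proof (rule AE_I2)
    fix x
    have "exp (c * \<bar>u x\<bar>) \<le> exp (c * u x) + exp ((-c) * u x)"
      by (cases "u x < 0") (auto simp: abs_if)
    then show "norm (exp (c * \<bar>u x\<bar>)) \<le> norm (exp (c * u x) + exp ((-c) * u x))" by simp
  qed
  show "(\<lambda>x. exp (c * \<bar>u x\<bar>)) \<in> borel_measurable M" by measurable
qed

lemma exp_abs_int2:
  assumes "u \<in> W" "v \<in> W" shows "integrable M (\<lambda>x. exp (c * \<bar>u x\<bar> + d * \<bar>v x\<bar>))"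
proof (rule Bochner_Integration.integrable_bound)
  note [measurable] = W_meas[OF assms(1)] W_meas[OF assms(2)]
  show "integrable M (\<lambda>x. exp (2 * c * \<bar>u x\<bar>) + exp (2 * d * \<bar>v x\<bar>))"
    by (intro Bochner_Integration.integrable_add exp_abs_int assms)
  show "AE x in M. norm (exp (c * \<bar>u x\<bar> + d * \<bar>v x\<bar>)) \<le> norm (exp (2 * c * \<bar>u x\<bar>) + exp (2 * d * \<bar>v x\<bar>))"
  proof (rule AE_I2)
    fix x
    have "c * \<bar>u x\<bar> + d * \<bar>v x\<bar> \<le> max (2 * c * \<bar>u x\<bar>) (2 * d * \<bar>v x\<bar>)" by (auto simp: max_def)
    then have "exp (c * \<bar>u x\<bar> + d * \<bar>v x\<bar>) \<le> exp (max (2 * c * \<bar>u x\<bar>) (2 * d * \<bar>v x\<bar>))" by simp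
    also have "\<dots> \<le> exp (2 * c * \<bar>u x\<bar>) + exp (2 * d * \<bar>v x\<bar>)" by (auto simp: max_def)
    finally show "norm (exp (c * \<bar>u x\<bar> + d * \<bar>v x\<bar>)) \<le> norm (exp (2 * c * \<bar>u x\<bar>) + exp (2 * d * \<bar>v x\<bar>))" by simp
  qed
  show "(\<lambda>x. exp (c * \<bar>u x\<bar> + d * \<bar>v x\<bar>)) \<in> borel_measurable M" by measurable
qed

text \<open>Uniform in t because exp (t z) \<le> 1 + exp (K z) for either sign of z. The difference
  of exponentials is handled by Cauchy-Schwarz, the exponential factor being bounded on the gradient
  ball.\<close>

lemma exp_integral_lipschitz:
  assumes "K \<ge> 0"
  shows "\<exists>C\<ge>0. \<forall>u\<in>W. \<forall>v\<in>W. \<forall>t. D u \<le> B \<longrightarrow> D v \<le> B \<longrightarrow> 0 \<le> t \<longrightarrow> t \<le> K \<longrightarrow>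
    \<bar>(\<integral>x. exp (t * u x) \<partial>M) - (\<integral>x. exp (t * v x) \<partial>M)\<bar> \<le> C * sqrt (nsq M (\<lambda>x. u x - v x))"
proof -
  obtain C2 where C2: "\<And>u. u \<in> W \<Longrightarrow> D u \<le> B \<Longrightarrow> (\<integral>x. exp (2 * K * u x) \<partial>M) \<le> C2"
    using trudinger[of B "2 * K"] unfolding D_def by blast
  define mm where "mm = measure M (space M)"
  \<comment> \<open>The numbers come from (p + q + r)^2 \<le> 3 p^2 + 3 q^2 + 3 r^2 with p = 2 and
    two exponentials bounded by \<open>C2\<close>.\<close>
  define C where "C = K * sqrt (\<bar>12 * mm + 6 * C2\<bar>)"
  have "\<bar>(\<integral>x. exp (t * u x) \<partial>M) - (\<integral>x. exp (t * v x) \<partial>M)\<bar> \<le> C * sqrt (nsq M (\<lambda>x. u x - v x))"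
    if u: "u \<in> W" and v: "v \<in> W" and b: "D u \<le> B" "D v \<le> B" and t: "0 \<le> t" "t \<le> K" for u v t
  proof -
    note [measurable] = W_meas[OF u] W_meas[OF v]
    define f where "f x = 2 + exp (K * u x) + exp (K * v x)" for x
    have fm[measurable]: "f \<in> borel_measurable M" unfolding f_def[abs_def] by measurable
    have f_le: "(norm (f x))\<^sup>2 \<le> 12 + 3 * exp (2 * K * u x) + 3 * exp (2 * K * v x)" for x
    proof -
      have "(p + q + r)\<^sup>2 \<le> 3 * p\<^sup>2 + 3 * q\<^sup>2 + 3 * r\<^sup>2" for p q r :: real
        using sum_squares_bound[of p q] sum_squares_bound[of p r] sum_squares_bound[of q r]
        by (simp add: power2_eq_square algebra_simps)
      from this[of 2 "exp (K * u x)" "exp (K * v x)"] show ?thesis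
        by (simp add: f_def exp_double[symmetric] mult.assoc)
    qed
    have int: "integrable M (\<lambda>x. 12 + 3 * exp (2 * K * u x) + 3 * exp (2 * K * v x))"
      using exp_int[OF u] exp_int[OF v] by (intro Bochner_Integration.integrable_add integrable_mult_right) auto
    have fsq: "sq_int M f" unfolding sq_int_def
    proof
      show "integrable M (\<lambda>x. (norm (f x))\<^sup>2)"
        by (rule Bochner_Integration.integrable_bound[OF int]) (use f_le in \<open>auto intro!: AE_I2 order_trans[OF f_le]\<close>)
    qed (rule fm)
    have fn: "nsq M f \<le> \<bar>12 * mm + 6 * C2\<bar>"
    proof -
      have "nsq M f \<le> (\<integral>x. 12 + 3 * exp (2 * K * u x) + 3 * exp (2 * K * v x) \<partial>M)"
        unfolding nsq_def using fsq int f_le by (intro integral_mono) (auto simp: sq_int_def)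
      also have "\<dots> = 12 * mm + 3 * (\<integral>x. exp (2 * K * u x) \<partial>M) + 3 * (\<integral>x. exp (2 * K * v x) \<partial>M)"
        using exp_int[OF u] exp_int[OF v] by (simp add: mm_def)
      finally show ?thesis using C2[OF u b(1)] C2[OF v b(2)] by linarith
    qed
    have d: "sq_int M (\<lambda>x. u x - v x)" by (intro sq_int_diff W_sq u v)
    have e1: "exp (t * z) \<le> 1 + exp (K * z)" for z
    proof (cases "z \<ge> 0")
      case True
      then have "exp (t * z) \<le> exp (K * z)" using t by (simp add: mult_right_mono)
      then show ?thesis by linarith
    next
      case False
      then have "t * z \<le> 0" using t by (simp add: mult_nonneg_nonpos)
      then show ?thesis by (simp add: add_increasing2)
    qed
    have pt: "\<bar>exp (t * u x) - exp (t * v x)\<bar> \<le> K * (norm (u x - v x) * norm (f x))" for x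
    proof -
      have "\<bar>exp (t * u x) - exp (t * v x)\<bar> \<le> \<bar>t * u x - t * v x\<bar> * (exp (t * u x) + exp (t * v x))"
        by (rule exp_diff_le)
      also have "\<dots> = t * \<bar>u x - v x\<bar> * (exp (t * u x) + exp (t * v x))"
        using t by (simp add: abs_mult flip: right_diff_distrib)
      also have "\<dots> \<le> K * \<bar>u x - v x\<bar> * f x"
        using e1[of "u x"] e1[of "v x"] t unfolding f_def by (intro mult_mono) auto
      also have "\<dots> = K * (norm (u x - v x) * norm (f x))"
        by (simp add: f_def mult.assoc add_pos_pos)
      finally show ?thesis .
    qed
    have "\<bar>(\<integral>x. exp (t * u x) \<partial>M) - (\<integral>x. exp (t * v x) \<partial>M)\<bar> = \<bar>\<integral>x. exp (t * u x) - exp (t * v x) \<partial>M\<bar>"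
      using exp_int[OF u] exp_int[OF v] by simp
    also have "\<dots> \<le> (\<integral>x. K * (norm (u x - v x) * norm (f x)) \<partial>M)"
      by (intro abs_integral_le Bochner_Integration.integrable_diff exp_int u v
          integrable_mult_right sq_int_mult_integrable d fsq pt)
    also have "\<dots> = K * (\<integral>x. norm (u x - v x) * norm (f x) \<partial>M)" by simp
    also have "\<dots> \<le> K * (sqrt (nsq M (\<lambda>x. u x - v x)) * sqrt (nsq M f))"
      using assms by (intro mult_left_mono Cauchy_Schwarz_integral d fsq) auto
    also have "\<dots> \<le> K * (sqrt (nsq M (\<lambda>x. u x - v x)) * sqrt (\<bar>12 * mm + 6 * C2\<bar>))"
      using assms fn by (intro mult_left_mono) auto
    finally show ?thesis by (simp add: C_def mult_ac)
  qed
  moreover have "C \<ge> 0" using assms by (simp add: C_def)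
  ultimately show ?thesis by blast
qed

lemma D_W_conv:
  assumes "\<And>n. U n \<in> W" "u \<in> W" "W_conv U u" shows "(\<lambda>n. D (U n)) \<longlonglongrightarrow> D u"
  unfolding D_def
proof (rule nsq_tendsto)
  show "(\<lambda>n. nsq M (\<lambda>x. G (U n) x - G u x)) \<longlonglongrightarrow> 0" using assms(3) by (simp add: W_conv_def)
qed (rule G_sq[OF assms(1)], rule G_sq[OF assms(2)])

lemma exp_integral_W_conv:
  assumes U: "\<And>n. U n \<in> W" "u \<in> W" "W_conv U u"
  shows "(\<lambda>n. \<integral>x. exp (U n x) \<partial>M) \<longlonglongrightarrow> (\<integral>x. exp (u x) \<partial>M)"
proof -
  have "Bseq (\<lambda>n. D (U n))" using D_W_conv[OF assms] convergentI convergent_imp_Bseq by blast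
  then obtain B0 where B0: "\<And>n. norm (D (U n)) \<le> B0" by (auto simp: Bseq_def)
  define B where "B = max B0 (D u)"
  obtain C where C0: "\<forall>u\<in>W. \<forall>v\<in>W. \<forall>t. D u \<le> B \<longrightarrow> D v \<le> B \<longrightarrow> 0 \<le> t \<longrightarrow> t \<le> 1 \<longrightarrow>
    \<bar>(\<integral>x. exp (t * u x) \<partial>M) - (\<integral>x. exp (t * v x) \<partial>M)\<bar> \<le> C * sqrt (nsq M (\<lambda>x. u x - v x))"
    using exp_integral_lipschitz[OF zero_le_one, of B] by blast
  have C: "\<bar>(\<integral>x. exp (1 * u x) \<partial>M) - (\<integral>x. exp (1 * v x) \<partial>M)\<bar> \<le> C * sqrt (nsq M (\<lambda>x. u x - v x))"
    if "u \<in> W" "v \<in> W" "D u \<le> B" "D v \<le> B" for u v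
    using C0[rule_format, OF that zero_le_one order_refl] .
  have b: "D (U n) \<le> B" "D u \<le> B" for n using B0[of n] by (auto simp: B_def)
  have "(\<lambda>n. (\<integral>x. exp (U n x) \<partial>M) - (\<integral>x. exp (u x) \<partial>M)) \<longlonglongrightarrow> 0"
  proof (rule Lim_null_comparison)
    show "\<forall>\<^sub>F n in sequentially. norm ((\<integral>x. exp (U n x) \<partial>M) - (\<integral>x. exp (u x) \<partial>M)) \<le> C * sqrt (nsq M (\<lambda>x. U n x - u x))"
      using C[OF U(1) U(2) b(1) b(2)] by simp
    have "(\<lambda>n. sqrt (nsq M (\<lambda>x. U n x - u x))) \<longlonglongrightarrow> 0"
      using tendsto_real_sqrt[of "\<lambda>n. nsq M (\<lambda>x. U n x - u x)" 0] U(3) by (simp add: W_conv_def)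
    from tendsto_mult_right_zero[OF this, of C]
    show "(\<lambda>n. C * sqrt (nsq M (\<lambda>x. U n x - u x))) \<longlonglongrightarrow> 0" .
  qed
  then show ?thesis by (simp add: LIM_zero_iff)
qed

lemma W_conv_scale:
  assumes "\<And>n. U n \<in> W" "u \<in> W" "W_conv U u"
  shows "W_conv (\<lambda>n x. t * U n x) (\<lambda>x. t * u x)"
proof -
  have 1: "nsq M (\<lambda>x. t * U n x - t * u x) = t\<^sup>2 * nsq M (\<lambda>x. U n x - u x)" for n
    using nsq_scaleR[of M t "\<lambda>x. U n x - u x"] by (simp add: algebra_simps)
  have 2: "nsq M (\<lambda>x. G (\<lambda>x. t * U n x) x - G (\<lambda>x. t * u x) x) = t\<^sup>2 * nsq M (\<lambda>x. G (U n) x - G u x)" for n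
  proof -
    note [measurable] = G_meas[OF assms(1)] G_meas[OF assms(2)] G_meas[OF W_scale[OF assms(1)]] G_meas[OF W_scale[OF assms(2)]]
    have "nsq M (\<lambda>x. G (\<lambda>x. t * U n x) x - G (\<lambda>x. t * u x) x) = nsq M (\<lambda>x. t *\<^sub>R (G (U n) x - G u x))"
      by (rule nsq_cong_AE) (use G_scale[OF assms(1)[of n], of t] G_scale[OF assms(2), of t] in \<open>auto simp: algebra_simps\<close>)
    then show ?thesis by (simp add: nsq_scaleR)
  qed
  show ?thesis using assms(3) unfolding W_conv_def 1 2 by (auto intro: tendsto_mult_right_zero)
qed

lemma W_conv_lincomb:
  assumes u: "u \<in> W" and v: "v \<in> W" and p: "p \<longlonglongrightarrow> p0" and q: "q \<longlonglongrightarrow> q0"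
  shows "W_conv (\<lambda>n x. p n * u x + q n * v x) (\<lambda>x. p0 * u x + q0 * v x)"
proof -
  note [measurable] = G_meas[OF u] G_meas[OF v] G_meas[OF W_lin[OF u v]]
  have lim: "(\<lambda>n. 2 * ((p n - p0)\<^sup>2 * A) + 2 * ((q n - q0)\<^sup>2 * B)) \<longlonglongrightarrow> 0" for A B :: real
    using p q by (auto intro!: tendsto_eq_intros)
  have 1: "nsq M (\<lambda>x. (p n * u x + q n * v x) - (p0 * u x + q0 * v x)) \<le>
      2 * ((p n - p0)\<^sup>2 * nsq M u) + 2 * ((q n - q0)\<^sup>2 * nsq M v)" for n
  proof -
    have "nsq M (\<lambda>x. (p n * u x + q n * v x) - (p0 * u x + q0 * v x)) =
      nsq M (\<lambda>x. (p n - p0) *\<^sub>R u x + (q n - q0) *\<^sub>R v x)" by (simp add: algebra_simps)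
    also have "\<dots> \<le> 2 * nsq M (\<lambda>x. (p n - p0) *\<^sub>R u x) + 2 * nsq M (\<lambda>x. (q n - q0) *\<^sub>R v x)"
      by (intro nsq_le_add sq_int_scaleR W_sq u v)
    finally show ?thesis unfolding nsq_scaleR .
  qed
  have 2: "nsq M (\<lambda>x. G (\<lambda>x. p n * u x + q n * v x) x - G (\<lambda>x. p0 * u x + q0 * v x) x) \<le>
      2 * ((p n - p0)\<^sup>2 * nsq M (G u)) + 2 * ((q n - q0)\<^sup>2 * nsq M (G v))" for n
  proof -
    have "nsq M (\<lambda>x. G (\<lambda>x. p n * u x + q n * v x) x - G (\<lambda>x. p0 * u x + q0 * v x) x) =
      nsq M (\<lambda>x. (p n - p0) *\<^sub>R G u x + (q n - q0) *\<^sub>R G v x)"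
      by (rule nsq_cong_AE) (use G_lin[OF u v, of "p n" "q n"] G_lin[OF u v, of p0 q0] in \<open>auto simp: algebra_simps\<close>)
    also have "\<dots> \<le> 2 * nsq M (\<lambda>x. (p n - p0) *\<^sub>R G u x) + 2 * nsq M (\<lambda>x. (q n - q0) *\<^sub>R G v x)"
      by (intro nsq_le_add sq_int_scaleR G_sq u v)
    finally show ?thesis unfolding nsq_scaleR .
  qed
  show ?thesis unfolding W_conv_def
  proof
    show "(\<lambda>n. nsq M (\<lambda>x. (p n * u x + q n * v x) - (p0 * u x + q0 * v x))) \<longlonglongrightarrow> 0"
      by (rule tendsto_sandwich[OF _ _ tendsto_const lim[of "nsq M u" "nsq M v"]]) (use 1 in auto)
    show "(\<lambda>n. nsq M (\<lambda>x. G (\<lambda>x. p n * u x + q n * v x) x - G (\<lambda>x. p0 * u x + q0 * v x) x)) \<longlonglongrightarrow> 0"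
      by (rule tendsto_sandwich[OF _ _ tendsto_const lim[of "nsq M (G u)" "nsq M (G v)"]]) (use 2 in auto)
  qed
qed

lemma is_path_lincomb:
  assumes u: "u \<in> W" and v: "v \<in> W" and "continuous_on {0..1} p" "continuous_on {0..1} q"
  shows "is_path (\<lambda>t x. p t * u x + q t * v x)"
  unfolding is_path_def
proof (intro conjI ballI allI impI)
  fix t :: real and X :: "nat \<Rightarrow> real" assume t: "t \<in> {0..1}" "\<forall>n. X n \<in> {0..1}" "X \<longlonglongrightarrow> t"
  show "W_conv (\<lambda>n x. p (X n) * u x + q (X n) * v x) (\<lambda>x. p t * u x + q t * v x)"
    by (rule W_conv_lincomb[OF u v]) (use assms(3,4) t in \<open>auto simp: continuous_on_sequentially o_def\<close>)
qed (rule W_lin[OF u v])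

lemma is_path_line: "u \<in> W \<Longrightarrow> is_path (\<lambda>t x. t * R * u x)"
proof -
  have c: "continuous_on {0..1} (\<lambda>t. t * R)" "continuous_on {0..1} (\<lambda>t::real. 0::real)"
    by (intro continuous_intros)+
  assume "u \<in> W"
  from is_path_lincomb[OF this this c] show ?thesis by simp
qed

end

text \<open>Two conditions on the size of \<open>lam\<close>: \<open>lam_C1\<close> raises a ridge
  of height a^2/2 - a^2/4 at unit gradient norm, and \<open>lam_CP\<close> makes the second
  derivative along rays positive at the origin.\<close>

locale mountain_pass = sobolev_model M W G + finsler F a b \<mu> \<Lambda>
  for M :: "'a measure" and W G F a b \<mu> \<Lambda> +
  fixes lam C1 CP :: real
  assumes lam_pos: "lam > 0"
    and C1: "u \<in> W \<Longrightarrow> nsq M (G u) \<le> 1 \<Longrightarrow> (\<integral>x. exp (u x) \<partial>M) \<le> C1"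
    and CP: "u \<in> W \<Longrightarrow> nsq M u \<le> CP * nsq M (G u)"
    and lam_C1: "lam * C1 \<le> a\<^sup>2 / 4" and lam_CP: "lam * CP < a\<^sup>2"
begin

section \<open>The energy, its continuity and its behaviour along rays\<close>

definition A :: "('a \<Rightarrow> real) \<Rightarrow> real" where "A u = (\<integral>x. (F (G u x))\<^sup>2 \<partial>M)"
definition E :: "('a \<Rightarrow> real) \<Rightarrow> real" where "E u = 1/2 * A u - lam * (\<integral>x. exp (u x) \<partial>M)"
definition E0 :: real where "E0 = E (\<lambda>x. 0)"

lemma F_meas [measurable]: "F \<in> borel_measurable borel"
  by (rule borel_measurable_continuous_onI[OF F_continuous])

lemma P_meas [measurable]: "P \<in> borel_measurable borel"
  by (rule borel_measurable_continuous_onI[OF P_continuous])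

lemma F_sq_integrable:
  assumes "sq_int M g" shows "integrable M (\<lambda>x. (F (g x))\<^sup>2)"
proof -
  note [measurable] = sq_int_meas[OF assms]
  show ?thesis
  proof (rule Bochner_Integration.integrable_bound)
    show "integrable M (\<lambda>x. b\<^sup>2 * (norm (g x))\<^sup>2)" by (intro integrable_mult_right sq_int_integrable assms)
    show "AE x in M. norm ((F (g x))\<^sup>2) \<le> norm (b\<^sup>2 * (norm (g x))\<^sup>2)" using F_sq_upper by simp
  qed measurable
qed

lemma A_int: "u \<in> W \<Longrightarrow> integrable M (\<lambda>x. (F (G u x))\<^sup>2)"
  by (rule F_sq_integrable[OF G_sq])

lemma A_lower: assumes "u \<in> W" shows "a\<^sup>2 * D u \<le> A u"
proof -
  have "a\<^sup>2 * D u = (\<integral>x. a\<^sup>2 * (norm (G u x))\<^sup>2 \<partial>M)" by (simp add: D_def nsq_def)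
  also have "\<dots> \<le> A u" unfolding A_def
    by (intro integral_mono integrable_mult_right sq_int_integrable G_sq A_int assms F_sq_lower)
  finally show ?thesis .
qed

lemma A_upper: assumes "u \<in> W" shows "A u \<le> b\<^sup>2 * D u"
proof -
  have "A u \<le> (\<integral>x. b\<^sup>2 * (norm (G u x))\<^sup>2 \<partial>M)" unfolding A_def
    by (intro integral_mono integrable_mult_right sq_int_integrable G_sq A_int assms F_sq_upper)
  also have "\<dots> = b\<^sup>2 * D u" by (simp add: D_def nsq_def)
  finally show ?thesis .
qed

lemma A_lin:
  assumes "u \<in> W" "v \<in> W"
  shows "A (\<lambda>x. s * u x + t * v x) = (\<integral>x. (F (s *\<^sub>R G u x + t *\<^sub>R G v x))\<^sup>2 \<partial>M)"
  unfolding A_def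
proof (rule integral_cong_AE)
  note [measurable] = G_meas[OF assms(1)] G_meas[OF assms(2)] G_meas[OF W_lin[OF assms]]
  show "(\<lambda>x. (F (G (\<lambda>x. s * u x + t * v x) x))\<^sup>2) \<in> borel_measurable M" by measurable
  show "(\<lambda>x. (F (s *\<^sub>R G u x + t *\<^sub>R G v x))\<^sup>2) \<in> borel_measurable M" by measurable
  show "AE x in M. (F (G (\<lambda>x. s * u x + t * v x) x))\<^sup>2 = (F (s *\<^sub>R G u x + t *\<^sub>R G v x))\<^sup>2"
    using G_lin[OF assms, of s t] by eventually_elim simp
qed

lemma A_scale: assumes "u \<in> W" shows "A (\<lambda>x. t * u x) = t\<^sup>2 * A u"
  using A_lin[OF assms assms, of t 0] by (simp add: F_hom power_mult_distrib A_def)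

lemma E_scale: "u \<in> W \<Longrightarrow> E (\<lambda>x. t * u x) = 1/2 * t\<^sup>2 * A u - lam * (\<integral>x. exp (t * u x) \<partial>M)"
  by (simp add: E_def A_scale)

lemma E0_eq: "E0 = - lam * measure M (space M)"
proof -
  have "A (\<lambda>x. 0) = 0" using A_scale[OF W_zero, of 0] by simp
  then show ?thesis by (simp add: E0_def E_def)
qed

lemma mm_pos: "measure M (space M) > 0"
proof (rule ccontr)
  assume "\<not> measure M (space M) > 0"
  then have "measure M (space M) = 0" using zero_less_measure_iff by blast
  then have z: "emeasure M (space M) = 0" by (simp add: emeasure_eq_measure)
  have "AE x in M. u x \<le> 0" for u :: "'a \<Rightarrow> real"
    by (rule AE_I[of _ _ "space M"]) (use z in auto)
  then show False using nontrivial by blast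
qed

lemma E0_neg: "E0 < 0" unfolding E0_eq using mm_pos lam_pos by simp

lemma exp_integral_nonneg: "0 \<le> (\<integral>x. exp (f x :: real) \<partial>M)" by (rule integral_nonneg_AE) simp

lemma E_le_D: assumes "u \<in> W" shows "E u \<le> b\<^sup>2 / 2 * D u"
proof -
  have "0 \<le> lam * (\<integral>x. exp (u x) \<partial>M)" using lam_pos exp_integral_nonneg[of u] by simp
  then show ?thesis using A_upper[OF assms] unfolding E_def by simp
qed

lemma mm_le_C1: "measure M (space M) \<le> C1"
  using C1[OF W_zero] D_scale[OF W_zero, of 0] by (simp add: D_def)

lemma C1_nonneg: "0 \<le> C1" using mm_le_C1 mm_pos by simp

text \<open>By the Poincare inequality u vanishes almost everywhere, so the whole ray has the energy
  of the origin.\<close>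

lemma E_zero_D:
  assumes u: "u \<in> W" and D0: "D u = 0" shows "E (\<lambda>x. t * u x) = E0"
proof -
  note [measurable] = W_meas[OF u]
  have "A u = 0" using A_lower[OF u] A_upper[OF u] D0 by simp
  have "nsq M u \<le> 0" using CP[OF u] D0 by (simp add: D_def)
  then have "nsq M u = 0" using nsq_nonneg[of M u] by linarith
  then have "AE x in M. (norm (u x))\<^sup>2 = 0"
    unfolding nsq_def
    by (subst (asm) integral_nonneg_eq_0_iff_AE) (use sq_int_integrable[OF W_sq[OF u]] in auto)
  then have "AE x in M. exp (t * u x) = exp 0" by eventually_elim simp
  then have "(\<integral>x. exp (t * u x) \<partial>M) = (\<integral>x. exp 0 \<partial>M)"
    by (intro integral_cong_AE) auto
  then show ?thesis unfolding E_scale[OF u] E0_eq using \<open>A u = 0\<close> by simp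
qed

lemma E_ge_of_D_le_1:
  assumes "u \<in> W" "D u \<le> 1" shows "E u \<ge> 1/2 * (a\<^sup>2 * D u) - lam * C1"
proof -
  have "lam * (\<integral>x. exp (u x) \<partial>M) \<le> lam * C1"
    using C1[OF assms(1)] assms(2) lam_pos by (intro mult_left_mono) (auto simp: D_def)
  then show ?thesis using A_lower[OF assms(1)] unfolding E_def by linarith
qed

text \<open>Rescaling to unit gradient norm reaches the ridge: every nontrivial ray climbs to at
  least a^2/4, while the energy of the origin is negative.\<close>

lemma peak:
  assumes u: "u \<in> W" "D u > 0" shows "E (\<lambda>x. (1 / sqrt (D u)) * u x) \<ge> a\<^sup>2 / 4"
proof -
  have v: "(\<lambda>x. (1 / sqrt (D u)) * u x) \<in> W" by (rule W_scale[OF u(1)])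
  have D1: "D (\<lambda>x. (1 / sqrt (D u)) * u x) = 1"
    unfolding D_scale[OF u(1)] using u(2) by (simp add: power_divide)
  show ?thesis using E_ge_of_D_le_1[OF v] lam_C1 unfolding D1 by simp
qed

lemma E_W_conv:
  assumes U: "\<And>n. U n \<in> W" "u \<in> W" "W_conv U u" shows "(\<lambda>n. E (U n)) \<longlonglongrightarrow> E u"
proof -
  have b: "\<bar>A (U n) - A u\<bar> \<le> b\<^sup>2 * (sqrt (nsq M (\<lambda>x. G (U n) x - G u x)) * (sqrt (D (U n)) + sqrt (D u)))" for n
  proof -
    define d where "d x = G (U n) x - G u x" for x
    have d: "sq_int M d" unfolding d_def[abs_def] by (intro sq_int_diff G_sq U)
    note i = sq_int_mult_integrable[OF d G_sq[OF U(1)[of n]]] sq_int_mult_integrable[OF d G_sq[OF U(2)]]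
    have "\<bar>A (U n) - A u\<bar> = \<bar>\<integral>x. (F (G (U n) x))\<^sup>2 - (F (G u x))\<^sup>2 \<partial>M\<bar>"
      unfolding A_def using A_int[OF U(1)] A_int[OF U(2)] by simp
    also have "\<dots> \<le> (\<integral>x. b\<^sup>2 * (norm (d x) * norm (G (U n) x) + norm (d x) * norm (G u x)) \<partial>M)"
    proof (rule abs_integral_le)
      show "\<bar>(F (G (U n) x))\<^sup>2 - (F (G u x))\<^sup>2\<bar> \<le> b\<^sup>2 * (norm (d x) * norm (G (U n) x) + norm (d x) * norm (G u x))" for x
        using F_sq_lipschitz[of "G (U n) x" "G u x"] by (simp add: d_def distrib_left)
      show "integrable M (\<lambda>x. (F (G (U n) x))\<^sup>2 - (F (G u x))\<^sup>2)"
        by (intro Bochner_Integration.integrable_diff A_int U)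
      show "integrable M (\<lambda>x. b\<^sup>2 * (norm (d x) * norm (G (U n) x) + norm (d x) * norm (G u x)))"
        by (intro integrable_mult_right Bochner_Integration.integrable_add i)
    qed
    also have "\<dots> = b\<^sup>2 * ((\<integral>x. norm (d x) * norm (G (U n) x) \<partial>M) + (\<integral>x. norm (d x) * norm (G u x) \<partial>M))"
      using i by simp
    also have "\<dots> \<le> b\<^sup>2 * (sqrt (nsq M d) * sqrt (nsq M (G (U n))) + sqrt (nsq M d) * sqrt (nsq M (G u)))"
      by (intro mult_left_mono add_mono Cauchy_Schwarz_integral d G_sq U) simp
    finally show ?thesis by (simp add: D_def d_def[abs_def] distrib_left)
  qed
  have "(\<lambda>n. A (U n) - A u) \<longlonglongrightarrow> 0"
  proof (rule Lim_null_comparison)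
    show "\<forall>\<^sub>F n in sequentially. norm (A (U n) - A u) \<le>
        b\<^sup>2 * (sqrt (nsq M (\<lambda>x. G (U n) x - G u x)) * (sqrt (D (U n)) + sqrt (D u)))"
      using b by simp
    have "(\<lambda>n. nsq M (\<lambda>x. G (U n) x - G u x)) \<longlonglongrightarrow> 0" using U(3) by (simp add: W_conv_def)
    then show "(\<lambda>n. b\<^sup>2 * (sqrt (nsq M (\<lambda>x. G (U n) x - G u x)) * (sqrt (D (U n)) + sqrt (D u)))) \<longlonglongrightarrow> 0"
      using D_W_conv[OF U] by (auto intro!: tendsto_eq_intros)
  qed
  then have "(\<lambda>n. A (U n)) \<longlonglongrightarrow> A u" by (simp add: LIM_zero_iff)
  then show ?thesis unfolding E_def by (intro tendsto_intros exp_integral_W_conv U)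
qed

lemma power_exp_bound: "\<bar>z ^ k * exp (t * z)\<bar> \<le> exp ((real k + \<bar>t\<bar>) * \<bar>z\<bar>)" for z t :: real
proof -
  have "\<bar>z ^ k * exp (t * z)\<bar> = \<bar>z\<bar> ^ k * exp (t * z)" by (simp add: abs_mult power_abs)
  also have "\<dots> \<le> exp \<bar>z\<bar> ^ k * exp (\<bar>t\<bar> * \<bar>z\<bar>)"
    by (intro mult_mono power_mono abs_le_exp_abs) (auto simp: abs_mult[symmetric])
  also have "\<dots> = exp ((real k + \<bar>t\<bar>) * \<bar>z\<bar>)"
    by (simp add: exp_of_nat_mult[symmetric] exp_add[symmetric] distrib_right)
  finally show ?thesis .
qed

lemma power_exp_int:
  assumes "u \<in> W" shows "integrable M (\<lambda>x. (u x) ^ k * exp (t * u x))"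
proof -
  note [measurable] = W_meas[OF assms]
  show ?thesis
    by (rule Bochner_Integration.integrable_bound[OF exp_abs_int[OF assms, of "real k + \<bar>t\<bar>"]])
      (auto intro!: AE_I2 power_exp_bound)
qed

text \<open>The power of u is absorbed into the exponential, which yields one dominating function
  for all parameters within distance 1 of t.\<close>

lemma power_exp_deriv:
  assumes "u \<in> W"
  shows "((\<lambda>t. \<integral>x. (u x) ^ k * exp (t * u x) \<partial>M) has_real_derivative (\<integral>x. (u x) ^ Suc k * exp (t * u x) \<partial>M)) (at t)"
proof (rule DERIV_integral_dominated[where d=1])
  note [measurable] = W_meas[OF assms]
  show "(\<lambda>x. (u x) ^ Suc k * exp (t * u x)) \<in> borel_measurable M" by measurable
  show "integrable M (\<lambda>x. exp ((real (Suc k) + (\<bar>t\<bar> + 1)) * \<bar>u x\<bar>))" by (rule exp_abs_int[OF assms])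
  show "integrable M (\<lambda>x. (u x) ^ k * exp (s * u x))" for s by (rule power_exp_int[OF assms])
  show "((\<lambda>t. (u x) ^ k * exp (t * u x)) has_real_derivative (u x) ^ Suc k * exp (s * u x)) (at s)" for s x
    by (auto intro!: derivative_eq_intros)
  fix s x assume s: "\<bar>s - t\<bar> < 1"
  have "\<bar>(u x) ^ Suc k * exp (s * u x)\<bar> \<le> exp ((real (Suc k) + \<bar>s\<bar>) * \<bar>u x\<bar>)" by (rule power_exp_bound)
  also have "\<dots> \<le> exp ((real (Suc k) + (\<bar>t\<bar> + 1)) * \<bar>u x\<bar>)"
    using s by (simp only: exp_le_cancel_iff) (intro mult_right_mono, auto)
  finally show "\<bar>(u x) ^ Suc k * exp (s * u x)\<bar> \<le> exp ((real (Suc k) + (\<bar>t\<bar> + 1)) * \<bar>u x\<bar>)" .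
qed simp

text \<open>The tangent of exp at \<theta> z is compared with exp at 0 and at z, and the two
  inequalities are averaged.\<close>

lemma exp_convex_zero: "0 \<le> \<theta> \<Longrightarrow> \<theta> \<le> 1 \<Longrightarrow> exp (\<theta> * z) \<le> (1 - \<theta>) + \<theta> * exp z" for \<theta> z :: real
proof -
  assume \<theta>: "0 \<le> \<theta>" "\<theta> \<le> 1"
  have "exp (\<theta> * z) * (1 + (0 - \<theta> * z)) \<le> exp (\<theta> * z) * exp (0 - \<theta> * z)"
    by (intro mult_left_mono exp_ge_add_one_self) auto
  then have 1: "exp (\<theta> * z) * (1 + (0 - \<theta> * z)) \<le> 1" by (simp add: exp_minus)
  have "exp (\<theta> * z) * (1 + (z - \<theta> * z)) \<le> exp (\<theta> * z) * exp (z - \<theta> * z)"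
    by (intro mult_left_mono exp_ge_add_one_self) auto
  then have 2: "exp (\<theta> * z) * (1 + (z - \<theta> * z)) \<le> exp z" by (simp add: exp_diff)
  have "exp (\<theta> * z) = (1 - \<theta>) * (exp (\<theta> * z) * (1 + (0 - \<theta> * z))) + \<theta> * (exp (\<theta> * z) * (1 + (z - \<theta> * z)))"
    by (simp add: algebra_simps)
  also have "\<dots> \<le> (1 - \<theta>) * 1 + \<theta> * exp z"
    using 1 2 \<theta> by (intro add_mono mult_left_mono) auto
  finally show ?thesis by simp
qed

text \<open>The second derivative of the energy along a ray is concave because it subtracts the
  integral of \<open>u\<^sup>2 exp (t u)\<close>; as it is positive at the origin, the energy along every ray is first
  convex and then concave, whatever the sign of \<open>u\<close>.\<close>

lemma E_shape:
  assumes u: "u \<in> W" "D u > 0" and s: "0 < s1" "s1 < s2" "s2 < s3"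
    and v: "E0 < E (\<lambda>x. s1 * u x)" "E (\<lambda>x. s2 * u x) \<le> E (\<lambda>x. s1 * u x)"
  shows "E (\<lambda>x. s3 * u x) < E (\<lambda>x. s2 * u x)"
proof -
  define k where "k j t = (\<integral>x. (u x) ^ j * exp (t * u x) \<partial>M)" for j t
  define h where "h t = 1/2 * t\<^sup>2 * A u - lam * k 0 t" for t
  define h' where "h' t = t * A u - lam * k 1 t" for t
  define h'' where "h'' t = A u - lam * k 2 t" for t
  have kd: "(k j has_real_derivative k (Suc j) t) (at t)" for j t
    unfolding k_def[abs_def] by (rule power_exp_deriv[OF u(1)])
  have d1: "(h has_real_derivative h' t) (at t)" for t
    unfolding h_def[abs_def] h'_def using kd[of 0 t] by (auto intro!: derivative_eq_intros)
  have d2: "(h' has_real_derivative h'' t) (at t)" for t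
    unfolding h'_def[abs_def] h''_def using kd[of 1 t] by (auto intro!: derivative_eq_intros simp: numeral_2_eq_2)
  have hE: "E (\<lambda>x. t * u x) = h t" for t by (simp add: E_scale[OF u(1)] h_def k_def)
  have h0: "h 0 = E0" using hE[of 0] by (simp add: E0_def)
  have conc: "(1 - \<theta>) * h'' 0 + \<theta> * h'' t \<le> h'' (\<theta> * t)" if \<theta>: "0 \<le> \<theta>" "\<theta> \<le> 1" for \<theta> t
  proof -
    have "k 2 (\<theta> * t) \<le> (\<integral>x. (1 - \<theta>) * ((u x)^2 * exp (0 * u x)) + \<theta> * ((u x)^2 * exp (t * u x)) \<partial>M)"
      unfolding k_def
    proof (intro integral_mono Bochner_Integration.integrable_add integrable_mult_right power_exp_int u(1))
      fix x
      have "(u x)^2 * exp (\<theta> * (t * u x)) \<le> (u x)^2 * ((1 - \<theta>) + \<theta> * exp (t * u x))"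
        using exp_convex_zero[OF \<theta>] by (intro mult_left_mono) auto
      then show "(u x)^2 * exp (\<theta> * t * u x) \<le> (1 - \<theta>) * ((u x)^2 * exp (0 * u x)) + \<theta> * ((u x)^2 * exp (t * u x))"
        by (simp add: algebra_simps)
    qed
    also have "\<dots> = (1 - \<theta>) * k 2 0 + \<theta> * k 2 t"
      unfolding k_def
      by (subst Bochner_Integration.integral_add)
        (simp_all only: integral_mult_right_zero integrable_mult_right power_exp_int[OF u(1)])
    finally have "lam * k 2 (\<theta> * t) \<le> lam * ((1 - \<theta>) * k 2 0 + \<theta> * k 2 t)"
      using lam_pos by simp
    then show ?thesis by (simp add: h''_def algebra_simps)
  qed
  \<comment> \<open>The Poincare inequality bounds \<lambda> times the integral of u^2 by
    \<open>lam * CP * D u\<close>, which \<open>lam_CP\<close> puts below a^2 D u and hence below A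
    u.\<close>
  have pos: "h'' 0 > 0"
  proof -
    have "k 2 0 = nsq M u" by (simp add: k_def nsq_def)
    then have "lam * k 2 0 \<le> lam * (CP * D u)" using CP[OF u(1)] lam_pos by (simp add: D_def)
    also have "\<dots> < a\<^sup>2 * D u" using lam_CP u(2) by (simp add: mult.assoc[symmetric])
    also have "\<dots> \<le> A u" by (rule A_lower[OF u(1)])
    finally show ?thesis by (simp add: h''_def)
  qed
  show ?thesis unfolding hE
  proof (rule convex_concave_shape[OF d1 d2 _ pos s])
    show "(1 - \<theta>) * h'' 0 + \<theta> * h'' t \<le> h'' (\<theta> * t)" if "0 \<le> \<theta>" "\<theta> \<le> 1" for \<theta> t
      by (rule conc[OF that])
    show "h 0 < h s1" "h s2 \<le> h s1" using v unfolding h0 hE by auto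
  qed
qed

text \<open>The peaks of rays. Being a family of weak inequalities between energies the condition
  survives limits, and it excludes a local minimum that a ray may have near the origin.\<close>

definition nehari :: "('a \<Rightarrow> real) set" where
  "nehari = {u \<in> W. D u > 0 \<and> (\<forall>t\<ge>0. E (\<lambda>x. t * u x) \<le> E u)}"

lemma nehari_E: assumes "u \<in> nehari" shows "E u \<ge> a\<^sup>2 / 4"
proof -
  have u: "u \<in> W" "D u > 0" "\<And>t. t \<ge> 0 \<Longrightarrow> E (\<lambda>x. t * u x) \<le> E u" using assms by (auto simp: nehari_def)
  show ?thesis using peak[OF u(1,2)] u(3)[of "1 / sqrt (D u)"] u(2) by simp
qed

lemma is_path_cont_E:
  assumes "is_path \<gamma>" shows "continuous_on {0..1} (\<lambda>t. E (\<lambda>x. s * \<gamma> t x))"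
  unfolding continuous_on_sequentially o_def
proof (intro ballI allI impI)
  fix t X assume t: "t \<in> {0..1::real}" and X: "(\<forall>n. X n \<in> {0..1}) \<and> X \<longlonglongrightarrow> t"
  have W1: "\<gamma> (X n) \<in> W" for n using assms X unfolding is_path_def by blast
  have W2: "\<gamma> t \<in> W" using assms t unfolding is_path_def by blast
  have "W_conv (\<lambda>n. \<gamma> (X n)) (\<gamma> t)" using assms t X unfolding is_path_def by blast
  from W_conv_scale[OF W1 W2 this, of s]
  show "(\<lambda>n. E (\<lambda>x. s * \<gamma> (X n) x)) \<longlonglongrightarrow> E (\<lambda>x. s * \<gamma> t x)"
    by (intro E_W_conv W_scale W1 W2)
qed

lemma is_path_cont_E1: "is_path \<gamma> \<Longrightarrow> continuous_on {0..1} (\<lambda>t. E (\<gamma> t))"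
  using is_path_cont_E[of \<gamma> 1] by simp

lemma is_path_cont_D:
  assumes "is_path \<gamma>" shows "continuous_on {0..1} (\<lambda>t. D (\<gamma> t))"
  unfolding continuous_on_sequentially o_def
proof (intro ballI allI impI)
  fix t X assume t: "t \<in> {0..1::real}" and X: "(\<forall>n. X n \<in> {0..1}) \<and> X \<longlonglongrightarrow> t"
  have W1: "\<gamma> (X n) \<in> W" for n using assms X unfolding is_path_def by blast
  have W2: "\<gamma> t \<in> W" using assms t unfolding is_path_def by blast
  have "W_conv (\<lambda>n. \<gamma> (X n)) (\<gamma> t)" using assms t X unfolding is_path_def by blast
  then show "(\<lambda>n. D (\<gamma> (X n))) \<longlonglongrightarrow> D (\<gamma> t)" by (intro D_W_conv W1 W2)
qed

text \<open>Detects that the peak of the ray has been passed: an earlier point is higher than both w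
  and the origin. Being a strict inequality, it defines an open set of times along a path.\<close>

definition beyond :: "('a \<Rightarrow> real) \<Rightarrow> bool" where
  "beyond w \<longleftrightarrow> (\<exists>s. 0 < s \<and> s < 1 \<and> E (\<lambda>x. s * w x) > max E0 (E w))"

text \<open>The unit interval is connected: the times at which the path is before the peak of its
  ray and those at which it is beyond are open and disjoint, contain 0 and 1 respectively, and a
  time in neither set is a crossing.\<close>

lemma crossing:
  assumes \<gamma>: "is_path \<gamma>" "\<gamma> 0 = (\<lambda>x. 0)" and w: "beyond (\<gamma> 1)"
  shows "\<exists>t\<in>{0..1}. \<gamma> t \<in> nehari"
proof (rule ccontr)
  assume no: "\<not> (\<exists>t\<in>{0..1}. \<gamma> t \<in> nehari)"
  let ?I = "{0..1::real}"
  \<comment> \<open>Below this value of \<open>D\<close> the energy is less than the ridge a^2/4.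
    Such points are added to \<open>S1\<close> by hand, since at the origin itself no multiple has a
    larger energy.\<close>
  define \<rho> where "\<rho> = a\<^sup>2 / (2 * b\<^sup>2)"
  have \<rho>: "\<rho> > 0" "\<rho> < 1"
  proof -
    have "a\<^sup>2 \<le> b\<^sup>2" using a_pos a_le_b by (intro power_mono) auto
    moreover have "b\<^sup>2 > 0" "a\<^sup>2 > 0" using a_pos b_pos by auto
    ultimately show "\<rho> > 0" "\<rho> < 1" unfolding \<rho>_def
      by (simp_all only: divide_less_eq_1_pos mult_pos_pos divide_pos_pos zero_less_numeral)
  qed
  define S1 where "S1 = (?I \<inter> (\<lambda>t. D (\<gamma> t)) -` {..<\<rho>}) \<union>
    (\<Union>s\<in>{1<..}. ?I \<inter> (\<lambda>t. E (\<lambda>x. s * \<gamma> t x) - E (\<gamma> t)) -` {0<..})"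
  define S2 where "S2 = (\<Union>s\<in>{0<..<1}. ?I \<inter> (\<lambda>t. E (\<lambda>x. s * \<gamma> t x) - max E0 (E (\<gamma> t))) -` {0<..})"
  have W: "\<gamma> t \<in> W" if "t \<in> ?I" for t using \<gamma>(1) that unfolding is_path_def by blast
  have c1: "continuous_on ?I (\<lambda>t. E (\<lambda>x. s * \<gamma> t x) - E (\<gamma> t))" for s
    by (intro continuous_on_diff is_path_cont_E is_path_cont_E1 \<gamma>(1))
  have c2: "continuous_on ?I (\<lambda>t. E (\<lambda>x. s * \<gamma> t x) - max E0 (E (\<gamma> t)))" for s
    by (intro continuous_on_diff continuous_on_max continuous_on_const is_path_cont_E is_path_cont_E1 \<gamma>(1))
  have o1: "openin (top_of_set ?I) S1" unfolding S1_def
  proof (intro openin_Un openin_Union)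
    show "openin (top_of_set ?I) (?I \<inter> (\<lambda>t. D (\<gamma> t)) -` {..<\<rho>})"
      by (intro continuous_openin_preimage_gen is_path_cont_D \<gamma>(1)) simp
  next
    fix T assume "T \<in> (\<lambda>s. ?I \<inter> (\<lambda>t. E (\<lambda>x. s * \<gamma> t x) - E (\<gamma> t)) -` {0<..}) ` {1<..}"
    then obtain s where "T = ?I \<inter> (\<lambda>t. E (\<lambda>x. s * \<gamma> t x) - E (\<gamma> t)) -` {0<..}" by blast
    then show "openin (top_of_set ?I) T" by (simp only:) (rule continuous_openin_preimage_gen[OF c1], simp)
  qed
  have o2: "openin (top_of_set ?I) S2" unfolding S2_def
  proof (intro openin_Union)
    fix T assume "T \<in> (\<lambda>s. ?I \<inter> (\<lambda>t. E (\<lambda>x. s * \<gamma> t x) - max E0 (E (\<gamma> t))) -` {0<..}) ` {0<..<1}"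
    then obtain s where "T = ?I \<inter> (\<lambda>t. E (\<lambda>x. s * \<gamma> t x) - max E0 (E (\<gamma> t))) -` {0<..}" by blast
    then show "openin (top_of_set ?I) T" by (simp only:) (rule continuous_openin_preimage_gen[OF c2], simp)
  qed
  have up: "\<exists>s>1. E (\<lambda>x. s * \<gamma> t x) > E (\<gamma> t)" if t: "t \<in> ?I" "0 < D (\<gamma> t)" "D (\<gamma> t) < \<rho>" for t
  proof -
    define s where "s = 1 / sqrt (D (\<gamma> t))"
    have "sqrt (D (\<gamma> t)) < 1" using t \<rho> by simp
    then have "s > 1" using t(2) by (simp add: s_def)
    moreover have "E (\<lambda>x. s * \<gamma> t x) \<ge> a\<^sup>2 / 4" unfolding s_def by (rule peak[OF W[OF t(1)] t(2)])
    moreover have "E (\<gamma> t) < a\<^sup>2 / 4"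
    proof -
      have "E (\<gamma> t) \<le> b\<^sup>2 / 2 * D (\<gamma> t)" by (rule E_le_D[OF W[OF t(1)]])
      also have "\<dots> < b\<^sup>2 / 2 * \<rho>" using t(3) b_pos by (intro mult_strict_left_mono) auto
      also have "\<dots> = a\<^sup>2 / 4" using b_pos by (simp add: \<rho>_def)
      finally show ?thesis .
    qed
    ultimately show ?thesis by (intro exI[of _ s]) linarith
  qed
  \<comment> \<open>Past its peak a ray only descends, by \<open>E_shape\<close>, whereas
    \<open>S1\<close> asks for a higher point further out; for small \<open>D\<close> the ridge is
    such a point.\<close>
  have disj: "S1 \<inter> S2 = {}"
  proof (rule ccontr)
    assume "S1 \<inter> S2 \<noteq> {}"
    then obtain t where t1: "t \<in> S1" and t2: "t \<in> S2" by blast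
    have tI: "t \<in> ?I" using t2 by (auto simp: S2_def)
    obtain s where s: "0 < s" "s < 1" "E (\<lambda>x. s * \<gamma> t x) > max E0 (E (\<gamma> t))" using t2 by (auto simp: S2_def)
    have Dp: "D (\<gamma> t) > 0"
    proof (rule ccontr)
      assume "\<not> D (\<gamma> t) > 0"
      then have "D (\<gamma> t) = 0" using D_nonneg[of "\<gamma> t"] by linarith
      from E_zero_D[OF W[OF tI] this, of s] show False using s(3) by simp
    qed
    have "\<exists>s'>1. E (\<lambda>x. s' * \<gamma> t x) > E (\<gamma> t)"
    proof (cases "D (\<gamma> t) < \<rho>")
      case True then show ?thesis by (rule up[OF tI Dp])
    next
      case False then show ?thesis using t1 by (auto simp: S1_def)
    qed
    then obtain s' where s': "s' > 1" "E (\<lambda>x. s' * \<gamma> t x) > E (\<gamma> t)" by blast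
    have "E (\<lambda>x. s' * \<gamma> t x) < E (\<lambda>x. 1 * \<gamma> t x)"
      by (rule E_shape[OF W[OF tI] Dp s(1,2) s'(1)]) (use s(3) in auto)
    then show False using s'(2) by simp
  qed
  have cover: "?I \<subseteq> S1 \<union> S2"
  proof
    fix t assume t: "t \<in> ?I"
    show "t \<in> S1 \<union> S2"
    proof (rule ccontr)
      assume n: "t \<notin> S1 \<union> S2"
      then have n1: "D (\<gamma> t) \<ge> \<rho>" and n2: "\<And>s. s > 1 \<Longrightarrow> E (\<lambda>x. s * \<gamma> t x) \<le> E (\<gamma> t)"
        using t by (force simp: S1_def)+
      have n3: "E (\<lambda>x. s * \<gamma> t x) \<le> max E0 (E (\<gamma> t))" if "0 < s" "s < 1" for s
      proof (rule ccontr)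
        assume "\<not> ?thesis"
        then have "E (\<lambda>x. s * \<gamma> t x) - max E0 (E (\<gamma> t)) > 0" by linarith
        then have "t \<in> S2" using t that unfolding S2_def by (intro UN_I[of s]) auto
        then show False using n by blast
      qed
      have Dp: "D (\<gamma> t) > 0" using n1 \<rho>(1) by linarith
      define s where "s = 1 / sqrt (D (\<gamma> t))"
      have s: "s > 0" using Dp by (simp add: s_def)
      have Es: "E (\<lambda>x. s * \<gamma> t x) \<ge> a\<^sup>2 / 4" unfolding s_def by (rule peak[OF W[OF t] Dp])
      have a2: "a\<^sup>2 / 4 > 0" using a_pos by simp
      \<comment> \<open>A strict gap to the origin follows from the ridge, wherever it lies relative
        to the point: further out, at the point, or before it.\<close>
      have E0lt: "E0 < E (\<gamma> t)"
      proof -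
        consider "s > 1" | "s = 1" | "s < 1" by linarith
        then show ?thesis
        proof cases
          case 1 then show ?thesis using n2[OF 1] Es E0_neg a2 by linarith
        next
          case 2
          then have "E (\<lambda>x. s * \<gamma> t x) = E (\<gamma> t)" by simp
          then show ?thesis using Es E0_neg a2 by linarith
        next
          case 3 then show ?thesis using n3[OF s 3] Es E0_neg a2 by linarith
        qed
      qed
      have "E (\<lambda>x. r * \<gamma> t x) \<le> E (\<gamma> t)" if r: "r \<ge> 0" for r
      proof -
        consider "r > 1" | "r = 1" | "0 < r" "r < 1" | "r = 0" using r by linarith
        then show ?thesis
        proof cases
          case 3 then show ?thesis using n3[OF 3] E0lt by simp
        next
          case 4 then show ?thesis using E0lt by (simp add: E0_def)
        qed (use n2 in auto)
      qed
      then have "\<gamma> t \<in> nehari" using W[OF t] Dp by (simp add: nehari_def)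
      then show False using no t by blast
    qed
  qed
  have "D (\<gamma> 0) = 0" using D_scale[OF W_zero, of 0] \<gamma>(2) by simp
  then have "0 \<in> S1" using \<rho> by (auto simp: S1_def)
  moreover have "1 \<in> S2" using w unfolding beyond_def by (auto simp: S2_def)
  moreover have "connected ?I" by simp
  ultimately show False using o1 o2 disj cover unfolding connected_openin by blast
qed

text \<open>For \<open>D w \<le> 1\<close> the energy is at least \<open>- lam * C1\<close>; a lower
  point therefore has larger gradient norm, and its ray has met the ridge earlier.\<close>

lemma low_imp_beyond:
  assumes w: "w \<in> W" "E w < - lam * C1" shows "beyond w"
proof -
  have D1: "D w > 1"
  proof (rule ccontr)
    assume "\<not> D w > 1"
    then have "E w \<ge> 1/2 * (a\<^sup>2 * D w) - lam * C1" by (intro E_ge_of_D_le_1 w) simp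
    moreover have "0 \<le> a\<^sup>2 * D w" by simp
    ultimately show False using w(2) by simp
  qed
  have "E (\<lambda>x. (1 / sqrt (D w)) * w x) \<ge> a\<^sup>2 / 4" using D1 by (intro peak w) simp
  moreover have "E w < 0" using w(2) mult_nonneg_nonneg[OF less_imp_le[OF lam_pos] C1_nonneg] by simp
  moreover have "a\<^sup>2 / 4 > 0" using a_pos by simp
  ultimately have "E (\<lambda>x. (1 / sqrt (D w)) * w x) > max E0 (E w)" using E0_neg by linarith
  moreover have "0 < 1 / sqrt (D w)" "1 / sqrt (D w) < 1" using D1 by auto
  ultimately show ?thesis unfolding beyond_def by blast
qed

lemma low_le_E0: "- lam * C1 \<le> E0"
  unfolding E0_eq using mm_le_C1 lam_pos by simp

end

section \<open>Bounds on the set of peaks and attainment of the minimum\<close>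

context mountain_pass
begin

definition pos_part :: "('a \<Rightarrow> real) \<Rightarrow> 'a \<Rightarrow> real" where "pos_part u x = max 0 (u x)"

lemma pos_part_sq: assumes "u \<in> W" shows "sq_int M (pos_part u)"
proof -
  note [measurable] = W_meas[OF assms]
  have m[measurable]: "pos_part u \<in> borel_measurable M" unfolding pos_part_def[abs_def] by measurable
  have "integrable M (\<lambda>x. (norm (pos_part u x))\<^sup>2)"
    by (rule Bochner_Integration.integrable_bound[OF sq_int_integrable[OF W_sq[OF assms]]])
      (auto simp: pos_part_def max_def)
  then show ?thesis using m by (simp add: sq_int_def)
qed

text \<open>The fourth-order term of the exponential series outgrows the quadratic part. Its
  integral is bounded below by Cauchy-Schwarz on the finite measure space, and it is taken over the
  positive part, as a negative u gives no growth.\<close>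

lemma descend:
  assumes u: "u \<in> W" "D u \<le> B" "\<delta> \<le> nsq M (pos_part u)" "0 \<le> \<delta>" and K: "0 \<le> K"
  shows "E (\<lambda>x. K * u x) \<le> 1/2 * K\<^sup>2 * (b\<^sup>2 * B) - lam * (K ^ 4 * \<delta>\<^sup>2 / (24 * measure M (space M)))"
proof -
  note [measurable] = W_meas[OF u(1)] sq_int_meas[OF pos_part_sq[OF u(1)]]
  define mm where "mm = measure M (space M)"
  have mm: "mm > 0" using mm_pos by (simp add: mm_def)
  have i4: "integrable M (\<lambda>x. (pos_part u x) ^ 4)"
  proof (rule Bochner_Integration.integrable_bound[OF exp_abs_int[OF u(1), of "4 + \<bar>0\<bar>"]])
    have "(pos_part u x) ^ 4 \<le> exp ((4 + \<bar>0\<bar>) * \<bar>u x\<bar>)" for x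
    proof -
      have "(pos_part u x) ^ 4 \<le> \<bar>u x ^ 4 * exp (0 * u x)\<bar>" by (auto simp: pos_part_def max_def)
      also have "\<dots> \<le> exp ((4 + \<bar>0\<bar>) * \<bar>u x\<bar>)" using power_exp_bound[of "u x" 4 0] by simp
      finally show ?thesis .
    qed
    then show "AE x in M. norm (pos_part u x ^ 4) \<le> norm (exp ((4 + \<bar>0\<bar>) * \<bar>u x\<bar>))" by (auto simp: pos_part_def)
  qed measurable
  have sq2: "sq_int M (\<lambda>x. (pos_part u x)\<^sup>2)" using i4 unfolding sq_int_def by simp
  have sq1: "sq_int M (\<lambda>x. 1::real)" unfolding sq_int_def by simp
  have "nsq M (pos_part u) = (\<integral>x. norm ((pos_part u x)\<^sup>2) * norm (1::real) \<partial>M)" by (simp add: nsq_def)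
  also have "\<dots> \<le> sqrt (nsq M (\<lambda>x. (pos_part u x)\<^sup>2)) * sqrt (nsq M (\<lambda>x. 1::real))"
    by (rule Cauchy_Schwarz_integral[OF sq2 sq1])
  also have "\<dots> = sqrt (\<integral>x. (pos_part u x) ^ 4 \<partial>M) * sqrt mm" by (simp add: nsq_def mm_def)
  finally have "\<delta> \<le> sqrt (\<integral>x. (pos_part u x) ^ 4 \<partial>M) * sqrt mm" using u(3) by linarith
  then have "\<delta>\<^sup>2 \<le> (sqrt (\<integral>x. (pos_part u x) ^ 4 \<partial>M) * sqrt mm)\<^sup>2" using u(4) by (intro power_mono) auto
  also have "\<dots> = (\<integral>x. (pos_part u x) ^ 4 \<partial>M) * mm"
    using mm by (simp add: power_mult_distrib integral_nonneg_AE)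
  finally have 1: "\<delta>\<^sup>2 / mm \<le> (\<integral>x. (pos_part u x) ^ 4 \<partial>M)" using mm by (simp add: field_simps)
  have "K ^ 4 / 24 * (\<integral>x. (pos_part u x) ^ 4 \<partial>M) = (\<integral>x. K ^ 4 / 24 * (pos_part u x) ^ 4 \<partial>M)" by simp
  also have "\<dots> \<le> (\<integral>x. exp (K * u x) \<partial>M)"
  proof (intro integral_mono integrable_mult_right i4 exp_int u(1))
    fix x
    show "K ^ 4 / 24 * pos_part u x ^ 4 \<le> exp (K * u x)"
    proof (cases "u x \<ge> 0")
      case True
      then have "(K * u x) ^ 4 / fact 4 \<le> exp (K * u x)" using K by (intro exp_ge_power) auto
      then show ?thesis using True by (simp add: pos_part_def power_mult_distrib fact_numeral)
    qed (simp add: pos_part_def)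
  qed
  finally have "K ^ 4 / 24 * (\<delta>\<^sup>2 / mm) \<le> (\<integral>x. exp (K * u x) \<partial>M)"
    using mult_left_mono[OF 1, of "K ^ 4 / 24"] by simp
  then have 2: "lam * (K ^ 4 * \<delta>\<^sup>2 / (24 * mm)) \<le> lam * (\<integral>x. exp (K * u x) \<partial>M)"
    using lam_pos by (intro mult_left_mono) auto
  have "A u \<le> b\<^sup>2 * B" using A_upper[OF u(1)] mult_left_mono[OF u(2), of "b\<^sup>2"] by simp
  then have "1/2 * K\<^sup>2 * A u \<le> 1/2 * K\<^sup>2 * (b\<^sup>2 * B)" by (intro mult_left_mono) auto
  with 2 show ?thesis unfolding E_scale[OF u(1)] mm_def by linarith
qed

text \<open>One multiple K serves all elements with gradient bound B and positive mass \<delta>;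
  this uniformity later bounds the distance from a midpoint to the peak of its ray.\<close>

lemma exists_low:
  assumes "\<delta> > 0" "B \<ge> 0"
  shows "\<exists>K>0. \<forall>u\<in>W. D u \<le> B \<longrightarrow> \<delta> \<le> nsq M (pos_part u) \<longrightarrow> E (\<lambda>x. K * u x) < - lam * C1"
proof -
  define g where "g = lam * (\<delta>\<^sup>2 / (24 * measure M (space M)))"
  define p where "p = 1/2 * (b\<^sup>2 * B)"
  define c where "c = lam * C1"
  have g: "g > 0" using lam_pos assms(1) mm_pos by (simp add: g_def)
  have p: "p \<ge> 0" using assms(2) by (simp add: p_def)
  have c: "c \<ge> 0" using lam_pos C1_nonneg by (simp add: c_def)
  \<comment> \<open>With y = K^2 the bound of \<open>descend\<close> reads y (p - g y). This y makes
    the bracket at most -(c + 1), and y \<ge> 1 then keeps the product below -c.\<close>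
  define y where "y = (p + c + 1) / g + 1"
  have y: "y \<ge> 1" using g p c by (simp add: y_def)
  have gy: "p - g * y \<le> - (c + 1)" using g by (simp add: y_def field_simps)
  have "E (\<lambda>x. sqrt y * u x) < - lam * C1" if u: "u \<in> W" "D u \<le> B" "\<delta> \<le> nsq M (pos_part u)" for u
  proof -
    have y4: "sqrt y ^ 4 = y\<^sup>2"
    proof -
      have "sqrt y ^ 4 = ((sqrt y)\<^sup>2)\<^sup>2" by (simp only: power_mult[symmetric]) simp
      then show ?thesis using y by simp
    qed
    have "E (\<lambda>x. sqrt y * u x) \<le> 1/2 * (sqrt y)\<^sup>2 * (b\<^sup>2 * B) - lam * (sqrt y ^ 4 * \<delta>\<^sup>2 / (24 * measure M (space M)))"
      using assms(1) y by (intro descend u) auto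
    also have "\<dots> = y * (p - g * y)" using y unfolding y4 p_def g_def by (simp add: power2_eq_square algebra_simps)
    also have "\<dots> \<le> y * (- (c + 1))" using gy y by (intro mult_left_mono) auto
    also have "\<dots> \<le> 1 * (- (c + 1))" using y c by (intro mult_right_mono_neg) auto
    finally show ?thesis by (simp add: c_def)
  qed
  then show ?thesis using y by (intro exI[of _ "sqrt y"]) auto
qed

text \<open>The segment from the origin to a low multiple of a function that is not almost
  everywhere nonpositive crosses a peak.\<close>

lemma nehari_nonempty: "nehari \<noteq> {}"
proof -
  obtain u where u: "u \<in> W" "\<not> (AE x in M. u x \<le> 0)" using nontrivial by blast
  note [measurable] = W_meas[OF u(1)] sq_int_meas[OF pos_part_sq[OF u(1)]]
  have "nsq M (pos_part u) \<noteq> 0"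
  proof
    assume "nsq M (pos_part u) = 0"
    then have "AE x in M. (norm (pos_part u x))\<^sup>2 = 0"
      unfolding nsq_def
      by (subst (asm) integral_nonneg_eq_0_iff_AE) (use sq_int_integrable[OF pos_part_sq[OF u(1)]] in auto)
    then have "AE x in M. u x \<le> 0" by eventually_elim (auto simp: pos_part_def max_def split: if_splits)
    then show False using u(2) by blast
  qed
  then have "nsq M (pos_part u) > 0" using nsq_nonneg[of M "pos_part u"] by linarith
  from exists_low[OF this D_nonneg[of u]] u(1)
  obtain K where K: "K > 0" "E (\<lambda>x. K * u x) < - lam * C1" by blast
  have "\<exists>t\<in>{0..1}. (\<lambda>x. t * K * u x) \<in> nehari"
  proof (rule crossing[OF is_path_line[OF u(1)]])
    show "beyond (\<lambda>x. 1 * K * u x)" using low_imp_beyond[OF W_scale[OF u(1)] K(2)] by simp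
  qed simp
  then show ?thesis by blast
qed

lemma nehari_A: assumes "u \<in> nehari" shows "A u \<ge> a\<^sup>2 / 2"
proof -
  have "0 \<le> lam * (\<integral>x. exp (u x) \<partial>M)" using lam_pos exp_integral_nonneg[of u] by simp
  then show ?thesis using nehari_E[OF assms] unfolding E_def by linarith
qed

text \<open>Comparison of a peak with its double: 3/2 A u is at most \<lambda> times the integral of
  exp (2 u) - exp u, and the integrand is at most the positive part times exp (2 u). As A is bounded
  below on peaks, the positive part cannot be small.\<close>

lemma nehari_pos_part: "\<exists>\<delta>>0. \<forall>u\<in>nehari. D u \<le> B \<longrightarrow> \<delta> \<le> nsq M (pos_part u)"
proof -
  obtain C4 where C4: "\<forall>u\<in>W. nsq M (G u) \<le> B \<longrightarrow> integrable M (\<lambda>x. exp (4 * u x)) \<and> (\<integral>x. exp (4 * u x) \<partial>M) \<le> C4"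
    using trudinger[of B 4] by blast
  define L where "L = \<bar>C4\<bar> + 1"
  have L: "L > 0" by (simp add: L_def)
  define d where "d = 3 / 4 * a\<^sup>2 / (lam * sqrt L)"
  have d: "d > 0" using a_pos lam_pos L by (simp add: d_def)
  have "d\<^sup>2 \<le> nsq M (pos_part u)" if u: "u \<in> nehari" "D u \<le> B" for u
  proof -
    have uW: "u \<in> W" using u by (simp add: nehari_def)
    note [measurable] = W_meas[OF uW] sq_int_meas[OF pos_part_sq[OF uW]]
    have i4: "integrable M (\<lambda>x. exp (4 * u x))" by (rule exp_int[OF uW])
    have e4: "(exp (2 * u x))\<^sup>2 = exp (4 * u x)" for x by (simp add: exp_double[symmetric])
    have es: "sq_int M (\<lambda>x. exp (2 * u x))" using i4 unfolding sq_int_def by (simp add: e4)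
    have en: "nsq M (\<lambda>x. exp (2 * u x)) \<le> L"
    proof -
      have "nsq M (\<lambda>x. exp (2 * u x)) = (\<integral>x. exp (4 * u x) \<partial>M)" by (simp add: nsq_def e4)
      also have "\<dots> \<le> C4" using C4 uW u(2) by (simp add: D_def)
      finally show ?thesis by (simp add: L_def)
    qed
    have "E (\<lambda>x. 2 * u x) \<le> E u" using u by (simp add: nehari_def)
    then have "3/2 * A u \<le> lam * ((\<integral>x. exp (2 * u x) \<partial>M) - (\<integral>x. exp (u x) \<partial>M))"
      unfolding E_scale[OF uW] by (simp add: E_def algebra_simps)
    also have "(\<integral>x. exp (2 * u x) \<partial>M) - (\<integral>x. exp (u x) \<partial>M) = (\<integral>x. exp (2 * u x) - exp (1 * u x) \<partial>M)"
      using exp_int[OF uW, of 2] exp_int[OF uW, of 1] by simp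
    also have "\<dots> \<le> (\<integral>x. norm (pos_part u x) * norm (exp (2 * u x)) \<partial>M)"
    proof (intro integral_mono Bochner_Integration.integrable_diff exp_int uW sq_int_mult_integrable pos_part_sq es)
      fix x
      show "exp (2 * u x) - exp (1 * u x) \<le> norm (pos_part u x) * norm (exp (2 * u x))"
      proof (cases "u x \<ge> 0")
        case True
        have "exp (2 * u x) * (1 + (- u x)) \<le> exp (2 * u x) * exp (- u x)"
          by (intro mult_left_mono exp_ge_add_one_self) auto
        also have "\<dots> = exp (u x)" by (simp add: exp_add[symmetric])
        finally show ?thesis using True by (simp add: pos_part_def algebra_simps)
      next
        case False
        then have "exp (2 * u x) \<le> exp (u x)" by simp
        then have "exp (2 * u x) - exp (1 * u x) \<le> 0" by simp
        also have "0 \<le> norm (pos_part u x) * norm (exp (2 * u x))" by simp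
        finally show ?thesis .
      qed
    qed
    also have "\<dots> \<le> sqrt (nsq M (pos_part u)) * sqrt (nsq M (\<lambda>x. exp (2 * u x)))"
      by (rule Cauchy_Schwarz_integral[OF pos_part_sq[OF uW] es])
    also have "\<dots> \<le> sqrt (nsq M (pos_part u)) * sqrt L" using en by (intro mult_left_mono) auto
    finally have "3/2 * A u \<le> lam * (sqrt (nsq M (pos_part u)) * sqrt L)" using lam_pos by simp
    moreover have "3 / 4 * a\<^sup>2 \<le> 3/2 * A u" using nehari_A[OF u(1)] by simp
    ultimately have "3 / 4 * a\<^sup>2 \<le> sqrt (nsq M (pos_part u)) * (lam * sqrt L)" by (simp add: mult_ac)
    then have "d \<le> sqrt (nsq M (pos_part u))" unfolding d_def using lam_pos L by (subst pos_divide_le_eq) auto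
    then have "d\<^sup>2 \<le> (sqrt (nsq M (pos_part u)))\<^sup>2" using d by (intro power_mono) auto
    then show ?thesis by simp
  qed
  then show ?thesis using d by (intro exI[of _ "d\<^sup>2"]) auto
qed

text \<open>Comparison of a peak with its half: \<lambda> times the integral of exp u is at most 3/8
  A u plus a remainder that is partly absorbed, which leaves a positive share of 1/2 A u in the
  energy.\<close>

lemma nehari_bound: assumes "u \<in> nehari" shows "A u \<le> 14 * E u + 32 * (lam * measure M (space M))"
proof -
  have uW: "u \<in> W" using assms by (simp add: nehari_def)
  have "E (\<lambda>x. (1/2) * u x) \<le> E u" using assms unfolding nehari_def by (auto simp del: times_divide_eq_left)
  then have 1: "lam * (\<integral>x. exp (u x) \<partial>M) \<le> 3/8 * A u + lam * (\<integral>x. exp ((1/2) * u x) \<partial>M)"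
    unfolding E_scale[OF uW] by (simp add: E_def power2_eq_square)
  have "(\<integral>x. exp ((1/2) * u x) \<partial>M) \<le> (\<integral>x. 1/8 * exp (1 * u x) + 2 \<partial>M)"
  proof (intro integral_mono Bochner_Integration.integrable_add integrable_mult_right exp_int uW)
    fix x
    have "exp (1 * u x) = (exp ((1/2) * u x))\<^sup>2" by (simp add: exp_double[symmetric])
    moreover have "y \<le> 1/8 * y\<^sup>2 + 2" for y :: real
      using zero_le_power2[of "y - 4"] by (simp add: power2_eq_square algebra_simps)
    ultimately show "exp ((1/2) * u x) \<le> 1/8 * exp (1 * u x) + 2" by presburger
  qed simp
  also have "\<dots> = 1/8 * (\<integral>x. exp (u x) \<partial>M) + 2 * measure M (space M)"
    using exp_int[OF uW, of 1] by simp
  finally have "lam * (\<integral>x. exp ((1/2) * u x) \<partial>M) \<le> lam * (1/8 * (\<integral>x. exp (u x) \<partial>M) + 2 * measure M (space M))"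
    using lam_pos by simp
  then have "lam * (\<integral>x. exp ((1/2) * u x) \<partial>M) \<le> 1/8 * (lam * (\<integral>x. exp (u x) \<partial>M)) + 2 * (lam * measure M (space M))"
    by (simp add: algebra_simps)
  note 2 = this
  \<comment> \<open>Elimination of x: 7/8 x \<le> 3/8 p + 2 z, hence 1/2 p - x \<ge> p/14 - 16/7 z,
    which is where 14 and 32 come from.\<close>
  have gen: "p \<le> 14 * (1/2 * p - x) + 32 * z" if "x \<le> 3/8 * p + y" "y \<le> 1/8 * x + 2 * z" for p x y z :: real
    using that by (simp add: field_simps)
  show ?thesis unfolding E_def by (rule gen[OF 1 2])
qed

lemma Psi_int:
  assumes f: "sq_int M f" and g: "sq_int M g"
  shows "integrable M (\<lambda>x. Psi (f x, g x))"
proof -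
  have "integrable M (\<lambda>x. (F (f x))\<^sup>2 / 2 + (F (g x))\<^sup>2 / 2 - (F ((1/2) *\<^sub>R (f x + g x)))\<^sup>2)"
    by (intro Bochner_Integration.integrable_diff Bochner_Integration.integrable_add integrable_divide
      F_sq_integrable f g sq_int_scaleR sq_int_add)
  then show ?thesis by (simp only: Psi_def prod.case)
qed

lemma A_midpoint:
  assumes u: "u \<in> W" and v: "v \<in> W"
  shows "A (\<lambda>x. (1/2) * u x + (1/2) * v x) = 1/2 * A u + 1/2 * A v - (\<integral>x. Psi (G u x, G v x) \<partial>M)"
proof -
  have m: "integrable M (\<lambda>x. (F ((1/2) *\<^sub>R (G u x + G v x)))\<^sup>2)"
    by (intro F_sq_integrable sq_int_scaleR sq_int_add G_sq u v)
  have "(\<integral>x. Psi (G u x, G v x) \<partial>M) =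
    (\<integral>x. (F (G u x))\<^sup>2 / 2 + (F (G v x))\<^sup>2 / 2 - (F ((1/2) *\<^sub>R (G u x + G v x)))\<^sup>2 \<partial>M)"
    by (simp only: Psi_def prod.case)
  also have "\<dots> = (\<integral>x. (F (G u x))\<^sup>2 / 2 + (F (G v x))\<^sup>2 / 2 \<partial>M) - (\<integral>x. (F ((1/2) *\<^sub>R (G u x + G v x)))\<^sup>2 \<partial>M)"
    by (intro Bochner_Integration.integral_diff m Bochner_Integration.integrable_add integrable_divide A_int u v)
  also have "(\<integral>x. (F (G u x))\<^sup>2 / 2 + (F (G v x))\<^sup>2 / 2 \<partial>M) = 1/2 * A u + 1/2 * A v"
    unfolding A_def using A_int[OF u] A_int[OF v] by simp
  also have "(\<integral>x. (F ((1/2) *\<^sub>R (G u x + G v x)))\<^sup>2 \<partial>M) = A (\<lambda>x. (1/2) * u x + (1/2) * v x)"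
    unfolding A_lin[OF u v] by (simp only: scaleR_add_right)
  finally show ?thesis by simp
qed

lemma D_midpoint:
  assumes u: "u \<in> W" "D u \<le> B" and v: "v \<in> W" "D v \<le> B"
  shows "D (\<lambda>x. (1/2) * u x + (1/2) * v x) \<le> B"
proof -
  have "D (\<lambda>x. (1/2) * u x + (1/2) * v x) \<le> 2 * nsq M (\<lambda>x. (1/2) *\<^sub>R G u x) + 2 * nsq M (\<lambda>x. (1/2) *\<^sub>R G v x)"
    unfolding D_def nsq_G_lin[OF u(1) v(1)] by (intro nsq_le_add sq_int_scaleR G_sq u v)
  also have "\<dots> = 1/2 * D u + 1/2 * D v" unfolding nsq_scaleR D_def by (simp add: power2_eq_square)
  finally show ?thesis using u(2) v(2) by linarith
qed

text \<open>For two almost minimizing elements that are close in \<open>L\<^sup>2\<close>, the ray through their midpoint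
  crosses \<open>nehari\<close> within a bounded distance, so the uniform convexity defect \<open>Psi\<close> must be small.\<close>

lemma midpoint_defect:
  assumes c: "\<And>v. v \<in> nehari \<Longrightarrow> c \<le> E v" and B: "B > 0"
  shows "\<exists>\<delta>>0. \<exists>C\<ge>0. \<exists>q>0. \<forall>u\<in>nehari. \<forall>v\<in>nehari. D u \<le> B \<longrightarrow> D v \<le> B \<longrightarrow> nsq M (\<lambda>x. u x - v x) \<le> \<delta> \<longrightarrow>
    q * (\<integral>x. Psi (G u x, G v x) \<partial>M) \<le> 1/2 * E u + 1/2 * E v - c + C * sqrt (nsq M (\<lambda>x. u x - v x))"
proof -
  obtain \<delta> where \<delta>: "\<delta> > 0" "\<forall>u\<in>nehari. D u \<le> B \<longrightarrow> \<delta> \<le> nsq M (pos_part u)" using nehari_pos_part by blast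
  have "\<delta> / 4 > 0" "B \<ge> 0" using \<delta> B by auto
  from exists_low[OF this] obtain K where K: "K > 0"
    "\<forall>u\<in>W. D u \<le> B \<longrightarrow> \<delta> / 4 \<le> nsq M (pos_part u) \<longrightarrow> E (\<lambda>x. K * u x) < - lam * C1" by blast
  obtain C where C: "C \<ge> 0" "\<forall>u\<in>W. \<forall>v\<in>W. \<forall>t. D u \<le> B \<longrightarrow> D v \<le> B \<longrightarrow> 0 \<le> t \<longrightarrow> t \<le> K \<longrightarrow>
    \<bar>(\<integral>x. exp (t * u x) \<partial>M) - (\<integral>x. exp (t * v x) \<partial>M)\<bar> \<le> C * sqrt (nsq M (\<lambda>x. u x - v x))"
    using exp_integral_lipschitz[OF less_imp_le[OF K(1)], of B] by blast
  define q where "q = a\<^sup>2 / (4 * (b\<^sup>2 * B))"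
  have q: "q > 0" using a_pos b_pos B by (simp add: q_def)
  have main: "q * (\<integral>x. Psi (G u x, G v x) \<partial>M) \<le> 1/2 * E u + 1/2 * E v - c + (lam * C) * sqrt (nsq M (\<lambda>x. u x - v x))"
    if u: "u \<in> nehari" "D u \<le> B" and v: "v \<in> nehari" "D v \<le> B" and uv: "nsq M (\<lambda>x. u x - v x) \<le> \<delta>" for u v
  proof -
    have uW: "u \<in> W" and vW: "v \<in> W" using u v by (auto simp: nehari_def)
    define w where "w = (\<lambda>x. (1/2) * u x + (1/2) * v x)"
    have wW: "w \<in> W" unfolding w_def by (rule W_lin[OF uW vW])
    have Dw: "D w \<le> B" unfolding w_def by (rule D_midpoint[OF uW u(2) vW v(2)])
    have nu: "nsq M (\<lambda>x. u x - w x) = 1/4 * nsq M (\<lambda>x. u x - v x)"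
    proof -
      have "(\<lambda>x. u x - w x) = (\<lambda>x. (1/2) *\<^sub>R (u x - v x))" by (auto simp: w_def field_simps)
      then show ?thesis by (simp only: nsq_scaleR) (simp add: power2_eq_square)
    qed
    have nv: "nsq M (\<lambda>x. v x - w x) = 1/4 * nsq M (\<lambda>x. u x - v x)"
    proof -
      have "(\<lambda>x. v x - w x) = (\<lambda>x. (-1/2) *\<^sub>R (u x - v x))" by (auto simp: w_def field_simps)
      then show ?thesis by (simp only: nsq_scaleR) (simp add: power2_eq_square)
    qed
    \<comment> \<open>The midpoint differs from u by half of u - v, and taking positive parts does
      not enlarge distances; so \<delta> \<le> 2 (\<delta>/4) plus twice the mass of w, which leaves
      a quarter.\<close>
    have ppw: "\<delta> / 4 \<le> nsq M (pos_part w)"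
    proof -
      have d: "sq_int M (\<lambda>x. pos_part u x - pos_part w x)" by (intro sq_int_diff pos_part_sq uW wW)
      have "\<delta> \<le> nsq M (\<lambda>x. (pos_part u x - pos_part w x) + pos_part w x)" using \<delta>(2) u by simp
      also have "\<dots> \<le> 2 * nsq M (\<lambda>x. pos_part u x - pos_part w x) + 2 * nsq M (pos_part w)"
        by (rule nsq_le_add[OF d pos_part_sq[OF wW]])
      also have "nsq M (\<lambda>x. pos_part u x - pos_part w x) \<le> nsq M (\<lambda>x. u x - w x)"
        unfolding nsq_def
        by (intro integral_mono sq_int_integrable[OF d] sq_int_integrable[OF sq_int_diff[OF W_sq[OF uW] W_sq[OF wW]]] power_mono)
          (auto simp: pos_part_def max_def)
      finally show ?thesis using nu uv by simp
    qed
    have low: "E (\<lambda>x. K * w x) < - lam * C1" using K(2) wW Dw ppw by blast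
    have "\<exists>t\<in>{0..1}. (\<lambda>x. t * K * w x) \<in> nehari"
    proof (rule crossing[OF is_path_line[OF wW]])
      show "beyond (\<lambda>x. 1 * K * w x)" using low_imp_beyond[OF W_scale[OF wW] low] by simp
    qed simp
    then obtain t where t: "t \<in> {0..1}" "(\<lambda>x. t * K * w x) \<in> nehari" by blast
    define \<tau> where "\<tau> = t * K"
    have \<tau>: "0 \<le> \<tau>" "\<tau> \<le> K" "(\<lambda>x. \<tau> * w x) \<in> nehari"
      using t K(1) by (auto simp: \<tau>_def mult_left_le_one_le)
    \<comment> \<open>The peak on the ray of the midpoint has energy at least a^2/4, so it cannot be
      close to the origin; this bounds \<tau> from below.\<close>
    have q\<tau>: "q \<le> 1/2 * \<tau>\<^sup>2"
    proof -
      have "a\<^sup>2 / 4 \<le> b\<^sup>2 / 2 * (\<tau>\<^sup>2 * D w)"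
        using nehari_E[OF \<tau>(3)] E_le_D[OF W_scale[OF wW], of \<tau>] unfolding D_scale[OF wW] by linarith
      also have "\<dots> \<le> b\<^sup>2 / 2 * (\<tau>\<^sup>2 * B)" using Dw by (intro mult_left_mono) auto
      finally have "a\<^sup>2 \<le> (1/2 * \<tau>\<^sup>2) * (4 * (b\<^sup>2 * B))" by (simp add: algebra_simps)
      then show ?thesis unfolding q_def using b_pos B by (subst pos_divide_le_eq) auto
    qed
    define S where "S = sqrt (nsq M (\<lambda>x. u x - v x))"
    have S2: "sqrt (1/4 * nsq M (\<lambda>x. u x - v x)) \<le> S" unfolding S_def
      by (intro real_sqrt_le_mono) simp
    have ku: "\<bar>(\<integral>x. exp (\<tau> * u x) \<partial>M) - (\<integral>x. exp (\<tau> * w x) \<partial>M)\<bar> \<le> C * S"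
      using C(2)[rule_format, OF uW wW u(2) Dw \<tau>(1,2)] mult_left_mono[OF S2 C(1)] unfolding nu by linarith
    have kv: "\<bar>(\<integral>x. exp (\<tau> * v x) \<partial>M) - (\<integral>x. exp (\<tau> * w x) \<partial>M)\<bar> \<le> C * S"
      using C(2)[rule_format, OF vW wW v(2) Dw \<tau>(1,2)] mult_left_mono[OF S2 C(1)] unfolding nv by linarith
    have kk: "1/2 * (\<integral>x. exp (\<tau> * u x) \<partial>M) + 1/2 * (\<integral>x. exp (\<tau> * v x) \<partial>M) - (\<integral>x. exp (\<tau> * w x) \<partial>M) \<le> C * S"
      using ku kv by linarith
    define I where "I = (\<integral>x. Psi (G u x, G v x) \<partial>M)"
    have I: "I \<ge> 0" unfolding I_def by (intro integral_nonneg_AE) (simp add: Psi_nonneg)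
    have Aw: "A w = 1/2 * A u + 1/2 * A v - I" unfolding w_def I_def by (rule A_midpoint[OF uW vW])
    \<comment> \<open>The infimum is tested at the peak of the midpoint's ray; replacing \<tau> u
      and \<tau> v by u and v can only raise the energy, both being peaks.\<close>
    have "c \<le> E (\<lambda>x. \<tau> * w x)" by (rule c[OF \<tau>(3)])
    also have "\<dots> = 1/2 * E (\<lambda>x. \<tau> * u x) + 1/2 * E (\<lambda>x. \<tau> * v x) - 1/2 * \<tau>\<^sup>2 * I
        + lam * (1/2 * (\<integral>x. exp (\<tau> * u x) \<partial>M) + 1/2 * (\<integral>x. exp (\<tau> * v x) \<partial>M) - (\<integral>x. exp (\<tau> * w x) \<partial>M))"
      unfolding E_scale[OF uW] E_scale[OF vW] E_scale[OF wW] Aw by (simp add: algebra_simps)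
    also have "\<dots> \<le> 1/2 * E u + 1/2 * E v - q * I + lam * (C * S)"
    proof -
      have "E (\<lambda>x. \<tau> * u x) \<le> E u" "E (\<lambda>x. \<tau> * v x) \<le> E v" using u v \<tau>(1) by (auto simp: nehari_def)
      moreover have "q * I \<le> 1/2 * \<tau>\<^sup>2 * I" using q\<tau> I by (intro mult_right_mono) auto
      moreover have "lam * (1/2 * (\<integral>x. exp (\<tau> * u x) \<partial>M) + 1/2 * (\<integral>x. exp (\<tau> * v x) \<partial>M) - (\<integral>x. exp (\<tau> * w x) \<partial>M)) \<le> lam * (C * S)"
        using kk lam_pos by (intro mult_left_mono) auto
      ultimately show ?thesis by linarith
    qed
    finally show ?thesis unfolding I_def S_def by (simp add: mult.assoc)
  qed
  have "lam * C \<ge> 0" using lam_pos C(1) by simp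
  then show ?thesis using \<delta>(1) q main by blast
qed

lemma minimizer: "\<exists>u\<in>nehari. \<forall>v\<in>nehari. E u \<le> E v"
proof -
  define c where "c = Inf (E ` nehari)"
  have bdd: "bdd_below (E ` nehari)" using nehari_E by (intro bdd_belowI2)
  have c: "c \<le> E v" if "v \<in> nehari" for v unfolding c_def by (rule cInf_lower[OF _ bdd]) (use that in simp)
  have "\<exists>u. u \<in> nehari \<and> E u < c + 1 / Suc n" for n
  proof -
    have "Inf (E ` nehari) < c + 1 / Suc n" by (simp add: c_def)
    then show ?thesis using cInf_lessD[of "E ` nehari" "c + 1 / Suc n"] nehari_nonempty by blast
  qed
  then obtain U where U: "\<And>n. U n \<in> nehari" "\<And>n. E (U n) < c + 1 / Suc n" by metis
  define B where "B = (14 * (\<bar>c\<bar> + 1) + 32 * (lam * measure M (space M))) / a\<^sup>2"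
  have B: "B > 0" unfolding B_def using a_pos lam_pos mm_pos by (intro divide_pos_pos add_pos_pos) auto
  have UB: "D (U n) \<le> B" for n
  proof -
    have uW: "U n \<in> W" using U(1)[of n] by (simp add: nehari_def)
    have "1 / real (Suc n) \<le> 1" by simp
    then have "E (U n) \<le> \<bar>c\<bar> + 1" using U(2)[of n] by linarith
    then have "a\<^sup>2 * D (U n) \<le> 14 * (\<bar>c\<bar> + 1) + 32 * (lam * measure M (space M))"
      using nehari_bound[OF U(1)[of n]] A_lower[OF uW] by (simp add: algebra_simps)
    then show ?thesis unfolding B_def using a_pos by (subst pos_le_divide_eq) (auto simp: mult.commute)
  qed
  have UW: "U n \<in> W" for n using U(1)[of n] by (simp add: nehari_def)
  from rellich[of U B, OF UW UB[unfolded D_def]] obtain r :: "nat \<Rightarrow> nat" where r: "strict_mono r"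
    "\<forall>e>0. \<exists>N. \<forall>m\<ge>N. \<forall>n\<ge>N. nsq M (\<lambda>x. U (r m) x - U (r n) x) < e" by blast
  define V where "V n = U (r n)" for n
  have V: "V n \<in> nehari" "V n \<in> W" "D (V n) \<le> B" for n using U UW UB by (auto simp: V_def)
  have VE: "E (V n) < c + 1 / Suc n" for n
  proof -
    have "real (Suc n) \<le> real (Suc (r n))" using seq_suble[OF r(1), of n] by simp
    then have "1 / real (Suc (r n)) \<le> 1 / real (Suc n)" by (intro divide_left_mono) auto
    then show ?thesis using U(2)[of "r n"] unfolding V_def by linarith
  qed
  have Vc: "\<exists>N. \<forall>m\<ge>N. \<forall>n\<ge>N. nsq M (\<lambda>x. V m x - V n x) < e" if "e > 0" for e
    using r(2) that by (simp add: V_def)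
  from midpoint_defect[OF c B] obtain \<delta> C q where dC: "\<delta> > 0" "C \<ge> 0" "q > 0"
    and def: "\<forall>u\<in>nehari. \<forall>v\<in>nehari. D u \<le> B \<longrightarrow> D v \<le> B \<longrightarrow> nsq M (\<lambda>x. u x - v x) \<le> \<delta> \<longrightarrow>
    q * (\<integral>x. Psi (G u x, G v x) \<partial>M) \<le> 1/2 * E u + 1/2 * E v - c + C * sqrt (nsq M (\<lambda>x. u x - v x))"
    by blast
  have cau: "\<exists>N. \<forall>m\<ge>N. \<forall>n\<ge>N. nsq M (\<lambda>x. V m x - V n x) < e \<and> nsq M (\<lambda>x. G (V m) x - G (V n) x) < e"
    if e: "e > 0" for e
  proof -
    \<comment> \<open>Half of e is spent on the modulus of convexity, where the gradients contribute
      at most 2 B, and a quarter on the defect.\<close>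
    define \<epsilon> where "\<epsilon> = e / (4 * B)"
    have \<epsilon>: "\<epsilon> > 0" using e B by (simp add: \<epsilon>_def)
    obtain \<kappa> where \<kappa>: "\<kappa> \<ge> 0" "\<forall>x y. (norm (x - y))\<^sup>2 \<le> \<epsilon> * ((norm x)\<^sup>2 + (norm y)\<^sup>2) + \<kappa> * Psi (x, y)"
      using Psi_modulus[OF \<epsilon>] by blast
    \<comment> \<open>The summand 1 keeps \<open>L\<close> positive when \<kappa> = 0.\<close>
    define L where "L = \<kappa> / q * (1 + C) + 1"
    have L0: "\<kappa> / q * (1 + C) \<ge> 0" using \<kappa>(1) dC by simp
    have L: "L > 0" using L0 by (simp add: L_def)
    define \<eta> where "\<eta> = e / (4 * L)"
    have \<eta>: "\<eta> > 0" using e L by (simp add: \<eta>_def)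
    obtain N1 where N1: "\<forall>m\<ge>N1. \<forall>n\<ge>N1. nsq M (\<lambda>x. V m x - V n x) < min (min e \<delta>) (\<eta>\<^sup>2)"
      using Vc[of "min (min e \<delta>) (\<eta>\<^sup>2)"] e dC \<eta> by auto
    obtain N2 where N2: "1 / real (Suc N2) < \<eta>" using nat_approx_posE[OF \<eta>] by blast
    have "nsq M (\<lambda>x. V m x - V n x) < e \<and> nsq M (\<lambda>x. G (V m) x - G (V n) x) < e"
      if mn: "m \<ge> max N1 N2" "n \<ge> max N1 N2" for m n
    proof -
      have n1: "nsq M (\<lambda>x. V m x - V n x) < min (min e \<delta>) (\<eta>\<^sup>2)" using N1 mn by simp
      have En: "E (V k) < c + \<eta>" if "k \<ge> max N1 N2" for k
      proof -
        have "1 / real (Suc k) \<le> 1 / real (Suc N2)" using that by (intro divide_left_mono) auto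
        then show ?thesis using VE[of k] N2 by linarith
      qed
      have sq: "sqrt (nsq M (\<lambda>x. V m x - V n x)) \<le> \<eta>"
        using n1 \<eta> by (intro real_le_lsqrt) auto
      define I where "I = (\<integral>x. Psi (G (V m) x, G (V n) x) \<partial>M)"
      have "q * I \<le> 1/2 * E (V m) + 1/2 * E (V n) - c + C * sqrt (nsq M (\<lambda>x. V m x - V n x))"
        unfolding I_def using def V n1 by simp
      also have "\<dots> \<le> \<eta> + C * \<eta>"
        using En[OF mn(1)] En[OF mn(2)] mult_left_mono[OF sq dC(2)] by linarith
      finally have "I \<le> (1 + C) * \<eta> / q" using dC(3) by (simp add: field_simps)
      then have "\<kappa> * I \<le> \<kappa> * ((1 + C) * \<eta> / q)" using \<kappa>(1) by (rule mult_left_mono)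
      also have "\<dots> = (\<kappa> / q * (1 + C)) * \<eta>" by simp
      also have "\<dots> \<le> L * \<eta>" using \<eta> by (intro mult_right_mono) (auto simp: L_def)
      also have "\<dots> = e / 4" using L by (simp add: \<eta>_def)
      finally have kI: "\<kappa> * I \<le> e / 4" .
      have "nsq M (\<lambda>x. G (V m) x - G (V n) x) \<le>
        (\<integral>x. \<epsilon> * ((norm (G (V m) x))\<^sup>2 + (norm (G (V n) x))\<^sup>2) + \<kappa> * Psi (G (V m) x, G (V n) x) \<partial>M)"
        unfolding nsq_def
        by (intro integral_mono sq_int_integrable sq_int_diff Bochner_Integration.integrable_add integrable_mult_right Psi_int G_sq V)
          (use \<kappa>(2) in blast)
      also have "\<dots> = \<epsilon> * (D (V m) + D (V n)) + \<kappa> * I"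
        unfolding I_def D_def nsq_def
        using sq_int_integrable[OF G_sq[OF V(2)]] Psi_int[OF G_sq[OF V(2)] G_sq[OF V(2)]]
        by simp
      also have "\<dots> \<le> \<epsilon> * (2 * B) + e / 4"
        using V(3)[of m] V(3)[of n] \<epsilon> kI by (intro add_mono mult_left_mono) auto
      also have "\<dots> = e / 2 + e / 4" using B by (simp add: \<epsilon>_def)
      finally show ?thesis using n1 e by simp
    qed
    then show ?thesis by blast
  qed
  from W_complete[of V, OF V(2) cau] obtain u where u: "u \<in> W" "W_conv V u" unfolding W_conv_def by blast
  have lim: "(\<lambda>n. E (V n)) \<longlonglongrightarrow> E u" by (rule E_W_conv[OF V(2) u])
  have Eu: "E u \<le> c"
  proof (rule LIMSEQ_le[OF lim])
    show "(\<lambda>n. c + 1 / Suc n) \<longlonglongrightarrow> c"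
      using tendsto_add[OF tendsto_const[of c] LIMSEQ_inverse_real_of_nat] by (simp add: inverse_eq_divide)
  qed (use VE in \<open>auto intro!: exI[of _ 0] less_imp_le\<close>)
  have Em: "E u \<ge> a\<^sup>2 / 4"
    by (rule LIMSEQ_le_const[OF lim]) (use nehari_E[OF V(1)] in auto)
  \<comment> \<open>The lower bound a^2/4 for peaks persists in the limit and keeps it away from the
    origin.\<close>
  have Du: "D u > 0"
  proof (rule ccontr)
    assume "\<not> D u > 0"
    then have "D u = 0" using D_nonneg[of u] by linarith
    from E_zero_D[OF u(1) this, of 1] have "E u = E0" by simp
    moreover have "0 \<le> a\<^sup>2 / 4" by simp
    ultimately show False using Em E0_neg by linarith
  qed
  have "E (\<lambda>x. t * u x) \<le> E u" if "t \<ge> 0" for t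
  proof (rule LIMSEQ_le[OF _ lim])
    show "(\<lambda>n. E (\<lambda>x. t * V n x)) \<longlonglongrightarrow> E (\<lambda>x. t * u x)"
      by (intro E_W_conv W_scale V(2) u(1) W_conv_scale u(2))
    show "\<exists>N. \<forall>n\<ge>N. E (\<lambda>x. t * V n x) \<le> E (V n)" using V(1) that by (auto simp: nehari_def)
  qed
  then have "u \<in> nehari" using u(1) Du by (simp add: nehari_def)
  then show ?thesis using Eu c by (meson order_trans)
qed

end

section \<open>The first variation at a minimizing peak\<close>

context mountain_pass
begin

text \<open>The derivative in direction v at t u + s v. Both parameters are kept because a bent ray
  moves in both of them.\<close>

definition dE :: "('a \<Rightarrow> real) \<Rightarrow> ('a \<Rightarrow> real) \<Rightarrow> real \<Rightarrow> real \<Rightarrow> real" where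
  "dE u v t s = (\<integral>x. P (t *\<^sub>R G u x + s *\<^sub>R G v x) \<bullet> G v x \<partial>M) - lam * (\<integral>x. exp (t * u x + s * v x) * v x \<partial>M)"

lemma P_dot_bound:
  assumes "\<bar>t\<bar> \<le> T" "\<bar>s\<bar> \<le> S"
  shows "\<bar>P (t *\<^sub>R p + s *\<^sub>R q) \<bullet> q\<bar> \<le> b\<^sup>2 * (T * (norm p * norm q) + S * (norm q * norm q))"
proof -
  have "\<bar>P (t *\<^sub>R p + s *\<^sub>R q) \<bullet> q\<bar> \<le> norm (P (t *\<^sub>R p + s *\<^sub>R q)) * norm q" by (rule Cauchy_Schwarz_ineq2)
  also have "\<dots> \<le> (b\<^sup>2 * norm (t *\<^sub>R p + s *\<^sub>R q)) * norm q" by (intro mult_right_mono P_bound) simp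
  also have "\<dots> \<le> (b\<^sup>2 * (T * norm p + S * norm q)) * norm q"
  proof (intro mult_right_mono mult_left_mono)
    have "norm (t *\<^sub>R p + s *\<^sub>R q) \<le> \<bar>t\<bar> * norm p + \<bar>s\<bar> * norm q"
      using norm_triangle_ineq[of "t *\<^sub>R p" "s *\<^sub>R q"] by simp
    also have "\<dots> \<le> T * norm p + S * norm q" using assms by (intro add_mono mult_right_mono) auto
    finally show "norm (t *\<^sub>R p + s *\<^sub>R q) \<le> T * norm p + S * norm q" .
  qed auto
  finally show ?thesis by (simp add: algebra_simps)
qed

lemma exp_dot_bound:
  fixes t s p q T S :: real
  assumes "\<bar>t\<bar> \<le> T" "\<bar>s\<bar> \<le> S"
  shows "\<bar>exp (t * p + s * q) * q\<bar> \<le> exp (T * \<bar>p\<bar> + (S + 1) * \<bar>q\<bar>)"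
proof -
  have "t * p + s * q \<le> \<bar>t * p\<bar> + \<bar>s * q\<bar>" by linarith
  also have "\<dots> \<le> T * \<bar>p\<bar> + S * \<bar>q\<bar>" unfolding abs_mult using assms by (intro add_mono mult_right_mono) auto
  finally have "exp (t * p + s * q) \<le> exp (T * \<bar>p\<bar> + S * \<bar>q\<bar>)" by simp
  then have "exp (t * p + s * q) * \<bar>q\<bar> \<le> exp (T * \<bar>p\<bar> + S * \<bar>q\<bar>) * exp \<bar>q\<bar>"
    by (intro mult_mono abs_le_exp_abs) auto
  also have "\<dots> = exp (T * \<bar>p\<bar> + (S + 1) * \<bar>q\<bar>)" by (simp add: exp_add[symmetric] algebra_simps)
  finally show ?thesis by (simp add: abs_mult)
qed

lemma P_dot_int:
  assumes u: "u \<in> W" and v: "v \<in> W"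
  shows "integrable M (\<lambda>x. b\<^sup>2 * (T * (norm (G u x) * norm (G v x)) + S * (norm (G v x) * norm (G v x))))"
  by (intro integrable_mult_right Bochner_Integration.integrable_add sq_int_mult_integrable G_sq u v)

text \<open>Differentiation under the integral, dominated by products of gradient norms in the first
  term and by an exponential of |u| and |v| in the second.\<close>

lemma E_line_deriv:
  assumes u: "u \<in> W" and v: "v \<in> W"
  shows "((\<lambda>s. E (\<lambda>x. t * u x + s * v x)) has_real_derivative dE u v t s) (at s)"
proof -
  note [measurable] = W_meas[OF u] W_meas[OF v] G_meas[OF u] G_meas[OF v]
  have 1: "((\<lambda>s. \<integral>x. (F (t *\<^sub>R G u x + s *\<^sub>R G v x))\<^sup>2 / 2 \<partial>M) has_real_derivative
      (\<integral>x. P (t *\<^sub>R G u x + s *\<^sub>R G v x) \<bullet> G v x \<partial>M)) (at s)"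
  proof (rule DERIV_integral_dominated[where d=1, OF _ _ _ _ P_dot_int[OF u v, of "\<bar>t\<bar>" "\<bar>s\<bar> + 1"]])
    show "((\<lambda>s. (F (t *\<^sub>R G u x + s *\<^sub>R G v x))\<^sup>2 / 2) has_real_derivative P (t *\<^sub>R G u x + r *\<^sub>R G v x) \<bullet> G v x) (at r)" for r x
      by (rule half_F_sq_line_deriv)
    show "integrable M (\<lambda>x. (F (t *\<^sub>R G u x + r *\<^sub>R G v x))\<^sup>2 / 2)" for r
      by (intro integrable_divide F_sq_integrable sq_int_lin G_sq u v)
    show "(\<lambda>x. P (t *\<^sub>R G u x + s *\<^sub>R G v x) \<bullet> G v x) \<in> borel_measurable M" by measurable
    show "\<bar>P (t *\<^sub>R G u x + r *\<^sub>R G v x) \<bullet> G v x\<bar> \<le> b\<^sup>2 * (\<bar>t\<bar> * (norm (G u x) * norm (G v x)) + (\<bar>s\<bar> + 1) * (norm (G v x) * norm (G v x)))"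
      if "\<bar>r - s\<bar> < 1" for r x by (rule P_dot_bound) (use that in auto)
  qed simp
  have 2: "((\<lambda>s. \<integral>x. exp (t * u x + s * v x) \<partial>M) has_real_derivative (\<integral>x. exp (t * u x + s * v x) * v x \<partial>M)) (at s)"
  proof (rule DERIV_integral_dominated[where d=1, OF _ _ _ _ exp_abs_int2[OF u v, of "\<bar>t\<bar>" "(\<bar>s\<bar> + 1) + 1"]])
    show "((\<lambda>s. exp (t * u x + s * v x)) has_real_derivative exp (t * u x + r * v x) * v x) (at r)" for r x
      by (auto intro!: derivative_eq_intros)
    show "integrable M (\<lambda>x. exp (t * u x + r * v x))" for r
      using exp_int[OF W_lin[OF u v, of t r], of 1] by simp
    show "\<bar>exp (t * u x + r * v x) * v x\<bar> \<le> exp (\<bar>t\<bar> * \<bar>u x\<bar> + ((\<bar>s\<bar> + 1) + 1) * \<bar>v x\<bar>)"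
      if "\<bar>r - s\<bar> < 1" for r x by (rule exp_dot_bound) (use that in auto)
  qed auto
  have "(\<lambda>s. E (\<lambda>x. t * u x + s * v x)) = (\<lambda>s. (\<integral>x. (F (t *\<^sub>R G u x + s *\<^sub>R G v x))\<^sup>2 / 2 \<partial>M) - lam * (\<integral>x. exp (t * u x + s * v x) \<partial>M))"
    by (simp add: E_def A_lin[OF u v])
  then show ?thesis unfolding dE_def
    using DERIV_diff[OF 1 DERIV_cmult[OF 2, of lam]] by simp
qed

text \<open>Joint continuity, so that a negative derivative at the peak stays negative in a
  neighbourhood within the plane spanned by u and v.\<close>

lemma dE_cont:
  assumes u: "u \<in> W" and v: "v \<in> W" and t: "t \<longlonglongrightarrow> t0" and s: "s \<longlonglongrightarrow> s0"
  shows "(\<lambda>n. dE u v (t n) (s n)) \<longlonglongrightarrow> dE u v t0 s0"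
proof -
  note [measurable] = W_meas[OF u] W_meas[OF v] G_meas[OF u] G_meas[OF v]
  obtain T where T: "\<And>n. \<bar>t n\<bar> \<le> T" using convergent_imp_Bseq[OF convergentI[OF t]] by (auto simp: Bseq_def)
  obtain S where S: "\<And>n. \<bar>s n\<bar> \<le> S" using convergent_imp_Bseq[OF convergentI[OF s]] by (auto simp: Bseq_def)
  have Pc: "isCont P z" for z using P_continuous by (simp add: continuous_on_eq_continuous_at)
  have 1: "(\<lambda>n. \<integral>x. P (t n *\<^sub>R G u x + s n *\<^sub>R G v x) \<bullet> G v x \<partial>M) \<longlonglongrightarrow> (\<integral>x. P (t0 *\<^sub>R G u x + s0 *\<^sub>R G v x) \<bullet> G v x \<partial>M)"
  proof (rule integral_dominated_convergence[OF _ _ P_dot_int[OF u v, of T S]])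
    show "AE x in M. (\<lambda>n. P (t n *\<^sub>R G u x + s n *\<^sub>R G v x) \<bullet> G v x) \<longlonglongrightarrow> P (t0 *\<^sub>R G u x + s0 *\<^sub>R G v x) \<bullet> G v x"
    proof (rule AE_I2)
      fix x
      have "(\<lambda>n. t n *\<^sub>R G u x + s n *\<^sub>R G v x) \<longlonglongrightarrow> t0 *\<^sub>R G u x + s0 *\<^sub>R G v x" by (intro tendsto_intros t s)
      from isCont_tendsto_compose[OF Pc this]
      show "(\<lambda>n. P (t n *\<^sub>R G u x + s n *\<^sub>R G v x) \<bullet> G v x) \<longlonglongrightarrow> P (t0 *\<^sub>R G u x + s0 *\<^sub>R G v x) \<bullet> G v x"
        by (intro tendsto_inner tendsto_const)
    qed
    show "AE x in M. norm (P (t n *\<^sub>R G u x + s n *\<^sub>R G v x) \<bullet> G v x) \<le> b\<^sup>2 * (T * (norm (G u x) * norm (G v x)) + S * (norm (G v x) * norm (G v x)))" for n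
      unfolding real_norm_def by (intro AE_I2 P_dot_bound T S)
  qed measurable
  have 2: "(\<lambda>n. \<integral>x. exp (t n * u x + s n * v x) * v x \<partial>M) \<longlonglongrightarrow> (\<integral>x. exp (t0 * u x + s0 * v x) * v x \<partial>M)"
  proof (rule integral_dominated_convergence[OF _ _ exp_abs_int2[OF u v, of T "S + 1"]])
    show "AE x in M. (\<lambda>n. exp (t n * u x + s n * v x) * v x) \<longlonglongrightarrow> exp (t0 * u x + s0 * v x) * v x"
      by (intro AE_I2 tendsto_intros t s)
    show "AE x in M. norm (exp (t n * u x + s n * v x) * v x) \<le> exp (T * \<bar>u x\<bar> + (S + 1) * \<bar>v x\<bar>)" for n
      unfolding real_norm_def by (intro AE_I2 exp_dot_bound T S)
  qed measurable
  show ?thesis unfolding dE_def by (intro tendsto_intros 1 2)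
qed

text \<open>With two equal maxima on a ray, the energy at their midpoint would not exceed the first
  one, so \<open>E_shape\<close> would force a strict drop before the second.\<close>

lemma nehari_strict:
  assumes u: "u \<in> nehari" and t: "t \<ge> 0" "t \<noteq> 1" shows "E (\<lambda>x. t * u x) < E u"
proof (rule ccontr)
  assume n: "\<not> E (\<lambda>x. t * u x) < E u"
  have uW: "u \<in> W" "D u > 0" and max: "\<And>s. s \<ge> 0 \<Longrightarrow> E (\<lambda>x. s * u x) \<le> E u" using u by (auto simp: nehari_def)
  have eq: "E (\<lambda>x. t * u x) = E u" using n max[OF t(1)] by linarith
  have pos: "E0 < E u" using nehari_E[OF u] E0_neg zero_le_power2[of a] by linarith
  have t0: "t \<noteq> 0" using eq pos by (auto simp: E0_def)
  define p q where "p = min t 1" and "q = max t 1"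
  have pq: "0 < p" "p < q" using t t0 by (auto simp: p_def q_def min_def max_def)
  have Ep: "E (\<lambda>x. p * u x) = E u" and Eq: "E (\<lambda>x. q * u x) = E u" using eq by (auto simp: p_def q_def min_def max_def)
  have m: "p < (p + q) / 2" "(p + q) / 2 < q" using pq by auto
  have "E (\<lambda>x. q * u x) < E (\<lambda>x. ((p + q) / 2) * u x)"
    by (rule E_shape[OF uW pq(1) m]) (use Ep pos max[of "(p + q) / 2"] pq in auto)
  moreover have "0 \<le> (p + q) / 2" using pq by simp
  ultimately show False using Eq max[of "(p + q) / 2"] by linarith
qed

text \<open>An end point for the ray through u. That R differs from 1, because a peak has
  nonnegative energy, leaves room to bend the ray near u and keep its end fixed.\<close>

lemma nehari_far:
  assumes u: "u \<in> nehari" shows "\<exists>R>0. R \<noteq> 1 \<and> E (\<lambda>x. R * u x) < - lam * C1"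
proof -
  obtain \<delta> where \<delta>: "\<delta> > 0" "\<forall>w\<in>nehari. D w \<le> D u \<longrightarrow> \<delta> \<le> nsq M (pos_part w)" using nehari_pos_part by blast
  from exists_low[OF \<delta>(1) D_nonneg[of u]] obtain K where K: "K > 0"
    "\<forall>w\<in>W. D w \<le> D u \<longrightarrow> \<delta> \<le> nsq M (pos_part w) \<longrightarrow> E (\<lambda>x. K * w x) < - lam * C1" by blast
  have uW: "u \<in> W" using u by (simp add: nehari_def)
  have "\<delta> \<le> nsq M (pos_part u)" using \<delta>(2) u by blast
  then have low: "E (\<lambda>x. K * u x) < - lam * C1" using K(2) uW by blast
  have "K \<noteq> 1"
  proof
    assume "K = 1"
    then have "E u < - lam * C1" using low by simp
    then have "E u < 0" using low_le_E0 E0_neg by linarith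
    moreover have "0 \<le> a\<^sup>2 / 4" by simp
    ultimately show False using nehari_E[OF u] by linarith
  qed
  then show ?thesis using K(1) low by blast
qed

text \<open>If the derivative at a minimizer were negative in some direction, bending the ray through
  the minimizer in that direction near its peak would give a path avoiding \<open>nehari\<close>.\<close>

lemma minimizer_dE_nonneg:
  assumes u: "u \<in> nehari" and min: "\<And>w. w \<in> nehari \<Longrightarrow> E u \<le> E w" and v: "v \<in> W"
  shows "dE u v 1 0 \<ge> 0"
proof (rule ccontr)
  assume "\<not> dE u v 1 0 \<ge> 0"
  then have neg: "dE u v 1 0 < 0" by simp
  have uW: "u \<in> W" using u by (simp add: nehari_def)
  have "\<exists>d>0. \<forall>t s. \<bar>t - 1\<bar> < d \<longrightarrow> \<bar>s\<bar> < d \<longrightarrow> dE u v t s < 0"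
  proof (rule ccontr)
    assume "\<not> ?thesis"
    then have "\<forall>n. \<exists>t s. \<bar>t - 1\<bar> < 1 / real (Suc n) \<and> \<bar>s\<bar> < 1 / real (Suc n) \<and> \<not> dE u v t s < 0"
      by (metis of_nat_0_less_iff zero_less_Suc zero_less_divide_1_iff)
    then obtain t s where ts: "\<And>n. \<bar>t n - 1\<bar> < 1 / real (Suc n)" "\<And>n. \<bar>s n\<bar> < 1 / real (Suc n)"
      "\<And>n. \<not> dE u v (t n) (s n) < 0" by metis
    have z: "(\<lambda>n. 1 / real (Suc n)) \<longlonglongrightarrow> 0" using LIMSEQ_inverse_real_of_nat by (simp add: inverse_eq_divide)
    have "(\<lambda>n. t n - 1) \<longlonglongrightarrow> 0" by (rule Lim_null_comparison[OF _ z]) (intro always_eventually allI, use ts(1) in \<open>simp add: less_imp_le\<close>)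
    then have t1: "t \<longlonglongrightarrow> 1" by (simp add: LIM_zero_iff)
    have s0: "s \<longlonglongrightarrow> 0" by (rule Lim_null_comparison[OF _ z]) (intro always_eventually allI, use ts(2) in \<open>simp add: less_imp_le\<close>)
    have "0 \<le> dE u v 1 0"
      by (rule LIMSEQ_le_const[OF dE_cont[OF uW v t1 s0]]) (use ts(3) in \<open>auto simp: not_less\<close>)
    then show False using neg by simp
  qed
  then obtain d where d: "d > 0" "\<And>t s. \<bar>t - 1\<bar> < d \<Longrightarrow> \<bar>s\<bar> < d \<Longrightarrow> dE u v t s < 0" by blast
  obtain R where R: "R > 0" "R \<noteq> 1" "E (\<lambda>x. R * u x) < - lam * C1" using nehari_far[OF u] by blast
  \<comment> \<open>Below d, so that the derivative is negative on the bend; below 1, so that the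
    bend vanishes at the origin; at most |R - 1|, so that it vanishes at the end point.\<close>
  define e where "e = min (min (d / 2) (1 / 2)) \<bar>R - 1\<bar>"
  have e: "e > 0" "e < d" "e < 1" "e \<le> \<bar>R - 1\<bar>" using d(1) R(2) by (auto simp: e_def min_def)
  \<comment> \<open>A tent over the peak t = 1, positive exactly within distance e of it.\<close>
  define \<eta> where "\<eta> t = max 0 (1 - \<bar>t - 1\<bar> / e)" for t
  have \<eta>_le: "\<eta> t \<le> 1" "\<eta> t \<ge> 0" for t using e(1) by (auto simp: \<eta>_def)
  have \<eta>0: "\<eta> t = 0" if "\<bar>t - 1\<bar> \<ge> e" for t using that e(1) by (simp add: \<eta>_def max_def)
  define \<gamma> where "\<gamma> \<tau> x = (\<tau> * R) * u x + (e * \<eta> (\<tau> * R)) * v x" for \<tau> x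
  have c1: "continuous_on {0..1} (\<lambda>\<tau>. \<tau> * R)" by (intro continuous_intros)
  have c2: "continuous_on {0..1} (\<lambda>\<tau>. e * \<eta> (\<tau> * R))"
    unfolding \<eta>_def using e(1) by (intro continuous_intros) auto
  have p: "is_path \<gamma>" unfolding \<gamma>_def[abs_def] by (rule is_path_lincomb[OF uW v c1 c2])
  have g0: "\<gamma> 0 = (\<lambda>x. 0)" using \<eta>0[of 0] e(3) by (simp add: \<gamma>_def fun_eq_iff)
  have g1: "\<gamma> 1 = (\<lambda>x. R * u x)" using \<eta>0[of R] e(4) by (simp add: \<gamma>_def fun_eq_iff)
  obtain \<tau> where \<tau>: "\<tau> \<in> {0..1}" "\<gamma> \<tau> \<in> nehari"
    using crossing[OF p g0] low_imp_beyond[OF W_scale[OF uW] R(3)] unfolding g1 by blast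
  define t where "t = \<tau> * R"
  have t: "t \<ge> 0" using \<tau>(1) R(1) by (simp add: t_def)
  have Eg: "E (\<gamma> \<tau>) = E (\<lambda>x. t * u x + (e * \<eta> t) * v x)" by (simp add: \<gamma>_def[abs_def] t_def)
  \<comment> \<open>Off the bend the path follows the ray, whose peak is strict; on the bend the
    energy falls below that of t u, which is at most that of u.\<close>
  have "E (\<gamma> \<tau>) < E u"
  proof (cases "\<bar>t - 1\<bar> < e")
    case False
    then have z: "\<eta> t = 0" using \<eta>0[of t] by simp
    have "t \<noteq> 1" using False e(1) by auto
    then show ?thesis unfolding Eg z using nehari_strict[OF u t] by simp
  next
    case True
    have pos: "0 < e * \<eta> t" using True e(1) by (simp add: \<eta>_def)
    have le: "e * \<eta> t \<le> e" using \<eta>_le(1)[of t] e(1) by (simp add: mult_left_le)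
    from MVT2[OF pos, of "\<lambda>s. E (\<lambda>x. t * u x + s * v x)" "dE u v t"] E_line_deriv[OF uW v]
    obtain z where z: "0 < z" "z < e * \<eta> t"
      "E (\<lambda>x. t * u x + (e * \<eta> t) * v x) - E (\<lambda>x. t * u x + 0 * v x) = (e * \<eta> t - 0) * dE u v t z" by blast
    have "dE u v t z < 0" using d(2)[of t z] True e(2) z le by linarith
    then have "(e * \<eta> t - 0) * dE u v t z < 0" using pos by (simp add: mult_pos_neg)
    then have "E (\<gamma> \<tau>) < E (\<lambda>x. t * u x)" using z(3) unfolding Eg by simp
    also have "\<dots> \<le> E u" using u t by (simp add: nehari_def)
    finally show ?thesis .
  qed
  then show False using min[OF \<tau>(2)] by simp
qed

text \<open>The inequality is used in the directions v and -v.\<close>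

lemma minimizer_dE:
  assumes u: "u \<in> nehari" and min: "\<And>w. w \<in> nehari \<Longrightarrow> E u \<le> E w" and v: "v \<in> W"
  shows "dE u v 1 0 = 0"
proof (rule antisym)
  have uW: "u \<in> W" using u by (simp add: nehari_def)
  have vW: "(\<lambda>x. (-1) * v x) \<in> W" by (rule W_scale[OF v])
  note [measurable] = W_meas[OF uW] W_meas[OF v] G_meas[OF uW] G_meas[OF v] G_meas[OF vW]
  have g: "AE x in M. G (\<lambda>x. (-1) * v x) x = - G v x" using G_scale[OF v, of "-1"] by simp
  have "(\<integral>x. P (G u x) \<bullet> G (\<lambda>x. (-1) * v x) x \<partial>M) = (\<integral>x. - (P (G u x) \<bullet> G v x) \<partial>M)"
  proof (rule integral_cong_AE)
    show "AE x in M. P (G u x) \<bullet> G (\<lambda>x. (-1) * v x) x = - (P (G u x) \<bullet> G v x)"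
      using g by eventually_elim simp
  qed measurable
  then have "dE u (\<lambda>x. (-1) * v x) 1 0 = - dE u v 1 0" by (simp add: dE_def)
  then show "dE u v 1 0 \<le> 0" using minimizer_dE_nonneg[OF u min vW] by simp
qed (rule minimizer_dE_nonneg[OF u min v])

text \<open>The minimax value is described without suprema and infima: every admissible path reaches
  the level of u, and the straight path stays below it, since it runs along the ray whose peak is
  u.\<close>

theorem mountain_pass_solution:
  "\<exists>u\<in>W. \<exists>w\<in>W. E w \<le> E0 \<and> E0 < E u \<and> (\<forall>v\<in>W. dE u v 1 0 = 0) \<and>
     (\<forall>\<gamma>. is_path \<gamma> \<longrightarrow> \<gamma> 0 = (\<lambda>x. 0) \<longrightarrow> \<gamma> 1 = w \<longrightarrow> (\<exists>t\<in>{0..1}. E u \<le> E (\<gamma> t))) \<and>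
     (\<exists>\<gamma>. is_path \<gamma> \<and> \<gamma> 0 = (\<lambda>x. 0) \<and> \<gamma> 1 = w \<and> (\<forall>t\<in>{0..1}. E (\<gamma> t) \<le> E u))"
proof -
  obtain u where u: "u \<in> nehari" and min: "\<And>v. v \<in> nehari \<Longrightarrow> E u \<le> E v" using minimizer by blast
  have uW: "u \<in> W" using u by (simp add: nehari_def)
  obtain R where R: "R > 0" "E (\<lambda>x. R * u x) < - lam * C1" using nehari_far[OF u] by blast
  define w where "w = (\<lambda>x. R * u x)"
  have wW: "w \<in> W" unfolding w_def by (rule W_scale[OF uW])
  have bw: "beyond w" unfolding w_def by (rule low_imp_beyond[OF W_scale[OF uW] R(2)])
  have 1: "E w \<le> E0" using R(2) low_le_E0 unfolding w_def by linarith
  have 2: "E0 < E u" using nehari_E[OF u] E0_neg zero_le_power2[of a] by linarith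
  have 3: "\<forall>v\<in>W. dE u v 1 0 = 0" using minimizer_dE[OF u min] by blast
  have 4: "\<exists>t\<in>{0..1}. E u \<le> E (\<gamma> t)" if "is_path \<gamma>" "\<gamma> 0 = (\<lambda>x. 0)" "\<gamma> 1 = w" for \<gamma>
    using crossing[OF that(1,2)] bw min unfolding that(3) by blast
  have 5: "\<forall>t\<in>{0..1}. E (\<lambda>x. t * R * u x) \<le> E u" using u R(1) by (auto simp: nehari_def)
  have 6: "is_path (\<lambda>t x. t * R * u x)" by (rule is_path_line[OF uW])
  have 7: "(\<lambda>x. 0 * R * u x) = (\<lambda>x. 0)" "(\<lambda>x. 1 * R * u x) = w" by (auto simp: w_def)
  show ?thesis using uW wW 1 2 3 4 5 6 7 by blast
qed

end

section \<open>The Sobolev space of the domain satisfies the abstract properties\<close>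

context planar_domain
begin

lemma W0_lin_ex:
  assumes u: "u \<in> W0 \<Omega>" and v: "v \<in> W0 \<Omega>"
  shows "(\<lambda>x. s * u x + t * v x) \<in> W0 \<Omega>"
    "weak_grad \<Omega> (\<lambda>x. s * u x + t * v x) (\<lambda>x. s *\<^sub>R wgrad \<Omega> u x + t *\<^sub>R wgrad \<Omega> v x)"
proof -
  note U = W0_props[OF u] and V = W0_props[OF v]
  have sq: "sq_int MO (\<lambda>x. s * u x + t * v x)" using sq_int_lin[OF U(1) V(1), of s t] by simp
  have sg: "sq_int MO (\<lambda>x. s *\<^sub>R wgrad \<Omega> u x + t *\<^sub>R wgrad \<Omega> v x)" by (rule sq_int_lin[OF U(2) V(2)])
  show wg: "weak_grad \<Omega> (\<lambda>x. s * u x + t * v x) (\<lambda>x. s *\<^sub>R wgrad \<Omega> u x + t *\<^sub>R wgrad \<Omega> v x)"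
  proof (rule weak_gradI[OF sq sg])
    fix \<phi> i assume \<phi>: "test_fn \<Omega> \<phi>"
    note i = sq_int_mult_real(1)[OF U(1) tf_sq(2)[OF \<phi>, of i]] sq_int_mult_real(1)[OF V(1) tf_sq(2)[OF \<phi>, of i]]
      sq_int_mult_real(1)[OF comp_sq_int[OF U(2), of i] tf_sq(1)[OF \<phi>]] sq_int_mult_real(1)[OF comp_sq_int[OF V(2), of i] tf_sq(1)[OF \<phi>]]
    have "(\<integral>x. (s * u x + t * v x) * pd i \<phi> x \<partial>MO) = (\<integral>x. s * (u x * pd i \<phi> x) + t * (v x * pd i \<phi> x) \<partial>MO)"
      by (simp add: algebra_simps)
    also have "\<dots> = s * (\<integral>x. u x * pd i \<phi> x \<partial>MO) + t * (\<integral>x. v x * pd i \<phi> x \<partial>MO)"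
      using i by simp
    also have "\<dots> = - (s * (\<integral>x. wgrad \<Omega> u x $ i * \<phi> x \<partial>MO) + t * (\<integral>x. wgrad \<Omega> v x $ i * \<phi> x \<partial>MO))"
      using weak_gradD[OF U(3) \<phi>, of i] weak_gradD[OF V(3) \<phi>, of i] by simp
    also have "s * (\<integral>x. wgrad \<Omega> u x $ i * \<phi> x \<partial>MO) + t * (\<integral>x. wgrad \<Omega> v x $ i * \<phi> x \<partial>MO) =
      (\<integral>x. s * (wgrad \<Omega> u x $ i * \<phi> x) + t * (wgrad \<Omega> v x $ i * \<phi> x) \<partial>MO)" using i by simp
    also have "\<dots> = (\<integral>x. (s *\<^sub>R wgrad \<Omega> u x + t *\<^sub>R wgrad \<Omega> v x) $ i * \<phi> x \<partial>MO)" by (simp add: algebra_simps)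
    finally show "(\<integral>x. (s * u x + t * v x) * pd i \<phi> x \<partial>MO) = - (\<integral>x. (s *\<^sub>R wgrad \<Omega> u x + t *\<^sub>R wgrad \<Omega> v x) $ i * \<phi> x \<partial>MO)" .
  qed
  obtain \<phi> where \<phi>: "approx \<phi> u (wgrad \<Omega> u)" using W0_approx[OF u] by blast
  obtain \<psi> where \<psi>: "approx \<psi> v (wgrad \<Omega> v)" using W0_approx[OF v] by blast
  have t1: "test_fn \<Omega> (\<phi> n)" and t2: "test_fn \<Omega> (\<psi> n)" for n using \<phi> \<psi> by (auto simp: approx_def)
  have cg: "classical_grad (\<lambda>x. s * \<phi> n x + t * \<psi> n x) x = s *\<^sub>R classical_grad (\<phi> n) x + t *\<^sub>R classical_grad (\<psi> n) x" for n x
    by (simp add: vec_eq_iff pd_lin[OF test_fn_smooth[OF t1] test_fn_smooth[OF t2]])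
  have b: "nsq MO (\<lambda>x. (s *\<^sub>R f x + t *\<^sub>R g x) - (s *\<^sub>R f' x + t *\<^sub>R g' x)) \<le> 2 * (s\<^sup>2 * nsq MO (\<lambda>x. f x - f' x)) + 2 * (t\<^sup>2 * nsq MO (\<lambda>x. g x - g' x))"
    if "sq_int MO f" "sq_int MO f'" "sq_int MO g" "sq_int MO g'" for f f' g g' :: "R2 \<Rightarrow> 'b::euclidean_space"
  proof -
    have "(\<lambda>x. (s *\<^sub>R f x + t *\<^sub>R g x) - (s *\<^sub>R f' x + t *\<^sub>R g' x)) = (\<lambda>x. s *\<^sub>R (f x - f' x) + t *\<^sub>R (g x - g' x))"
      by (simp add: algebra_simps)
    then show ?thesis
      using nsq_le_add[OF sq_int_scaleR[OF sq_int_diff[OF that(1,2)], of s] sq_int_scaleR[OF sq_int_diff[OF that(3,4)], of t]]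
      unfolding nsq_scaleR by simp
  qed
  have lim: "(\<lambda>n. 2 * (s\<^sup>2 * p n) + 2 * (t\<^sup>2 * q n)) \<longlonglongrightarrow> 0" if "p \<longlonglongrightarrow> 0" "q \<longlonglongrightarrow> 0" for p q :: "nat \<Rightarrow> real"
    using that by (auto intro!: tendsto_eq_intros)
  have ap: "approx (\<lambda>n x. s * \<phi> n x + t * \<psi> n x) (\<lambda>x. s * u x + t * v x) (\<lambda>x. s *\<^sub>R wgrad \<Omega> u x + t *\<^sub>R wgrad \<Omega> v x)"
    unfolding approx_def
  proof (intro conjI allI)
    show "test_fn \<Omega> (\<lambda>x. s * \<phi> n x + t * \<psi> n x)" for n by (rule test_fn_lin[OF t1 t2])
    show "(\<lambda>n. nsq MO (\<lambda>x. s * \<phi> n x + t * \<psi> n x - (s * u x + t * v x))) \<longlonglongrightarrow> 0"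
    proof (rule tendsto_sandwich[OF _ _ tendsto_const])
      show "(\<lambda>n. 2 * (s\<^sup>2 * nsq MO (\<lambda>x. \<phi> n x - u x)) + 2 * (t\<^sup>2 * nsq MO (\<lambda>x. \<psi> n x - v x))) \<longlonglongrightarrow> 0"
        using \<phi> \<psi> by (intro lim) (auto simp: approx_def)
      show "\<forall>\<^sub>F n in sequentially. nsq MO (\<lambda>x. s * \<phi> n x + t * \<psi> n x - (s * u x + t * v x)) \<le>
          2 * (s\<^sup>2 * nsq MO (\<lambda>x. \<phi> n x - u x)) + 2 * (t\<^sup>2 * nsq MO (\<lambda>x. \<psi> n x - v x))"
        using b[OF tf_sq(1)[OF t1] U(1) tf_sq(1)[OF t2] V(1)] by simp
    qed simp
    show "(\<lambda>n. nsq MO (\<lambda>x. classical_grad (\<lambda>x. s * \<phi> n x + t * \<psi> n x) x - (s *\<^sub>R wgrad \<Omega> u x + t *\<^sub>R wgrad \<Omega> v x))) \<longlonglongrightarrow> 0"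
      unfolding cg
    proof (rule tendsto_sandwich[OF _ _ tendsto_const])
      show "(\<lambda>n. 2 * (s\<^sup>2 * nsq MO (\<lambda>x. classical_grad (\<phi> n) x - wgrad \<Omega> u x)) + 2 * (t\<^sup>2 * nsq MO (\<lambda>x. classical_grad (\<psi> n) x - wgrad \<Omega> v x))) \<longlonglongrightarrow> 0"
        using \<phi> \<psi> by (intro lim) (auto simp: approx_def)
      show "\<forall>\<^sub>F n in sequentially. nsq MO (\<lambda>x. s *\<^sub>R classical_grad (\<phi> n) x + t *\<^sub>R classical_grad (\<psi> n) x - (s *\<^sub>R wgrad \<Omega> u x + t *\<^sub>R wgrad \<Omega> v x)) \<le>
          2 * (s\<^sup>2 * nsq MO (\<lambda>x. classical_grad (\<phi> n) x - wgrad \<Omega> u x)) + 2 * (t\<^sup>2 * nsq MO (\<lambda>x. classical_grad (\<psi> n) x - wgrad \<Omega> v x))"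
        using b[OF cg_sq(1)[OF t1] U(2) cg_sq(1)[OF t2] V(2)] by simp
    qed simp
  qed
  show "(\<lambda>x. s * u x + t * v x) \<in> W0 \<Omega>"
  proof (rule W0_I[OF _ _ sq wg sg ap])
    show "(\<lambda>x. s * u x + t * v x) \<in> borel_measurable lebesgue" using U(5) V(5) by measurable
  qed (simp add: U(4) V(4))
qed

lemma W0_approx_eps:
  assumes u: "u \<in> W0 \<Omega>" and e: "e > 0"
  shows "\<exists>\<phi>. test_fn \<Omega> \<phi> \<and> nsq MO (\<lambda>x. \<phi> x - u x) < e \<and> nsq MO (\<lambda>x. classical_grad \<phi> x - wgrad \<Omega> u x) < e"
proof -
  obtain \<phi> where \<phi>: "approx \<phi> u (wgrad \<Omega> u)" using W0_approx[OF u] by blast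
  have "\<forall>\<^sub>F n in sequentially. nsq MO (\<lambda>x. \<phi> n x - u x) < e"
    "\<forall>\<^sub>F n in sequentially. nsq MO (\<lambda>x. classical_grad (\<phi> n) x - wgrad \<Omega> u x) < e"
    using \<phi> e unfolding approx_def by (auto intro: order_tendstoD)
  then have "\<forall>\<^sub>F n in sequentially. nsq MO (\<lambda>x. \<phi> n x - u x) < e \<and> nsq MO (\<lambda>x. classical_grad (\<phi> n) x - wgrad \<Omega> u x) < e"
    by (rule eventually_conj)
  then obtain n where "nsq MO (\<lambda>x. \<phi> n x - u x) < e \<and> nsq MO (\<lambda>x. classical_grad (\<phi> n) x - wgrad \<Omega> u x) < e"
    using eventually_happens by force
  then show ?thesis using \<phi> unfolding approx_def by blast
qed

text \<open>One test function per element with an error tied to the index; this takes the place of a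
  diagonal argument in the two limit procedures below.\<close>

lemma W0_approx_seq:
  assumes U: "\<And>n. U n \<in> W0 \<Omega>"
  shows "\<exists>\<phi>. \<forall>n. test_fn \<Omega> (\<phi> n) \<and> nsq MO (\<lambda>x. \<phi> n x - U n x) < inverse (real (Suc n)) \<and>
    nsq MO (\<lambda>x. classical_grad (\<phi> n) x - wgrad \<Omega> (U n) x) < inverse (real (Suc n))"
proof (rule choice, intro allI)
  fix n
  have "inverse (real (Suc n)) > 0" by simp
  from W0_approx_eps[OF U[of n] this]
  show "\<exists>\<phi>. test_fn \<Omega> \<phi> \<and> nsq MO (\<lambda>x. \<phi> x - U n x) < inverse (real (Suc n)) \<and>
    nsq MO (\<lambda>x. classical_grad \<phi> x - wgrad \<Omega> (U n) x) < inverse (real (Suc n))" .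
qed

lemma inverse_Suc_tendsto: "(\<lambda>n. c * inverse (real (Suc n))) \<longlonglongrightarrow> 0"
  using tendsto_mult_right_zero[OF LIMSEQ_inverse_real_of_nat, of c] .

text \<open>Functions and gradients converge separately. The defining identity of the weak gradient
  is continuous in both, so it passes to the limits, and the test functions attached to the sequence
  approximate the limit.\<close>

lemma W0_complete:
  assumes U: "\<And>n. U n \<in> W0 \<Omega>"
    and C: "\<And>e. e > 0 \<Longrightarrow> \<exists>N. \<forall>m\<ge>N. \<forall>n\<ge>N. nsq MO (\<lambda>x. U m x - U n x) < e \<and> nsq MO (\<lambda>x. wgrad \<Omega> (U m) x - wgrad \<Omega> (U n) x) < e"
  shows "\<exists>u\<in>W0 \<Omega>. (\<lambda>n. nsq MO (\<lambda>x. U n x - u x)) \<longlonglongrightarrow> 0 \<and> (\<lambda>n. nsq MO (\<lambda>x. wgrad \<Omega> (U n) x - wgrad \<Omega> u x)) \<longlonglongrightarrow> 0"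
proof -
  note P = W0_props[OF U]
  have "\<exists>f. sq_int MO f \<and> (\<lambda>n. nsq MO (\<lambda>x. U n x - f x)) \<longlonglongrightarrow> 0"
    by (rule sq_int_complete[OF P(1)]) (use C in blast)
  then obtain f where f: "sq_int MO f" "(\<lambda>n. nsq MO (\<lambda>x. U n x - f x)) \<longlonglongrightarrow> 0" by blast
  have "\<exists>g. sq_int MO g \<and> (\<lambda>n. nsq MO (\<lambda>x. wgrad \<Omega> (U n) x - g x)) \<longlonglongrightarrow> 0"
    by (rule sq_int_complete[OF P(2)]) (use C in blast)
  then obtain g where g: "sq_int MO g" "(\<lambda>n. nsq MO (\<lambda>x. wgrad \<Omega> (U n) x - g x)) \<longlonglongrightarrow> 0" by blast
  \<comment> \<open>The limit is set to zero outside the domain, as \<open>W0\<close>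
    demands.\<close>
  define u where "u x = indicator \<Omega> x *\<^sub>R f x" for x
  have um: "u \<in> borel_measurable lebesgue"
    unfolding u_def[abs_def] using sq_int_meas[OF f(1)] meas_MO[of f] by (simp add: set_borel_measurable_def)
  have eqO: "u x = f x" if "x \<in> space MO" for x using that by (simp add: u_def space_MO)
  have umo: "u \<in> borel_measurable MO" using sq_int_meas[OF f(1)] measurable_cong[of MO u f borel] eqO by blast
  have AEu: "AE x in MO. f x = u x" using eqO by (intro AE_I2) simp
  have us: "sq_int MO u" by (rule sq_int_cong_AE[OF f(1) umo AEu])
  have ud: "nsq MO (\<lambda>x. h x - u x) = nsq MO (\<lambda>x. h x - f x)" for h
    unfolding nsq_def by (intro Bochner_Integration.integral_cong refl) (simp add: eqO)
  have ul: "(\<lambda>n. nsq MO (\<lambda>x. U n x - u x)) \<longlonglongrightarrow> 0" unfolding ud by (rule f(2))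
  have conv: "(\<lambda>n. \<integral>x. h n x * k x \<partial>MO) \<longlonglongrightarrow> (\<integral>x. h' x * k x \<partial>MO)"
    if h: "\<And>n. sq_int MO (h n)" "sq_int MO h'" "(\<lambda>n. nsq MO (\<lambda>x. h n x - h' x)) \<longlonglongrightarrow> 0" and k: "sq_int MO k"
    for h :: "nat \<Rightarrow> R2 \<Rightarrow> real" and h' k
  proof -
    have "(\<lambda>n. (\<integral>x. h n x * k x \<partial>MO) - (\<integral>x. h' x * k x \<partial>MO)) \<longlonglongrightarrow> 0"
    proof (rule Lim_null_comparison)
      show "\<forall>\<^sub>F n in sequentially. norm ((\<integral>x. h n x * k x \<partial>MO) - (\<integral>x. h' x * k x \<partial>MO)) \<le> sqrt (nsq MO (\<lambda>x. h n x - h' x)) * sqrt (nsq MO k)"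
      proof (intro always_eventually allI)
        fix n
        have "(\<integral>x. h n x * k x \<partial>MO) - (\<integral>x. h' x * k x \<partial>MO) = (\<integral>x. (h n x - h' x) * k x \<partial>MO)"
          using Bochner_Integration.integral_diff[OF sq_int_mult_real(1)[OF h(1)[of n] k] sq_int_mult_real(1)[OF h(2) k]] by (simp add: left_diff_distrib)
        then show "norm ((\<integral>x. h n x * k x \<partial>MO) - (\<integral>x. h' x * k x \<partial>MO)) \<le> sqrt (nsq MO (\<lambda>x. h n x - h' x)) * sqrt (nsq MO k)"
          using sq_int_mult_real(2)[OF sq_int_diff[OF h(1)[of n] h(2)] k] by simp
      qed
      have "(\<lambda>n. sqrt (nsq MO (\<lambda>x. h n x - h' x))) \<longlonglongrightarrow> 0" using tendsto_real_sqrt[OF h(3)] by simp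
      from tendsto_mult_left_zero[OF this] show "(\<lambda>n. sqrt (nsq MO (\<lambda>x. h n x - h' x)) * sqrt (nsq MO k)) \<longlonglongrightarrow> 0" .
    qed
    then show ?thesis by (simp add: LIM_zero_iff)
  qed
  have wg: "weak_grad \<Omega> u g"
  proof (rule weak_gradI[OF us g(1)])
    fix \<phi> i assume \<phi>: "test_fn \<Omega> \<phi>"
    have 1: "(\<lambda>n. \<integral>x. U n x * pd i \<phi> x \<partial>MO) \<longlonglongrightarrow> (\<integral>x. u x * pd i \<phi> x \<partial>MO)"
      by (rule conv[OF P(1) us ul tf_sq(2)[OF \<phi>]])
    have gi: "(\<lambda>n. nsq MO (\<lambda>x. wgrad \<Omega> (U n) x $ i - g x $ i)) \<longlonglongrightarrow> 0"
    proof (rule tendsto_sandwich[OF _ _ tendsto_const g(2)])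
      show "\<forall>\<^sub>F n in sequentially. nsq MO (\<lambda>x. wgrad \<Omega> (U n) x $ i - g x $ i) \<le> nsq MO (\<lambda>x. wgrad \<Omega> (U n) x - g x)"
        using comp_nsq_le[OF sq_int_diff[OF P(2) g(1)], of _ i] by simp
    qed simp
    have 2: "(\<lambda>n. \<integral>x. wgrad \<Omega> (U n) x $ i * \<phi> x \<partial>MO) \<longlonglongrightarrow> (\<integral>x. g x $ i * \<phi> x \<partial>MO)"
      by (rule conv[OF comp_sq_int[OF P(2)] comp_sq_int[OF g(1)] gi tf_sq(1)[OF \<phi>]])
    have "(\<lambda>n. \<integral>x. U n x * pd i \<phi> x \<partial>MO) \<longlonglongrightarrow> - (\<integral>x. g x $ i * \<phi> x \<partial>MO)"
      using tendsto_minus[OF 2] weak_gradD[OF P(3) \<phi>, of _ i] by simp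
    from LIMSEQ_unique[OF 1 this] show "(\<integral>x. u x * pd i \<phi> x \<partial>MO) = - (\<integral>x. g x $ i * \<phi> x \<partial>MO)" .
  qed
  obtain \<phi> where \<phi>: "\<And>n. test_fn \<Omega> (\<phi> n)" "\<And>n. nsq MO (\<lambda>x. \<phi> n x - U n x) < inverse (real (Suc n))"
    "\<And>n. nsq MO (\<lambda>x. classical_grad (\<phi> n) x - wgrad \<Omega> (U n) x) < inverse (real (Suc n))"
    using W0_approx_seq[of U, OF U] by blast
  have tri: "nsq MO (\<lambda>x. p x - r x) \<le> 2 * nsq MO (\<lambda>x. p x - q x) + 2 * nsq MO (\<lambda>x. q x - r x)"
    if "sq_int MO p" "sq_int MO q" "sq_int MO r" for p q r :: "R2 \<Rightarrow> 'b::euclidean_space"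
    using nsq_le_add[OF sq_int_diff[OF that(1,2)] sq_int_diff[OF that(2,3)]] by simp
  have lim: "(\<lambda>n. 2 * inverse (real (Suc n)) + 2 * q n) \<longlonglongrightarrow> 0" if "q \<longlonglongrightarrow> 0" for q :: "nat \<Rightarrow> real"
    using tendsto_add[OF inverse_Suc_tendsto tendsto_mult_right_zero[OF that, of 2], of 2] by simp
  have ap: "approx \<phi> u g" unfolding approx_def
  proof (intro conjI allI)
    show "test_fn \<Omega> (\<phi> n)" for n by (rule \<phi>(1))
    show "(\<lambda>n. nsq MO (\<lambda>x. \<phi> n x - u x)) \<longlonglongrightarrow> 0"
    proof (rule tendsto_sandwich[OF _ _ tendsto_const lim[OF ul]])
      show "\<forall>\<^sub>F n in sequentially. nsq MO (\<lambda>x. \<phi> n x - u x) \<le> 2 * inverse (real (Suc n)) + 2 * nsq MO (\<lambda>x. U n x - u x)"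
      proof (intro always_eventually allI)
        fix n show "nsq MO (\<lambda>x. \<phi> n x - u x) \<le> 2 * inverse (real (Suc n)) + 2 * nsq MO (\<lambda>x. U n x - u x)"
          using tri[OF tf_sq(1)[OF \<phi>(1)[of n]] P(1)[of n] us] \<phi>(2)[of n] by linarith
      qed
    qed simp
    show "(\<lambda>n. nsq MO (\<lambda>x. classical_grad (\<phi> n) x - g x)) \<longlonglongrightarrow> 0"
    proof (rule tendsto_sandwich[OF _ _ tendsto_const lim[OF g(2)]])
      show "\<forall>\<^sub>F n in sequentially. nsq MO (\<lambda>x. classical_grad (\<phi> n) x - g x) \<le> 2 * inverse (real (Suc n)) + 2 * nsq MO (\<lambda>x. wgrad \<Omega> (U n) x - g x)"
      proof (intro always_eventually allI)
        fix n show "nsq MO (\<lambda>x. classical_grad (\<phi> n) x - g x) \<le> 2 * inverse (real (Suc n)) + 2 * nsq MO (\<lambda>x. wgrad \<Omega> (U n) x - g x)"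
          using tri[OF cg_sq(1)[OF \<phi>(1)[of n]] P(2)[of n] g(1)] \<phi>(3)[of n] by linarith
      qed
    qed simp
  qed
  have uW: "u \<in> W0 \<Omega>" by (rule W0_I[OF _ um us wg g(1) ap]) (simp add: u_def)
  have "nsq MO (\<lambda>x. wgrad \<Omega> (U n) x - wgrad \<Omega> u x) = nsq MO (\<lambda>x. wgrad \<Omega> (U n) x - g x)" for n
  proof (rule nsq_cong_AE)
    show "AE x in MO. wgrad \<Omega> (U n) x - wgrad \<Omega> u x = wgrad \<Omega> (U n) x - g x"
      using wgrad_AE[OF wg] by eventually_elim simp
    show "(\<lambda>x. wgrad \<Omega> (U n) x - wgrad \<Omega> u x) \<in> borel_measurable MO"
      by (rule sq_int_meas[OF sq_int_diff[OF P(2) wgrad_sq(1)[OF wg g(1)]]])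
    show "(\<lambda>x. wgrad \<Omega> (U n) x - g x) \<in> borel_measurable MO"
      by (rule sq_int_meas[OF sq_int_diff[OF P(2) g(1)]])
  qed
  then show ?thesis using uW ul g(2) by (intro bexI[of _ u]) auto
qed

lemma W0_poincare: assumes u: "u \<in> W0 \<Omega>" shows "nsq MO u \<le> 4 * R\<^sup>2 * nsq MO (wgrad \<Omega> u)"
proof -
  note U = W0_props[OF u]
  obtain \<phi> where \<phi>: "approx \<phi> u (wgrad \<Omega> u)" using W0_approx[OF u] by blast
  have t: "test_fn \<Omega> (\<phi> n)" for n using \<phi> by (simp add: approx_def)
  have 1: "(\<lambda>n. nsq MO (\<phi> n)) \<longlonglongrightarrow> nsq MO u"
    by (rule nsq_tendsto[OF tf_sq(1)[OF t] U(1)]) (use \<phi> in \<open>simp add: approx_def\<close>)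
  have 2: "(\<lambda>n. nsq MO (classical_grad (\<phi> n))) \<longlonglongrightarrow> nsq MO (wgrad \<Omega> u)"
    by (rule nsq_tendsto[OF cg_sq(1)[OF t] U(2)]) (use \<phi> in \<open>simp add: approx_def\<close>)
  show ?thesis
  proof (rule LIMSEQ_le[OF 1 tendsto_mult_left[OF 2]])
    have "nsq MO (\<phi> n) \<le> 4 * R\<^sup>2 * nsq MO (classical_grad (\<phi> n))" for n
      unfolding cg_sq(2)[OF t] tf_sq(3)[OF t] using R by (intro C1c_poincare[OF tf_C1c[OF t]]) simp
    then show "\<exists>N. \<forall>n\<ge>N. nsq MO (\<phi> n) \<le> 4 * R\<^sup>2 * nsq MO (classical_grad (\<phi> n))" by blast
  qed
qed

text \<open>The constant of \<open>exp_integral_bound\<close> with |p| for p, to cover exponents of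
  both signs.\<close>

definition expC :: "real \<Rightarrow> real \<Rightarrow> real" where
  "expC p B = exp (2 * \<bar>p\<bar>) * (4 * R\<^sup>2) * (1 + 2 * exp (8 * exp \<bar>p\<bar> * B))"

lemma test_exp_bound:
  assumes \<phi>: "test_fn \<Omega> \<phi>" and B: "nsq MO (classical_grad \<phi>) \<le> B"
  shows "(\<integral>\<^sup>+x. ennreal (exp (p * \<phi> x)) \<partial>MO) \<le> ennreal (expC p B)"
proof -
  \<comment> \<open>A negative exponent is handled by changing the sign of the function; the summand
    \<open>0 * \<phi> z\<close> gives the result the form of a linear combination, whose derivatives
    are known.\<close>
  define \<sigma> :: real where "\<sigma> = (if p \<ge> 0 then 1 else -1)"
  define w where "w z = \<sigma> * \<phi> z + 0 * \<phi> z" for z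
  have pw: "p * \<phi> z = \<bar>p\<bar> * w z" for z by (simp add: w_def \<sigma>_def)
  have C: "C1c R w (\<lambda>z. \<sigma> * pd 1 \<phi> z + 0 * pd 1 \<phi> z) (\<lambda>z. \<sigma> * pd 2 \<phi> z + 0 * pd 2 \<phi> z)"
    unfolding w_def[abs_def] by (rule C1c_lin[OF tf_C1c[OF \<phi>] tf_C1c[OF \<phi>]])
  have n: "nsq lborel (\<lambda>z. \<sigma> * f z + 0 * f z) = nsq lborel f" for f :: "R2 \<Rightarrow> real"
    using nsq_scaleR[of lborel \<sigma> f] by (simp add: \<sigma>_def split: if_splits)
  have B': "nsq lborel (\<lambda>z. \<sigma> * pd 1 \<phi> z + 0 * pd 1 \<phi> z) + nsq lborel (\<lambda>z. \<sigma> * pd 2 \<phi> z + 0 * pd 2 \<phi> z) \<le> B"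
    unfolding n using B unfolding cg_sq(2)[OF \<phi>] .
  have wm: "w \<in> borel_measurable borel" using C bsupp_meas by (auto simp: C1c_def)
  have "(\<integral>\<^sup>+x. ennreal (exp (p * \<phi> x)) \<partial>MO) = (\<integral>\<^sup>+x\<in>\<Omega>. ennreal (exp (\<bar>p\<bar> * w x)) \<partial>lebesgue)"
    unfolding MO_def pw by (rule nn_integral_restrict_space[OF Om_sets'])
  also have "\<dots> = (\<integral>\<^sup>+x\<in>\<Omega>. ennreal (exp (\<bar>p\<bar> * w x)) \<partial>lborel)"
    by (rule nn_integral_completion)
  also have "\<dots> \<le> (\<integral>\<^sup>+x\<in>sqbox R. ennreal (exp (\<bar>p\<bar> * w x)) \<partial>lborel)"
    using Om_sub by (intro nn_integral_mono mult_left_mono) (auto simp: indicator_def)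
  also have "\<dots> \<le> ennreal (expC p B)" unfolding expC_def
    using R by (intro exp_integral_bound[OF _ C _ B']) auto
  finally show ?thesis .
qed

text \<open>Fatou's lemma along an almost everywhere convergent subsequence of test functions. Their
  squared gradient norms fall below B + 1 eventually, which explains the constant.\<close>

lemma W0_trudinger:
  assumes u: "u \<in> W0 \<Omega>" and B: "nsq MO (wgrad \<Omega> u) \<le> B"
  shows "integrable MO (\<lambda>x. exp (p * u x)) \<and> (\<integral>x. exp (p * u x) \<partial>MO) \<le> expC p (B + 1)"
proof -
  note U = W0_props[OF u]
  obtain \<phi> where \<phi>: "approx \<phi> u (wgrad \<Omega> u)" using W0_approx[OF u] by blast
  have t: "test_fn \<Omega> (\<phi> n)" for n using \<phi> by (simp add: approx_def)
  have "(\<lambda>n. nsq MO (classical_grad (\<phi> n))) \<longlonglongrightarrow> nsq MO (wgrad \<Omega> u)"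
    by (rule nsq_tendsto[OF cg_sq(1)[OF t] U(2)]) (use \<phi> in \<open>simp add: approx_def\<close>)
  then have ev: "\<forall>\<^sub>F n in sequentially. nsq MO (classical_grad (\<phi> n)) < B + 1" by (rule order_tendstoD) (use B in simp)
  have "\<exists>r::nat\<Rightarrow>nat. strict_mono r \<and> (AE x in MO. (\<lambda>n. \<phi> (r n) x - u x) \<longlonglongrightarrow> 0)"
    by (rule nsq_AE_subseq[OF sq_int_diff[OF tf_sq(1)[OF t] U(1)]]) (use \<phi> in \<open>simp add: approx_def\<close>)
  then obtain r :: "nat \<Rightarrow> nat" where r: "strict_mono r" "AE x in MO. (\<lambda>n. \<phi> (r n) x - u x) \<longlonglongrightarrow> 0" by blast
  have evr: "\<forall>\<^sub>F n in sequentially. nsq MO (classical_grad (\<phi> (r n))) < B + 1"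
    by (rule eventually_subseq[OF r(1) ev])
  have m[measurable]: "u \<in> borel_measurable MO" "\<And>n. \<phi> n \<in> borel_measurable MO"
    using sq_int_meas[OF U(1)] sq_int_meas[OF tf_sq(1)[OF t]] by auto
  have "(\<integral>\<^sup>+x. ennreal (exp (p * u x)) \<partial>MO) \<le> (\<integral>\<^sup>+x. liminf (\<lambda>n. ennreal (exp (p * \<phi> (r n) x))) \<partial>MO)"
  proof (rule nn_integral_mono_AE)
    show "AE x in MO. ennreal (exp (p * u x)) \<le> liminf (\<lambda>n. ennreal (exp (p * \<phi> (r n) x)))"
      using r(2)
    proof eventually_elim
      case (elim x)
      then have "(\<lambda>n. \<phi> (r n) x) \<longlonglongrightarrow> u x" by (simp add: LIM_zero_iff)
      then have "(\<lambda>n. ennreal (exp (p * \<phi> (r n) x))) \<longlonglongrightarrow> ennreal (exp (p * u x))"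
        by (intro tendsto_ennrealI tendsto_intros)
      then have "liminf (\<lambda>n. ennreal (exp (p * \<phi> (r n) x))) = ennreal (exp (p * u x))"
        by (rule lim_imp_Liminf[rotated]) simp
      then show ?case by simp
    qed
  qed
  also have "\<dots> \<le> liminf (\<lambda>n. \<integral>\<^sup>+x. ennreal (exp (p * \<phi> (r n) x)) \<partial>MO)"
    by (rule nn_integral_liminf) measurable
  also have "\<dots> \<le> ennreal (expC p (B + 1))"
  proof (rule Liminf_le)
    show "\<forall>\<^sub>F n in sequentially. (\<integral>\<^sup>+x. ennreal (exp (p * \<phi> (r n) x)) \<partial>MO) \<le> ennreal (expC p (B + 1))"
      using evr by eventually_elim (rule test_exp_bound[OF t less_imp_le])
  qed simp
  finally have *: "(\<integral>\<^sup>+x. ennreal (exp (p * u x)) \<partial>MO) \<le> ennreal (expC p (B + 1))" .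
  have int: "integrable MO (\<lambda>x. exp (p * u x))"
  proof (rule integrableI_bounded)
    have "(\<integral>\<^sup>+x. ennreal (norm (exp (p * u x))) \<partial>MO) \<le> ennreal (expC p (B + 1))" using * by simp
    then show "(\<integral>\<^sup>+x. ennreal (norm (exp (p * u x))) \<partial>MO) < \<infinity>" by (rule le_less_trans) simp
  qed measurable
  have "0 \<le> expC p (B + 1)" by (simp add: expC_def add_nonneg_nonneg)
  then have "(\<integral>x. exp (p * u x) \<partial>MO) \<le> expC p (B + 1)"
    using * by (subst (asm) nn_integral_eq_integral[OF int]) (auto simp: ennreal_le_iff)
  with int show ?thesis by blast
qed

text \<open>Compactness is transferred from test functions at squared distance below 1/(n+1), whose
  squared gradient norms are at most 2 + 2 B.\<close>

lemma W0_rellich: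
  assumes U: "\<And>n. U n \<in> W0 \<Omega>" and B: "\<And>n. nsq MO (wgrad \<Omega> (U n)) \<le> B"
  shows "\<exists>r::nat \<Rightarrow> nat. strict_mono r \<and> (\<forall>e>0. \<exists>N. \<forall>m\<ge>N. \<forall>n\<ge>N. nsq MO (\<lambda>x. U (r m) x - U (r n) x) < e)"
proof -
  note P = W0_props[OF U]
  obtain \<phi> where \<phi>: "\<And>n. test_fn \<Omega> (\<phi> n)" "\<And>n. nsq MO (\<lambda>x. \<phi> n x - U n x) < inverse (real (Suc n))"
    "\<And>n. nsq MO (\<lambda>x. classical_grad (\<phi> n) x - wgrad \<Omega> (U n) x) < inverse (real (Suc n))"
    using W0_approx_seq[of U, OF U] by blast
  have b: "nsq lborel (pd 1 (\<phi> n)) + nsq lborel (pd 2 (\<phi> n)) \<le> 2 + 2 * B" for n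
  proof -
    have "nsq MO (classical_grad (\<phi> n)) \<le> 2 * nsq MO (\<lambda>x. classical_grad (\<phi> n) x - wgrad \<Omega> (U n) x) + 2 * nsq MO (wgrad \<Omega> (U n))"
      using nsq_le_add[OF sq_int_diff[OF cg_sq(1)[OF \<phi>(1)] P(2)] P(2), of n n n] by simp
    moreover have "inverse (real (Suc n)) \<le> 1" by (simp add: inverse_le_1_iff)
    ultimately show ?thesis using \<phi>(3)[of n] B[of n] unfolding cg_sq(2)[OF \<phi>(1)] by linarith
  qed
  obtain k :: "nat \<Rightarrow> nat" where k: "strict_mono k" "\<And>e. e > 0 \<Longrightarrow> \<exists>N. \<forall>m\<ge>N. \<forall>n\<ge>N. nsq lborel (\<lambda>z. \<phi> (k m) z - \<phi> (k n) z) < e"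
    using C1c_rellich[of R \<phi> "\<lambda>n. pd 1 (\<phi> n)" "\<lambda>n. pd 2 (\<phi> n)" "2 + 2 * B", OF R tf_C1c[OF \<phi>(1)] b] by blast
  have "\<exists>N. \<forall>m\<ge>N. \<forall>n\<ge>N. nsq MO (\<lambda>x. U (k m) x - U (k n) x) < e" if e: "e > 0" for e
  proof -
    \<comment> \<open>The three squared distances will enter with the factors 2, 4 and 4, so that
      e/16, e/8 and e/16 add up to 7/8 e.\<close>
    obtain N1 where N1: "\<forall>m\<ge>N1. \<forall>n\<ge>N1. nsq lborel (\<lambda>z. \<phi> (k m) z - \<phi> (k n) z) < e / 8" using k(2)[of "e / 8"] e by auto
    obtain N2 where N2: "inverse (real (Suc N2)) < e / 16" using reals_Archimedean[of "e / 16"] e by auto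
    have small: "nsq MO (\<lambda>x. \<phi> (k n) x - U (k n) x) < e / 16" if "n \<ge> N2" for n
    proof -
      have "real (Suc N2) \<le> real (Suc (k n))" using that seq_suble[OF k(1), of n] by simp
      then have "inverse (real (Suc (k n))) \<le> inverse (real (Suc N2))" by (intro le_imp_inverse_le) auto
      then show ?thesis using \<phi>(2)[of "k n"] N2 by linarith
    qed
    have "nsq MO (\<lambda>x. U (k m) x - U (k n) x) < e" if mn: "m \<ge> max N1 N2" "n \<ge> max N1 N2" for m n
    proof -
      define p q r where "p = (\<lambda>x. U (k m) x - \<phi> (k m) x)" and "q = (\<lambda>x. \<phi> (k m) x - \<phi> (k n) x)" and "r = (\<lambda>x. \<phi> (k n) x - U (k n) x)"
      have s: "sq_int MO p" "sq_int MO q" "sq_int MO r" unfolding p_def q_def r_def by (intro sq_int_diff P(1) tf_sq(1)[OF \<phi>(1)])+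
      have "nsq MO (\<lambda>x. U (k m) x - U (k n) x) = nsq MO (\<lambda>x. p x + (q x + r x))" by (simp add: p_def q_def r_def)
      also have "\<dots> \<le> 2 * nsq MO p + 2 * nsq MO (\<lambda>x. q x + r x)" by (rule nsq_le_add[OF s(1) sq_int_add[OF s(2,3)]])
      also have "\<dots> \<le> 2 * nsq MO p + 2 * (2 * nsq MO q + 2 * nsq MO r)" using nsq_le_add[OF s(2,3)] by simp
      also have "nsq MO p = nsq MO (\<lambda>x. \<phi> (k m) x - U (k m) x)" unfolding p_def by (rule nsq_minus)
      also have "nsq MO q = nsq lborel q"
      proof (rule supp_nsq_MO(1))
        show "q \<in> borel_measurable borel" unfolding q_def
          using bsupp_meas[OF tf_bs(1)[OF \<phi>(1)]] by (intro borel_measurable_diff) auto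
      qed (simp add: q_def test_fn_zero_outside[OF \<phi>(1)])
      also have "2 * nsq MO (\<lambda>x. \<phi> (k m) x - U (k m) x) + 2 * (2 * nsq lborel q + 2 * nsq MO r) < e"
      proof -
        have "nsq lborel q < e / 8" using N1 mn unfolding q_def by simp
        moreover have "nsq MO r < e / 16" "nsq MO (\<lambda>x. \<phi> (k m) x - U (k m) x) < e / 16"
          unfolding r_def using small mn by auto
        ultimately show ?thesis using e by (simp add: field_simps)
      qed
      finally show ?thesis .
    qed
    then show ?thesis by blast
  qed
  then show ?thesis using k(1) by blast
qed

text \<open>A single bump function, positive on an open box and hence on a set of positive
  measure.\<close>

lemma W0_nontrivial: "\<exists>u\<in>W0 \<Omega>. \<not> (AE x in MO. u x \<le> 0)"
proof -
  obtain x where x: "x \<in> \<Omega>" using ne by blast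
  obtain l u where lu: "cbox l u \<subseteq> \<Omega>" "x \<in> box l u" using open_contains_cbox[OF op x] by metis
  define \<phi> where "\<phi> = (\<lambda>x::R2. bump (l$1) (u$1) 1 (x$1) * bump (l$2) (u$2) 1 (x$2))"
  have t: "test_fn \<Omega> \<phi>" unfolding \<phi>_def by (rule test_fn_bump[OF lu(1)])
  have pos: "\<phi> y > 0" if "y \<in> box l u" for y
    using that unfolding \<phi>_def by (intro mult_pos_pos bump_pos) (auto simp: mem_box_cart)
  have "\<not> (AE y in MO. \<phi> y \<le> 0)"
  proof
    assume "AE y in MO. \<phi> y \<le> 0"
    then have "AE y in lebesgue. y \<in> \<Omega> \<longrightarrow> \<phi> y \<le> 0" unfolding MO_def by (subst (asm) AE_restrict_space_iff[OF Om_sets'])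
    then have "AE y in lebesgue. y \<notin> box l u"
      by eventually_elim (use pos lu(1) box_subset_cbox[of l u] in force)
    then have "negligible (box l u)"
      unfolding negligible_iff_null_sets by (subst AE_iff_null_sets) auto
    moreover have "\<not> negligible (box l u)" using lu(2) by (intro open_not_negligible) auto
    ultimately show False by simp
  qed
  then show ?thesis using test_in_W0[OF t] by blast
qed

lemma sobolev: "sobolev_model MO (W0 \<Omega>) (wgrad \<Omega>)"
proof (unfold_locales, goal_cases)
  case (1 u) then show ?case by (rule W0_props(1))
next
  case (2 u) then show ?case by (rule W0_props(2))
next
  case (3 u v s t) then show ?case by (rule W0_lin_ex(1))
next
  case (4 u v s t) then show ?case by (intro wgrad_AE W0_lin_ex(2))
next
  case (5 U) then show ?case by (rule W0_complete)
next
  case 6 show ?case using R W0_poincare by (intro exI[of _ "4 * R\<^sup>2"]) auto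
next
  case (7 B p) show ?case using W0_trudinger by blast
next
  case (8 U B) then show ?case by (rule W0_rellich)
next
  case 9 show ?case by (rule W0_nontrivial)
qed

end

section \<open>Convergence and paths with respect to \<open>wdist\<close>\<close>

context planar_domain
begin

lemma W0_wdist:
  assumes "u \<in> W0 \<Omega>" "v \<in> W0 \<Omega>"
  shows "wdist \<Omega> u v = sqrt (nsq MO (\<lambda>x. u x - v x) + nsq MO (\<lambda>x. wgrad \<Omega> u x - wgrad \<Omega> v x))"
  by (rule wdist_eq[OF W0_props(1)[OF assms(1)] W0_props(1)[OF assms(2)] W0_props(2)[OF assms(1)] W0_props(2)[OF assms(2)]])

lemma wdist_tendsto_iff:
  assumes U: "\<And>n. U n \<in> W0 \<Omega>" and u: "u \<in> W0 \<Omega>"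
  shows "(\<lambda>n. wdist \<Omega> (U n) u) \<longlonglongrightarrow> 0 \<longleftrightarrow> sobolev_model.W_conv MO (wgrad \<Omega>) U u"
  unfolding sobolev_model.W_conv_def[OF sobolev] W0_wdist[OF U u]
proof
  assume "(\<lambda>n. sqrt (nsq MO (\<lambda>x. U n x - u x) + nsq MO (\<lambda>x. wgrad \<Omega> (U n) x - wgrad \<Omega> u x))) \<longlonglongrightarrow> 0"
  from tendsto_power[OF this, of 2]
  have s: "(\<lambda>n. nsq MO (\<lambda>x. U n x - u x) + nsq MO (\<lambda>x. wgrad \<Omega> (U n) x - wgrad \<Omega> u x)) \<longlonglongrightarrow> 0" by simp
  show "(\<lambda>n. nsq MO (\<lambda>x. U n x - u x)) \<longlonglongrightarrow> 0 \<and> (\<lambda>n. nsq MO (\<lambda>x. wgrad \<Omega> (U n) x - wgrad \<Omega> u x)) \<longlonglongrightarrow> 0"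
    by (intro conjI; rule tendsto_sandwich[OF _ _ tendsto_const s]; simp)
next
  assume "(\<lambda>n. nsq MO (\<lambda>x. U n x - u x)) \<longlonglongrightarrow> 0 \<and> (\<lambda>n. nsq MO (\<lambda>x. wgrad \<Omega> (U n) x - wgrad \<Omega> u x)) \<longlonglongrightarrow> 0"
  then have "(\<lambda>n. nsq MO (\<lambda>x. U n x - u x) + nsq MO (\<lambda>x. wgrad \<Omega> (U n) x - wgrad \<Omega> u x)) \<longlonglongrightarrow> 0 + 0"
    by (intro tendsto_add) auto
  from tendsto_real_sqrt[OF this]
  show "(\<lambda>n. sqrt (nsq MO (\<lambda>x. U n x - u x) + nsq MO (\<lambda>x. wgrad \<Omega> (U n) x - wgrad \<Omega> u x))) \<longlonglongrightarrow> 0" by simp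
qed

lemma wdist_refl: "wdist \<Omega> u u = 0"
  by (simp add: wdist_def)

lemma W0_path_iff: "W0_path \<Omega> \<gamma> \<longleftrightarrow> sobolev_model.is_path MO (W0 \<Omega>) (wgrad \<Omega>) \<gamma>"
proof
  assume p: "W0_path \<Omega> \<gamma>"
  then have W: "\<And>t. t \<in> {0..1} \<Longrightarrow> \<gamma> t \<in> W0 \<Omega>" unfolding W0_path_def by blast
  show "sobolev_model.is_path MO (W0 \<Omega>) (wgrad \<Omega>) \<gamma>" unfolding sobolev_model.is_path_def[OF sobolev]
  proof (intro conjI ballI allI impI)
    fix t :: real and X :: "nat \<Rightarrow> real" assume t: "t \<in> {0..1}" and X: "\<forall>n. X n \<in> {0..1}" "X \<longlonglongrightarrow> t"
    have "(\<lambda>n. wdist \<Omega> (\<gamma> (X n)) (\<gamma> t)) \<longlonglongrightarrow> 0"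
    proof (rule LIMSEQ_I)
      fix e :: real assume "e > 0"
      then obtain d where d: "d > 0" "\<forall>s\<in>{0..1}. \<bar>s - t\<bar> < d \<longrightarrow> wdist \<Omega> (\<gamma> s) (\<gamma> t) < e"
        using p t unfolding W0_path_def by blast
      obtain N where N: "\<forall>n\<ge>N. norm (X n - t) < d" using LIMSEQ_D[OF X(2) d(1)] by blast
      have "norm (wdist \<Omega> (\<gamma> (X n)) (\<gamma> t) - 0) < e" if "n \<ge> N" for n
      proof -
        have "0 \<le> wdist \<Omega> (\<gamma> (X n)) (\<gamma> t)" unfolding W0_wdist[OF W[OF X(1)[rule_format]] W[OF t]] by simp
        then show ?thesis using d(2) N that X(1) by simp
      qed
      then show "\<exists>no. \<forall>n\<ge>no. norm (wdist \<Omega> (\<gamma> (X n)) (\<gamma> t) - 0) < e" by blast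
    qed
    then show "sobolev_model.W_conv MO (wgrad \<Omega>) (\<lambda>n. \<gamma> (X n)) (\<gamma> t)"
      using wdist_tendsto_iff[of "\<lambda>n. \<gamma> (X n)" "\<gamma> t", OF W[OF X(1)[rule_format]] W[OF t]] by blast
  qed (rule W)
next
  assume p: "sobolev_model.is_path MO (W0 \<Omega>) (wgrad \<Omega>) \<gamma>"
  then have W: "\<And>t. t \<in> {0..1} \<Longrightarrow> \<gamma> t \<in> W0 \<Omega>"
    and W_conv: "\<And>t X. t \<in> {0..1} \<Longrightarrow> \<forall>n. X n \<in> {0..1} \<Longrightarrow> X \<longlonglongrightarrow> t \<Longrightarrow> sobolev_model.W_conv MO (wgrad \<Omega>) (\<lambda>n. \<gamma> (X n)) (\<gamma> t)"
    unfolding sobolev_model.is_path_def[OF sobolev] by blast+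
  show "W0_path \<Omega> \<gamma>" unfolding W0_path_def
  proof (intro conjI ballI allI impI)
    fix t e :: real assume t: "t \<in> {0..1}" and e: "e > 0"
    have "((\<lambda>s. wdist \<Omega> (\<gamma> s) (\<gamma> t)) \<longlongrightarrow> 0) (at t within {0..1})"
      unfolding tendsto_at_iff_sequentially o_def
    proof (intro allI impI)
      fix X :: "nat \<Rightarrow> real" assume "\<forall>i. X i \<in> {0..1} - {t}" and X: "X \<longlonglongrightarrow> t"
      then have X1: "\<forall>n. X n \<in> {0..1}" by blast
      show "(\<lambda>n. wdist \<Omega> (\<gamma> (X n)) (\<gamma> t)) \<longlonglongrightarrow> 0"
        using wdist_tendsto_iff[of "\<lambda>n. \<gamma> (X n)" "\<gamma> t", OF W[OF X1[rule_format]] W[OF t]] W_conv[OF t X1 X] by blast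
    qed
    then have "\<forall>\<^sub>F s in at t within {0..1}. wdist \<Omega> (\<gamma> s) (\<gamma> t) < e" using e by (rule order_tendstoD)
    then obtain d where d: "d > 0" "\<forall>s\<in>{0..1}. s \<noteq> t \<and> dist s t < d \<longrightarrow> wdist \<Omega> (\<gamma> s) (\<gamma> t) < e"
      unfolding eventually_at by blast
    \<comment> \<open>The punctured limit says nothing at s = t, where the distance is zero.\<close>
    have "wdist \<Omega> (\<gamma> s) (\<gamma> t) < e" if "s \<in> {0..1}" "\<bar>s - t\<bar> < d" for s
      using d(2) that e wdist_refl[of "\<gamma> t"] by (cases "s = t") (auto simp: dist_real_def)
    then show "\<exists>d>0. \<forall>s\<in>{0..1}. \<bar>s - t\<bar> < d \<longrightarrow> wdist \<Omega> (\<gamma> s) (\<gamma> t) < e" using d(1) by blast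
  qed (rule W)
qed

end

section \<open>The threshold for \<lambda> and the minimax value\<close>

theorem theorem3p2:
  fixes F :: "real^2 \<Rightarrow> real" and \<Omega> :: "(real^2) set" and a b \<mu> \<Lambda> :: real
  assumes "standing_F F a b \<mu> \<Lambda>"
    and "open \<Omega>" and "connected \<Omega>" and "bounded \<Omega>" and "\<Omega> \<noteq> {}"
  shows "\<exists>lam0>0. \<forall>lam.  0 < lam \<and> lam < lam0 \<longrightarrow>
           (\<exists>w0\<in>W0 \<Omega>. energy F \<Omega> lam w0 \<le> energy F \<Omega> lam (\<lambda>x. 0) \<and>
              (\<exists>u. weak_solution F \<Omega> lam u \<and> critical_point F \<Omega> lam u \<and>
                   energy F \<Omega> lam u = minimax F \<Omega> lam w0) \<and>
              minimax F \<Omega> lam w0 > energy F \<Omega> lam (\<lambda>x. 0) \<and>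
              energy F \<Omega> lam (\<lambda>x. 0) = - lam * measure lebesgue \<Omega>)"
proof -
  obtain R where R: "R > 0" "\<And>z. z \<in> \<Omega> \<Longrightarrow> norm z < R"
    using assms(4) bounded_pos_less[of \<Omega>] by blast
  interpret planar_domain \<Omega> R
  proof
    fix z assume "z \<in> \<Omega>"
    then show "\<bar>z $ 1\<bar> < R \<and> \<bar>z $ 2\<bar> < R"
      using R(2)[of z] component_le_norm_cart[of z 1] component_le_norm_cart[of z 2] by linarith
  qed (use assms R in auto)
  interpret finsler F a b \<mu> \<Lambda> by unfold_locales (rule assms(1))
  interpret S: sobolev_model MO "W0 \<Omega>" "wgrad \<Omega>" by (rule sobolev)
  \<comment> \<open>Exponent 1 and gradient bound 1, increased by the slack 1 of
    \<open>W0_trudinger\<close>.\<close>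
  define C1 where "C1 = expC 1 2"
  define CP where "CP = 4 * R\<^sup>2"
  have C1: "C1 \<ge> 0" by (simp add: C1_def expC_def add_nonneg_nonneg)
  have CP: "CP \<ge> 0" by (simp add: CP_def)
  \<comment> \<open>The two smallness conditions of \<open>mountain_pass\<close>; the added 1 keeps
    the denominators positive.\<close>
  define lam0 where "lam0 = min (a\<^sup>2 / (4 * (C1 + 1))) (a\<^sup>2 / (CP + 1))"
  have lam0: "lam0 > 0" using a_pos C1 CP by (simp add: lam0_def)
  show ?thesis
  proof (intro exI[of _ lam0] conjI allI impI lam0)
    fix lam assume lam: "0 < lam \<and> lam < lam0"
    interpret mp: mountain_pass MO "W0 \<Omega>" "wgrad \<Omega>" F a b \<mu> \<Lambda> lam C1 CP
    proof unfold_locales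
      show "lam > 0" using lam by simp
      show "(\<integral>x. exp (u x) \<partial>MO) \<le> C1" if "u \<in> W0 \<Omega>" "nsq MO (wgrad \<Omega> u) \<le> 1" for u
        using W0_trudinger[OF that, of 1] by (simp add: C1_def)
      show "nsq MO u \<le> CP * nsq MO (wgrad \<Omega> u)" if "u \<in> W0 \<Omega>" for u
        unfolding CP_def by (rule W0_poincare[OF that])
      have "lam * (4 * (C1 + 1)) \<le> a\<^sup>2" using lam C1 by (simp add: lam0_def pos_less_divide_eq)
      moreover have "lam * C1 \<le> lam * (C1 + 1)" using lam by simp
      ultimately show "lam * C1 \<le> a\<^sup>2 / 4" by (simp add: algebra_simps)
      have "lam * (CP + 1) < a\<^sup>2" using lam CP by (simp add: lam0_def pos_less_divide_eq)
      then show "lam * CP < a\<^sup>2" using lam by (simp add: distrib_left)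
    qed
    have en: "energy F \<Omega> lam u = mp.E u" for u
      unfolding energy_def mp.E_def mp.A_def integral_MO ..
    obtain u w where u: "u \<in> W0 \<Omega>" and w: "w \<in> W0 \<Omega>" "mp.E w \<le> mp.E0" and gt: "mp.E0 < mp.E u"
      and crit: "\<forall>v\<in>W0 \<Omega>. mp.dE u v 1 0 = 0"
      and low: "\<forall>\<gamma>. S.is_path \<gamma> \<longrightarrow> \<gamma> 0 = (\<lambda>x. 0) \<longrightarrow> \<gamma> 1 = w \<longrightarrow> (\<exists>t\<in>{0..1}. mp.E u \<le> mp.E (\<gamma> t))"
      and line: "\<exists>\<gamma>. S.is_path \<gamma> \<and> \<gamma> 0 = (\<lambda>x. 0) \<and> \<gamma> 1 = w \<and> (\<forall>t\<in>{0..1}. mp.E (\<gamma> t) \<le> mp.E u)"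
      using mp.mountain_pass_solution by blast
    have mm: "minimax F \<Omega> lam w = mp.E u"
    proof -
      define X where "X = {(SUP t\<in>{0..1}. mp.E (\<gamma> t)) | \<gamma>. S.is_path \<gamma> \<and> \<gamma> 0 = (\<lambda>x. 0) \<and> \<gamma> 1 = w}"
      have ge: "mp.E u \<le> y" if "y \<in> X" for y
      proof -
        obtain \<gamma> where \<gamma>: "y = (SUP t\<in>{0..1}. mp.E (\<gamma> t))" "S.is_path \<gamma>" "\<gamma> 0 = (\<lambda>x. 0)" "\<gamma> 1 = w"
          using \<open>y \<in> X\<close> unfolding X_def by blast
        obtain t where t: "t \<in> {0..1}" "mp.E u \<le> mp.E (\<gamma> t)" using low \<gamma> by blast
        \<comment> \<open>Continuity along the path bounds the energies, without which the supremum
          over the reals would carry no information.\<close>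
        have "compact ((\<lambda>t. mp.E (\<gamma> t)) ` {0..1})"
          by (intro compact_continuous_image mp.is_path_cont_E1[OF \<gamma>(2)] compact_Icc)
        then have "bdd_above ((\<lambda>t. mp.E (\<gamma> t)) ` {0..1})" by (intro bounded_imp_bdd_above compact_imp_bounded)
        from cSUP_upper[OF t(1) this] show ?thesis using t(2) \<gamma>(1) by simp
      qed
      obtain \<gamma> where \<gamma>: "S.is_path \<gamma>" "\<gamma> 0 = (\<lambda>x. 0)" "\<gamma> 1 = w" "\<forall>t\<in>{0..1}. mp.E (\<gamma> t) \<le> mp.E u" using line by blast
      have mem: "(SUP t\<in>{0..1}. mp.E (\<gamma> t)) \<in> X" unfolding X_def using \<gamma>(1-3) by blast
      have "bdd_below X" using ge by (intro bdd_belowI)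
      then have "Inf X \<le> (SUP t\<in>{0..1}. mp.E (\<gamma> t))" by (rule cInf_lower[OF mem])
      also have "\<dots> \<le> mp.E u" by (intro cSUP_least) (use \<gamma>(4) in auto)
      finally have "Inf X \<le> mp.E u" .
      moreover have "mp.E u \<le> Inf X" using mem ge by (intro cInf_greatest) auto
      ultimately have "Inf X = mp.E u" by simp
      then show ?thesis unfolding minimax_def en X_def W0_path_iff .
    qed
    have cp: "critical_point F \<Omega> lam u" unfolding critical_point_def en
    proof (intro conjI ballI u)
      fix v assume v: "v \<in> W0 \<Omega>"
      show "((\<lambda>t. mp.E (\<lambda>x. u x + t * v x)) has_real_derivative 0) (at 0)"
        using mp.E_line_deriv[OF u v, of 1 0] crit v by simp
    qed
    have ws: "weak_solution F \<Omega> lam u" unfolding weak_solution_def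
    proof (intro conjI allI impI u)
      fix \<phi> assume \<phi>: "test_fn \<Omega> \<phi>"
      have "mp.dE u \<phi> 1 0 = 0" using crit test_in_W0[OF \<phi>] by blast
      then have 1: "(\<integral>x. P (wgrad \<Omega> u x) \<bullet> wgrad \<Omega> \<phi> x \<partial>MO) = lam * (\<integral>x. exp (u x) * \<phi> x \<partial>MO)"
        by (simp add: mp.dE_def)
      have "(\<integral>x. F (wgrad \<Omega> u x) * (Fgrad F (wgrad \<Omega> u x) \<bullet> classical_grad \<phi> x) \<partial>MO) =
        (\<integral>x. P (wgrad \<Omega> u x) \<bullet> classical_grad \<phi> x \<partial>MO)" by (simp add: P_def)
      \<comment> \<open>The first variation contains \<open>wgrad \<Omega> \<phi>\<close>, the weak
        formulation the classical gradient; for a test function they agree almost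
        everywhere.\<close>
      also have "\<dots> = (\<integral>x. P (wgrad \<Omega> u x) \<bullet> wgrad \<Omega> \<phi> x \<partial>MO)"
      proof (rule integral_cong_AE)
        note [measurable] = mp.P_meas sq_int_meas[OF W0_props(2)[OF u]] sq_int_meas[OF cg_sq(1)[OF \<phi>]] sq_int_meas[OF wgrad_test(1)[OF \<phi>]]
        show "(\<lambda>x. P (wgrad \<Omega> u x) \<bullet> classical_grad \<phi> x) \<in> borel_measurable MO" by measurable
        show "(\<lambda>x. P (wgrad \<Omega> u x) \<bullet> wgrad \<Omega> \<phi> x) \<in> borel_measurable MO" by measurable
        show "AE x in MO. P (wgrad \<Omega> u x) \<bullet> classical_grad \<phi> x = P (wgrad \<Omega> u x) \<bullet> wgrad \<Omega> \<phi> x"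
          using wgrad_test(2)[OF \<phi>] by eventually_elim simp
      qed
      finally show "(LINT x:\<Omega>|lebesgue. F (wgrad \<Omega> u x) * (Fgrad F (wgrad \<Omega> u x) \<bullet> classical_grad \<phi> x)) =
        lam * (LINT x:\<Omega>|lebesgue. exp (u x) * \<phi> x)" unfolding integral_MO 1 .
    qed
    have e0: "mp.E (\<lambda>x. 0) = - lam * measure lebesgue \<Omega>"
      using mp.E0_eq unfolding mp.E0_def measure_MO .
    have "mp.E w \<le> mp.E (\<lambda>x. 0)" "mp.E (\<lambda>x. 0) < mp.E u" using w(2) gt unfolding mp.E0_def by auto
    then show "\<exists>w0\<in>W0 \<Omega>. energy F \<Omega> lam w0 \<le> energy F \<Omega> lam (\<lambda>x. 0) \<and>
              (\<exists>u. weak_solution F \<Omega> lam u \<and> critical_point F \<Omega> lam u \<and>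
                   energy F \<Omega> lam u = minimax F \<Omega> lam w0) \<and>
              minimax F \<Omega> lam w0 > energy F \<Omega> lam (\<lambda>x. 0) \<and>
              energy F \<Omega> lam (\<lambda>x. 0) = - lam * measure lebesgue \<Omega>"
      using w(1) ws cp e0 mm unfolding en by (intro bexI[of _ w] conjI exI[of _ u]) auto
  qed
qed

end
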